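(* Let $n\geq 3$ and $c\neq 0$, and let $M$ be a connected real hypersurface of a complex space form $M^n(c)$. Let $S$ be the Ricci tensor of $M$, $g$ the induced metric, and $H$ the holomorphic distribution of $M$. Then there is a constant $a$ such that $S(X,Y)=a\,g(X,Y)$ for all $X,Y\in H$ if and only if $M$ is a pseudo-Einstein real hypersurface.
   Context: $M^n(c)$ denotes a complex space form of complex dimension $n$ (real dimension $2n$) with constant holomorphic sectional curvature $4c$, with almost complex structure $J$ and Hermitian metric $G$. A real hypersurface $M$ is a real $(2n-1)$-dimensional manifold immersed in $M^n(c)$, with induced Riemannian metric $g$ and unit normal vector field $N$. The structure vector field is $\xi=-JN\in T(M)$, and $\eta(X)=g(X,\xi)$. The holomorphic distribution is $H(x)=\{X\in T_x(M)\mid \eta(X)=0\}$. The Ricci tensor $S$ of $(M,g)$ is regarded as a symmetric $(0,2)$-tensor. $M$ is called pseudo-Einstein if there are constants $a$ and $b$ such that $S(X,Y)=a\,g(X,Y)+b\,\eta(X)\eta(Y)$ for all tangent vectors $X,Y$ of $M$. *)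

theory Defs
  imports "HOL-Analysis.Analysis"
begin

section \<open>Smooth maps between open subsets of Euclidean spaces\<close>

text \<open>Only used for open \<open>S\<close>, where total differentiability with all directional
  derivatives of class \<open>C\<^sup>k\<close> is equivalent to class \<open>C\<^sup>k\<^sup>+\<^sup>1\<close>.\<close>

primrec Ck_on :: "nat \<Rightarrow> 'a::euclidean_space set \<Rightarrow> ('a \<Rightarrow> 'b::real_normed_vector) \<Rightarrow> bool" where
  "Ck_on 0 S f \<longleftrightarrow> continuous_on S f"
| "Ck_on (Suc k) S f \<longleftrightarrow>
     (\<forall>x\<in>S. f differentiable (at x)) \<and> (\<forall>v. Ck_on k S (\<lambda>x. frechet_derivative f (at x) v))"

definition smooth_on :: "'a::euclidean_space set \<Rightarrow> ('a \<Rightarrow> 'b::real_normed_vector) \<Rightarrow> bool" where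
  "smooth_on S f \<longleftrightarrow> (\<forall>k. Ck_on k S f)"


section \<open>Smooth manifolds and tangent vectors\<close>

text \<open>The points of a manifold form a whole type. A chart is its domain together with
  the coordinate map; values of the coordinate map off the domain are irrelevant.\<close>

type_synonym ('m, 'e) chart = "'m set \<times> ('m \<Rightarrow> 'e)"

abbreviation chart_dom :: "('m, 'e) chart \<Rightarrow> 'm set" where
  "chart_dom \<equiv> fst"

abbreviation coords :: "('m, 'e) chart \<Rightarrow> 'm \<Rightarrow> 'e" where
  "coords \<equiv> snd"

definition chart_inv :: "('m, 'e) chart \<Rightarrow> 'e \<Rightarrow> 'm" where
  "chart_inv \<kappa> = inv_into (chart_dom \<kappa>) (coords \<kappa>)"

definition chart_image :: "('m, 'e) chart \<Rightarrow> 'e set" where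
  "chart_image \<kappa> = coords \<kappa> ` chart_dom \<kappa>"

definition transition :: "('m, 'e) chart \<Rightarrow> ('m, 'e) chart \<Rightarrow> 'e \<Rightarrow> 'e" where
  "transition \<kappa> \<kappa>' = coords \<kappa>' \<circ> chart_inv \<kappa>"

text \<open>The Hausdorff and second countability axioms are carried by the type classes.
  The atlas need not be maximal.\<close>

definition smooth_manifold ::
    "('m::{t2_space,second_countable_topology}, 'e::euclidean_space) chart set \<Rightarrow> bool" where
  "smooth_manifold A \<longleftrightarrow>
     (\<Union>\<kappa>\<in>A. chart_dom \<kappa>) = UNIV \<and>
     (\<forall>\<kappa>\<in>A. open (chart_dom \<kappa>) \<and> open (chart_image \<kappa>) \<and>
        homeomorphism (chart_dom \<kappa>) (chart_image \<kappa>) (coords \<kappa>) (chart_inv \<kappa>)) \<and>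
     (\<forall>\<kappa>\<in>A. \<forall>\<kappa>'\<in>A. smooth_on (coords \<kappa> ` (chart_dom \<kappa> \<inter> chart_dom \<kappa>')) (transition \<kappa> \<kappa>'))"

definition chart_at :: "('m, 'e) chart set \<Rightarrow> 'm \<Rightarrow> ('m, 'e) chart" where
  "chart_at A p = (SOME \<kappa>. \<kappa> \<in> A \<and> p \<in> chart_dom \<kappa>)"

text \<open>A tangent vector at \<open>p\<close> is the family of its component vectors in all charts around
  \<open>p\<close>, related by the differentials of the transition maps. Components in
  other charts are set to \<open>0\<close>, so that each tangent vector has a single representative.\<close>

type_synonym ('m, 'e) tvec = "('m, 'e) chart \<Rightarrow> 'e"

definition tangent_space ::
    "('m, 'e::euclidean_space) chart set \<Rightarrow> 'm \<Rightarrow> ('m, 'e) tvec set" where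
  "tangent_space A p = {X.
     (\<forall>\<kappa>\<in>A. \<forall>\<kappa>'\<in>A. p \<in> chart_dom \<kappa> \<inter> chart_dom \<kappa>' \<longrightarrow>
        X \<kappa>' = frechet_derivative (transition \<kappa> \<kappa>') (at (coords \<kappa> p)) (X \<kappa>)) \<and>
     (\<forall>\<kappa>. \<not> (\<kappa> \<in> A \<and> p \<in> chart_dom \<kappa>) \<longrightarrow> X \<kappa> = 0)}"

text \<open>The tangent vector at \<open>p\<close> with component vector \<open>v\<close> in the chart \<open>\<kappa>\<close>.\<close>

definition coord_vec ::
    "('m, 'e::euclidean_space) chart set \<Rightarrow> ('m, 'e) chart \<Rightarrow> 'm \<Rightarrow> 'e \<Rightarrow> ('m, 'e) tvec" where
  "coord_vec A \<kappa> p v = (\<lambda>\<kappa>'. if \<kappa>' \<in> A \<and> p \<in> chart_dom \<kappa>'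
     then frechet_derivative (transition \<kappa> \<kappa>') (at (coords \<kappa> p)) v else 0)"


section \<open>Riemannian metrics and curvature\<close>

text \<open>A \<open>(0,2)\<close>-tensor field takes a point and two tangent vectors at that point.\<close>

type_synonym ('m, 'e) tensor2 = "'m \<Rightarrow> ('m, 'e) tvec \<Rightarrow> ('m, 'e) tvec \<Rightarrow> real"

definition in_chart ::
    "('m, 'e::euclidean_space) chart set \<Rightarrow> ('m, 'e) tensor2 \<Rightarrow> ('m, 'e) chart
      \<Rightarrow> 'e \<Rightarrow> 'e \<Rightarrow> 'e \<Rightarrow> real" where
  "in_chart A g \<kappa> x v w =
     g (chart_inv \<kappa> x) (coord_vec A \<kappa> (chart_inv \<kappa> x) v) (coord_vec A \<kappa> (chart_inv \<kappa> x) w)"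

definition riemannian_metric ::
    "('m, 'e::euclidean_space) chart set \<Rightarrow> ('m, 'e) tensor2 \<Rightarrow> bool" where
  "riemannian_metric A g \<longleftrightarrow>
     (\<forall>\<kappa>\<in>A.
        (\<forall>x\<in>chart_image \<kappa>. bilinear (in_chart A g \<kappa> x) \<and>
           (\<forall>v w. in_chart A g \<kappa> x v w = in_chart A g \<kappa> x w v) \<and>
           (\<forall>v. v \<noteq> 0 \<longrightarrow> in_chart A g \<kappa> x v v > 0)) \<and>
        (\<forall>v w. smooth_on (chart_image \<kappa>) (\<lambda>x. in_chart A g \<kappa> x v w)))"

text \<open>The Levi-Civita connection of a metric \<open>\<gamma>\<close> on an open subset of a Euclidean space is
  \<open>\<nabla>\<^sub>v w = \<Gamma>(v,w)\<close> for constant vector fields \<open>v\<close> and \<open>w\<close>; the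
  defining equation of \<open>\<Gamma>\<close> is the Koszul formula.\<close>

definition christoffel ::
    "('e::euclidean_space \<Rightarrow> 'e \<Rightarrow> 'e \<Rightarrow> real) \<Rightarrow> 'e \<Rightarrow> 'e \<Rightarrow> 'e \<Rightarrow> 'e" where
  "christoffel \<gamma> x v w = (THE z. \<forall>u. 2 * \<gamma> x z u =
       frechet_derivative (\<lambda>y. \<gamma> y w u) (at x) v
     + frechet_derivative (\<lambda>y. \<gamma> y v u) (at x) w
     - frechet_derivative (\<lambda>y. \<gamma> y v w) (at x) u)"

text \<open>\<open>R(u,v)w = \<nabla>\<^sub>u \<nabla>\<^sub>v w - \<nabla>\<^sub>v \<nabla>\<^sub>u w\<close> for constant vector fields, whose
  bracket vanishes. With this sign round spheres have positive curvature.\<close>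

definition local_curvature ::
    "('e::euclidean_space \<Rightarrow> 'e \<Rightarrow> 'e \<Rightarrow> real) \<Rightarrow> 'e \<Rightarrow> 'e \<Rightarrow> 'e \<Rightarrow> 'e \<Rightarrow> 'e" where
  "local_curvature \<gamma> x u v w =
       frechet_derivative (\<lambda>y. christoffel \<gamma> y v w) (at x) u
     - frechet_derivative (\<lambda>y. christoffel \<gamma> y u w) (at x) v
     + christoffel \<gamma> x u (christoffel \<gamma> x v w)
     - christoffel \<gamma> x v (christoffel \<gamma> x u w)"

definition curvature ::
    "('m, 'e::euclidean_space) chart set \<Rightarrow> ('m, 'e) tensor2 \<Rightarrow> 'm
      \<Rightarrow> ('m, 'e) tvec \<Rightarrow> ('m, 'e) tvec \<Rightarrow> ('m, 'e) tvec \<Rightarrow> ('m, 'e) tvec" where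
  "curvature A g p X Y Z = (\<lambda>\<kappa>. if \<kappa> \<in> A \<and> p \<in> chart_dom \<kappa>
     then local_curvature (in_chart A g \<kappa>) (coords \<kappa> p) (X \<kappa>) (Y \<kappa>) (Z \<kappa>) else 0)"

definition sectional_curvature ::
    "('m, 'e::euclidean_space) chart set \<Rightarrow> ('m, 'e) tensor2 \<Rightarrow> ('m, 'e) tensor2" where
  "sectional_curvature A g p X Y =
     g p (curvature A g p X Y Y) X / (g p X X * g p Y Y - (g p X Y)\<^sup>2)"

text \<open>\<open>S(X,Y)\<close> is the trace of \<open>Z \<mapsto> R(Z,X)Y\<close>, computed in a chart around \<open>p\<close>.\<close>

definition ricci ::
    "('m, 'e::euclidean_space) chart set \<Rightarrow> ('m, 'e) tensor2 \<Rightarrow> ('m, 'e) tensor2" where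
  "ricci A g p X Y =
     (\<Sum>b\<in>Basis. curvature A g p (coord_vec A (chart_at A p) p b) X Y (chart_at A p) \<bullet> b)"


section \<open>Complex space forms\<close>

definition endo_in_chart ::
    "('m, 'e::euclidean_space) chart set \<Rightarrow> ('m \<Rightarrow> ('m, 'e) tvec \<Rightarrow> ('m, 'e) tvec)
      \<Rightarrow> ('m, 'e) chart \<Rightarrow> 'e \<Rightarrow> 'e \<Rightarrow> 'e" where
  "endo_in_chart A J \<kappa> x v = J (chart_inv \<kappa> x) (coord_vec A \<kappa> (chart_inv \<kappa> x) v) \<kappa>"

definition almost_complex_structure ::
    "('m, 'e::euclidean_space) chart set \<Rightarrow> ('m \<Rightarrow> ('m, 'e) tvec \<Rightarrow> ('m, 'e) tvec) \<Rightarrow> bool" where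
  "almost_complex_structure A J \<longleftrightarrow>
     (\<forall>p. \<forall>X\<in>tangent_space A p. J p X \<in> tangent_space A p \<and> J p (J p X) = - X) \<and>
     (\<forall>\<kappa>\<in>A.
        (\<forall>x\<in>chart_image \<kappa>. linear (endo_in_chart A J \<kappa> x)) \<and>
        (\<forall>v. smooth_on (chart_image \<kappa>) (\<lambda>x. endo_in_chart A J \<kappa> x v)))"

definition hermitian_metric ::
    "('m, 'e::euclidean_space) chart set \<Rightarrow> ('m, 'e) tensor2
      \<Rightarrow> ('m \<Rightarrow> ('m, 'e) tvec \<Rightarrow> ('m, 'e) tvec) \<Rightarrow> bool" where
  "hermitian_metric A G J \<longleftrightarrow> riemannian_metric A G \<and>
     (\<forall>p. \<forall>X\<in>tangent_space A p. \<forall>Y\<in>tangent_space A p. G p (J p X) (J p Y) = G p X Y)"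

text \<open>\<open>\<nabla>J = 0\<close>, that is, \<open>\<nabla>\<^sub>u (J v) = J (\<nabla>\<^sub>u v)\<close> for coordinate vector fields.\<close>

definition parallel_endo ::
    "('m, 'e::euclidean_space) chart set \<Rightarrow> ('m, 'e) tensor2
      \<Rightarrow> ('m \<Rightarrow> ('m, 'e) tvec \<Rightarrow> ('m, 'e) tvec) \<Rightarrow> bool" where
  "parallel_endo A G J \<longleftrightarrow> (\<forall>\<kappa>\<in>A. \<forall>x\<in>chart_image \<kappa>. \<forall>u v.
     frechet_derivative (\<lambda>y. endo_in_chart A J \<kappa> y v) (at x) u
       + christoffel (in_chart A G \<kappa>) x u (endo_in_chart A J \<kappa> x v)
     = endo_in_chart A J \<kappa> x (christoffel (in_chart A G \<kappa>) x u v))"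

definition kaehler_manifold ::
    "('m::{t2_space,second_countable_topology}, 'e::euclidean_space) chart set
      \<Rightarrow> ('m, 'e) tensor2 \<Rightarrow> ('m \<Rightarrow> ('m, 'e) tvec \<Rightarrow> ('m, 'e) tvec) \<Rightarrow> bool" where
  "kaehler_manifold A G J \<longleftrightarrow> smooth_manifold A \<and> almost_complex_structure A J \<and>
     hermitian_metric A G J \<and> parallel_endo A G J"

text \<open>Neither completeness nor simple connectedness is required.\<close>

definition complex_space_form ::
    "nat \<Rightarrow> real \<Rightarrow> ('m::{t2_space,second_countable_topology}, 'e::euclidean_space) chart set
      \<Rightarrow> ('m, 'e) tensor2 \<Rightarrow> ('m \<Rightarrow> ('m, 'e) tvec \<Rightarrow> ('m, 'e) tvec) \<Rightarrow> bool" where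
  "complex_space_form n c A G J \<longleftrightarrow> DIM('e) = 2 * n \<and> kaehler_manifold A G J \<and>
     (\<forall>p. \<forall>X\<in>tangent_space A p. X \<noteq> (\<lambda>_. 0) \<longrightarrow> sectional_curvature A G p X (J p X) = 4 * c)"


section \<open>Real hypersurfaces\<close>

text \<open>Below, \<open>A\<close> is the atlas of the hypersurface and \<open>B\<close> that of the ambient manifold.\<close>

definition local_rep :: "('m, 'h) chart \<Rightarrow> ('b, 'e) chart \<Rightarrow> ('m \<Rightarrow> 'b) \<Rightarrow> 'h \<Rightarrow> 'e" where
  "local_rep \<kappa> \<mu> f = coords \<mu> \<circ> f \<circ> chart_inv \<kappa>"

definition smooth_map ::
    "('m::topological_space, 'h::euclidean_space) chart set
      \<Rightarrow> ('b::topological_space, 'e::euclidean_space) chart set \<Rightarrow> ('m \<Rightarrow> 'b) \<Rightarrow> bool" where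
  "smooth_map A B f \<longleftrightarrow> continuous_on UNIV f \<and>
     (\<forall>\<kappa>\<in>A. \<forall>\<mu>\<in>B.
        smooth_on (coords \<kappa> ` (chart_dom \<kappa> \<inter> f -` chart_dom \<mu>)) (local_rep \<kappa> \<mu> f))"

definition differential ::
    "('m, 'h::euclidean_space) chart set \<Rightarrow> ('b, 'e::euclidean_space) chart set \<Rightarrow> ('m \<Rightarrow> 'b)
      \<Rightarrow> 'm \<Rightarrow> ('m, 'h) tvec \<Rightarrow> ('b, 'e) tvec" where
  "differential A B f p X = (\<lambda>\<mu>. if \<mu> \<in> B \<and> f p \<in> chart_dom \<mu>
     then frechet_derivative (local_rep (chart_at A p) \<mu> f) (at (coords (chart_at A p) p))
            (X (chart_at A p))
     else 0)"

definition immersion ::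
    "('m::topological_space, 'h::euclidean_space) chart set
      \<Rightarrow> ('b::topological_space, 'e::euclidean_space) chart set \<Rightarrow> ('m \<Rightarrow> 'b) \<Rightarrow> bool" where
  "immersion A B f \<longleftrightarrow> smooth_map A B f \<and>
     (\<forall>p. inj_on (differential A B f p) (tangent_space A p))"

definition induced_metric ::
    "('m, 'h::euclidean_space) chart set \<Rightarrow> ('b, 'e::euclidean_space) chart set
      \<Rightarrow> ('b, 'e) tensor2 \<Rightarrow> ('m \<Rightarrow> 'b) \<Rightarrow> ('m, 'h) tensor2" where
  "induced_metric A B G f p X Y = G (f p) (differential A B f p X) (differential A B f p Y)"

definition smooth_along ::
    "('m, 'h::euclidean_space) chart set \<Rightarrow> ('b, 'e::euclidean_space) chart set \<Rightarrow> ('m \<Rightarrow> 'b)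
      \<Rightarrow> 'm set \<Rightarrow> ('m \<Rightarrow> ('b, 'e) tvec) \<Rightarrow> bool" where
  "smooth_along A B f W V \<longleftrightarrow> (\<forall>\<kappa>\<in>A. \<forall>\<mu>\<in>B.
     smooth_on (coords \<kappa> ` (chart_dom \<kappa> \<inter> W \<inter> f -` chart_dom \<mu>)) (\<lambda>x. V (chart_inv \<kappa> x) \<mu>))"

text \<open>A unit normal vector field is in general only available locally, and globally only up to
  sign (a smooth global one exists precisely if the hypersurface is orientable). So \<open>N\<close> is
  required to agree up to sign with a smooth field near each point. The sign is immaterial
  for \<open>ker \<eta>\<close> and \<open>\<eta> \<otimes> \<eta>\<close>.\<close>

definition unit_normal_field ::
    "('m::topological_space, 'h::euclidean_space) chart set \<Rightarrow> ('b, 'e::euclidean_space) chart set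
      \<Rightarrow> ('b, 'e) tensor2 \<Rightarrow> ('m \<Rightarrow> 'b) \<Rightarrow> ('m \<Rightarrow> ('b, 'e) tvec) \<Rightarrow> bool" where
  "unit_normal_field A B G f N \<longleftrightarrow>
     (\<forall>p. N p \<in> tangent_space B (f p) \<and> G (f p) (N p) (N p) = 1 \<and>
        (\<forall>X\<in>tangent_space A p. G (f p) (differential A B f p X) (N p) = 0)) \<and>
     (\<forall>p. \<exists>W N'. open W \<and> p \<in> W \<and> smooth_along A B f W N' \<and>
        (\<forall>q\<in>W. N q = N' q \<or> N q = - N' q))"

definition real_hypersurface ::
    "('m::{t2_space,second_countable_topology}, 'h::euclidean_space) chart set
      \<Rightarrow> ('b::{t2_space,second_countable_topology}, 'e::euclidean_space) chart set
      \<Rightarrow> ('b, 'e) tensor2 \<Rightarrow> ('m \<Rightarrow> 'b) \<Rightarrow> ('m \<Rightarrow> ('b, 'e) tvec) \<Rightarrow> bool" where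
  "real_hypersurface A B G f N \<longleftrightarrow> DIM('h) = DIM('e) - 1 \<and>
     smooth_manifold A \<and> immersion A B f \<and> unit_normal_field A B G f N"

text \<open>\<open>\<xi> = -J N\<close>, read as a tangent vector of the hypersurface through the differential
  of the immersion.\<close>

definition structure_vector ::
    "('m, 'h::euclidean_space) chart set \<Rightarrow> ('b, 'e::euclidean_space) chart set
      \<Rightarrow> ('b \<Rightarrow> ('b, 'e) tvec \<Rightarrow> ('b, 'e) tvec) \<Rightarrow> ('m \<Rightarrow> 'b) \<Rightarrow> ('m \<Rightarrow> ('b, 'e) tvec)
      \<Rightarrow> 'm \<Rightarrow> ('m, 'h) tvec" where
  "structure_vector A B J f N p =
     (THE X. X \<in> tangent_space A p \<and> differential A B f p X = - J (f p) (N p))"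

definition contact_form ::
    "('m, 'h::euclidean_space) chart set \<Rightarrow> ('b, 'e::euclidean_space) chart set
      \<Rightarrow> ('b, 'e) tensor2 \<Rightarrow> ('b \<Rightarrow> ('b, 'e) tvec \<Rightarrow> ('b, 'e) tvec)
      \<Rightarrow> ('m \<Rightarrow> 'b) \<Rightarrow> ('m \<Rightarrow> ('b, 'e) tvec) \<Rightarrow> 'm \<Rightarrow> ('m, 'h) tvec \<Rightarrow> real" where
  "contact_form A B G J f N p X = induced_metric A B G f p X (structure_vector A B J f N p)"

definition holomorphic_distribution ::
    "('m, 'h::euclidean_space) chart set \<Rightarrow> ('b, 'e::euclidean_space) chart set
      \<Rightarrow> ('b, 'e) tensor2 \<Rightarrow> ('b \<Rightarrow> ('b, 'e) tvec \<Rightarrow> ('b, 'e) tvec)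
      \<Rightarrow> ('m \<Rightarrow> 'b) \<Rightarrow> ('m \<Rightarrow> ('b, 'e) tvec) \<Rightarrow> 'm \<Rightarrow> ('m, 'h) tvec set" where
  "holomorphic_distribution A B G J f N p =
     {X \<in> tangent_space A p. contact_form A B G J f N p X = 0}"

definition pseudo_einstein ::
    "('m, 'h::euclidean_space) chart set \<Rightarrow> ('b, 'e::euclidean_space) chart set
      \<Rightarrow> ('b, 'e) tensor2 \<Rightarrow> ('b \<Rightarrow> ('b, 'e) tvec \<Rightarrow> ('b, 'e) tvec)
      \<Rightarrow> ('m \<Rightarrow> 'b) \<Rightarrow> ('m \<Rightarrow> ('b, 'e) tvec) \<Rightarrow> bool" where
  "pseudo_einstein A B G J f N \<longleftrightarrow>
     (\<exists>a b. \<forall>p. \<forall>X\<in>tangent_space A p. \<forall>Y\<in>tangent_space A p.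
        ricci A (induced_metric A B G f) p X Y =
          a * induced_metric A B G f p X Y
          + b * contact_form A B G J f N p X * contact_form A B G J f N p Y)"

end

theory Submission
  imports Defs
begin

text \<open>By the Gauss equation, the condition says that \<open>h A - A\<^sup>2\<close>, with \<open>A\<close> the shape operator and
  \<open>h\<close> its trace, restricts on \<open>H\<close> to a multiple of the metric. Differentiating this
  and using the Codazzi equation restricts the first jet of \<open>A\<close>.

  Where \<open>A \<xi> = \<alpha> \<xi> + \<beta> U\<close> with \<open>\<beta> \<noteq> 0\<close>, \<open>A\<close> has at most two eigenvalues \<open>\<lambda>\<^sub>1\<close>, \<open>\<lambda>\<^sub>2\<close> on the complement of
  \<open>\<xi>\<close> and \<open>U\<close>. With \<open>\<tau>\<close> the trace there, one of them satisfies \<open>c = \<tau> \<lambda>\<^sub>i\<close>, say \<open>i = 1\<close>, and \<open>h\<close>, \<open>\<tau>\<close>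
  are locally constant. The vector field \<open>Q = \<phi> A \<xi>\<close> then lies in the eigenspace of \<open>\<lambda>\<^sub>1\<close>. A unit eigenvector \<open>W\<close> for
  \<open>\<lambda>\<^sub>2\<close> would give \<open>\<langle>R(W, Q) Q, W\<rangle> = 0\<close>, contradicting the Gauss equation; if there is none, \<open>d\<alpha>\<close> is a
  nonzero multiple of the dual of \<open>Q\<close>, and \<open>d d\<alpha> = 0\<close> forces \<open>\<alpha>\<close> to be constant, again a contradiction.

  Hence \<open>A \<xi> = \<alpha> \<xi>\<close>. Then \<open>S(\<xi>, X) = 0\<close> for \<open>X\<close> in \<open>H\<close>, and the relation
  \<open>2 A \<phi> A - \<alpha> (A \<phi> + \<phi> A) = 2 c \<phi>\<close> on \<open>H\<close> leaves only
  finitely many values for \<open>S(\<xi>, \<xi>)\<close>, which is therefore constant by connectedness.\<close>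

section \<open>Smooth maps on open sets\<close>

text \<open>The obstacle is that \<open>h\<close> may vary. Only the product \<open>k\<close> of the
  two eigenvalues is constant from the start, so an eigenvalue equation cannot simply be
  differentiated, and bases of eigenvectors come without a smooth choice. The argument therefore
  alternates between two levels. The jet equations are solved at a single point, as linear algebra
  in freely chosen bases; what has to pass to a neighbourhood is phrased through \<open>tau\<close>,
  \<open>h\<close> and \<open>disc\<close>, which do not depend on the order of the eigenvalues.

  The number \<open>c\<close> meets \<open>\<tau> l_i\<close> because \<open>H\<close> is not
  parallel: differentiating the condition brings in the mixed component
  \<open>S(\<xi>, U) = \<tau> \<beta>\<close>, and antisymmetrising with Codazzi compares it with
  \<open>c\<close>. If \<open>c\<close> differed from both products, \<open>\<phi>\<close> would map
  each eigenspace into its orthogonal complement, and a dimension count would put \<open>Q\<close>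
  into the larger one. For \<open>n \<ge> 3\<close> that one has dimension at least 2, which makes
  its eigenvalue 0, and the jet equations then contradict \<open>c \<noteq> 0\<close>. Once
  \<open>c = \<tau> l1\<close>, the trace identity for \<open>\<tau>\<close> leaves finitely many
  values.\<close>

abbreviation fd :: "('a::real_normed_vector \<Rightarrow> 'b::real_normed_vector) \<Rightarrow> 'a \<Rightarrow> 'a \<Rightarrow> 'b" where
  "fd f x \<equiv> frechet_derivative f (at x)"

lemma fd_eq: "(f has_derivative f') (at x) \<Longrightarrow> fd f x = f'"
  by (metis frechet_derivative_at)

lemma fd_cong:
  assumes "open S" "x \<in> S" "\<And>y. y \<in> S \<Longrightarrow> f y = g y"
  shows "fd f x = fd g x"
proof -
  have "(f has_derivative d) (at x) \<longleftrightarrow> (g has_derivative d) (at x)" for d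
    using has_derivative_transform_within_open[of f d x UNIV S g]
      has_derivative_transform_within_open[of g d x UNIV S f] assms by auto
  then show ?thesis unfolding frechet_derivative_def by simp
qed

lemma differentiable_cong_open:
  assumes "open S" "x \<in> S" "\<And>y. y \<in> S \<Longrightarrow> f y = g y" "f differentiable (at x)"
  shows "g differentiable (at x)"
  using assms has_derivative_transform_within_open[of f _ x UNIV S g]
  unfolding differentiable_def by blast

lemma Ck_on_cong:
  assumes "open S" "\<And>x. x \<in> S \<Longrightarrow> f x = g x" "Ck_on k S f"
  shows "Ck_on k S g"
  using assms(2,3)
proof (induction k arbitrary: f g)
  case 0
  then show ?case by (metis Ck_on.simps(1) continuous_on_cong)
next
  case (Suc k)
  have "g differentiable (at x)" if "x \<in> S" for x
    using differentiable_cong_open[OF assms(1) that, of f g] Suc.prems that by simp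
  moreover have "Ck_on k S (\<lambda>x. fd g x v)" for v
    by (rule Suc.IH[of "\<lambda>x. fd f x v"])
       (use Suc.prems fd_cong[OF assms(1), of _ f g] in auto)
  ultimately show ?case by simp
qed

lemma Ck_on_subset: "Ck_on k S f \<Longrightarrow> T \<subseteq> S \<Longrightarrow> Ck_on k T f"
  by (induction k arbitrary: f) (auto intro: continuous_on_subset)

lemma differentiable_imp_Ck_on_0: "(\<And>x. x \<in> S \<Longrightarrow> f differentiable (at x)) \<Longrightarrow> Ck_on 0 S f"
  by (simp add: continuous_at_imp_continuous_on differentiable_imp_continuous_within)

lemma Ck_on_Suc_D: "Ck_on (Suc k) S f \<Longrightarrow> Ck_on k S f"
proof (induction k arbitrary: f)
  case 0
  then show ?case by (intro differentiable_imp_Ck_on_0) auto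
qed auto

lemma Ck_on_const [simp]: "Ck_on k S (\<lambda>x. c)"
proof (induction k arbitrary: c)
  case (Suc k)
  have "fd (\<lambda>x. c) x = (\<lambda>v. 0)" for x by (rule fd_eq) simp
  then show ?case using Suc by simp
qed simp

lemma Ck_on_add:
  assumes "open S" "Ck_on k S f" "Ck_on k S g"
  shows "Ck_on k S (\<lambda>x. f x + g x)"
  using assms(2,3)
proof (induction k arbitrary: f g)
  case 0
  then show ?case by (simp add: continuous_on_add)
next
  case (Suc k)
  have d: "fd (\<lambda>x. f x + g x) x v = fd f x v + fd g x v" if "x \<in> S" for x v
    using Suc.prems that fd_eq[OF has_derivative_add[of f "fd f x" "at x" g "fd g x"]]
    by (simp add: frechet_derivative_works)
  have "Ck_on k S (\<lambda>x. fd (\<lambda>x. f x + g x) x v)" for v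
    by (rule Ck_on_cong[OF assms(1), of "\<lambda>x. fd f x v + fd g x v"])
       (use d Suc in auto)
  then show ?case using Suc.prems by auto
qed

lemma Ck_on_bilinear:
  assumes "open S" "bounded_bilinear pr" "Ck_on k S f" "Ck_on k S g"
  shows "Ck_on k S (\<lambda>x. pr (f x) (g x))"
  using assms(3,4)
proof (induction k arbitrary: f g)
  case 0
  then show ?case using bounded_bilinear.continuous_on[OF assms(2)] by simp
next
  case (Suc k)
  have h: "((\<lambda>x. pr (f x) (g x)) has_derivative (\<lambda>v. pr (f x) (fd g x v) + pr (fd f x v) (g x))) (at x)"
    if "x \<in> S" for x
    using Suc.prems that bounded_bilinear.FDERIV[OF assms(2), of f "fd f x" x UNIV g "fd g x"]
    by (simp add: frechet_derivative_works)
  have "Ck_on k S (\<lambda>x. fd (\<lambda>x. pr (f x) (g x)) x v)" for v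
    by (rule Ck_on_cong[OF assms(1), of "\<lambda>x. pr (f x) (fd g x v) + pr (fd f x v) (g x)"])
       (use fd_eq[OF h] Suc Ck_on_Suc_D[OF Suc.prems(1)] Ck_on_Suc_D[OF Suc.prems(2)]
         in \<open>auto intro!: Ck_on_add assms\<close>)
  then show ?case using h by (auto simp: differentiable_def)
qed

lemma Ck_on_linear:
  assumes "open S" "bounded_linear L" "Ck_on k S f"
  shows "Ck_on k S (\<lambda>x. L (f x))"
  using assms(3)
proof (induction k arbitrary: f)
  case 0
  then show ?case using bounded_linear.continuous_on[OF assms(2)] by simp
next
  case (Suc k)
  have h: "((\<lambda>x. L (f x)) has_derivative (\<lambda>v. L (fd f x v))) (at x)" if "x \<in> S" for x
    using Suc.prems that bounded_linear.has_derivative[OF assms(2), of f "fd f x" "at x"]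
    by (simp add: frechet_derivative_works)
  have "Ck_on k S (\<lambda>x. fd (\<lambda>x. L (f x)) x v)" for v
    by (rule Ck_on_cong[OF assms(1), of "\<lambda>x. L (fd f x v)"]) (use fd_eq[OF h] Suc in auto)
  then show ?case using h by (auto simp: differentiable_def)
qed

lemma Ck_on_sum:
  assumes "open S" "\<And>i. i \<in> I \<Longrightarrow> Ck_on k S (f i)"
  shows "Ck_on k S (\<lambda>x. \<Sum>i\<in>I. f i x)"
  using assms(2)
  by (induction I rule: infinite_finite_induct) (auto intro: Ck_on_add assms)

lemma linear_Basis_expand:
  assumes "linear L"
  shows "L (v::'a::euclidean_space) = (\<Sum>b\<in>Basis. (v \<bullet> b) *\<^sub>R L b)"
proof -
  have "L v = L (\<Sum>b\<in>Basis. (v \<bullet> b) *\<^sub>R b)" by (simp add: euclidean_representation)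
  then show ?thesis by (simp add: linear_sum[OF assms] linear_scale[OF assms])
qed

lemma linear_fd: "f differentiable (at x) \<Longrightarrow> linear (fd f x)"
  by (metis frechet_derivative_works has_derivative_linear)

lemma fd_chain:
  assumes "f differentiable (at x)" "g differentiable (at (f x))"
  shows "fd (\<lambda>x. g (f x)) x v = fd g (f x) (fd f x v)"
  using fd_eq[OF diff_chain_at[of f "fd f x" x g "fd g (f x)"]] assms
  by (simp add: frechet_derivative_works o_def)

text \<open>The chain rule evaluates \<open>fd g\<close> in the moving direction
  \<open>fd f x v\<close>, whereas \<open>Ck_on\<close> controls fixed directions only. Expanding
  that direction in the basis gives a sum of products of maps of class \<open>k\<close>, to which
  the induction hypothesis applies.\<close>

lemma Ck_on_compose:
  fixes f :: "'a::euclidean_space \<Rightarrow> 'b::euclidean_space"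
  assumes "open S" "open T" "\<And>x. x \<in> S \<Longrightarrow> f x \<in> T" "Ck_on k S f" "Ck_on k T g"
  shows "Ck_on k S (\<lambda>x. g (f x))"
  using assms(4,5)
proof (induction k arbitrary: g)
  case 0
  then show ?case using assms(3) continuous_on_compose2[of T g S f] by auto
next
  case (Suc k)
  have d: "g differentiable (at (f x))" "f differentiable (at x)" if "x \<in> S" for x
    using Suc.prems assms(3) that by auto
  have e: "fd (\<lambda>x. g (f x)) x v = (\<Sum>b\<in>Basis. (fd f x v \<bullet> b) *\<^sub>R fd g (f x) b)" if "x \<in> S" for x v
    using fd_chain[OF d(2) d(1)] linear_Basis_expand[OF linear_fd[OF d(1)]] that by metis
  have "Ck_on k S (\<lambda>x. \<Sum>b\<in>Basis. (fd f x v \<bullet> b) *\<^sub>R fd g (f x) b)" for v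
    by (intro Ck_on_sum Ck_on_bilinear[where pr=scaleR] bounded_bilinear_scaleR assms(1)
        Ck_on_linear[where L="\<lambda>x. x \<bullet> b" for b] bounded_linear_inner_left Suc.IH)
       (use Suc.prems Ck_on_Suc_D in auto)
  then have "Ck_on k S (\<lambda>x. fd (\<lambda>x. g (f x)) x v)" for v
    by (rule Ck_on_cong[OF assms(1), rotated]) (simp add: e)
  moreover have "(\<lambda>x. g (f x)) differentiable (at x)" if "x \<in> S" for x
    using differentiable_chain_at[of f x g] d that by (simp add: o_def)
  ultimately show ?case by simp
qed

text \<open>The derivative of the reciprocal is a product of the reciprocal itself, already of class
  \<open>k\<close>, and a derivative of \<open>f\<close>. So the induction runs on \<open>k\<close>
  with \<open>f\<close> fixed. The square root is treated alike.\<close>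

lemma Ck_on_inverse:
  fixes f :: "'a::euclidean_space \<Rightarrow> real"
  assumes "open S" "\<And>x. x \<in> S \<Longrightarrow> f x \<noteq> 0" "Ck_on k S f"
  shows "Ck_on k S (\<lambda>x. inverse (f x))"
  using assms(3)
proof (induction k)
  case 0
  then show ?case using assms(2) by (simp add: continuous_on_inverse)
next
  case (Suc k)
  have h: "((\<lambda>x. inverse (f x)) has_derivative (\<lambda>v. - (inverse (f x) * fd f x v * inverse (f x)))) (at x)"
    if "x \<in> S" for x
    using Suc.prems assms(2) that by (intro Deriv.has_derivative_inverse) (auto simp: frechet_derivative_works)
  have i: "Ck_on k S (\<lambda>x. inverse (f x))" by (rule Suc.IH) (rule Ck_on_Suc_D[OF Suc.prems])
  have "Ck_on k S (\<lambda>x. - (inverse (f x) * fd f x v * inverse (f x)))" for v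
    by (intro Ck_on_linear[where L=uminus] Ck_on_bilinear[where pr="(*)"] bounded_bilinear_mult
        assms(1) i bounded_linear_minus bounded_linear_ident) (use Suc.prems in auto)
  then have "Ck_on k S (\<lambda>x. fd (\<lambda>x. inverse (f x)) x v)" for v
    by (rule Ck_on_cong[OF assms(1), rotated, of _ "\<lambda>x. - (inverse (f x) * fd f x v * inverse (f x))"]) (simp add: fd_eq[OF h])
  then show ?case using h by (auto simp: differentiable_def)
qed

lemma Ck_on_sqrt:
  fixes f :: "'a::euclidean_space \<Rightarrow> real"
  assumes "open S" "\<And>x. x \<in> S \<Longrightarrow> f x > 0" "Ck_on k S f"
  shows "Ck_on k S (\<lambda>x. sqrt (f x))"
  using assms(3)
proof (induction k)
  case 0
  then show ?case using continuous_on_real_sqrt by simp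
next
  case (Suc k)
  have h: "((\<lambda>x. sqrt (f x)) has_derivative (\<lambda>v. fd f x v * (inverse (sqrt (f x)) / 2))) (at x)"
    if "x \<in> S" for x
    using DERIV_real_sqrt[OF assms(2)[OF that]] Suc.prems that
    by (auto intro!: has_derivative_real_sqrt derivative_eq_intros
        simp: frechet_derivative_works field_simps assms(2) fun_eq_iff)
  have i: "Ck_on k S (\<lambda>x. sqrt (f x))" by (rule Suc.IH) (rule Ck_on_Suc_D[OF Suc.prems])
  have "Ck_on k S (\<lambda>x. inverse (sqrt (f x)))"
    by (rule Ck_on_inverse[OF assms(1) _ i]) (use assms(2) in force)
  then have "Ck_on k S (\<lambda>x. fd f x v * (inverse (sqrt (f x)) / 2))" for v
    by (intro Ck_on_linear[where L="\<lambda>x. x / 2"] Ck_on_bilinear[where pr="(*)"] bounded_bilinear_mult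
        assms(1) bounded_linear_divide) (use Suc.prems in auto)
  then have "Ck_on k S (\<lambda>x. fd (\<lambda>x. sqrt (f x)) x v)" for v
    by (rule Ck_on_cong[OF assms(1), rotated, of _ "\<lambda>x. fd f x v * (inverse (sqrt (f x)) / 2)"]) (simp add: fd_eq[OF h])
  then show ?case using h by (auto simp: differentiable_def)
qed

lemma smooth_on_cong: "open S \<Longrightarrow> (\<And>x. x \<in> S \<Longrightarrow> f x = g x) \<Longrightarrow> smooth_on S f \<Longrightarrow> smooth_on S g"
  unfolding smooth_on_def using Ck_on_cong by blast

lemma smooth_on_subset: "smooth_on S f \<Longrightarrow> T \<subseteq> S \<Longrightarrow> smooth_on T f"
  unfolding smooth_on_def using Ck_on_subset by blast

lemma smooth_on_diff: "smooth_on S f \<Longrightarrow> x \<in> S \<Longrightarrow> f differentiable (at x)"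
  unfolding smooth_on_def using Ck_on.simps(2) by blast

lemma smooth_on_has_derivative: "smooth_on S f \<Longrightarrow> x \<in> S \<Longrightarrow> (f has_derivative fd f x) (at x)"
  using smooth_on_diff frechet_derivative_works by blast

lemma smooth_on_linear_fd: "smooth_on S f \<Longrightarrow> x \<in> S \<Longrightarrow> linear (fd f x)"
  using smooth_on_diff linear_fd by blast

lemma smooth_on_continuous: "smooth_on S f \<Longrightarrow> continuous_on S f"
  unfolding smooth_on_def using Ck_on.simps(1) by blast

lemma smooth_on_fd_const: "smooth_on S f \<Longrightarrow> smooth_on S (\<lambda>x. fd f x v)"
  unfolding smooth_on_def using Ck_on.simps(2) by blast

lemma smooth_on_const: "smooth_on S (\<lambda>x. c)"
  unfolding smooth_on_def by simp

lemma smooth_on_bounded_linear: "open S \<Longrightarrow> bounded_linear L \<Longrightarrow> smooth_on S f \<Longrightarrow> smooth_on S (\<lambda>x. L (f x))"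
  unfolding smooth_on_def using Ck_on_linear by blast

lemma smooth_on_id: "open S \<Longrightarrow> smooth_on S (\<lambda>x. x)"
  unfolding smooth_on_def
proof
  fix k assume "open S"
  show "Ck_on k S (\<lambda>x. x)"
  proof (cases k)
    case (Suc j)
    have "fd (\<lambda>x. x) x = (\<lambda>v. v)" for x :: 'a by (rule fd_eq) simp
    then show ?thesis using Suc by simp
  qed simp
qed

lemma smooth_on_add: "open S \<Longrightarrow> smooth_on S f \<Longrightarrow> smooth_on S g \<Longrightarrow> smooth_on S (\<lambda>x. f x + g x)"
  unfolding smooth_on_def using Ck_on_add by blast

lemma smooth_on_minus: "open S \<Longrightarrow> smooth_on S f \<Longrightarrow> smooth_on S (\<lambda>x. - f x)"
  by (rule smooth_on_bounded_linear) (auto intro: bounded_linear_minus bounded_linear_ident)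

lemma smooth_on_diff': "open S \<Longrightarrow> smooth_on S f \<Longrightarrow> smooth_on S g \<Longrightarrow> smooth_on S (\<lambda>x. f x - g x)"
  using smooth_on_add[of S f "\<lambda>x. - g x"] smooth_on_minus[of S g] by simp

lemma smooth_on_scaleR: "open S \<Longrightarrow> smooth_on S f \<Longrightarrow> smooth_on S g \<Longrightarrow> smooth_on S (\<lambda>x. f x *\<^sub>R g x)"
  unfolding smooth_on_def using Ck_on_bilinear[OF _ bounded_bilinear_scaleR] by blast

lemma smooth_on_mult:
  fixes f g :: "_ \<Rightarrow> real"
  shows "open S \<Longrightarrow> smooth_on S f \<Longrightarrow> smooth_on S g \<Longrightarrow> smooth_on S (\<lambda>x. f x * g x)"
  unfolding smooth_on_def using Ck_on_bilinear[OF _ bounded_bilinear_mult] by blast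

lemma smooth_on_inner:
  fixes f g :: "_ \<Rightarrow> 'b::real_inner"
  shows "open S \<Longrightarrow> smooth_on S f \<Longrightarrow> smooth_on S g \<Longrightarrow> smooth_on S (\<lambda>x. f x \<bullet> g x)"
  unfolding smooth_on_def using Ck_on_bilinear[OF _ bounded_bilinear_inner] by blast

lemma smooth_on_sum: "open S \<Longrightarrow> (\<And>i. i \<in> I \<Longrightarrow> smooth_on S (f i)) \<Longrightarrow> smooth_on S (\<lambda>x. \<Sum>i\<in>I. f i x)"
  unfolding smooth_on_def by (simp add: Ck_on_sum)

lemma smooth_on_compose:
  fixes f :: "'a::euclidean_space \<Rightarrow> 'b::euclidean_space"
  shows "open S \<Longrightarrow> open T \<Longrightarrow> (\<And>x. x \<in> S \<Longrightarrow> f x \<in> T) \<Longrightarrow> smooth_on S f \<Longrightarrow> smooth_on T g \<Longrightarrow>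
    smooth_on S (\<lambda>x. g (f x))"
  unfolding smooth_on_def using Ck_on_compose by blast

lemma smooth_on_inverse:
  "open S \<Longrightarrow> (\<And>x. x \<in> S \<Longrightarrow> f x \<noteq> (0::real)) \<Longrightarrow> smooth_on S f \<Longrightarrow> smooth_on S (\<lambda>x. inverse (f x))"
  unfolding smooth_on_def using Ck_on_inverse by blast

lemma smooth_on_divide:
  "open S \<Longrightarrow> (\<And>x. x \<in> S \<Longrightarrow> g x \<noteq> (0::real)) \<Longrightarrow> smooth_on S f \<Longrightarrow> smooth_on S g \<Longrightarrow>
    smooth_on S (\<lambda>x. f x / g x)"
  unfolding divide_inverse by (intro smooth_on_mult smooth_on_inverse)

lemma smooth_on_sqrt:
  "open S \<Longrightarrow> (\<And>x. x \<in> S \<Longrightarrow> f x > 0) \<Longrightarrow> smooth_on S f \<Longrightarrow> smooth_on S (\<lambda>x. sqrt (f x))"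
  unfolding smooth_on_def using Ck_on_sqrt by blast

lemmas smooth_intros = smooth_on_const smooth_on_id smooth_on_add smooth_on_minus smooth_on_diff'
  smooth_on_scaleR smooth_on_mult smooth_on_inner smooth_on_sum

subsection \<open>Families of linear and bilinear maps\<close>

text \<open>Tensor fields are recorded as smooth on constant arguments only. Basis expansion extends
  this to variable arguments; \<open>fd_linear_family\<close> and the bilinear versions below give
  the matching Leibniz rules.\<close>

lemma smooth_on_linear_family:
  fixes \<beta> :: "'a::euclidean_space \<Rightarrow> 'b::euclidean_space \<Rightarrow> 'c::real_normed_vector"
  assumes "open S" "\<And>x. x \<in> S \<Longrightarrow> linear (\<beta> x)" "\<And>v. smooth_on S (\<lambda>x. \<beta> x v)" "smooth_on S Y"
  shows "smooth_on S (\<lambda>x. \<beta> x (Y x))"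
proof (rule smooth_on_cong[OF assms(1)])
  show "smooth_on S (\<lambda>x. \<Sum>b\<in>Basis. (Y x \<bullet> b) *\<^sub>R \<beta> x b)"
    by (intro smooth_intros assms)
qed (simp add: linear_Basis_expand[OF assms(2)] assms(1))

lemma fd_linear_family:
  fixes \<beta> :: "'a::euclidean_space \<Rightarrow> 'b::euclidean_space \<Rightarrow> 'c::real_normed_vector"
  assumes "open S" "\<And>x. x \<in> S \<Longrightarrow> linear (\<beta> x)" "\<And>v. smooth_on S (\<lambda>x. \<beta> x v)"
    and "x \<in> S" "Y differentiable (at x)"
  shows "fd (\<lambda>x. \<beta> x (Y x)) x u = fd (\<lambda>y. \<beta> y (Y x)) x u + \<beta> x (fd Y x u)"
proof -
  note hY = assms(5)[unfolded frechet_derivative_works]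
  note h\<beta> = smooth_on_has_derivative[OF assms(3,4)]
  have *: "((\<lambda>x. \<Sum>b\<in>Basis. (Y x \<bullet> b) *\<^sub>R \<beta> x b) has_derivative
     (\<lambda>u. \<Sum>b\<in>Basis. (Y x \<bullet> b) *\<^sub>R fd (\<lambda>y. \<beta> y b) x u + (fd Y x u \<bullet> b) *\<^sub>R \<beta> x b)) (at x)"
    by (intro has_derivative_sum has_derivative_scaleR has_derivative_inner_left hY h\<beta>)
  have **: "((\<lambda>y. \<Sum>b\<in>Basis. (Y x \<bullet> b) *\<^sub>R \<beta> y b) has_derivative
     (\<lambda>u. \<Sum>b\<in>Basis. (Y x \<bullet> b) *\<^sub>R fd (\<lambda>y. \<beta> y b) x u)) (at x)"
    by (intro has_derivative_sum has_derivative_scaleR_right h\<beta>)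
  have 1: "fd (\<lambda>x. \<beta> x (Y x)) x = fd (\<lambda>x. \<Sum>b\<in>Basis. (Y x \<bullet> b) *\<^sub>R \<beta> x b) x"
    by (rule fd_cong[OF assms(1,4)]) (rule linear_Basis_expand[OF assms(2)])
  have 2: "fd (\<lambda>y. \<beta> y (Y x)) x = fd (\<lambda>y. \<Sum>b\<in>Basis. (Y x \<bullet> b) *\<^sub>R \<beta> y b) x"
    by (rule fd_cong[OF assms(1,4)]) (rule linear_Basis_expand[OF assms(2)])
  show ?thesis unfolding 1 2 fd_eq[OF *] fd_eq[OF **]
    using linear_Basis_expand[OF assms(2)[OF assms(4)], of "fd Y x u"] by (simp add: sum.distrib)
qed

lemma bilinear_linears: "bilinear h \<Longrightarrow> linear (h a)" "bilinear h \<Longrightarrow> linear (\<lambda>x. h x b)"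
  unfolding bilinear_def by auto

lemma smooth_on_bilinear_family:
  fixes \<beta> :: "'a::euclidean_space \<Rightarrow> 'b::euclidean_space \<Rightarrow> 'd::euclidean_space \<Rightarrow> 'c::real_normed_vector"
  assumes "open S" "\<And>x. x \<in> S \<Longrightarrow> bilinear (\<beta> x)" "\<And>v w. smooth_on S (\<lambda>x. \<beta> x v w)"
    and "smooth_on S Y" "smooth_on S Z"
  shows "smooth_on S (\<lambda>x. \<beta> x (Y x) (Z x))"
proof -
  have s: "smooth_on S (\<lambda>x. \<beta> x (Y x) w)" for w
    by (rule smooth_on_linear_family[where \<beta>="\<lambda>x v. \<beta> x v w", OF assms(1) _ assms(3,4)])
       (rule bilinear_linears(2)[OF assms(2)])
  show ?thesis
    by (rule smooth_on_linear_family[where \<beta>="\<lambda>x w. \<beta> x (Y x) w", OF assms(1) _ s assms(5)])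
       (rule bilinear_linears(1)[OF assms(2)])
qed

lemma fd_bilinear_family:
  fixes \<beta> :: "'a::euclidean_space \<Rightarrow> 'b::euclidean_space \<Rightarrow> 'd::euclidean_space \<Rightarrow> 'c::real_normed_vector"
  assumes "open S" "\<And>x. x \<in> S \<Longrightarrow> bilinear (\<beta> x)" "\<And>v w. smooth_on S (\<lambda>x. \<beta> x v w)"
    and "x \<in> S" "smooth_on S Y" "Z differentiable (at x)"
  shows "fd (\<lambda>x. \<beta> x (Y x) (Z x)) x u =
    fd (\<lambda>y. \<beta> y (Y x) (Z x)) x u + \<beta> x (fd Y x u) (Z x) + \<beta> x (Y x) (fd Z x u)"
proof -
  have s: "smooth_on S (\<lambda>x. \<beta> x (Y x) w)" for w
    by (rule smooth_on_linear_family[where \<beta>="\<lambda>x v. \<beta> x v w", OF assms(1) _ assms(3,5)])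
       (rule bilinear_linears(2)[OF assms(2)])
  have "fd (\<lambda>x. \<beta> x (Y x) (Z x)) x u = fd (\<lambda>y. \<beta> y (Y y) (Z x)) x u + \<beta> x (Y x) (fd Z x u)"
    by (rule fd_linear_family[where \<beta>="\<lambda>x w. \<beta> x (Y x) w", OF assms(1) _ s assms(4,6)])
       (rule bilinear_linears(1)[OF assms(2)])
  moreover have "fd (\<lambda>y. \<beta> y (Y y) (Z x)) x u = fd (\<lambda>y. \<beta> y (Y x) (Z x)) x u + \<beta> x (fd Y x u) (Z x)"
    by (rule fd_linear_family[where \<beta>="\<lambda>y v. \<beta> y v (Z x)", OF assms(1) _ assms(3,4) smooth_on_diff[OF assms(5,4)]])
       (rule bilinear_linears(2)[OF assms(2)])
  ultimately show ?thesis by simp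
qed

lemma smooth_on_fd:
  assumes "open S" "smooth_on S f" "smooth_on S (v :: _ \<Rightarrow> 'a::euclidean_space)"
  shows "smooth_on S (\<lambda>x. fd f x (v x))"
  by (rule smooth_on_linear_family[where \<beta>="fd f", OF assms(1) _ smooth_on_fd_const[OF assms(2)] assms(3)])
     (rule smooth_on_linear_fd[OF assms(2)])

subsection \<open>Symmetry of second derivatives\<close>

lemma second_difference:
  fixes f :: "'a::real_normed_vector \<Rightarrow> real"
  assumes S: "open S" "x \<in> S" and df: "\<And>y. y \<in> S \<Longrightarrow> f differentiable (at y)"
    and dd: "(\<lambda>y. fd f y u) differentiable (at x)"
  shows "((\<lambda>t. (f (x + t *\<^sub>R u + t *\<^sub>R v) - f (x + t *\<^sub>R u) - f (x + t *\<^sub>R v) + f x) / t\<^sup>2)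
     \<longlongrightarrow> fd (\<lambda>y. fd f y u) x v) (at_right 0)"
proof (rule tendstoI)
  fix e :: real assume "e > 0"
  define g where "g = (\<lambda>y. fd f y u)"
  define L where "L = fd g x"
  have gL: "(g has_derivative L) (at x)" using dd by (simp add: L_def g_def frechet_derivative_works)
  have lin: "linear L" using gL has_derivative_linear by blast
  \<comment> \<open>\<open>t * M\<close> bounds the norms of both increments \<open>a\<close> and
    \<open>b\<close> below. Dividing \<open>e\<close> by \<open>4 * M\<close> leaves
    \<open>e / 2\<close> after two such errors, so the final inequality is strict.\<close>
  define M where "M = 2 * norm u + norm v + 1"
  have "M > 0" by (simp add: M_def add_nonneg_pos)
  define \<epsilon> where "\<epsilon> = e / (4 * M)"
  have "\<epsilon> > 0" using \<open>e > 0\<close> \<open>M > 0\<close> by (simp add: \<epsilon>_def)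
  then obtain d where d: "d > 0" "\<And>y. norm (y - x) < d \<Longrightarrow> norm (g y - g x - L (y - x)) \<le> \<epsilon> * norm (y - x)"
    using gL unfolding has_derivative_at_alt by blast
  obtain d' where d': "d' > 0" "ball x d' \<subseteq> S" using S openE by blast
  define r where "r = min d d' / M"
  have "r > 0" using d d' \<open>M > 0\<close> by (simp add: r_def)
  have main: "dist ((f (x + t *\<^sub>R u + t *\<^sub>R v) - f (x + t *\<^sub>R u) - f (x + t *\<^sub>R v) + f x) / t\<^sup>2) (L v) < e"
    if t: "0 < t" "t < r" for t
  proof -
    have tM: "t * M < min d d'" using t \<open>M > 0\<close> by (simp add: r_def pos_less_divide_eq)
    have nb: "norm (s *\<^sub>R u + a *\<^sub>R v) \<le> t * M" if "0 \<le> s" "s \<le> t" "0 \<le> a" "a \<le> t" for s a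
    proof -
      have "norm (s *\<^sub>R u + a *\<^sub>R v) \<le> s * norm u + a * norm v"
        using norm_triangle_ineq[of "s *\<^sub>R u" "a *\<^sub>R v"] that by simp
      also have "\<dots> \<le> t * norm u + t * norm v" using that by (intro add_mono mult_right_mono) auto
      also have "\<dots> \<le> t * M" using t by (simp add: M_def algebra_simps)
      finally show ?thesis .
    qed
    have inS: "x + s *\<^sub>R u + a *\<^sub>R v \<in> S" if "0 \<le> s" "s \<le> t" "0 \<le> a" "a \<le> t" for s a
      using nb[OF that] tM d' by (auto simp: subset_iff dist_norm norm_minus_commute add.assoc)
    have inS0: "x + s *\<^sub>R u \<in> S" if "0 \<le> s" "s \<le> t" for s
      using inS[of s 0] that t by simp
    \<comment> \<open>The numerator is \<open>p t - p 0\<close>. The mean value theorem turns it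
      into \<open>t\<close> times an increment of \<open>g\<close> between two points that differ by
      \<open>t *\<^sub>R v\<close>.\<close>
    define p where "p s = f (x + s *\<^sub>R u + t *\<^sub>R v) - f (x + s *\<^sub>R u)" for s
    have der: "(p has_real_derivative (g (x + s *\<^sub>R u + t *\<^sub>R v) - g (x + s *\<^sub>R u))) (at s)"
      if "0 \<le> s" "s \<le> t" for s
    proof -
      have a: "((\<lambda>s. x + s *\<^sub>R u + t *\<^sub>R v) has_derivative (\<lambda>h. h *\<^sub>R u)) (at s)"
        by (auto intro!: derivative_eq_intros)
      have b: "((\<lambda>s. x + s *\<^sub>R u) has_derivative (\<lambda>h. h *\<^sub>R u)) (at s)"
        by (auto intro!: derivative_eq_intros)
      have fa: "(f has_derivative fd f y) (at y)" if "y \<in> S" for y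
        using df[OF that] frechet_derivative_works by blast
      have "(p has_derivative (\<lambda>h. fd f (x + s *\<^sub>R u + t *\<^sub>R v) (h *\<^sub>R u) - fd f (x + s *\<^sub>R u) (h *\<^sub>R u))) (at s)"
        unfolding p_def
        by (intro has_derivative_diff has_derivative_compose[OF a fa] has_derivative_compose[OF b fa]
             inS inS0) (use that t in auto)
      moreover have "(\<lambda>h. fd f (x + s *\<^sub>R u + t *\<^sub>R v) (h *\<^sub>R u) - fd f (x + s *\<^sub>R u) (h *\<^sub>R u))
         = (*) (g (x + s *\<^sub>R u + t *\<^sub>R v) - g (x + s *\<^sub>R u))"
        using linear_scale[OF linear_fd[OF df]] inS[of s t] inS0[of s] that t
        by (auto simp: g_def fun_eq_iff algebra_simps)
      ultimately show ?thesis by (simp add: has_field_derivative_def)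
    qed
    obtain s where s: "0 < s" "s < t" "p t - p 0 = (t - 0) * (g (x + s *\<^sub>R u + t *\<^sub>R v) - g (x + s *\<^sub>R u))"
      using MVT2[of 0 t p "\<lambda>s. g (x + s *\<^sub>R u + t *\<^sub>R v) - g (x + s *\<^sub>R u)"] der t by auto
    define a where "a = s *\<^sub>R u + t *\<^sub>R v"
    define b where "b = s *\<^sub>R u"
    have na: "norm a \<le> t * M" unfolding a_def by (rule nb) (use s t in auto)
    have nbb: "norm b \<le> t * M" unfolding b_def using nb[of s 0] s t by simp
    have ea: "\<bar>g (x + a) - g x - L a\<bar> \<le> \<epsilon> * (t * M)"
      using order_trans[OF d(2)[of "x + a"] mult_left_mono[OF _ less_imp_le[OF \<open>\<epsilon> > 0\<close>], of _ "t * M"]] na tM by simp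
    have eb: "\<bar>g (x + b) - g x - L b\<bar> \<le> \<epsilon> * (t * M)"
      using order_trans[OF d(2)[of "x + b"] mult_left_mono[OF _ less_imp_le[OF \<open>\<epsilon> > 0\<close>], of _ "t * M"]] nbb tM by simp
    have Lab: "L a - L b = t * L v"
      using lin by (simp add: a_def b_def linear_add linear_scale)
    have "\<bar>(g (x + a) - g (x + b)) - t * L v\<bar> \<le> 2 * (\<epsilon> * (t * M))"
      using ea eb Lab by linarith
    also have "2 * (\<epsilon> * (t * M)) = t * e / 2" using \<open>M > 0\<close> by (simp add: \<epsilon>_def)
    finally have k: "\<bar>(g (x + a) - g (x + b)) - t * L v\<bar> \<le> t * e / 2" .
    have "f (x + t *\<^sub>R u + t *\<^sub>R v) - f (x + t *\<^sub>R u) - f (x + t *\<^sub>R v) + f x = p t - p 0"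
      by (simp add: p_def)
    also have "\<dots> = t * (g (x + a) - g (x + b))" using s by (simp add: a_def b_def add.assoc)
    finally have num: "f (x + t *\<^sub>R u + t *\<^sub>R v) - f (x + t *\<^sub>R u) - f (x + t *\<^sub>R v) + f x = t * (g (x + a) - g (x + b))" .
    have "(f (x + t *\<^sub>R u + t *\<^sub>R v) - f (x + t *\<^sub>R u) - f (x + t *\<^sub>R v) + f x) / t\<^sup>2 - L v
      = ((g (x + a) - g (x + b)) - t * L v) / t"
      unfolding num using t by (simp add: diff_divide_distrib power2_eq_square)
    then have "dist ((f (x + t *\<^sub>R u + t *\<^sub>R v) - f (x + t *\<^sub>R u) - f (x + t *\<^sub>R v) + f x) / t\<^sup>2) (L v)
      = \<bar>(g (x + a) - g (x + b)) - t * L v\<bar> / t" using t by (simp add: dist_real_def)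
    also have "\<dots> \<le> e / 2" using k t by (simp add: field_simps)
    finally show ?thesis using \<open>e > 0\<close> by simp
  qed
  then show "\<forall>\<^sub>F t in at_right 0. dist ((f (x + t *\<^sub>R u + t *\<^sub>R v) - f (x + t *\<^sub>R u) - f (x + t *\<^sub>R v) + f x) / t\<^sup>2)
     (fd (\<lambda>y. fd f y u) x v) < e"
    unfolding eventually_at_right_field using \<open>r > 0\<close> unfolding L_def g_def by blast
qed

lemma fd_fd_commute_real:
  fixes f :: "'a::euclidean_space \<Rightarrow> real"
  assumes "open S" "x \<in> S" "smooth_on S f"
  shows "fd (\<lambda>y. fd f y u) x v = fd (\<lambda>y. fd f y v) x u"
proof -
  have "(\<lambda>t. (f (x + t *\<^sub>R v + t *\<^sub>R u) - f (x + t *\<^sub>R v) - f (x + t *\<^sub>R u) + f x) / t\<^sup>2)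
    = (\<lambda>t. (f (x + t *\<^sub>R u + t *\<^sub>R v) - f (x + t *\<^sub>R u) - f (x + t *\<^sub>R v) + f x) / t\<^sup>2)"
    by (simp add: algebra_simps)
  moreover note second_difference[OF assms(1,2) smooth_on_diff[OF assms(3)]
      smooth_on_diff[OF smooth_on_fd_const[OF assms(3)] assms(2)], of u v]
  moreover note second_difference[OF assms(1,2) smooth_on_diff[OF assms(3)]
      smooth_on_diff[OF smooth_on_fd_const[OF assms(3)] assms(2)], of v u]
  ultimately show ?thesis
    using tendsto_unique[OF trivial_limit_at_right_real] by simp
qed

lemma fd_inner_const: "f differentiable (at x) \<Longrightarrow> fd (\<lambda>y. f y \<bullet> b) x v = fd f x v \<bullet> b"
  by (subst fd_eq[OF has_derivative_inner_left]) (auto simp: frechet_derivative_works)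

lemma fd_fd_commute:
  fixes f :: "'a::euclidean_space \<Rightarrow> 'b::euclidean_space"
  assumes "open S" "x \<in> S" "smooth_on S f"
  shows "fd (\<lambda>y. fd f y u) x v = fd (\<lambda>y. fd f y v) x u"
proof (rule euclidean_eqI)
  fix b :: 'b
  have s: "smooth_on S (\<lambda>y. f y \<bullet> b)"
    using smooth_on_bounded_linear[OF assms(1) bounded_linear_inner_left assms(3)] .
  have e: "fd (\<lambda>y. fd f y u) x v \<bullet> b = fd (\<lambda>y. fd (\<lambda>y. f y \<bullet> b) y u) x v" for u v
  proof -
    have "fd (\<lambda>y. fd (\<lambda>y. f y \<bullet> b) y u) x = fd (\<lambda>y. fd f y u \<bullet> b) x"
      by (rule fd_cong[OF assms(1,2)]) (simp add: fd_inner_const smooth_on_diff[OF assms(3)])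
    then show ?thesis
      by (simp add: fd_inner_const smooth_on_diff[OF smooth_on_fd_const[OF assms(3)] assms(2)])
  qed
  show "fd (\<lambda>y. fd f y u) x v \<bullet> b = fd (\<lambda>y. fd f y v) x u \<bullet> b"
    unfolding e using fd_fd_commute_real[OF assms(1,2) s, of u v] .
qed

section \<open>Inner products on a Euclidean space\<close>

locale ips =
  fixes g :: "'a::euclidean_space \<Rightarrow> 'a \<Rightarrow> real"
  assumes bil: "bilinear g" and sym: "g v w = g w v" and pos: "v \<noteq> 0 \<Longrightarrow> g v v > 0"
begin

lemma add_l: "g (a + b) c = g a c + g b c" using bil bilinear_ladd by blast
lemma add_r: "g c (a + b) = g c a + g c b" using bil bilinear_radd by blast
lemma diff_l: "g (a - b) c = g a c - g b c" using bil bilinear_lsub by blast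
lemma diff_r: "g c (a - b) = g c a - g c b" using bil bilinear_rsub by blast
lemma scale_l: "g (r *\<^sub>R a) c = r * g a c" using bilinear_lmul[OF bil] by simp
lemma scale_r: "g c (r *\<^sub>R a) = r * g c a" using bilinear_rmul[OF bil] by simp
lemma minus_l: "g (- a) c = - g a c" using bilinear_lneg[OF bil] by simp
lemma minus_r: "g c (- a) = - g c a" using bilinear_rneg[OF bil] by simp
lemma zero_l: "g 0 c = 0" using bilinear_lzero[OF bil] by simp
lemma zero_r: "g c 0 = 0" using bilinear_rzero[OF bil] by simp
lemma sum_l: "g (sum f I) c = (\<Sum>i\<in>I. g (f i) c)"
  using linear_sum[OF bilinear_linears(2)[OF bil]] .
lemma sum_r: "g c (sum f I) = (\<Sum>i\<in>I. g c (f i))"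
  using linear_sum[OF bilinear_linears(1)[OF bil]] .

lemmas ip_simps = add_l add_r diff_l diff_r scale_l scale_r minus_l minus_r zero_l zero_r

lemma nonneg: "g v v \<ge> 0" using pos[of v] zero_l by fastforce

lemma eq_0_iff: "g v v = 0 \<longleftrightarrow> v = 0" using pos[of v] zero_l by fastforce

lemma eqI: "(\<And>w. g u w = g v w) \<Longrightarrow> u = v"
  using eq_0_iff[of "u - v"] by (simp add: ip_simps)

definition ON :: "'a set \<Rightarrow> bool" where
  "ON E \<longleftrightarrow> (\<forall>e\<in>E. \<forall>e'\<in>E. g e e' = (if e = e' then 1 else 0))"

lemma ON_subset: "ON E \<Longrightarrow> E' \<subseteq> E \<Longrightarrow> ON E'" unfolding ON_def by blast

lemma ON_coeff:
  assumes "ON E" "finite E" "e \<in> E"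
  shows "g (\<Sum>e\<in>E. r e *\<^sub>R e) e = r e"
proof -
  have "g (\<Sum>e\<in>E. r e *\<^sub>R e) e = (\<Sum>e'\<in>E. if e' = e then r e' else 0)"
    unfolding sum_l scale_l using assms by (intro sum.cong) (auto simp: ON_def)
  then show ?thesis using assms by simp
qed

lemma ON_independent: assumes "ON E" shows "independent E"
proof (rule ccontr)
  assume "\<not> independent E"
  then obtain S u e where S: "finite S" "S \<subseteq> E" "e \<in> S" "u e \<noteq> (0::real)" "(\<Sum>v\<in>S. u v *\<^sub>R v) = 0"
    unfolding dependent_explicit by blast
  then have "u e = 0" using ON_coeff[OF ON_subset[OF assms S(2)] S(1,3), of u] zero_l by simp
  with S show False by simp
qed

lemma ON_finite: "ON E \<Longrightarrow> finite E" and ON_card: "ON E \<Longrightarrow> card E \<le> DIM('a)"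
  using independent_bound ON_independent by blast+

text \<open>An orthonormal subset of \<open>K\<close> of greatest cardinality, which exists since
  \<open>DIM('a)\<close> is a bound, must span \<open>K\<close>: otherwise the normalised residue of
  some vector could be adjoined.\<close>

lemma ON_basis_subspace:
  assumes K: "subspace K"
  obtains E where "E \<subseteq> K" "ON E" "finite E" "\<And>v. v \<in> K \<Longrightarrow> v = (\<Sum>e\<in>E. g v e *\<^sub>R e)"
proof -
  define P where "P m \<longleftrightarrow> (\<exists>E. E \<subseteq> K \<and> ON E \<and> card E = m)" for m
  have "P 0" unfolding P_def by (rule exI[of _ "{}"]) (auto simp: ON_def)
  moreover have "\<forall>m. P m \<longrightarrow> m \<le> DIM('a)" unfolding P_def using ON_card by blast
  ultimately obtain m where m: "P m" "\<forall>j. P j \<longrightarrow> j \<le> m"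
    using Nat.ex_has_greatest_nat[of P 0 "DIM('a)"] by auto
  obtain E where E: "E \<subseteq> K" "ON E" "card E = m" using m(1) unfolding P_def by blast
  have fin: "finite E" using E ON_finite by blast
  have "v = (\<Sum>e\<in>E. g v e *\<^sub>R e)" if v: "v \<in> K" for v
  proof (rule ccontr)
    assume ne: "v \<noteq> (\<Sum>e\<in>E. g v e *\<^sub>R e)"
    define z where "z = v - (\<Sum>e\<in>E. g v e *\<^sub>R e)"
    have "z \<noteq> 0" using ne by (simp add: z_def)
    have zK: "z \<in> K" unfolding z_def
      using E v K by (auto intro!: subspace_diff subspace_sum subspace_scale)
    have orth: "g z e = 0" if "e \<in> E" for e
      using ON_coeff[OF E(2) fin that, of "g v"] by (simp add: z_def diff_l)
    define y where "y = (1 / sqrt (g z z)) *\<^sub>R z"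
    have gzz: "g z z > 0" using pos \<open>z \<noteq> 0\<close> by blast
    have yy: "g y y = 1" using gzz by (simp add: y_def ip_simps)
    have yE: "g y e = 0" if "e \<in> E" for e using orth[OF that] by (simp add: y_def ip_simps)
    have "y \<notin> E" using yE yy by force
    have "ON (insert y E)" unfolding ON_def using E(2) yy yE sym \<open>y \<notin> E\<close> by (auto simp: ON_def)
    moreover have "insert y E \<subseteq> K" using E zK K by (simp add: y_def subspace_scale)
    moreover have "card (insert y E) = Suc m" using \<open>y \<notin> E\<close> fin E by simp
    ultimately have "P (Suc m)" unfolding P_def by blast
    then show False using m(2) by force
  qed
  then show ?thesis using that E fin by blast
qed

end

section \<open>Traces of endomorphisms\<close>

definition trace_lin :: "('a::euclidean_space \<Rightarrow> 'a) \<Rightarrow> real" where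
  "trace_lin L = (\<Sum>b\<in>Basis. L b \<bullet> b)"

lemma trace_rank_one:
  assumes "linear l"
  shows "trace_lin (\<lambda>z. l z *\<^sub>R v) = l v"
proof -
  have "l v = (\<Sum>b\<in>Basis. (v \<bullet> b) *\<^sub>R l b)" by (rule linear_Basis_expand[OF assms])
  then show ?thesis by (simp add: trace_lin_def mult.commute)
qed

lemma trace_add: "trace_lin (\<lambda>z. L z + M z) = trace_lin L + trace_lin M"
  and trace_diff: "trace_lin (\<lambda>z. L z - M z) = trace_lin L - trace_lin M"
  and trace_scale: "trace_lin (\<lambda>z. r *\<^sub>R L z) = r * trace_lin L"
  by (simp_all add: trace_lin_def inner_add_left inner_diff_left sum.distrib sum_subtractf sum_distrib_left)

lemma trace_id: "trace_lin (\<lambda>z::'a::euclidean_space. z) = DIM('a)"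
  by (simp add: trace_lin_def)

lemma trace_comm:
  fixes L M :: "'a::euclidean_space \<Rightarrow> 'a"
  assumes "linear L" "linear M"
  shows "trace_lin (\<lambda>z. L (M z)) = trace_lin (\<lambda>z. M (L z))"
proof -
  have 1: "L (M b) \<bullet> b = (\<Sum>e\<in>Basis. (M b \<bullet> e) * (L e \<bullet> b))" for b
    by (subst linear_Basis_expand[OF assms(1)]) (simp add: inner_sum_left)
  have 2: "M (L e) \<bullet> e = (\<Sum>b\<in>Basis. (M b \<bullet> e) * (L e \<bullet> b))" for e
    by (subst linear_Basis_expand[OF assms(2)]) (simp add: inner_sum_left mult.commute)
  show ?thesis unfolding trace_lin_def 1 2 by (rule sum.swap)
qed

context ips begin

text \<open>\<open>trace_lin\<close> is tied to the standard basis. Writing \<open>L\<close> as the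
  sum of the rank one maps \<open>g (L z) e *\<^sub>R e\<close> makes it computable in bases adapted
  to \<open>g\<close>.\<close>

lemma trace_ON:
  assumes "linear L" "finite E" "\<And>v. v = (\<Sum>e\<in>E. g v e *\<^sub>R e)"
  shows "trace_lin L = (\<Sum>e\<in>E. g (L e) e)"
proof -
  have "trace_lin L = trace_lin (\<lambda>z. \<Sum>e\<in>E. g (L z) e *\<^sub>R e)" using assms(3) by metis
  also have "\<dots> = (\<Sum>e\<in>E. trace_lin (\<lambda>z. g (L z) e *\<^sub>R e))"
    unfolding trace_lin_def by (simp add: inner_sum_left sum.swap[of _ E Basis])
  also have "\<dots> = (\<Sum>e\<in>E. g (L e) e)"
  proof (intro sum.cong refl trace_rank_one)
    show "linear (\<lambda>z. g (L z) e)" for e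
      using linear_compose[OF assms(1) bilinear_linears(2)[OF bil], of e] by (simp add: o_def)
  qed
  finally show ?thesis .
qed

lemma trace_skew:
  assumes "linear L" "\<And>v w. g (L v) w = - g v (L w)"
  shows "trace_lin L = 0"
proof -
  obtain E where E: "finite E" "\<And>v. v = (\<Sum>e\<in>E. g v e *\<^sub>R e)"
    using ON_basis_subspace[of UNIV] by auto
  have "g (L e) e = 0" for e using assms(2)[of e e] sym[of e "L e"] by simp
  then show ?thesis unfolding trace_ON[OF assms(1) E] by simp
qed

end

section \<open>Riemannian metrics on open sets\<close>

locale metric_on =
  fixes S :: "'a::euclidean_space set" and \<gamma> :: "'a \<Rightarrow> 'a \<Rightarrow> 'a \<Rightarrow> real"
  assumes op: "open S"
    and ips: "x \<in> S \<Longrightarrow> ips (\<gamma> x)"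
    and smooth: "smooth_on S (\<lambda>x. \<gamma> x v w)"
begin

lemma bil: "x \<in> S \<Longrightarrow> bilinear (\<gamma> x)" using ips ips.bil by blast

lemma smooth_metric: "smooth_on S Y \<Longrightarrow> smooth_on S Z \<Longrightarrow> smooth_on S (\<lambda>x. \<gamma> x (Y x) (Z x))"
  by (rule smooth_on_bilinear_family[OF op bil smooth])

text \<open>The induction carries both inclusions of spans: \<open>e b x \<in> span B\<close> keeps
  the next residue \<open>u\<close> away from 0, and the other one shows in the end that the frame
  spans. Smooth orthonormal frames later take the place of the inverse matrix of the metric in
  proofs of smoothness.\<close>

lemma gram_schmidt:
  assumes "finite B" "B \<subseteq> Basis"
  shows "\<exists>e. (\<forall>b\<in>B. smooth_on S (e b)) \<and>
    (\<forall>x\<in>S. (\<forall>b\<in>B. \<forall>b'\<in>B. \<gamma> x (e b x) (e b' x) = (if b = b' then 1 else 0)) \<and>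
       (\<forall>b\<in>B. b \<in> span ((\<lambda>b. e b x) ` B) \<and> e b x \<in> span B))"
  using assms
proof (induction B rule: finite_induct)
  case empty
  then show ?case by auto
next
  case (insert b0 B)
  then obtain e where E: "(\<forall>b\<in>B. smooth_on S (e b)) \<and>
    (\<forall>x\<in>S. (\<forall>b\<in>B. \<forall>b'\<in>B. \<gamma> x (e b x) (e b' x) = (if b = b' then 1 else 0)) \<and>
       (\<forall>b\<in>B. b \<in> span ((\<lambda>b. e b x) ` B) \<and> e b x \<in> span B))" by blast
  have e: "\<And>b. b \<in> B \<Longrightarrow> smooth_on S (e b)"
    "\<And>x b b'. x \<in> S \<Longrightarrow> b \<in> B \<Longrightarrow> b' \<in> B \<Longrightarrow> \<gamma> x (e b x) (e b' x) = (if b = b' then 1 else 0)"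
    "\<And>x b. x \<in> S \<Longrightarrow> b \<in> B \<Longrightarrow> b \<in> span ((\<lambda>b. e b x) ` B)"
    "\<And>x b. x \<in> S \<Longrightarrow> b \<in> B \<Longrightarrow> e b x \<in> span B" using E by blast+
  define u where "u x = b0 - (\<Sum>b\<in>B. \<gamma> x b0 (e b x) *\<^sub>R e b x)" for x
  define n where "n x = sqrt (\<gamma> x (u x) (u x))" for x
  define f where "f x = inverse (n x) *\<^sub>R u x" for x
  have su: "smooth_on S u" unfolding u_def
    by (intro smooth_on_diff' smooth_on_sum smooth_on_scaleR smooth_metric smooth_on_const op e)
  have b0: "b0 \<notin> span B"
  proof -
    have "independent (insert b0 B)" using insert.prems independent_Basis independent_mono by blast
    then show ?thesis using insert.hyps by (simp add: independent_insert)
  qed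
  have u0: "u x \<noteq> 0" if "x \<in> S" for x
  proof
    assume "u x = 0"
    then have "b0 = (\<Sum>b\<in>B. \<gamma> x b0 (e b x) *\<^sub>R e b x)" by (simp add: u_def)
    moreover have "(\<Sum>b\<in>B. \<gamma> x b0 (e b x) *\<^sub>R e b x) \<in> span B"
      by (intro span_sum span_scale e that)
    ultimately show False using b0 by metis
  qed
  have up: "\<gamma> x (u x) (u x) > 0" if "x \<in> S" for x using ips.pos[OF ips[OF that] u0[OF that]] .
  have np: "n x > 0" if "x \<in> S" for x using up[OF that] by (simp add: n_def)
  have sf: "smooth_on S f" unfolding f_def n_def
    by (intro smooth_on_scaleR smooth_on_inverse smooth_on_sqrt smooth_metric su op up)
       (use up in force)
  have ue: "\<gamma> x (u x) (e b x) = 0" if "x \<in> S" "b \<in> B" for x b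
  proof -
    interpret p: ips "\<gamma> x" by (rule ips[OF that(1)])
    have "(\<Sum>b'\<in>B. \<gamma> x b0 (e b' x) * \<gamma> x (e b' x) (e b x)) = (\<Sum>b'\<in>B. if b' = b then \<gamma> x b0 (e b' x) else 0)"
      using e(2) that by (intro sum.cong) auto
    then show ?thesis using that insert.hyps by (simp add: u_def p.ip_simps p.sum_l)
  qed
  have fe: "\<gamma> x (f x) (e b x) = 0" "\<gamma> x (e b x) (f x) = 0" if "x \<in> S" "b \<in> B" for x b
  proof -
    interpret p: ips "\<gamma> x" by (rule ips[OF that(1)])
    show "\<gamma> x (f x) (e b x) = 0" "\<gamma> x (e b x) (f x) = 0"
      using ue[OF that] p.sym by (simp_all add: f_def p.ip_simps)
  qed
  have ff: "\<gamma> x (f x) (f x) = 1" if "x \<in> S" for x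
  proof -
    interpret p: ips "\<gamma> x" by (rule ips[OF that(1)])
    have "\<gamma> x (u x) (u x) = n x * n x" using up[OF that] by (simp add: n_def)
    then show ?thesis using np[OF that] by (simp add: f_def p.ip_simps field_simps)
  qed
  define e' where "e' b = (if b = b0 then f else e b)" for b
  have e'b: "e' b = e b" if "b \<in> B" for b using that insert.hyps by (auto simp: e'_def)
  have img: "(\<lambda>b. e' b x) ` insert b0 B = insert (f x) ((\<lambda>b. e b x) ` B)" for x
    using e'b by (auto simp: e'_def image_iff)
  have sp: "b \<in> span ((\<lambda>b. e' b x) ` insert b0 B)" if "x \<in> S" "b \<in> insert b0 B" for x b
  proof -
    have *: "span ((\<lambda>b. e b x) ` B) \<subseteq> span (insert (f x) ((\<lambda>b. e b x) ` B))" by (intro span_mono) auto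
    have "b0 = n x *\<^sub>R f x + (\<Sum>b\<in>B. \<gamma> x b0 (e b x) *\<^sub>R e b x)"
      using np[OF that(1)] by (simp add: f_def u_def)
    moreover have "n x *\<^sub>R f x + (\<Sum>b\<in>B. \<gamma> x b0 (e b x) *\<^sub>R e b x) \<in> span (insert (f x) ((\<lambda>b. e b x) ` B))"
      by (intro span_add span_sum span_scale span_base) auto
    ultimately show ?thesis using that e(3)[of x b] * unfolding img by auto
  qed
  have sp': "e' b x \<in> span (insert b0 B)" if "x \<in> S" "b \<in> insert b0 B" for x b
  proof -
    have *: "span B \<subseteq> span (insert b0 B)" by (intro span_mono) auto
    have "f x \<in> span (insert b0 B)" unfolding f_def u_def
      using e(4)[OF that(1)] * by (intro span_scale span_diff span_sum) (auto intro: span_base)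
    then show ?thesis using that e(4)[of x b] * e'b by (cases "b = b0") (auto simp: e'_def)
  qed
  show ?case
  proof (intro exI[of _ e'] conjI ballI)
    show "smooth_on S (e' b)" if "b \<in> insert b0 B" for b using that e(1) sf by (auto simp: e'_def)
  next
    fix x b b' assume "x \<in> S" "b \<in> insert b0 B" "b' \<in> insert b0 B"
    then show "\<gamma> x (e' b x) (e' b' x) = (if b = b' then 1 else 0)"
      using e(2) fe ff insert.hyps by (auto simp: e'_def)
  qed (use sp sp' in auto)
qed

lemma ON_frame:
  obtains e :: "'a \<Rightarrow> 'a \<Rightarrow> 'a" where "\<And>b. b \<in> Basis \<Longrightarrow> smooth_on S (e b)"
    "\<And>x b b'. x \<in> S \<Longrightarrow> b \<in> Basis \<Longrightarrow> b' \<in> Basis \<Longrightarrow> \<gamma> x (e b x) (e b' x) = (if b = b' then 1 else 0)"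
    "\<And>x v. x \<in> S \<Longrightarrow> v = (\<Sum>b\<in>Basis. \<gamma> x v (e b x) *\<^sub>R e b x)"
proof -
  obtain e where E: "(\<forall>b\<in>Basis. smooth_on S (e b)) \<and>
    (\<forall>x\<in>S. (\<forall>b\<in>Basis. \<forall>b'\<in>Basis. \<gamma> x (e b x) (e b' x) = (if b = b' then 1 else 0)) \<and>
       (\<forall>b\<in>Basis. b \<in> span ((\<lambda>b. e b x) ` Basis) \<and> e b x \<in> span Basis))"
    using gram_schmidt[OF finite_Basis subset_refl] by blast
  have e: "\<And>b. b \<in> Basis \<Longrightarrow> smooth_on S (e b)"
    "\<And>x b b'. x \<in> S \<Longrightarrow> b \<in> Basis \<Longrightarrow> b' \<in> Basis \<Longrightarrow> \<gamma> x (e b x) (e b' x) = (if b = b' then 1 else 0)"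
    "\<And>x b. x \<in> S \<Longrightarrow> b \<in> Basis \<Longrightarrow> b \<in> span ((\<lambda>b. e b x) ` Basis)" using E by blast+
  have "v = (\<Sum>b\<in>Basis. \<gamma> x v (e b x) *\<^sub>R e b x)" if "x \<in> S" for x v
  proof -
    interpret p: ips "\<gamma> x" by (rule ips[OF that])
    define z where "z = v - (\<Sum>b\<in>Basis. \<gamma> x v (e b x) *\<^sub>R e b x)"
    have zb: "\<gamma> x z (e b x) = 0" if b: "b \<in> Basis" for b
    proof -
      have "(\<Sum>b'\<in>Basis. \<gamma> x v (e b' x) * \<gamma> x (e b' x) (e b x)) = (\<Sum>b'\<in>Basis. if b' = b then \<gamma> x v (e b' x) else 0)"
        using e(2) \<open>x \<in> S\<close> b by (intro sum.cong) auto
      then show ?thesis using b by (simp add: z_def p.ip_simps p.sum_l)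
    qed
    have "span ((\<lambda>b. e b x) ` Basis) \<subseteq> {w. \<gamma> x z w = 0}"
      by (rule span_minimal) (use zb in \<open>auto simp: subspace_def p.ip_simps\<close>)
    moreover have "span ((\<lambda>b. e b x) ` Basis) = UNIV"
      using span_minimal[of Basis "span ((\<lambda>b. e b x) ` Basis)"] e(3)[OF that] by auto
    ultimately have "z = 0" using p.eq_0_iff[of z] by auto
    then show ?thesis by (simp add: z_def)
  qed
  then show ?thesis using that e by blast
qed

end

section \<open>Levi-Civita connection and covariant derivatives along maps\<close>

lemma linear_fd_family:
  fixes \<beta> :: "'a::euclidean_space \<Rightarrow> 'b::euclidean_space \<Rightarrow> 'c::real_normed_vector"
  assumes "open S" "\<And>x. x \<in> S \<Longrightarrow> linear (\<beta> x)" "\<And>v. smooth_on S (\<lambda>x. \<beta> x v)" "x \<in> S"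
  shows "linear (\<lambda>a. fd (\<lambda>y. \<beta> y a) x v)"
proof (rule linearI)
  note h = smooth_on_has_derivative[OF assms(3,4)]
  show "fd (\<lambda>y. \<beta> y (a + b)) x v = fd (\<lambda>y. \<beta> y a) x v + fd (\<lambda>y. \<beta> y b) x v" for a b
    using fd_cong[OF assms(1,4), of "\<lambda>y. \<beta> y (a + b)" "\<lambda>y. \<beta> y a + \<beta> y b"]
      fd_eq[OF has_derivative_add[OF h[of a] h[of b]]] assms(2) by (simp add: linear_add)
  show "fd (\<lambda>y. \<beta> y (r *\<^sub>R a)) x v = r *\<^sub>R fd (\<lambda>y. \<beta> y a) x v" for r a
    using fd_cong[OF assms(1,4), of "\<lambda>y. \<beta> y (r *\<^sub>R a)" "\<lambda>y. r *\<^sub>R \<beta> y a"]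
      fd_eq[OF has_derivative_scaleR_right[OF h[of a], of r]] assms(2) by (simp add: linear_scale)
qed

text \<open>Derivative along the map \<open>F\<close> of a field \<open>Y\<close> of vectors at the
  points \<open>F x\<close>. With \<open>F\<close> the identity it is the Levi-Civita derivative on
  a chart image; with \<open>F\<close> a local immersion it differentiates ambient fields along the
  hypersurface.\<close>

definition cov :: "('a \<Rightarrow> 'a \<Rightarrow> 'a \<Rightarrow> 'a) \<Rightarrow> ('b::real_normed_vector \<Rightarrow> 'a::real_normed_vector) \<Rightarrow> ('b \<Rightarrow> 'a)
    \<Rightarrow> 'b \<Rightarrow> 'b \<Rightarrow> 'a" where
  "cov \<Gamma> F Y x u = fd Y x u + \<Gamma> (F x) (fd F x u) (Y x)"

lemma fd_ident [simp]: "fd (\<lambda>x. x) x = (\<lambda>v. v)" by (rule fd_eq) simp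

context metric_on begin

abbreviation dg :: "'a \<Rightarrow> 'a \<Rightarrow> 'a \<Rightarrow> 'a \<Rightarrow> real" where
  "dg x v a b \<equiv> fd (\<lambda>y. \<gamma> y a b) x v"

abbreviation \<Gamma> :: "'a \<Rightarrow> 'a \<Rightarrow> 'a \<Rightarrow> 'a" where "\<Gamma> \<equiv> christoffel \<gamma>"

lemma dg_linear1: "x \<in> S \<Longrightarrow> linear (\<lambda>v. dg x v a b)"
  using smooth_on_linear_fd[OF smooth] .

lemma dg_linear2: "x \<in> S \<Longrightarrow> linear (\<lambda>a. dg x v a b)"
  by (rule linear_fd_family[of S "\<lambda>y a. \<gamma> y a b", OF op]) (auto intro: bilinear_linears bil smooth)

lemma dg_linear3: "x \<in> S \<Longrightarrow> linear (\<lambda>b. dg x v a b)"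
  by (rule linear_fd_family[of S "\<lambda>y b. \<gamma> y a b", OF op]) (auto intro: bilinear_linears bil smooth)

lemma dg_sym: "x \<in> S \<Longrightarrow> dg x v a b = dg x v b a"
  by (rule fun_cong[OF fd_cong[OF op]]) (auto intro: ips.sym ips)

definition koszul :: "'a \<Rightarrow> 'a \<Rightarrow> 'a \<Rightarrow> 'a \<Rightarrow> real" where
  "koszul x v w u = dg x v w u + dg x w v u - dg x u v w"

lemma koszul_linear: assumes "x \<in> S" shows "linear (\<lambda>u. koszul x v w u)"
  unfolding koszul_def
  by (intro linear_compose_add linear_compose_sub dg_linear1 dg_linear3 assms)

lemma smooth_koszul: "smooth_on S Y \<Longrightarrow> smooth_on S (\<lambda>x. koszul x v w (Y x))"
  by (rule smooth_on_linear_family[where \<beta>="\<lambda>x u. koszul x v w u", OF op])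
     (auto simp: koszul_def intro!: smooth_on_add smooth_on_diff' smooth_on_fd_const smooth op
       koszul_linear[unfolded koszul_def])

lemma christoffel_unique:
  assumes "x \<in> S" "\<And>u. 2 * \<gamma> x z u = koszul x v w u"
  shows "\<Gamma> x v w = z"
  unfolding christoffel_def
proof (rule the_equality)
  show "\<forall>u. 2 * \<gamma> x z u = dg x v w u + dg x w v u - dg x u v w" using assms(2) by (simp add: koszul_def)
next
  fix z' assume z': "\<forall>u. 2 * \<gamma> x z' u = dg x v w u + dg x w v u - dg x u v w"
  have "\<gamma> x z' u = \<gamma> x z u" for u using z'[rule_format, of u] assms(2)[of u] by (simp add: koszul_def)
  then show "z' = z" by (rule ips.eqI[OF ips[OF assms(1)]])
qed

text \<open>The Koszul functional of \<open>v\<close> and \<open>w\<close> is represented by the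
  vector whose frame components are half its values on the frame. This gives existence for the
  definite description in \<open>christoffel\<close>, and its smoothness.\<close>

lemma christoffel_frame:
  obtains e :: "'a \<Rightarrow> 'a \<Rightarrow> 'a" where "\<And>b. b \<in> Basis \<Longrightarrow> smooth_on S (e b)"
    "\<And>x v w. x \<in> S \<Longrightarrow> \<Gamma> x v w = (\<Sum>b\<in>Basis. (koszul x v w (e b x) / 2) *\<^sub>R e b x)"
    "\<And>x v w u. x \<in> S \<Longrightarrow> 2 * \<gamma> x (\<Sum>b\<in>Basis. (koszul x v w (e b x) / 2) *\<^sub>R e b x) u = koszul x v w u"
proof (rule ON_frame)
  fix e :: "'a \<Rightarrow> 'a \<Rightarrow> 'a"
  assume e: "\<And>b. b \<in> Basis \<Longrightarrow> smooth_on S (e b)"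
    "\<And>x v. x \<in> S \<Longrightarrow> v = (\<Sum>b\<in>Basis. \<gamma> x v (e b x) *\<^sub>R e b x)"
  have k: "2 * \<gamma> x (\<Sum>b\<in>Basis. (koszul x v w (e b x) / 2) *\<^sub>R e b x) u = koszul x v w u"
    if "x \<in> S" for x v w u
  proof -
    interpret p: ips "\<gamma> x" by (rule ips[OF that])
    have "koszul x v w u = koszul x v w (\<Sum>b\<in>Basis. \<gamma> x u (e b x) *\<^sub>R e b x)" using e(2)[OF that] by metis
    also have "\<dots> = (\<Sum>b\<in>Basis. \<gamma> x u (e b x) * koszul x v w (e b x))"
      by (simp add: linear_sum[OF koszul_linear[OF that]] linear_scale[OF koszul_linear[OF that]])
    finally show ?thesis by (simp add: p.sum_l p.scale_l sum_distrib_left p.sym[of u] mult.commute)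
  qed
  show ?thesis using that[OF e(1) christoffel_unique[OF _ k] k] by blast
qed

lemma christoffel_eq: "x \<in> S \<Longrightarrow> 2 * \<gamma> x (\<Gamma> x v w) u = koszul x v w u"
  by (rule christoffel_frame) metis

lemma smooth_christoffel_const: "smooth_on S (\<lambda>x. \<Gamma> x v w)"
proof (rule christoffel_frame)
  fix e assume e: "\<And>b. b \<in> Basis \<Longrightarrow> smooth_on S (e b)"
    "\<And>x v w. x \<in> S \<Longrightarrow> \<Gamma> x v w = (\<Sum>b\<in>Basis. (koszul x v w (e b x) / 2) *\<^sub>R e b x)"
  have "smooth_on S (\<lambda>x. \<Sum>b\<in>Basis. (koszul x v w (e b x) / 2) *\<^sub>R e b x)"
    by (intro smooth_on_sum smooth_on_scaleR smooth_on_divide smooth_koszul e smooth_on_const op) auto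
  then show ?thesis by (rule smooth_on_cong[OF op, rotated]) (simp add: e)
qed

lemma christoffel_sym: "x \<in> S \<Longrightarrow> \<Gamma> x v w = \<Gamma> x w v"
  by (rule christoffel_unique) (auto simp: christoffel_eq koszul_def dg_sym)

lemma bil_christoffel: assumes "x \<in> S" shows "bilinear (\<Gamma> x)"
proof -
  interpret p: ips "\<gamma> x" by (rule ips[OF assms])
  have "linear (\<lambda>w. koszul x v w u)" for v u
    unfolding koszul_def
    by (intro linear_compose_add linear_compose_sub dg_linear1 dg_linear2 dg_linear3 assms)
  note k = linear_add[OF this] linear_scale[OF this]
  have l: "linear (\<Gamma> x v)" for v
  proof (rule linearI)
    show "\<Gamma> x v (a + b) = \<Gamma> x v a + \<Gamma> x v b" for a b
      by (rule christoffel_unique[OF assms]) (simp add: p.add_l distrib_left christoffel_eq[OF assms] k)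
    show "\<Gamma> x v (r *\<^sub>R a) = r *\<^sub>R \<Gamma> x v a" for r a
      by (rule christoffel_unique[OF assms])
         (use christoffel_eq[OF assms, of v a] in \<open>simp add: p.scale_l k mult.left_commute\<close>)
  qed
  have "(\<lambda>v. \<Gamma> x v w) = \<Gamma> x w" for w using christoffel_sym[OF assms] by blast
  then show ?thesis unfolding bilinear_def using l by metis
qed

lemma metric_compat: assumes "x \<in> S" shows "dg x v a b = \<gamma> x (\<Gamma> x v a) b + \<gamma> x a (\<Gamma> x v b)"
proof -
  have "2 * \<gamma> x (\<Gamma> x v a) b + 2 * \<gamma> x a (\<Gamma> x v b) = 2 * dg x v a b"
    using christoffel_eq[OF assms, of v a b] christoffel_eq[OF assms, of v b a]
      ips.sym[OF ips[OF assms], of a] dg_sym[OF assms] by (simp add: koszul_def)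
  then show ?thesis by simp
qed

lemma smooth_christoffel:
  fixes F :: "'b::euclidean_space \<Rightarrow> 'a"
  assumes "open W" "smooth_on W F" "\<And>x. x \<in> W \<Longrightarrow> F x \<in> S" "smooth_on W Y" "smooth_on W Z"
  shows "smooth_on W (\<lambda>x. \<Gamma> (F x) (Y x) (Z x))"
  by (rule smooth_on_bilinear_family[where \<beta>="\<lambda>x. \<Gamma> (F x)", OF assms(1) _ _ assms(4,5)])
     (use bil_christoffel assms(3) smooth_on_compose[OF assms(1) op assms(3,2) smooth_christoffel_const] in auto)

lemma smooth_metric_along:
  fixes F :: "'b::euclidean_space \<Rightarrow> 'a"
  assumes "open W" "smooth_on W F" "\<And>x. x \<in> W \<Longrightarrow> F x \<in> S" "smooth_on W Y" "smooth_on W Z"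
  shows "smooth_on W (\<lambda>x. \<gamma> (F x) (Y x) (Z x))"
  by (rule smooth_on_bilinear_family[where \<beta>="\<lambda>x. \<gamma> (F x)", OF assms(1) _ _ assms(4,5)])
     (use bil assms(3) smooth_on_compose[OF assms(1) op assms(3,2) smooth] in auto)

lemma smooth_cov:
  fixes F :: "'b::euclidean_space \<Rightarrow> 'a"
  assumes "open W" "smooth_on W F" "\<And>x. x \<in> W \<Longrightarrow> F x \<in> S" "smooth_on W Y" "smooth_on W U"
  shows "smooth_on W (\<lambda>x. cov \<Gamma> F Y x (U x))"
  unfolding cov_def
  by (intro smooth_on_add smooth_christoffel smooth_on_fd assms)

lemma metric_deriv_along:
  fixes F :: "'b::euclidean_space \<Rightarrow> 'a"
  assumes W: "open W" "smooth_on W F" "\<And>x. x \<in> W \<Longrightarrow> F x \<in> S"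
    and Y: "smooth_on W Y" "smooth_on W Z" and x: "x \<in> W"
  shows "fd (\<lambda>x. \<gamma> (F x) (Y x) (Z x)) x u
    = \<gamma> (F x) (cov \<Gamma> F Y x u) (Z x) + \<gamma> (F x) (Y x) (cov \<Gamma> F Z x u)"
proof -
  interpret p: ips "\<gamma> (F x)" by (rule ips[OF W(3)[OF x]])
  have "fd (\<lambda>x. \<gamma> (F x) (Y x) (Z x)) x u = fd (\<lambda>y. \<gamma> (F y) (Y x) (Z x)) x u
      + \<gamma> (F x) (fd Y x u) (Z x) + \<gamma> (F x) (Y x) (fd Z x u)"
    by (rule fd_bilinear_family[where \<beta>="\<lambda>x. \<gamma> (F x)", OF W(1) _ _ x Y(1) smooth_on_diff[OF Y(2) x]])
       (use bil W(3) smooth_on_compose[OF W(1) op W(3,2) smooth] in auto)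
  also have "fd (\<lambda>y. \<gamma> (F y) (Y x) (Z x)) x u = dg (F x) (fd F x u) (Y x) (Z x)"
    by (rule fd_chain[of F x "\<lambda>y. \<gamma> y (Y x) (Z x)"])
       (use smooth_on_diff[OF W(2) x] smooth_on_diff[OF smooth W(3)[OF x]] in auto)
  finally show ?thesis by (simp add: metric_compat[OF W(3)[OF x]] cov_def p.add_l p.add_r)
qed

text \<open>Ricci identity along a map: second derivatives of \<open>Y\<close> and of
  \<open>F\<close> cancel by symmetry, the terms with a first derivative of \<open>Y\<close> are
  symmetric in \<open>u\<close> and \<open>v\<close>, and the coordinate formula of the curvature at
  \<open>F x\<close> remains.\<close>

lemma cov_commutator:
  fixes F :: "'b::euclidean_space \<Rightarrow> 'a"
  assumes W: "open W" "smooth_on W F" "\<And>x. x \<in> W \<Longrightarrow> F x \<in> S"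
    and Y: "smooth_on W Y" and x: "x \<in> W"
  shows "cov \<Gamma> F (\<lambda>y. cov \<Gamma> F Y y v) x u - cov \<Gamma> F (\<lambda>y. cov \<Gamma> F Y y u) x v
    = local_curvature \<gamma> (F x) (fd F x u) (fd F x v) (Y x)"
proof -
  have Fx: "F x \<in> S" using W x by blast
  note bl = bil_christoffel[OF Fx]
  have *: "cov \<Gamma> F (\<lambda>y. cov \<Gamma> F Y y v) x u = fd (\<lambda>y. fd Y y v) x u
     + (fd (\<lambda>z. \<Gamma> z (fd F x v) (Y x)) (F x) (fd F x u)
       + \<Gamma> (F x) (fd (\<lambda>y. fd F y v) x u) (Y x) + \<Gamma> (F x) (fd F x v) (fd Y x u))
     + \<Gamma> (F x) (fd F x u) (fd Y x v + \<Gamma> (F x) (fd F x v) (Y x))" for u v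
  proof -
    have a: "smooth_on W (\<lambda>y. fd Y y v)" "smooth_on W (\<lambda>y. fd F y v)"
      "smooth_on W (\<lambda>y. \<Gamma> (F y) (fd F y v) (Y y))"
      by (intro smooth_on_fd_const smooth_christoffel W Y)+
    have "fd (\<lambda>y. cov \<Gamma> F Y y v) x u = fd (\<lambda>y. fd Y y v) x u + fd (\<lambda>y. \<Gamma> (F y) (fd F y v) (Y y)) x u"
      unfolding cov_def using fd_eq[OF has_derivative_add[OF smooth_on_has_derivative[OF a(1) x]
            smooth_on_has_derivative[OF a(3) x]]] by simp
    moreover have "fd (\<lambda>y. \<Gamma> (F y) (fd F y v) (Y y)) x u = fd (\<lambda>y. \<Gamma> (F y) (fd F x v) (Y x)) x u
       + \<Gamma> (F x) (fd (\<lambda>y. fd F y v) x u) (Y x) + \<Gamma> (F x) (fd F x v) (fd Y x u)"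
      by (rule fd_bilinear_family[where \<beta>="\<lambda>x. \<Gamma> (F x)", OF W(1) _ _ x a(2) smooth_on_diff[OF Y x]])
         (use bil_christoffel W(3) smooth_on_compose[OF W(1) op W(3,2) smooth_christoffel_const] in auto)
    moreover have "fd (\<lambda>y. \<Gamma> (F y) (fd F x v) (Y x)) x u = fd (\<lambda>z. \<Gamma> z (fd F x v) (Y x)) (F x) (fd F x u)"
      by (rule fd_chain[of F x "\<lambda>z. \<Gamma> z (fd F x v) (Y x)"])
         (use smooth_on_diff[OF W(2) x] smooth_on_diff[OF smooth_christoffel_const Fx] in auto)
    ultimately show ?thesis by (simp add: cov_def)
  qed
  show ?thesis
    unfolding * local_curvature_def fd_fd_commute[OF W(1) x Y, of v u] fd_fd_commute[OF W(1) x W(2), of v u]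
    by (simp add: bilinear_radd[OF bl])
qed

lemma local_curvature_linear:
  assumes "x \<in> S"
  shows "linear (\<lambda>u. local_curvature \<gamma> x u v w)" "linear (\<lambda>v. local_curvature \<gamma> x u v w)"
    "linear (\<lambda>w. local_curvature \<gamma> x u v w)"
proof -
  note b1 = bilinear_linears(1)[OF bil_christoffel] and b2 = bilinear_linears(2)[OF bil_christoffel]
  have l1: "linear (\<lambda>a. fd (\<lambda>y. \<Gamma> y v a) x u)" for u v
    by (rule linear_fd_family[of S "\<lambda>y a. \<Gamma> y v a", OF op b1 smooth_christoffel_const assms])
  have l2: "linear (\<lambda>a. fd (\<lambda>y. \<Gamma> y a v) x u)" for u v
    by (rule linear_fd_family[of S "\<lambda>y a. \<Gamma> y a v", OF op b2 smooth_christoffel_const assms])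
  have l3: "linear (\<lambda>u. fd (\<lambda>y. \<Gamma> y v w) x u)" for v w
    using smooth_on_linear_fd[OF smooth_christoffel_const assms] .
  have c: "linear (\<lambda>a. \<Gamma> x u (\<Gamma> x a w))" "linear (\<lambda>a. \<Gamma> x u (\<Gamma> x v a))" "linear (\<lambda>a. \<Gamma> x a (\<Gamma> x v w))" for u v w
    using linear_compose[OF b2[OF assms] b1[OF assms]] linear_compose[OF b1[OF assms] b1[OF assms]]
      b2[OF assms] by (auto simp: o_def)
  show "linear (\<lambda>u. local_curvature \<gamma> x u v w)" "linear (\<lambda>v. local_curvature \<gamma> x u v w)"
    "linear (\<lambda>w. local_curvature \<gamma> x u v w)"
    unfolding local_curvature_def by (intro linear_compose_add linear_compose_sub l1 l2 l3 c)+
qed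

lemma local_curvature_anti: "local_curvature \<gamma> x u v w = - local_curvature \<gamma> x v u w"
  by (simp add: local_curvature_def)

lemma local_curvature_bianchi:
  assumes "x \<in> S"
  shows "local_curvature \<gamma> x u v w + local_curvature \<gamma> x v w u + local_curvature \<gamma> x w u v = 0"
proof -
  have "fd (\<lambda>y. \<Gamma> y v w) x u = fd (\<lambda>y. \<Gamma> y w v) x u" for u v w
    by (rule fun_cong[OF fd_cong[OF op assms]]) (rule christoffel_sym)
  note s = this christoffel_sym[OF assms]
  show ?thesis unfolding local_curvature_def
    using s(1)[of v w u] s(1)[of u w v] s(1)[of u v w] s(2)[of v w] s(2)[of u w] s(2)[of u v] by simp
qed

text \<open>The second derivatives of the function \<open>\<gamma> y w w\<close> commute, and by
  metric compatibility their difference is twice \<open>\<gamma>(R(u, v) w, w)\<close>. So this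
  vanishes, and polarisation in \<open>w\<close> gives the claim.\<close>

lemma local_curvature_skew:
  assumes x: "x \<in> S"
  shows "\<gamma> x (local_curvature \<gamma> x u v a) b = - \<gamma> x a (local_curvature \<gamma> x u v b)"
proof -
  interpret p: ips "\<gamma> x" by (rule ips[OF x])
  note I = op smooth_on_id[OF op]
  have C: "smooth_on S (\<lambda>y. cov \<Gamma> (\<lambda>x. x) (\<lambda>x. w) y v)" for w v
    by (intro smooth_cov I smooth_on_const) auto
  have "\<gamma> x (local_curvature \<gamma> x u v w) w = 0" for w
  proof -
    have d1: "dg y v w w = 2 * \<gamma> y (cov \<Gamma> (\<lambda>x. x) (\<lambda>x. w) y v) w" if "y \<in> S" for y v
      using metric_deriv_along[OF I _ smooth_on_const smooth_on_const that, of w w v]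
        ips.sym[OF ips[OF that]] by simp
    have d2: "fd (\<lambda>y. dg y v w w) x u = 2 * (\<gamma> x (cov \<Gamma> (\<lambda>x. x) (\<lambda>y. cov \<Gamma> (\<lambda>x. x) (\<lambda>x. w) y v) x u) w
        + \<gamma> x (cov \<Gamma> (\<lambda>x. x) (\<lambda>x. w) x v) (cov \<Gamma> (\<lambda>x. x) (\<lambda>x. w) x u))" for u v
    proof -
      have "fd (\<lambda>y. dg y v w w) x = fd (\<lambda>y. 2 * \<gamma> y (cov \<Gamma> (\<lambda>x. x) (\<lambda>x. w) y v) w) x"
        by (rule fd_cong[OF op x]) (rule d1)
      also have "\<dots> = (\<lambda>u. 2 * fd (\<lambda>y. \<gamma> y (cov \<Gamma> (\<lambda>x. x) (\<lambda>x. w) y v) w) x u)"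
        by (rule fd_eq, intro has_derivative_mult_right smooth_on_has_derivative[OF _ x]
             smooth_metric C smooth_on_const)
      finally show ?thesis using metric_deriv_along[OF I _ C[of w v] smooth_on_const x, of w u] by simp
    qed
    have "fd (\<lambda>y. dg y v w w) x u = fd (\<lambda>y. dg y u w w) x v"
      by (rule fd_fd_commute[OF op x smooth])
    moreover have c: "local_curvature \<gamma> x u v w = cov \<Gamma> (\<lambda>x. x) (\<lambda>y. cov \<Gamma> (\<lambda>x. x) (\<lambda>x. w) y v) x u
        - cov \<Gamma> (\<lambda>x. x) (\<lambda>y. cov \<Gamma> (\<lambda>x. x) (\<lambda>x. w) y u) x v"
      using cov_commutator[OF I _ smooth_on_const x, of w v u] by simp
    ultimately show ?thesis
      unfolding d2 c p.diff_l using p.sym[of "cov \<Gamma> (\<lambda>x. x) (\<lambda>x. w) x v"] by simp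
  qed
  note z = this
  have "\<gamma> x (local_curvature \<gamma> x u v (a + b)) (a + b) = 0" by (rule z)
  then show ?thesis using z[of a] z[of b] p.sym[of a]
    by (simp add: linear_add[OF local_curvature_linear(3)[OF x]] p.ip_simps)
qed

end

text \<open>An isometric immersion preserves the tangential part of the connection, by the Koszul formula.\<close>

locale isometric_map = metric_on S \<gamma> for S :: "'a::euclidean_space set" and \<gamma> +
  fixes W :: "'b::euclidean_space set" and F :: "'b \<Rightarrow> 'a" and g :: "'b \<Rightarrow> 'b \<Rightarrow> 'b \<Rightarrow> real"
  assumes Wop: "open W" and FS: "x \<in> W \<Longrightarrow> F x \<in> S" and Fs: "smooth_on W F"
    and g_eq: "x \<in> W \<Longrightarrow> g x v w = \<gamma> (F x) (fd F x v) (fd F x w)"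
    and Finj: "x \<in> W \<Longrightarrow> fd F x v = 0 \<Longrightarrow> v = 0"
begin

lemma F_linear: "x \<in> W \<Longrightarrow> linear (fd F x)" using smooth_on_linear_fd[OF Fs] .

lemma metric_on_pullback: "metric_on W g"
proof
  show "open W" by (rule Wop)
  show "smooth_on W (\<lambda>x. g x v w)" for v w
    by (rule smooth_on_cong[OF Wop, of "\<lambda>x. \<gamma> (F x) (fd F x v) (fd F x w)"])
       (auto simp: g_eq intro!: smooth_metric_along Wop Fs FS smooth_on_fd_const)
  fix x assume x: "x \<in> W"
  interpret p: ips "\<gamma> (F x)" by (rule ips[OF FS[OF x]])
  note l = linear_add[OF F_linear[OF x]] linear_scale[OF F_linear[OF x]]
  show "bilinear (g x)" unfolding bilinear_def
    by (auto intro!: linearI simp: g_eq[OF x] l p.ip_simps)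
  show "g x v w = g x w v" for v w using p.sym by (simp add: g_eq[OF x])
  show "v \<noteq> 0 \<Longrightarrow> g x v v > 0" for v using p.pos Finj[OF x] by (auto simp: g_eq[OF x])
qed

sublocale pull: metric_on W g by (rule metric_on_pullback)

lemma gauss_tangential:
  assumes x: "x \<in> W"
  shows "\<gamma> (F x) (cov \<Gamma> F (\<lambda>y. fd F y v) x u) (fd F x w) = g x (christoffel g x u v) w"
proof -
  interpret p: ips "\<gamma> (F x)" by (rule ips[OF FS[OF x]])
  define K where "K u v = cov \<Gamma> F (\<lambda>y. fd F y v) x u" for u v
  have Ks: "K u v = K v u" for u v
    unfolding K_def cov_def fd_fd_commute[OF Wop x Fs, of v u]
    by (simp add: christoffel_sym[OF FS[OF x], of "fd F x u"])
  have d: "pull.dg x u v w = \<gamma> (F x) (K u v) (fd F x w) + \<gamma> (F x) (fd F x v) (K u w)" for u v w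
  proof -
    have "pull.dg x u v w = fd (\<lambda>y. \<gamma> (F y) (fd F y v) (fd F y w)) x u"
      by (rule fun_cong[OF fd_cong[OF Wop x]]) (rule g_eq)
    also have "\<dots> = \<gamma> (F x) (K u v) (fd F x w) + \<gamma> (F x) (fd F x v) (K u w)"
      unfolding K_def by (rule metric_deriv_along[OF Wop Fs FS _ _ x]) (auto intro: smooth_on_fd_const Fs)
    finally show ?thesis .
  qed
  have "2 * g x (christoffel g x u v) w = pull.koszul x u v w" by (rule pull.christoffel_eq[OF x])
  also have "\<dots> = 2 * \<gamma> (F x) (K u v) (fd F x w)"
    unfolding pull.koszul_def d using Ks p.sym by simp
  finally show ?thesis by (simp add: K_def)
qed

text \<open>When \<open>fd F\<close> is onto, the covariant derivative along \<open>F\<close> has no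
  normal part, so \<open>fd F\<close> intertwines both connections and therefore their commutators.
  Applied to transition maps, this makes the curvature independent of the chart.\<close>

lemma curvature_isometry:
  assumes x: "x \<in> W" and surj: "\<And>x. x \<in> W \<Longrightarrow> surj (fd F x)"
  shows "local_curvature \<gamma> (F x) (fd F x u) (fd F x v) (fd F x w) = fd F x (local_curvature g x u v w)"
proof -
  have c: "cov \<Gamma> F (\<lambda>y. fd F y v) x u = fd F x (christoffel g x u v)" if x: "x \<in> W" for x u v
  proof -
    interpret p: ips "\<gamma> (F x)" by (rule ips[OF FS[OF x]])
    show ?thesis
    proof (rule p.eqI)
      fix z
      obtain w where "z = fd F x w" using surj[OF x] by blast
      then show "\<gamma> (F x) (cov \<Gamma> F (\<lambda>y. fd F y v) x u) z = \<gamma> (F x) (fd F x (christoffel g x u v)) z"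
        using gauss_tangential[OF x] g_eq[OF x] by simp
    qed
  qed
  have cY: "cov \<Gamma> F (\<lambda>y. fd F y (Y y)) x u = fd F x (cov (christoffel g) (\<lambda>x. x) Y x u)"
    if Y: "smooth_on W Y" for Y u
  proof -
    have "fd (\<lambda>y. fd F y (Y y)) x u = fd (\<lambda>y. fd F y (Y x)) x u + fd F x (fd Y x u)"
      by (rule fd_linear_family[where \<beta>="fd F", OF Wop _ _ x smooth_on_diff[OF Y x]])
         (auto intro: F_linear smooth_on_fd_const Fs)
    then show ?thesis using c[OF x, of "Y x" u] linear_add[OF F_linear[OF x]]
      by (simp add: cov_def)
  qed
  have "cov \<Gamma> F (\<lambda>y. cov \<Gamma> F (\<lambda>y. fd F y w) y v) x u
     = fd F x (cov (christoffel g) (\<lambda>x. x) (\<lambda>y. cov (christoffel g) (\<lambda>x. x) (\<lambda>x. w) y v) x u)" for u v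
  proof -
    have "cov \<Gamma> F (\<lambda>y. cov \<Gamma> F (\<lambda>y. fd F y w) y v) x u
       = cov \<Gamma> F (\<lambda>y. fd F y (christoffel g y v w)) x u"
      unfolding cov_def[of _ _ "\<lambda>y. cov \<Gamma> F (\<lambda>y. fd F y w) y v"] cov_def[of _ _ "\<lambda>y. fd F y (christoffel g y v w)"]
      using fd_cong[OF Wop x, of "\<lambda>y. cov \<Gamma> F (\<lambda>y. fd F y w) y v" "\<lambda>y. fd F y (christoffel g y v w)"] c
        c[OF x] by simp
    then show ?thesis using cY[OF pull.smooth_christoffel_const] by (simp add: cov_def)
  qed
  note e = this
  show ?thesis
    using cov_commutator[OF Wop Fs FS smooth_on_fd_const[OF Fs] x, of w v u]
      pull.cov_commutator[OF Wop smooth_on_id[OF Wop] _ smooth_on_const x, of w v u]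
    unfolding e linear_diff[OF F_linear[OF x], symmetric] by simp
qed

end

section \<open>Curvature of complex space forms\<close>

text \<open>The holomorphic sectional curvature determines a Kaehler curvature tensor. Polarising
  \<open>T0\<close> gives \<open>q\<close>, a relation with coefficients 1 and 3 between the values
  for \<open>x, y\<close> and for \<open>x, J y\<close>; with \<open>J y\<close> in place of
  \<open>y\<close> the coefficients are exchanged, so both values vanish, and with them
  \<open>T\<close>.\<close>

lemma kaehler_curvature_like_eq_0:
  fixes T :: "'a::real_vector \<Rightarrow> 'a \<Rightarrow> 'a \<Rightarrow> 'a \<Rightarrow> real"
  assumes lin: "\<And>y z w. linear (\<lambda>x. T x y z w)" "\<And>x z w. linear (\<lambda>y. T x y z w)"
      "\<And>x y w. linear (\<lambda>z. T x y z w)" "\<And>x y z. linear (\<lambda>w. T x y z w)"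
    and a1: "\<And>x y z w. T x y z w = - T y x z w" and a2: "\<And>x y z w. T x y z w = - T x y w z"
    and b: "\<And>x y z w. T x y z w + T y z x w + T z x y w = 0"
    and J: "linear J" "\<And>x. J (J x) = - x" and TJ: "\<And>x y z w. T x y (J z) (J w) = T x y z w"
    and T0: "\<And>x. T x (J x) (J x) x = 0"
  shows "T x y z w = 0"
proof -
  have ps: "T x y z w = T z w x y" for x y z w
    using b[of x y z w] b[of y z w x] b[of z w x y] b[of w x y z]
      a1[of x y z w] a1[of x z y w] a1[of x w y z] a1[of y z x w] a1[of y w x z] a1[of z w x y]
      a2[of x y z w] a2[of x z y w] a2[of x w y z] a2[of y z x w] a2[of y w x z] a2[of z w x y]
      a1[of y x z w] a1[of z x y w] a1[of w x y z] a1[of z y x w] a1[of w y x z] a1[of w z x y]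
      a2[of y x z w] a2[of z x y w] a2[of w x y z] a2[of z y x w] a2[of w y x z] a2[of w z x y]
    by linarith
  have TJ': "T (J x) (J y) z w = T x y z w" for x y z w
    using ps[of "J x" "J y" z w] ps[of x y z w] TJ by simp
  note L = linear_add[OF lin(1)] linear_add[OF lin(2)] linear_add[OF lin(3)] linear_add[OF lin(4)]
    linear_diff[OF lin(1)] linear_diff[OF lin(2)] linear_diff[OF lin(3)] linear_diff[OF lin(4)]
    linear_neg[OF lin(1)] linear_neg[OF lin(2)] linear_neg[OF lin(3)] linear_neg[OF lin(4)]
    linear_add[OF J(1)] linear_diff[OF J(1)]
  have q: "T x y y x + 3 * T x (J y) (J y) x = 0" for x y
  proof -
    \<comment> \<open>Adding the values at \<open>x + y\<close> and \<open>x - y\<close> keeps the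
      terms of even degree in each variable.\<close>
    have p: "T (x + y) (J (x + y)) (J (x + y)) (x + y) + T (x - y) (J (x - y)) (J (x - y)) (x - y)
        = 2 * (T y (J y) (J x) x + T y (J x) (J y) x + T y (J x) (J x) y + T x (J y) (J y) x
        + T x (J y) (J x) y + T x (J x) (J y) y) + 2 * T x (J x) (J x) x + 2 * T y (J y) (J y) y"
      by (simp only: L) simp
    have e1: "T x (J y) (J x) y = T x (J y) (J y) x"
      using TJ[of x "J y" "J x" y] a2[of x "J y" x "J y"] by (simp add: J L)
    have e2: "T x (J x) (J y) y = T x y y x + T x (J y) (J y) x"
      using b[of x "J x" "J y" y] TJ'[of x y x y] a1[of "J y" x "J x" y] a2[of x y x y] e1 by simp
    have e3: "T y (J y) (J x) x = T x (J x) (J y) y"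
      using ps[of y "J y" "J x" x] a1[of "J x" x y "J y"] a2[of x "J x" y "J y"] by simp
    have e4: "T y (J x) (J y) x = T x (J y) (J x) y"
      using ps[of y "J x" "J y" x] a1[of "J y" x y "J x"] a2[of x "J y" y "J x"] by simp
    have e5: "T y (J x) (J x) y = T x (J y) (J y) x"
      using TJ'[of y "J x" "J x" y] TJ[of "J y" "J (J x)" "J x" y] a1[of "J y" x x "J y"] a2[of x "J y" x "J y"]
      by (simp add: J L)
    show ?thesis using p unfolding T0 e3 e4 e5 e1 e2 by simp
  qed
  have s: "T x y y x = 0" for x y using q[of x y] q[of x "J y"] by (simp add: J L)
  have s2: "T x y z x = 0" for x y z
    using s[of x "y + z"] s[of x y] s[of x z] ps[of x y z x] a1[of z x x y] a2[of x z x y] by (simp add: L)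
  have s3: "T x y z w = - T w y z x" for x y z w
    using s2[of "x + w" y z] s2[of x y z] s2[of w y z] by (simp add: L)
  show ?thesis
    using b[of x y z w] s3[of x y z w] s3[of y z x w] s3[of z x y w] a1[of w y z x] a1[of w z x y] a1[of w x y z]
      a2[of y w z x] a2[of z w x y] a2[of x w y z] ps[of y w x z] ps[of z w x y] ps[of x w y z]
      a2[of x y z w] a2[of y z x w] a2[of z x y w] s3[of z w x y] s3[of y w x z]
      a1[of y w x z] a1[of x z y w] a2[of x z w y] a1[of w y x z] a1[of z y x w]
    by linarith
qed

locale kaehler_on = metric_on S \<gamma> for S :: "'a::euclidean_space set" and \<gamma> +
  fixes J :: "'a \<Rightarrow> 'a \<Rightarrow> 'a" and c :: real
  assumes J_linear: "x \<in> S \<Longrightarrow> linear (J x)" and J_smooth: "smooth_on S (\<lambda>x. J x v)"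
    and J_J: "x \<in> S \<Longrightarrow> J x (J x v) = - v"
    and J_isom: "x \<in> S \<Longrightarrow> \<gamma> x (J x v) (J x w) = \<gamma> x v w"
    and J_parallel: "x \<in> S \<Longrightarrow> fd (\<lambda>y. J y v) x u + christoffel \<gamma> x u (J x v) = J x (christoffel \<gamma> x u v)"
    and hol_curv: "x \<in> S \<Longrightarrow>
      \<gamma> x (local_curvature \<gamma> x v (J x v) (J x v)) v = 4 * c * (\<gamma> x v v)\<^sup>2"
begin

lemma J_skew: "x \<in> S \<Longrightarrow> \<gamma> x (J x v) w = - \<gamma> x v (J x w)"
  using J_isom[of x v "J x w"] ips.minus_r[OF ips] by (simp add: J_J)

lemma J_skew0: "x \<in> S \<Longrightarrow> \<gamma> x (J x v) v = 0"
  using J_skew[of x v v] ips.sym[OF ips, of x v "J x v"] by simp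

lemma cov_J:
  fixes F :: "'b::euclidean_space \<Rightarrow> 'a"
  assumes W: "open W" "smooth_on W F" "\<And>x. x \<in> W \<Longrightarrow> F x \<in> S"
    and Y: "smooth_on W Y" and x: "x \<in> W"
  shows "cov \<Gamma> F (\<lambda>y. J (F y) (Y y)) x u = J (F x) (cov \<Gamma> F Y x u)"
proof -
  have Fx: "F x \<in> S" by (rule W(3)[OF x])
  have "fd (\<lambda>y. J (F y) (Y y)) x u = fd (\<lambda>y. J (F y) (Y x)) x u + J (F x) (fd Y x u)"
    by (rule fd_linear_family[where \<beta>="\<lambda>y. J (F y)", OF W(1) _ _ x smooth_on_diff[OF Y x]])
       (use J_linear W(3) smooth_on_compose[OF W(1) op W(3,2) J_smooth] in auto)
  moreover have "fd (\<lambda>y. J (F y) (Y x)) x u = fd (\<lambda>z. J z (Y x)) (F x) (fd F x u)"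
    by (rule fd_chain[of F x "\<lambda>z. J z (Y x)"])
       (use smooth_on_diff[OF W(2) x] smooth_on_diff[OF J_smooth Fx] in auto)
  ultimately show ?thesis
    using J_parallel[OF Fx, of "Y x" "fd F x u"] linear_add[OF J_linear[OF Fx]] by (simp add: cov_def)
qed

lemma smooth_J:
  fixes F :: "'b::euclidean_space \<Rightarrow> 'a"
  assumes W: "open W" "smooth_on W F" "\<And>x. x \<in> W \<Longrightarrow> F x \<in> S" and Y: "smooth_on W Y"
  shows "smooth_on W (\<lambda>y. J (F y) (Y y))"
  by (rule smooth_on_linear_family[where \<beta>="\<lambda>y. J (F y)", OF W(1) _ _ Y])
     (use J_linear W(3) smooth_on_compose[OF W(1) op W(3,2) J_smooth] in auto)

lemma curvature_J:
  assumes x: "x \<in> S"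
  shows "local_curvature \<gamma> x u v (J x w) = J x (local_curvature \<gamma> x u v w)"
proof -
  note I = op smooth_on_id[OF op]
  have C: "smooth_on S (\<lambda>y. cov \<Gamma> (\<lambda>x. x) (\<lambda>x. w) y v)" for w v
    by (intro smooth_cov I smooth_on_const) auto
  have *: "cov \<Gamma> (\<lambda>x. x) (\<lambda>y. cov \<Gamma> (\<lambda>x. x) (\<lambda>y. J y w) y v) x u
    = J x (cov \<Gamma> (\<lambda>x. x) (\<lambda>y. cov \<Gamma> (\<lambda>x. x) (\<lambda>x. w) y v) x u)" for u v
  proof -
    have 1: "cov \<Gamma> (\<lambda>x. x) (\<lambda>y. J y w) y v = J y (cov \<Gamma> (\<lambda>x. x) (\<lambda>x. w) y v)" if "y \<in> S" for y
      using cov_J[OF I _ smooth_on_const that, of w v] by simp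
    have "cov \<Gamma> (\<lambda>x. x) (\<lambda>y. cov \<Gamma> (\<lambda>x. x) (\<lambda>y. J y w) y v) x u
      = cov \<Gamma> (\<lambda>x. x) (\<lambda>y. J y (cov \<Gamma> (\<lambda>x. x) (\<lambda>x. w) y v)) x u"
      unfolding cov_def[of _ _ "\<lambda>y. cov \<Gamma> (\<lambda>x. x) (\<lambda>y. J y w) y v"]
        cov_def[of _ _ "\<lambda>y. J y (cov \<Gamma> (\<lambda>x. x) (\<lambda>x. w) y v)"]
      using fd_cong[OF op x 1] 1[OF x] by simp
    then show ?thesis using cov_J[OF I _ C[of w v] x, of u] by simp
  qed
  show ?thesis
    using cov_commutator[OF I _ J_smooth x, of w v u] cov_commutator[OF I _ smooth_on_const x, of w v u]
    unfolding * linear_diff[OF J_linear[OF x], symmetric] by simp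
qed

text \<open>Curvature tensor of the model with holomorphic sectional curvature 4, so that
  \<open>c *\<^sub>R R0\<close> matches the factor \<open>4 * c\<close> in
  \<open>hol_curv\<close>.\<close>

definition R0 :: "'a \<Rightarrow> 'a \<Rightarrow> 'a \<Rightarrow> 'a \<Rightarrow> 'a" where
  "R0 x u v w = \<gamma> x v w *\<^sub>R u - \<gamma> x u w *\<^sub>R v + \<gamma> x (J x v) w *\<^sub>R J x u - \<gamma> x (J x u) w *\<^sub>R J x v
     - (2 * \<gamma> x (J x u) v) *\<^sub>R J x w"

text \<open>The difference \<open>T\<close> of the two tensors has all Kaehler symmetries and
  vanishing holomorphic sectional curvature.\<close>

theorem space_form_curvature:
  assumes x: "x \<in> S"
  shows "local_curvature \<gamma> x u v w = c *\<^sub>R R0 x u v w"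
proof -
  interpret p: ips "\<gamma> x" by (rule ips[OF x])
  define T where "T u v w z = \<gamma> x (local_curvature \<gamma> x u v w) z - c * \<gamma> x (R0 x u v w) z" for u v w z
  note R = local_curvature_linear[OF x]
  note RL = linear_add[OF R(1)] linear_add[OF R(2)] linear_add[OF R(3)]
    linear_scale[OF R(1)] linear_scale[OF R(2)] linear_scale[OF R(3)]
  note JL = linear_add[OF J_linear[OF x]] linear_scale[OF J_linear[OF x]]
  note JS = J_skew[OF x]
  have "T u v w z = 0" for u v w z
  proof (rule kaehler_curvature_like_eq_0[of T "J x"])
    show "linear (\<lambda>u. T u v w z)" "linear (\<lambda>v. T u v w z)" "linear (\<lambda>w. T u v w z)" "linear (\<lambda>z. T u v w z)" for u v w z
      unfolding T_def R0_def by (rule linearI; simp add: RL JL p.ip_simps algebra_simps)+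
    show "T u v w z = - T v u w z" for u v w z
      unfolding T_def R0_def using local_curvature_anti[of x u v w] JS[of u v] p.sym[of u "J x v"]
      by (simp add: p.ip_simps algebra_simps)
    show "T u v w z = - T u v z w" for u v w z
      unfolding T_def R0_def using local_curvature_skew[OF x, of u v w z] p.sym[of w "local_curvature \<gamma> x u v z"]
        JS[of w z] p.sym[of w "J x z"] p.sym[of u z] p.sym[of v z] p.sym[of u w] p.sym[of v w]
      by (simp add: p.ip_simps algebra_simps)
    show "T u v w z + T v w u z + T w u v z = 0" for u v w z
      unfolding T_def R0_def using p.zero_l arg_cong[OF local_curvature_bianchi[OF x, of u v w], of "\<lambda>y. \<gamma> x y z"]
        JS[of u v] p.sym[of u "J x v"] JS[of v w] p.sym[of v "J x w"] JS[of u w] p.sym[of u "J x w"]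
        p.sym[of u v] p.sym[of u w] p.sym[of v w]
      by (simp add: p.ip_simps algebra_simps)
    show "linear (J x)" "J x (J x v) = - v" for v by (simp_all add: J_linear x J_J)
    show "T u v (J x w) (J x z) = T u v w z" for u v w z
      unfolding T_def R0_def curvature_J[OF x]
      by (simp add: p.ip_simps J_isom[OF x] J_J[OF x] JS algebra_simps)
    show "T v (J x v) (J x v) v = 0" for v
      unfolding T_def R0_def hol_curv[OF x] using J_skew0[OF x, of v] p.sym[of v "J x v"]
      by (simp add: p.ip_simps J_isom[OF x] J_J[OF x] algebra_simps power2_eq_square)
  qed
  then show ?thesis by (intro p.eqI) (simp add: T_def p.ip_simps)
qed

end

section \<open>The structure equations of a real hypersurface\<close>

text \<open>Intrinsic form of the equations satisfied by the shape operator \<open>A\<close>, the tangential part \<open>\<phi>\<close>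
  of the complex structure and the structure vector \<open>\<xi>\<close>.\<close>

locale hypersurface_eqs = metric_on W g for W :: "'b::euclidean_space set" and g +
  fixes A \<phi> :: "'b \<Rightarrow> 'b \<Rightarrow> 'b" and \<xi> :: "'b \<Rightarrow> 'b" and c :: real
  assumes A_linear: "x \<in> W \<Longrightarrow> linear (A x)" and \<phi>_linear: "x \<in> W \<Longrightarrow> linear (\<phi> x)"
    and A_smooth: "smooth_on W (\<lambda>x. A x v)" and \<phi>_smooth: "smooth_on W (\<lambda>x. \<phi> x v)" and \<xi>_smooth: "smooth_on W \<xi>"
    and A_sym: "x \<in> W \<Longrightarrow> g x (A x v) w = g x v (A x w)"
    and \<phi>_skew: "x \<in> W \<Longrightarrow> g x (\<phi> x v) w = - g x v (\<phi> x w)"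
    and \<phi>_\<phi>: "x \<in> W \<Longrightarrow> \<phi> x (\<phi> x v) = - v + g x v (\<xi> x) *\<^sub>R \<xi> x"
    and \<xi>_unit: "x \<in> W \<Longrightarrow> g x (\<xi> x) (\<xi> x) = 1"
    and nabla_\<xi>: "x \<in> W \<Longrightarrow> cov (christoffel g) (\<lambda>x. x) \<xi> x u = \<phi> x (A x u)"
    and nabla_\<phi>: "x \<in> W \<Longrightarrow> cov (christoffel g) (\<lambda>x. x) (\<lambda>y. \<phi> y v) x u
        = \<phi> x (christoffel g x u v) + g x v (\<xi> x) *\<^sub>R A x u - g x (A x u) v *\<^sub>R \<xi> x"
    and codazzi: "x \<in> W \<Longrightarrow> cov (christoffel g) (\<lambda>x. x) (\<lambda>y. A y v) x u - cov (christoffel g) (\<lambda>x. x) (\<lambda>y. A y u) x v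
        = c *\<^sub>R (g x u (\<xi> x) *\<^sub>R \<phi> x v - g x v (\<xi> x) *\<^sub>R \<phi> x u - (2 * g x (\<phi> x u) v) *\<^sub>R \<xi> x)"
    and gauss: "x \<in> W \<Longrightarrow> local_curvature g x u v w
        = c *\<^sub>R (g x v w *\<^sub>R u - g x u w *\<^sub>R v + g x (\<phi> x v) w *\<^sub>R \<phi> x u - g x (\<phi> x u) w *\<^sub>R \<phi> x v
            - (2 * g x (\<phi> x u) v) *\<^sub>R \<phi> x w)
          + g x (A x v) w *\<^sub>R A x u - g x (A x u) w *\<^sub>R A x v"

lemma cov_cong:
  assumes "open W" "x \<in> W" "\<And>y. y \<in> W \<Longrightarrow> Y y = Z y"
  shows "cov \<Gamma> F Y x u = cov \<Gamma> F Z x u"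
proof -
  have "fd Y x = fd Z x" by (rule fd_cong[OF assms])
  then show ?thesis using assms(3)[OF assms(2)] by (simp add: cov_def)
qed

context metric_on begin

lemma cov_add:
  assumes "F x \<in> S" "Y differentiable (at x)" "Z differentiable (at x)"
  shows "cov \<Gamma> F (\<lambda>x. Y x + Z x) x u = cov \<Gamma> F Y x u + cov \<Gamma> F Z x u"
  by (simp add: cov_def fd_eq[OF has_derivative_add[OF assms(2,3)[unfolded frechet_derivative_works]]]
      bilinear_radd[OF bil_christoffel[OF assms(1)]])

lemma cov_scale:
  assumes "F x \<in> S" "f differentiable (at x)" "Z differentiable (at x)"
  shows "cov \<Gamma> F (\<lambda>x. f x *\<^sub>R Z x) x u = f x *\<^sub>R cov \<Gamma> F Z x u + fd f x u *\<^sub>R Z x"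
  by (simp add: cov_def fd_eq[OF has_derivative_scaleR[OF assms(2,3)[unfolded frechet_derivative_works]]]
      bilinear_rmul[OF bil_christoffel[OF assms(1)]] algebra_simps)

lemma cov_minus:
  assumes "F x \<in> S" "Z differentiable (at x)"
  shows "cov \<Gamma> F (\<lambda>x. - Z x) x u = - cov \<Gamma> F Z x u"
  by (simp add: cov_def fd_eq[OF has_derivative_minus[OF assms(2)[unfolded frechet_derivative_works]]]
      bilinear_rneg[OF bil_christoffel[OF assms(1)]])

end

locale hypersurface = kaehler_on S \<gamma> J c + isometric_map S \<gamma> W F g
  for S :: "'a::euclidean_space set" and \<gamma> J c and W :: "'b::euclidean_space set" and F g +
  fixes \<nu> :: "'b \<Rightarrow> 'a"
  assumes codim: "DIM('b) + 1 = DIM('a)"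
    and \<nu>_smooth: "smooth_on W \<nu>"
    and \<nu>_unit: "x \<in> W \<Longrightarrow> \<gamma> (F x) (\<nu> x) (\<nu> x) = 1"
    and \<nu>_normal: "x \<in> W \<Longrightarrow> \<gamma> (F x) (fd F x v) (\<nu> x) = 0"
begin

text \<open>Tangential component of an ambient vector, expressed in the chart of the hypersurface.
  It is fixed by its inner products, since \<open>g\<close> is nondegenerate.\<close>

definition tang :: "'b \<Rightarrow> 'a \<Rightarrow> 'b" where
  "tang x Y = (THE v. \<forall>w. g x v w = \<gamma> (F x) Y (fd F x w))"

lemma tang_frame:
  obtains e :: "'b \<Rightarrow> 'b \<Rightarrow> 'b" where "\<And>b. b \<in> Basis \<Longrightarrow> smooth_on W (e b)"
    "\<And>x Y. x \<in> W \<Longrightarrow> tang x Y = (\<Sum>b\<in>Basis. \<gamma> (F x) Y (fd F x (e b x)) *\<^sub>R e b x)"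
    "\<And>x Y w. x \<in> W \<Longrightarrow> g x (tang x Y) w = \<gamma> (F x) Y (fd F x w)"
proof (rule pull.ON_frame)
  fix e :: "'b \<Rightarrow> 'b \<Rightarrow> 'b"
  assume e: "\<And>b. b \<in> Basis \<Longrightarrow> smooth_on W (e b)"
    "\<And>x v. x \<in> W \<Longrightarrow> v = (\<Sum>b\<in>Basis. g x v (e b x) *\<^sub>R e b x)"
  have k: "g x (\<Sum>b\<in>Basis. \<gamma> (F x) Y (fd F x (e b x)) *\<^sub>R e b x) w = \<gamma> (F x) Y (fd F x w)" if x: "x \<in> W" for x Y w
  proof -
    interpret p: ips "\<gamma> (F x)" by (rule ips[OF FS[OF x]])
    interpret q: ips "g x" by (rule pull.ips[OF x])
    have "\<gamma> (F x) Y (fd F x w) = \<gamma> (F x) Y (fd F x (\<Sum>b\<in>Basis. g x w (e b x) *\<^sub>R e b x))" using e(2)[OF x] by metis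
    also have "\<dots> = (\<Sum>b\<in>Basis. g x w (e b x) * \<gamma> (F x) Y (fd F x (e b x)))"
      by (simp add: linear_sum[OF F_linear[OF x]] linear_scale[OF F_linear[OF x]] p.sum_r p.scale_r)
    finally show ?thesis by (simp add: q.sum_l q.scale_l q.sym[of w] mult.commute)
  qed
  have t: "tang x Y = (\<Sum>b\<in>Basis. \<gamma> (F x) Y (fd F x (e b x)) *\<^sub>R e b x)" if x: "x \<in> W" for x Y
    unfolding tang_def
  proof (rule the_equality)
    show "\<forall>w. g x (\<Sum>b\<in>Basis. \<gamma> (F x) Y (fd F x (e b x)) *\<^sub>R e b x) w = \<gamma> (F x) Y (fd F x w)" using k[OF x] by blast
    show "v = (\<Sum>b\<in>Basis. \<gamma> (F x) Y (fd F x (e b x)) *\<^sub>R e b x)" if "\<forall>w. g x v w = \<gamma> (F x) Y (fd F x w)" for v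
      by (rule ips.eqI[OF pull.ips[OF x]]) (simp add: k[OF x] that)
  qed
  show ?thesis by (rule that[OF e(1) t]) (simp_all add: t k)
qed

lemma g_tang: "x \<in> W \<Longrightarrow> g x (tang x Y) w = \<gamma> (F x) Y (fd F x w)"
  by (rule tang_frame) metis

lemma smooth_tang:
  assumes "smooth_on W Y" shows "smooth_on W (\<lambda>x. tang x (Y x))"
proof (rule tang_frame)
  fix e assume e: "\<And>b. b \<in> Basis \<Longrightarrow> smooth_on W (e b)"
    "\<And>x Y. x \<in> W \<Longrightarrow> tang x Y = (\<Sum>b\<in>Basis. \<gamma> (F x) Y (fd F x (e b x)) *\<^sub>R e b x)"
  have "smooth_on W (\<lambda>x. \<Sum>b\<in>Basis. \<gamma> (F x) (Y x) (fd F x (e b x)) *\<^sub>R e b x)"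
    by (intro smooth_on_sum smooth_on_scaleR smooth_metric_along smooth_on_fd Wop Fs FS assms e)
  then show ?thesis by (rule smooth_on_cong[OF Wop, rotated]) (simp add: e)
qed

lemma tang_linear: assumes x: "x \<in> W" shows "linear (tang x)"
proof (rule linearI)
  interpret p: ips "\<gamma> (F x)" by (rule ips[OF FS[OF x]])
  interpret q: ips "g x" by (rule pull.ips[OF x])
  show "tang x (Y + Z) = tang x Y + tang x Z" for Y Z
    by (rule q.eqI) (simp add: g_tang[OF x] q.add_l p.add_l)
  show "tang x (r *\<^sub>R Y) = r *\<^sub>R tang x Y" for r Y
    by (rule q.eqI) (simp add: g_tang[OF x] q.scale_l p.scale_l)
qed

text \<open>What is left of \<open>Y\<close> is orthogonal to the range of \<open>fd F x\<close> and
  to \<open>\<nu> x\<close>. By \<open>codim\<close> and injectivity these span the ambient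
  space.\<close>

lemma normal_decomposition:
  assumes x: "x \<in> W"
  shows "Y = fd F x (tang x Y) + \<gamma> (F x) Y (\<nu> x) *\<^sub>R \<nu> x"
proof -
  interpret p: ips "\<gamma> (F x)" by (rule ips[OF FS[OF x]])
  define z where "z = Y - fd F x (tang x Y) - \<gamma> (F x) Y (\<nu> x) *\<^sub>R \<nu> x"
  have zF: "\<gamma> (F x) z (fd F x w) = 0" for w
    using g_tang[OF x, of Y w] \<nu>_normal[OF x, of w] p.sym[of "\<nu> x"] by (simp add: z_def p.ip_simps g_eq[OF x])
  have z\<nu>: "\<gamma> (F x) z (\<nu> x) = 0"
    using \<nu>_normal[OF x] \<nu>_unit[OF x] by (simp add: z_def p.ip_simps)
  have inj: "inj (fd F x)" using linear_injective_0[OF F_linear[OF x]] Finj[OF x] by blast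
  have sub: "subspace (range (fd F x))" using linear_subspace_image[OF F_linear[OF x] subspace_UNIV] .
  have dimr: "dim (range (fd F x)) = DIM('b)"
    using dim_image_eq[OF F_linear[OF x], of UNIV] inj by simp
  have "\<nu> x \<notin> range (fd F x)"
    using \<nu>_normal[OF x] \<nu>_unit[OF x] by fastforce
  then have "\<nu> x \<notin> span (range (fd F x))" using sub by (simp add: span_eq_iff[THEN iffD2])
  then have "dim (insert (\<nu> x) (range (fd F x))) = DIM('a)"
    using dimr codim by (simp add: dim_insert)
  then have sp: "span (insert (\<nu> x) (range (fd F x))) = UNIV" by (simp add: dim_eq_full)
  have "span (insert (\<nu> x) (range (fd F x))) \<subseteq> {w. \<gamma> (F x) z w = 0}"
    by (rule span_minimal) (use zF z\<nu> in \<open>auto simp: subspace_def p.ip_simps\<close>)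
  then have "z = 0" using sp p.eq_0_iff[of z] by auto
  then show ?thesis by (simp add: z_def algebra_simps)
qed

definition shape :: "'b \<Rightarrow> 'b \<Rightarrow> 'b" where "shape x u = - tang x (cov \<Gamma> F \<nu> x u)"
definition phi :: "'b \<Rightarrow> 'b \<Rightarrow> 'b" where "phi x v = tang x (J (F x) (fd F x v))"
definition xi :: "'b \<Rightarrow> 'b" where "xi x = tang x (- J (F x) (\<nu> x))"

lemma smooth_fields: "smooth_on W (\<lambda>x. shape x v)" "smooth_on W (\<lambda>x. phi x v)" "smooth_on W xi"
  unfolding shape_def phi_def xi_def
  by (intro smooth_on_minus smooth_tang smooth_cov smooth_J smooth_on_fd_const smooth_on_const \<nu>_smooth Wop Fs FS; assumption?)+

lemma weingarten:
  assumes x: "x \<in> W" shows "cov \<Gamma> F \<nu> x u = - fd F x (shape x u)"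
proof -
  interpret p: ips "\<gamma> (F x)" by (rule ips[OF FS[OF x]])
  have "fd (\<lambda>x. \<gamma> (F x) (\<nu> x) (\<nu> x)) x u = fd (\<lambda>x. 1) x u"
    by (rule fun_cong[OF fd_cong[OF Wop x]]) (rule \<nu>_unit)
  then have "\<gamma> (F x) (cov \<Gamma> F \<nu> x u) (\<nu> x) = 0"
    using metric_deriv_along[OF Wop Fs FS \<nu>_smooth \<nu>_smooth x, of u] p.sym[of "\<nu> x"] by simp
  then show ?thesis using normal_decomposition[OF x, of "cov \<Gamma> F \<nu> x u"]
    by (simp add: shape_def linear_neg[OF F_linear[OF x]])
qed

text \<open>Gauss formula. The tangential part is \<open>gauss_tangential\<close>; the normal part
  comes from differentiating the orthogonality of \<open>fd F x v\<close> and
  \<open>\<nu> x\<close>.\<close>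

lemma second_fundamental_form:
  assumes x: "x \<in> W"
  shows "cov \<Gamma> F (\<lambda>y. fd F y v) x u = fd F x (christoffel g x u v) + g x (shape x u) v *\<^sub>R \<nu> x"
proof -
  interpret p: ips "\<gamma> (F x)" by (rule ips[OF FS[OF x]])
  have "fd (\<lambda>x. \<gamma> (F x) (fd F x v) (\<nu> x)) x u = fd (\<lambda>x. 0) x u"
    by (rule fun_cong[OF fd_cong[OF Wop x]]) (rule \<nu>_normal)
  then have "\<gamma> (F x) (cov \<Gamma> F (\<lambda>y. fd F y v) x u) (\<nu> x) = g x (shape x u) v"
    using metric_deriv_along[OF Wop Fs FS smooth_on_fd_const[OF Fs] \<nu>_smooth x, of v u]
    by (simp add: weingarten[OF x] p.ip_simps g_eq[OF x] p.sym)
  moreover have "tang x (cov \<Gamma> F (\<lambda>y. fd F y v) x u) = christoffel g x u v"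
    by (rule ips.eqI[OF pull.ips[OF x]]) (simp add: g_tang[OF x] gauss_tangential[OF x])
  ultimately show ?thesis using normal_decomposition[OF x, of "cov \<Gamma> F (\<lambda>y. fd F y v) x u"] by simp
qed

lemma cov_tangent_field:
  assumes x: "x \<in> W" and Z: "smooth_on W Z"
  shows "cov \<Gamma> F (\<lambda>y. fd F y (Z y)) x u
    = fd F x (cov (christoffel g) (\<lambda>x. x) Z x u) + g x (shape x u) (Z x) *\<^sub>R \<nu> x"
proof -
  have "fd (\<lambda>y. fd F y (Z y)) x u = fd (\<lambda>y. fd F y (Z x)) x u + fd F x (fd Z x u)"
    by (rule fd_linear_family[where \<beta>="fd F", OF Wop _ _ x smooth_on_diff[OF Z x]])
       (auto intro: F_linear smooth_on_fd_const Fs)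
  then show ?thesis using second_fundamental_form[OF x, of "Z x" u] linear_add[OF F_linear[OF x]]
    by (simp add: cov_def)
qed

lemma shape_sym: "x \<in> W \<Longrightarrow> g x (shape x u) v = g x u (shape x v)"
proof -
  assume x: "x \<in> W"
  interpret p: ips "\<gamma> (F x)" by (rule ips[OF FS[OF x]])
  have "cov \<Gamma> F (\<lambda>y. fd F y v) x u = cov \<Gamma> F (\<lambda>y. fd F y u) x v"
    unfolding cov_def fd_fd_commute[OF Wop x Fs, of v u]
    by (simp add: christoffel_sym[OF FS[OF x], of "fd F x u"])
  then have "g x (shape x u) v *\<^sub>R \<nu> x = g x (shape x v) u *\<^sub>R \<nu> x"
    by (simp add: second_fundamental_form[OF x] pull.christoffel_sym[OF x, of u])
  moreover have "\<nu> x \<noteq> 0" using \<nu>_unit[OF x] p.zero_l by force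
  ultimately show ?thesis using ips.sym[OF pull.ips[OF x], of "shape x v"] by simp
qed

lemma fd_xi: assumes x: "x \<in> W" shows "fd F x (xi x) = - J (F x) (\<nu> x)"
proof -
  interpret p: ips "\<gamma> (F x)" by (rule ips[OF FS[OF x]])
  show ?thesis using normal_decomposition[OF x, of "- J (F x) (\<nu> x)"] J_skew0[OF FS[OF x], of "\<nu> x"]
    by (simp add: xi_def p.minus_l)
qed

lemma J_\<nu>: "x \<in> W \<Longrightarrow> J (F x) (\<nu> x) = - fd F x (xi x)" using fd_xi by simp

lemma J_fd: assumes x: "x \<in> W"
  shows "J (F x) (fd F x v) = fd F x (phi x v) + g x v (xi x) *\<^sub>R \<nu> x"
proof -
  interpret p: ips "\<gamma> (F x)" by (rule ips[OF FS[OF x]])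
  show ?thesis using normal_decomposition[OF x, of "J (F x) (fd F x v)"] J_skew[OF FS[OF x], of "fd F x v" "\<nu> x"]
    by (simp add: phi_def J_\<nu>[OF x] p.ip_simps g_eq[OF x])
qed

lemma fd_inj: "x \<in> W \<Longrightarrow> fd F x u = fd F x v \<Longrightarrow> u = v"
  using Finj[of x "u - v"] by (simp add: linear_diff[OF F_linear])

lemma shape_linear: assumes x: "x \<in> W" shows "linear (shape x)"
proof -
  have "linear (cov \<Gamma> F \<nu> x)"
    unfolding cov_def
    using linear_compose[OF F_linear[OF x] bilinear_linears(2)[OF bil_christoffel[OF FS[OF x]]]]
      smooth_on_linear_fd[OF \<nu>_smooth x] by (auto intro!: linear_compose_add simp: o_def)
  then show ?thesis
    using linear_compose_neg[OF linear_compose[OF _ tang_linear[OF x]]] by (simp add: shape_def[abs_def] o_def)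
qed

lemma phi_linear: assumes x: "x \<in> W" shows "linear (phi x)"
  using linear_compose[OF linear_compose[OF F_linear[OF x] J_linear[OF FS[OF x]]] tang_linear[OF x]]
  by (simp add: phi_def[abs_def] o_def)

lemma g_phi: "x \<in> W \<Longrightarrow> g x (phi x v) w = \<gamma> (F x) (J (F x) (fd F x v)) (fd F x w)"
  by (simp add: phi_def g_tang)

lemma \<nu>_normal': "x \<in> W \<Longrightarrow> \<gamma> (F x) (\<nu> x) (fd F x v) = 0"
  using \<nu>_normal ips.sym[OF ips[OF FS]] by metis

sublocale hypersurface_eqs W g shape phi xi c
proof
  fix x v w u
  show "smooth_on W (\<lambda>x. shape x v)" "smooth_on W (\<lambda>x. phi x v)" "smooth_on W xi" by (rule smooth_fields)+
  assume x: "x \<in> W"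
  interpret p: ips "\<gamma> (F x)" by (rule ips[OF FS[OF x]])
  interpret q: ips "g x" by (rule pull.ips[OF x])
  note Fl = linear_add[OF F_linear[OF x]] linear_scale[OF F_linear[OF x]] linear_neg[OF F_linear[OF x]]
    linear_diff[OF F_linear[OF x]]
  note Jl = linear_add[OF J_linear[OF FS[OF x]]] linear_scale[OF J_linear[OF FS[OF x]]] linear_neg[OF J_linear[OF FS[OF x]]]
  note N = \<nu>_normal[OF x] \<nu>_normal'[OF x] \<nu>_unit[OF x]
  show "shape x (v + w) = shape x v + shape x w" "phi x (v + w) = phi x v + phi x w"
    "shape x (r *\<^sub>R v) = r *\<^sub>R shape x v" "phi x (r *\<^sub>R v) = r *\<^sub>R phi x v" for r
    by (simp_all add: linear_add[OF shape_linear[OF x]] linear_add[OF phi_linear[OF x]]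
        linear_scale[OF shape_linear[OF x]] linear_scale[OF phi_linear[OF x]])
  show "g x (shape x v) w = g x v (shape x w)" by (rule shape_sym[OF x])
  show "g x (phi x v) w = - g x v (phi x w)"
    using J_skew[OF FS[OF x], of "fd F x v" "fd F x w"] q.sym[of v "phi x w"] p.sym[of "fd F x v"] by (simp add: g_phi[OF x])
  \<comment> \<open>\<open>J\<close> is applied twice to \<open>fd F x v\<close>. Pairing the result
    with the normal shows that \<open>phi x v\<close> is orthogonal to \<open>xi x\<close>, and
    injectivity of \<open>fd F x\<close> then gives the identity.\<close>
  have "fd F x (phi x (phi x v)) = fd F x (- v + g x v (xi x) *\<^sub>R xi x) + (g x (phi x v) (xi x)) *\<^sub>R (- \<nu> x)"
    using J_J[OF FS[OF x], of "fd F x v"] by (simp add: J_fd[OF x] Fl Jl J_\<nu>[OF x] algebra_simps) 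
  then have "fd F x (phi x (phi x v) - (- v + g x v (xi x) *\<^sub>R xi x)) = (g x (phi x v) (xi x)) *\<^sub>R (- \<nu> x)"
    by (simp add: Fl)
  moreover have "g x (phi x v) (xi x) = 0"
    using arg_cong[OF calculation, of "\<lambda>y. \<gamma> (F x) y (\<nu> x)"] N by (simp add: p.ip_simps)
  ultimately show "phi x (phi x v) = - v + g x v (xi x) *\<^sub>R xi x"
    using Finj[OF x, of "phi x (phi x v) - (- v + g x v (xi x) *\<^sub>R xi x)"] by simp
  show "g x (xi x) (xi x) = 1"
    by (simp add: g_eq[OF x] fd_xi[OF x] p.ip_simps J_isom[OF FS[OF x]] N)
  have d\<nu>: "smooth_on W (\<lambda>y. - fd F y (shape y u))" for u
    by (intro smooth_on_minus smooth_on_fd Wop Fs smooth_fields)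
  have c\<nu>: "cov \<Gamma> F (\<lambda>y. cov \<Gamma> F \<nu> y v) x u = - fd F x (cov (christoffel g) (\<lambda>x. x) (\<lambda>y. shape y v) x u)
      - g x (shape x u) (shape x v) *\<^sub>R \<nu> x" for u v
  proof -
    have "cov \<Gamma> F (\<lambda>y. cov \<Gamma> F \<nu> y v) x u = cov \<Gamma> F (\<lambda>y. - fd F y (shape y v)) x u"
      by (rule cov_cong[OF Wop x]) (rule weingarten)
    also have "\<dots> = - cov \<Gamma> F (\<lambda>y. fd F y (shape y v)) x u"
      by (rule cov_minus[where F=F and x=x, OF FS[OF x]]) (rule smooth_on_diff[OF smooth_on_fd[OF Wop Fs smooth_fields(1)] x])
    finally show ?thesis by (simp add: cov_tangent_field[OF x smooth_fields(1)])
  qed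
  show "cov (christoffel g) (\<lambda>x. x) (\<lambda>y. shape y v) x u - cov (christoffel g) (\<lambda>x. x) (\<lambda>y. shape y u) x v
        = c *\<^sub>R (g x u (xi x) *\<^sub>R phi x v - g x v (xi x) *\<^sub>R phi x u - (2 * g x (phi x u) v) *\<^sub>R xi x)"
  proof (rule fd_inj[OF x])
    \<comment> \<open>Codazzi is the tangential part of the Ricci identity for the unit normal. The
      normal parts in \<open>c\<nu>\<close> cancel because
      \<open>g x (shape x u) (shape x v)\<close> is symmetric in \<open>u\<close> and
      \<open>v\<close>.\<close>
    have "fd F x (cov (christoffel g) (\<lambda>x. x) (\<lambda>y. shape y v) x u - cov (christoffel g) (\<lambda>x. x) (\<lambda>y. shape y u) x v)
      = - local_curvature \<gamma> (F x) (fd F x u) (fd F x v) (\<nu> x)"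
      using cov_commutator[OF Wop Fs FS \<nu>_smooth x, of v u] q.sym[of "shape x u" "shape x v"]
      by (simp add: c\<nu> Fl algebra_simps)
    also have "\<dots> = fd F x (c *\<^sub>R (g x u (xi x) *\<^sub>R phi x v - g x v (xi x) *\<^sub>R phi x u - (2 * g x (phi x u) v) *\<^sub>R xi x))"
      unfolding space_form_curvature[OF FS[OF x]] R0_def
      by (simp add: J_fd[OF x] J_\<nu>[OF x] N p.ip_simps Fl g_eq[OF x, symmetric] algebra_simps)
    finally show "fd F x (cov (christoffel g) (\<lambda>x. x) (\<lambda>y. shape y v) x u - cov (christoffel g) (\<lambda>x. x) (\<lambda>y. shape y u) x v)
      = fd F x (c *\<^sub>R (g x u (xi x) *\<^sub>R phi x v - g x v (xi x) *\<^sub>R phi x u - (2 * g x (phi x u) v) *\<^sub>R xi x))" .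
  qed
  show "cov (christoffel g) (\<lambda>x. x) xi x u = phi x (shape x u)"
  proof (rule q.eqI)
    fix z
    have "cov \<Gamma> F (\<lambda>y. fd F y (xi y)) x u = cov \<Gamma> F (\<lambda>y. - J (F y) (\<nu> y)) x u"
      by (rule cov_cong[OF Wop x]) (rule fd_xi)
    also have "\<dots> = J (F x) (fd F x (shape x u))"
      using cov_minus[where F=F and x=x, OF FS[OF x] smooth_on_diff[OF smooth_J[OF Wop Fs FS \<nu>_smooth] x]]
        cov_J[OF Wop Fs FS \<nu>_smooth x] by (simp add: weingarten[OF x] Jl)
    finally show "g x (cov (christoffel g) (\<lambda>x. x) xi x u) z = g x (phi x (shape x u)) z"
      using cov_tangent_field[OF x smooth_fields(3), of u] N
      by (simp add: g_eq[OF x] J_fd[OF x] p.ip_simps)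
  qed
  show "cov (christoffel g) (\<lambda>x. x) (\<lambda>y. phi y v) x u
        = phi x (christoffel g x u v) + g x v (xi x) *\<^sub>R shape x u - g x (shape x u) v *\<^sub>R xi x"
  proof (rule q.eqI)
    fix z
    have s: "smooth_on W (\<lambda>y. fd F y (phi y v))" "smooth_on W (\<lambda>y. g y v (xi y))"
      by (intro smooth_on_fd Wop Fs smooth_fields pull.smooth_metric smooth_on_const)+
    \<comment> \<open>The derivative of \<open>phi\<close> is the tangential part of the parallelism
      of \<open>J\<close>, applied to the decomposition \<open>J_fd\<close>.\<close>
    have "cov \<Gamma> F (\<lambda>y. J (F y) (fd F y v)) x u = cov \<Gamma> F (\<lambda>y. fd F y (phi y v) + g y v (xi y) *\<^sub>R \<nu> y) x u"
      by (rule cov_cong[OF Wop x]) (rule J_fd)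
    then have e: "J (F x) (cov \<Gamma> F (\<lambda>y. fd F y v) x u) = cov \<Gamma> F (\<lambda>y. fd F y (phi y v)) x u
        + (g x v (xi x) *\<^sub>R cov \<Gamma> F \<nu> x u + fd (\<lambda>y. g y v (xi y)) x u *\<^sub>R \<nu> x)"
      using cov_J[OF Wop Fs FS smooth_on_fd_const[OF Fs, of v] x, of u] cov_add[where F=F and x=x, OF FS[OF x] smooth_on_diff[OF s(1) x] smooth_on_diff[OF smooth_on_scaleR[OF Wop s(2) \<nu>_smooth] x]]
        cov_scale[where F=F and x=x, OF FS[OF x] smooth_on_diff[OF s(2) x] smooth_on_diff[OF \<nu>_smooth x]] by simp
    show "g x (cov (christoffel g) (\<lambda>x. x) (\<lambda>y. phi y v) x u) z
      = g x (phi x (christoffel g x u v) + g x v (xi x) *\<^sub>R shape x u - g x (shape x u) v *\<^sub>R xi x) z"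
      using arg_cong[OF e, of "\<lambda>y. \<gamma> (F x) y (fd F x z)"] N
      by (simp add: second_fundamental_form[OF x] cov_tangent_field[OF x smooth_fields(2)] weingarten[OF x]
          Jl J_fd[OF x] J_\<nu>[OF x] p.ip_simps q.ip_simps g_eq[OF x, symmetric])
  qed
  show "local_curvature g x u v w
        = c *\<^sub>R (g x v w *\<^sub>R u - g x u w *\<^sub>R v + g x (phi x v) w *\<^sub>R phi x u - g x (phi x u) w *\<^sub>R phi x v
            - (2 * g x (phi x u) v) *\<^sub>R phi x w)
          + g x (shape x v) w *\<^sub>R shape x u - g x (shape x u) w *\<^sub>R shape x v"
  proof (rule q.eqI)
    fix z
    \<comment> \<open>In the second derivative of a tangent field the normal component of the first
      one is differentiated too. Its tangential contribution, through \<open>weingarten\<close>, is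
      the quadratic term in the shape operator.\<close>
    have e: "\<gamma> (F x) (cov \<Gamma> F (\<lambda>y. cov \<Gamma> F (\<lambda>y. fd F y w) y v) x u) (fd F x z)
      = g x (cov (christoffel g) (\<lambda>x. x) (\<lambda>y. cov (christoffel g) (\<lambda>x. x) (\<lambda>x. w) y v) x u) z
        - g x (shape x v) w * g x (shape x u) z" for u v
    proof -
      have s: "smooth_on W (\<lambda>y. fd F y (christoffel g y v w))" "smooth_on W (\<lambda>y. g y (shape y v) w)"
        by (intro smooth_on_fd Wop Fs smooth_fields pull.smooth_metric smooth_on_const pull.smooth_christoffel_const)+
      have "cov \<Gamma> F (\<lambda>y. cov \<Gamma> F (\<lambda>y. fd F y w) y v) x u
         = cov \<Gamma> F (\<lambda>y. fd F y (christoffel g y v w) + g y (shape y v) w *\<^sub>R \<nu> y) x u"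
        by (rule cov_cong[OF Wop x]) (rule second_fundamental_form)
      also have "\<dots> = cov \<Gamma> F (\<lambda>y. fd F y (christoffel g y v w)) x u
          + (g x (shape x v) w *\<^sub>R cov \<Gamma> F \<nu> x u + fd (\<lambda>y. g y (shape y v) w) x u *\<^sub>R \<nu> x)"
        using cov_add[where F=F and x=x, OF FS[OF x] smooth_on_diff[OF s(1) x] smooth_on_diff[OF smooth_on_scaleR[OF Wop s(2) \<nu>_smooth] x]]
          cov_scale[where F=F and x=x, OF FS[OF x] smooth_on_diff[OF s(2) x] smooth_on_diff[OF \<nu>_smooth x]] by simp
      finally show ?thesis using N
        by (simp add: cov_tangent_field[OF x pull.smooth_christoffel_const] weingarten[OF x]
            p.ip_simps g_eq[OF x, symmetric]) (simp add: cov_def)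
    qed
    have k1: "g x (local_curvature g x u v w) z = g x (cov (christoffel g) (\<lambda>x. x) (\<lambda>y. cov (christoffel g) (\<lambda>x. x) (\<lambda>x. w) y v) x u) z
       - g x (cov (christoffel g) (\<lambda>x. x) (\<lambda>y. cov (christoffel g) (\<lambda>x. x) (\<lambda>x. w) y u) x v) z"
      using pull.cov_commutator[OF Wop smooth_on_id[OF Wop] _ smooth_on_const x, of w v u] by (simp add: q.diff_l[symmetric])
    have k2: "\<gamma> (F x) (local_curvature \<gamma> (F x) (fd F x u) (fd F x v) (fd F x w)) (fd F x z)
       = \<gamma> (F x) (cov \<Gamma> F (\<lambda>y. cov \<Gamma> F (\<lambda>y. fd F y w) y v) x u) (fd F x z)
       - \<gamma> (F x) (cov \<Gamma> F (\<lambda>y. cov \<Gamma> F (\<lambda>y. fd F y w) y u) x v) (fd F x z)"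
      using cov_commutator[OF Wop Fs FS smooth_on_fd_const[OF Fs] x, of w v u] by (simp add: p.diff_l[symmetric])
    have k3: "\<gamma> (F x) (local_curvature \<gamma> (F x) (fd F x u) (fd F x v) (fd F x w)) (fd F x z)
      = c * (g x v w * g x u z - g x u w * g x v z + g x (phi x v) w * g x (phi x u) z - g x (phi x u) w * g x (phi x v) z
            - (2 * g x (phi x u) v) * g x (phi x w) z)"
      unfolding space_form_curvature[OF FS[OF x]] R0_def
      by (simp add: p.ip_simps g_eq[OF x, symmetric] g_phi[OF x, symmetric])
    show "g x (local_curvature g x u v w) z
        = g x (c *\<^sub>R (g x v w *\<^sub>R u - g x u w *\<^sub>R v + g x (phi x v) w *\<^sub>R phi x u - g x (phi x u) w *\<^sub>R phi x v
            - (2 * g x (phi x u) v) *\<^sub>R phi x w)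
          + g x (shape x v) w *\<^sub>R shape x u - g x (shape x u) w *\<^sub>R shape x v) z"
      using k1 k2 k3 unfolding e by (simp add: q.ip_simps)
  qed
qed

end

section \<open>Pointwise consequences of the Codazzi equation\<close>

context ips begin

text \<open>Off \<open>Z\<close> the operator satisfies \<open>(A - l1) (A - l2) = 0\<close>. Hence
  \<open>(A - l2) / (l1 - l2)\<close> and \<open>(l1 - A) / (l1 - l2)\<close>, the maps that give
  \<open>w1\<close> and \<open>w2\<close>, are complementary projections onto the two
  eigenspaces.\<close>

lemma adapted_basis:
  assumes Z: "ON Z" "finite Z" and A: "linear A" "\<And>v w. g (A v) w = g v (A w)"
    and inv: "\<And>v z. (\<And>z. z \<in> Z \<Longrightarrow> g v z = 0) \<Longrightarrow> z \<in> Z \<Longrightarrow> g (A v) z = 0"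
    and pol: "\<And>v. (\<And>z. z \<in> Z \<Longrightarrow> g v z = 0) \<Longrightarrow> A (A v) = (l1 + l2) *\<^sub>R A v - (l1 * l2) *\<^sub>R v"
    and l: "l1 \<noteq> l2"
  obtains E1 E2 where "finite E1" "finite E2" "ON E1" "ON E2"
    "\<And>e. e \<in> E1 \<Longrightarrow> A e = l1 *\<^sub>R e" "\<And>e. e \<in> E2 \<Longrightarrow> A e = l2 *\<^sub>R e"
    "\<And>e z. e \<in> E1 \<union> E2 \<Longrightarrow> z \<in> Z \<Longrightarrow> g e z = 0"
    "\<And>v. v = (\<Sum>e\<in>Z. g v e *\<^sub>R e) + (\<Sum>e\<in>E1. g v e *\<^sub>R e) + (\<Sum>e\<in>E2. g v e *\<^sub>R e)"
proof -
  define D where "D = {v. \<forall>z\<in>Z. g v z = 0}"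
  have sub: "subspace {v \<in> D. A v = r *\<^sub>R v}" for r
    by (auto simp: subspace_def D_def ip_simps linear_0[OF A(1)] linear_add[OF A(1)] linear_scale[OF A(1)] scaleR_add_right)
  obtain E1 where E1: "E1 \<subseteq> {v \<in> D. A v = l1 *\<^sub>R v}" "ON E1" "finite E1"
    "\<And>v. v \<in> {v \<in> D. A v = l1 *\<^sub>R v} \<Longrightarrow> v = (\<Sum>e\<in>E1. g v e *\<^sub>R e)"
    using ON_basis_subspace[OF sub[of l1]] by blast
  obtain E2 where E2: "E2 \<subseteq> {v \<in> D. A v = l2 *\<^sub>R v}" "ON E2" "finite E2"
    "\<And>v. v \<in> {v \<in> D. A v = l2 *\<^sub>R v} \<Longrightarrow> v = (\<Sum>e\<in>E2. g v e *\<^sub>R e)"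
    using ON_basis_subspace[OF sub[of l2]] by blast
  have orth: "g v w = 0" if "A v = l1 *\<^sub>R v" "A w = l2 *\<^sub>R w" for v w
    using A(2)[of v w] that l by (simp add: ip_simps)
  have "v = (\<Sum>e\<in>Z. g v e *\<^sub>R e) + (\<Sum>e\<in>E1. g v e *\<^sub>R e) + (\<Sum>e\<in>E2. g v e *\<^sub>R e)" for v
  proof -
    define w where "w = v - (\<Sum>e\<in>Z. g v e *\<^sub>R e)"
    have wZ: "g w z = 0" if "z \<in> Z" for z
      using ON_coeff[OF Z that, of "g v"] by (simp add: w_def ip_simps)
    define w1 where "w1 = (1 / (l1 - l2)) *\<^sub>R (A w - l2 *\<^sub>R w)"
    define w2 where "w2 = (1 / (l1 - l2)) *\<^sub>R (l1 *\<^sub>R w - A w)"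
    have wD: "w1 \<in> D" "w2 \<in> D" using wZ inv[OF wZ] by (auto simp: D_def w1_def w2_def ip_simps)
    have pw: "A (A w) = (l1 + l2) *\<^sub>R A w - (l1 * l2) *\<^sub>R w" by (rule pol) (rule wZ)
    note AL = linear_diff[OF A(1)] linear_scale[OF A(1)] pw
    have e1: "A w1 = l1 *\<^sub>R w1" unfolding w1_def AL by (simp add: algebra_simps)
    have e2: "A w2 = l2 *\<^sub>R w2" unfolding w2_def AL by (simp add: algebra_simps)
    have "w1 + w2 = (1 / (l1 - l2)) *\<^sub>R ((l1 - l2) *\<^sub>R w)"
      unfolding w1_def w2_def scaleR_add_right[symmetric] by (simp add: algebra_simps)
    then have w: "w = w1 + w2" using l by simp
    have Zo: "g (\<Sum>e\<in>Z. g v e *\<^sub>R e) e = 0" if "e \<in> D" for e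
      unfolding sum_l scale_l
    proof (intro sum.neutral ballI)
      fix z assume "z \<in> Z"
      then show "g v z * g z e = 0" using that sym[of z e] by (simp add: D_def)
    qed
    have v: "v = (\<Sum>e\<in>Z. g v e *\<^sub>R e) + (w1 + w2)" using w by (simp add: w_def algebra_simps)
    have c1: "g v e = g w1 e" if "e \<in> E1" for e
      using that E1(1) orth[of e w2] e2 Zo[of e] sym[of w2 e] by (subst v) (auto simp: ip_simps)
    have c2: "g v e = g w2 e" if "e \<in> E2" for e
      using that E2(1) orth[of w1 e] e1 Zo[of e] by (subst v) (auto simp: ip_simps)
    have "w1 = (\<Sum>e\<in>E1. g v e *\<^sub>R e)" using E1(4)[of w1] wD e1 c1 by (simp cong: sum.cong)
    moreover have "w2 = (\<Sum>e\<in>E2. g v e *\<^sub>R e)" using E2(4)[of w2] wD e2 c2 by (simp cong: sum.cong)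
    ultimately show ?thesis using v by (simp add: add.assoc)
  qed
  then show ?thesis using that[of E1 E2] E1 E2 unfolding D_def by blast
qed

end

text \<open>Linear algebra of one tangent space. By the Gauss equation the Ricci tensor is
  \<open>a g\<close> on \<open>H\<close> exactly when \<open>ricci_H\<close> holds with
  \<open>k = a - (2 n + 1) c\<close>.\<close>

locale pointwise = ips g for g :: "'a::euclidean_space \<Rightarrow> 'a \<Rightarrow> real" +
  fixes A \<phi> :: "'a \<Rightarrow> 'a" and \<xi> :: 'a and k h :: real
  assumes A_linear: "linear A" and A_sym: "g (A v) w = g v (A w)"
    and \<phi>_linear: "linear \<phi>" and \<phi>_skew: "g (\<phi> v) w = - g v (\<phi> w)"
    and \<phi>_\<phi>: "\<phi> (\<phi> v) = - v + g v \<xi> *\<^sub>R \<xi>" and \<xi>_unit: "g \<xi> \<xi> = 1"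
    and h_eq: "h = trace_lin A"
    and ricci_H: "\<And>Y Z. g Y \<xi> = 0 \<Longrightarrow> g Z \<xi> = 0 \<Longrightarrow> h * g (A Y) Z - g (A Y) (A Z) = k * g Y Z"
begin

lemmas A_simps = linear_add[OF A_linear] linear_diff[OF A_linear] linear_scale[OF A_linear]
  linear_neg[OF A_linear] linear_0[OF A_linear]
lemmas \<phi>_simps = linear_add[OF \<phi>_linear] linear_diff[OF \<phi>_linear] linear_scale[OF \<phi>_linear]
  linear_neg[OF \<phi>_linear] linear_0[OF \<phi>_linear]

lemma \<phi>_\<xi>: "\<phi> \<xi> = 0"
proof -
  have "\<phi> (\<phi> \<xi>) = 0" by (simp add: \<phi>_\<phi> \<xi>_unit)
  then have "g (\<phi> \<xi>) (\<phi> \<xi>) = 0" by (simp add: \<phi>_skew zero_r)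
  then show ?thesis by (simp add: eq_0_iff)
qed

lemma \<phi>_H: "g (\<phi> v) \<xi> = 0" "g \<xi> (\<phi> v) = 0"
  using \<phi>_skew[of v \<xi>] \<phi>_\<xi> sym[of \<xi>] by (simp_all add: zero_r)

lemma g_\<phi>_\<phi>: "g (\<phi> v) (\<phi> w) = g v w - g v \<xi> * g w \<xi>"
  using sym[of \<xi> w] sym[of v \<xi>] by (simp add: \<phi>_skew \<phi>_\<phi> ip_simps)

lemma g_\<phi>_self: "g (\<phi> v) v = 0"
  using \<phi>_skew[of v v] sym[of v "\<phi> v"] by simp

end

section \<open>Points where \<open>\<xi>\<close> is not principal\<close>

locale nonhopf = pointwise g A \<phi> \<xi> k h for g :: "'a::euclidean_space \<Rightarrow> 'a \<Rightarrow> real" and A \<phi> \<xi> k h +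
  fixes U :: 'a and \<alpha> \<beta> \<gamma> l1 l2 :: real and E1 E2 :: "'a set"
  assumes A_\<xi>: "A \<xi> = \<alpha> *\<^sub>R \<xi> + \<beta> *\<^sub>R U" and A_U: "A U = \<gamma> *\<^sub>R U + \<beta> *\<^sub>R \<xi>"
    and U_unit: "g U U = 1" and U_\<xi>: "g U \<xi> = 0" and \<beta>0: "\<beta> \<noteq> 0"
    and roots: "l1 + l2 = h" "l1 * l2 = k" "\<beta>\<^sup>2 = (l1 - \<gamma>) * (\<gamma> - l2)"
    and fin: "finite E1" "finite E2" and onE: "ON E1" "ON E2"
    and eig: "\<And>e. e \<in> E1 \<Longrightarrow> A e = l1 *\<^sub>R e" "\<And>e. e \<in> E2 \<Longrightarrow> A e = l2 *\<^sub>R e"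
    and orth\<xi>: "\<And>e. e \<in> E1 \<union> E2 \<Longrightarrow> g e \<xi> = 0" and orthU: "\<And>e. e \<in> E1 \<union> E2 \<Longrightarrow> g e U = 0"
    and expand: "\<And>v. v = g v \<xi> *\<^sub>R \<xi> + g v U *\<^sub>R U + (\<Sum>e\<in>E1. g v e *\<^sub>R e) + (\<Sum>e\<in>E2. g v e *\<^sub>R e)"
begin

definition ev :: "real \<Rightarrow> 'a \<Rightarrow> bool" where
  "ev l X \<longleftrightarrow> g X \<xi> = 0 \<and> g X U = 0 \<and> A X = l *\<^sub>R X"

text \<open>Trace of \<open>A\<close> on the complement of \<open>\<xi>\<close> and
  \<open>U\<close>, as \<open>\<tau>_eq\<close> shows. Written through \<open>h\<close>,
  \<open>\<alpha>\<close> and \<open>\<gamma>\<close> it does not refer to the eigenspaces and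
  extends to a smooth function.\<close>

definition \<tau> :: real where "\<tau> = h - \<alpha> - \<gamma>"

text \<open>The situation is symmetric in the two eigenvalues; statements are proved for
  \<open>l1\<close> and transported to \<open>l2\<close> by this.\<close>

lemma swap: "nonhopf g A \<phi> \<xi> k h U \<alpha> \<beta> \<gamma> l2 l1 E2 E1"
proof
  show "v = g v \<xi> *\<^sub>R \<xi> + g v U *\<^sub>R U + (\<Sum>e\<in>E2. g v e *\<^sub>R e) + (\<Sum>e\<in>E1. g v e *\<^sub>R e)" for v
    by (rule trans[OF expand[of v]]) simp
  show "l2 + l1 = h" "l2 * l1 = k" using roots by (simp_all add: mult.commute)
  show "\<beta>\<^sup>2 = (l2 - \<gamma>) * (\<gamma> - l1)" unfolding roots(3) by (simp add: algebra_simps)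
qed (auto simp: A_\<xi> A_U U_unit U_\<xi> \<beta>0 fin onE eig orth\<xi> orthU)

text \<open>\<open>\<beta>\<^sup>2 > 0\<close> places \<open>\<gamma>\<close> strictly between the
  two roots.\<close>

lemma l1_l2: "l1 \<noteq> l2" "l1 \<noteq> \<gamma>" "l2 \<noteq> \<gamma>"
proof -
  have "\<beta>\<^sup>2 > 0" using \<beta>0 by simp
  then have *: "(l1 - \<gamma>) * (\<gamma> - l2) > 0" using roots by simp
  then show "l1 \<noteq> \<gamma>" "l2 \<noteq> \<gamma>" by auto
  show "l1 \<noteq> l2"
  proof
    assume "l1 = l2"
    then have "(l1 - \<gamma>) * (\<gamma> - l2) = - (l1 - \<gamma>)\<^sup>2" by (simp add: power2_eq_square algebra_simps)
    then show False using * by (simp add: not_less)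
  qed
qed

lemma ev_E: "e \<in> E1 \<Longrightarrow> ev l1 e" "e \<in> E2 \<Longrightarrow> ev l2 e"
  by (auto simp: ev_def orth\<xi> orthU eig)

lemma ev_sym: "ev l X \<Longrightarrow> g \<xi> X = 0" "ev l X \<Longrightarrow> g U X = 0"
  using sym by (auto simp: ev_def)

lemma U_\<xi>': "g \<xi> U = 0" using sym U_\<xi> by simp

lemma ev_orth: "ev l1 X \<Longrightarrow> ev l2 Y \<Longrightarrow> g X Y = 0"
  using A_sym[of X Y] l1_l2 by (simp add: ev_def ip_simps)

lemma E_orth: "e \<in> E1 \<Longrightarrow> e' \<in> E2 \<Longrightarrow> g e e' = 0 \<and> g e' e = 0"
  using ev_orth[of e e'] ev_E sym by auto

lemma parseval: "g v w = g v \<xi> * g w \<xi> + g v U * g w U + (\<Sum>e\<in>E1. g v e * g w e) + (\<Sum>e\<in>E2. g v e * g w e)"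
proof -
  have "g v w = g (g v \<xi> *\<^sub>R \<xi> + g v U *\<^sub>R U + (\<Sum>e\<in>E1. g v e *\<^sub>R e) + (\<Sum>e\<in>E2. g v e *\<^sub>R e)) w"
    using expand[of v] by metis
  then show ?thesis unfolding add_l scale_l sum_l by (simp add: sym[of w])
qed

lemma eqI_basis:
  assumes "g v \<xi> = g w \<xi>" "g v U = g w U" "\<And>e. ev l1 e \<Longrightarrow> g v e = g w e" "\<And>e. ev l2 e \<Longrightarrow> g v e = g w e"
  shows "v = w"
proof (rule eqI)
  show "g v u = g w u" for u
    unfolding parseval[of v u] parseval[of w u] by (simp add: assms ev_E cong: sum.cong)
qed

lemma trace_eq:
  assumes L: "linear L"
  shows "trace_lin L = g (L \<xi>) \<xi> + g (L U) U + (\<Sum>e\<in>E1. g (L e) e) + (\<Sum>e\<in>E2. g (L e) e)"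
proof -
  have ne: "\<xi> \<noteq> U" using \<xi>_unit U_\<xi>' by auto
  have nE: "\<xi> \<notin> E1 \<union> E2" "U \<notin> E1 \<union> E2" using orth\<xi>[of \<xi>] orthU[of U] \<xi>_unit U_unit by auto
  have dis: "E1 \<inter> E2 = {}"
  proof -
    have "e \<notin> E2" if "e \<in> E1" for e using E_orth[of e e] that onE(1) unfolding ON_def by force
    then show ?thesis by blast
  qed
  define B where "B = insert \<xi> (insert U (E1 \<union> E2))"
  have sm: "sum f B = f \<xi> + f U + sum f E1 + sum f E2" for f :: "'a \<Rightarrow> 'b::comm_monoid_add"
    using ne nE fin dis by (simp add: B_def sum.union_disjoint add.assoc)
  have "finite B" using fin by (simp add: B_def)
  then show ?thesis using trace_ON[OF L, of B] expand unfolding sm by blast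
qed

lemma card_eq: "card E1 + card E2 + 2 = DIM('a)"
proof -
  have "real (DIM('a)) = 1 + 1 + real (card E1) + real (card E2)"
    unfolding trace_id[symmetric, where 'a='a] trace_eq[OF linear_ident]
    using onE by (simp add: ON_def U_unit \<xi>_unit)
  then show ?thesis by linarith
qed

lemma \<tau>_eq: "\<tau> = real (card E1) * l1 + real (card E2) * l2"
proof -
  have "h = \<alpha> + \<gamma> + real (card E1) * l1 + real (card E2) * l2"
    unfolding h_eq trace_eq[OF A_linear]
    using onE by (simp add: ON_def A_\<xi> A_U ip_simps U_unit \<xi>_unit U_\<xi> U_\<xi>' eig)
  then show ?thesis unfolding \<tau>_def by linarith
qed

definition P :: 'a where "P = \<phi> U"

lemma \<phi>_P: "\<phi> P = - U" by (simp add: P_def \<phi>_\<phi> U_\<xi>)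

lemma P_H: "g P \<xi> = 0" "g \<xi> P = 0" "g P U = 0" "g U P = 0" "g P P = 1"
  using g_\<phi>_self[of U] sym[of U P] by (simp_all add: P_def \<phi>_H g_\<phi>_\<phi> U_unit U_\<xi>)

lemma ev_P: assumes "\<And>e. e \<in> E2 \<Longrightarrow> g P e = 0" shows "ev l1 P"
proof -
  have "P = (\<Sum>e\<in>E1. g P e *\<^sub>R e)" using expand[of P] assms by (simp add: P_H)
  moreover have "A (\<Sum>e\<in>E1. g P e *\<^sub>R e) = l1 *\<^sub>R (\<Sum>e\<in>E1. g P e *\<^sub>R e)"
    by (simp add: linear_sum[OF A_linear] A_simps eig scaleR_sum_right mult.commute)
  ultimately have "A P = l1 *\<^sub>R P" by simp
  then show ?thesis by (simp add: ev_def P_H)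
qed

text \<open>Here \<open>\<phi>\<close> sends each eigenspace into the span of \<open>U\<close> and
  the other one. With \<open>s\<close> the squared norm of the block of \<open>\<phi>\<close>
  between them, and \<open>p1\<close>, \<open>p2\<close> those of the projections of
  \<open>P\<close>, the dimensions are \<open>p1 + s\<close> and \<open>p2 + s\<close>, where
  \<open>p1 + p2 = 1\<close>. They cannot be equal, so they differ by 1 and one of
  \<open>p1\<close>, \<open>p2\<close> is 0.\<close>

lemma totally_real_count:
  assumes t1: "\<And>X Y. X \<in> E1 \<Longrightarrow> Y \<in> E1 \<Longrightarrow> g (\<phi> X) Y = 0"
    and t2: "\<And>X Y. X \<in> E2 \<Longrightarrow> Y \<in> E2 \<Longrightarrow> g (\<phi> X) Y = 0"
    and odd: "odd (DIM('a))"
  shows "(card E1 = card E2 + 1 \<and> ev l1 P) \<or> (card E2 = card E1 + 1 \<and> ev l2 P)"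
proof -
  have gP: "g (\<phi> X) U = - g P X" for X using \<phi>_skew[of X U] sym[of X P] by (simp add: P_def)
  define p1 where "p1 = (\<Sum>e\<in>E1. g P e * g P e)"
  define p2 where "p2 = (\<Sum>e\<in>E2. g P e * g P e)"
  define s where "s = (\<Sum>X\<in>E1. \<Sum>Y\<in>E2. g (\<phi> X) Y * g (\<phi> X) Y)"
  have p: "p1 + p2 = 1" using parseval[of P P] by (simp add: P_H p1_def p2_def)
  have n1: "1 = g P X * g P X + (\<Sum>Y\<in>E2. g (\<phi> X) Y * g (\<phi> X) Y)" if "X \<in> E1" for X
    using parseval[of "\<phi> X" "\<phi> X"] that t1 onE(1) by (simp add: g_\<phi>_\<phi> orth\<xi> \<phi>_H gP ON_def)
  have n2: "1 = g P Y * g P Y + (\<Sum>X\<in>E1. g (\<phi> X) Y * g (\<phi> X) Y)" if "Y \<in> E2" for Y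
  proof -
    have "(\<Sum>X\<in>E1. g (\<phi> Y) X * g (\<phi> Y) X) = (\<Sum>X\<in>E1. g (\<phi> X) Y * g (\<phi> X) Y)"
    proof (rule sum.cong[OF refl])
      show "g (\<phi> Y) X * g (\<phi> Y) X = g (\<phi> X) Y * g (\<phi> X) Y" for X
        using \<phi>_skew[of Y X] sym[of Y "\<phi> X"] by simp
    qed
    then show ?thesis using parseval[of "\<phi> Y" "\<phi> Y"] that t2 onE(2)
      by (simp add: g_\<phi>_\<phi> orth\<xi> \<phi>_H gP ON_def)
  qed
  have "real (card E1) = (\<Sum>X\<in>E1. g P X * g P X + (\<Sum>Y\<in>E2. g (\<phi> X) Y * g (\<phi> X) Y))"
    using sum.cong[OF refl n1, of E1] by simp
  then have m1: "real (card E1) = p1 + s" by (simp add: sum.distrib p1_def s_def)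
  have "real (card E2) = (\<Sum>Y\<in>E2. g P Y * g P Y + (\<Sum>X\<in>E1. g (\<phi> X) Y * g (\<phi> X) Y))"
    using sum.cong[OF refl n2, of E2] by simp
  then have m2: "real (card E2) = p2 + s" unfolding s_def by (subst sum.swap) (simp add: sum.distrib p2_def)
  have pp: "p1 \<ge> 0" "p2 \<ge> 0" by (auto simp: p1_def p2_def intro!: sum_nonneg)
  \<comment> \<open>The sum of both cardinalities is \<open>DIM('a) - 2\<close>, an odd
    number.\<close>
  have "card E1 \<noteq> card E2" using card_eq odd by presburger
  moreover have "real (card E1) \<le> real (card E2) + 1" "real (card E2) \<le> real (card E1) + 1" using m1 m2 p pp by linarith+
  ultimately consider "card E1 = card E2 + 1" | "card E2 = card E1 + 1" by linarith
  then show ?thesis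
  proof cases
    case 1
    then have "p2 = 0" using m1 m2 p by simp
    then have "g P e = 0" if "e \<in> E2" for e using that fin by (auto simp: p2_def sum_nonneg_eq_0_iff)
    then show ?thesis using ev_P 1 by blast
  next
    case 2
    then have "p1 = 0" using m1 m2 p by simp
    then have "g P e = 0" if "e \<in> E1" for e using that fin by (auto simp: p1_def sum_nonneg_eq_0_iff)
    then have "ev l2 P" by (rule nonhopf.ev_P[OF swap])
    then show ?thesis using 2 by blast
  qed
qed

end

context pointwise begin

text \<open>The compression of \<open>A\<close> to \<open>H\<close> has \<open>U\<close> as an
  eigenvector. Hence \<open>\<xi>\<close> and \<open>U\<close> span an invariant plane, and on its
  complement \<open>A\<close> satisfies the quadratic equation with roots \<open>l1\<close> and
  \<open>l2\<close>.\<close>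

lemma nonhopf_exists:
  assumes "A \<xi> \<noteq> g (A \<xi>) \<xi> *\<^sub>R \<xi>"
  obtains U \<alpha> \<beta> \<gamma> l1 l2 E1 E2 where "nonhopf g A \<phi> \<xi> k h U \<alpha> \<beta> \<gamma> l1 l2 E1 E2"
proof -
  define \<alpha> where "\<alpha> = g (A \<xi>) \<xi>"
  define V where "V = A \<xi> - \<alpha> *\<^sub>R \<xi>"
  define \<beta> where "\<beta> = sqrt (g V V)"
  define U where "U = (1 / \<beta>) *\<^sub>R V"
  have "V \<noteq> 0" using assms by (simp add: V_def \<alpha>_def)
  then have b: "\<beta> > 0" "g V V = \<beta> * \<beta>" using pos[of V] by (auto simp: \<beta>_def)
  have V: "V = \<beta> *\<^sub>R U" using b by (simp add: U_def)
  have Ax: "A \<xi> = \<alpha> *\<^sub>R \<xi> + \<beta> *\<^sub>R U" using V by (simp add: V_def algebra_simps)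
  have UU: "g U U = 1" using b by (simp add: U_def ip_simps)
  have Ux: "g U \<xi> = 0" "g \<xi> U = 0" using sym[of \<xi> U] by (simp_all add: U_def V_def ip_simps \<xi>_unit \<alpha>_def)
  \<comment> \<open>On \<open>H\<close> this is \<open>A\<close> followed by the projection along
    \<open>\<xi>\<close>. Its square differs from the compression of \<open>A\<^sup>2\<close> by
    \<open>\<beta>\<^sup>2\<close> times the projection to \<open>U\<close>.\<close>
  define B where "B X = A X - (\<beta> * g X U) *\<^sub>R \<xi>" for X
  have BH: "g (B X) \<xi> = 0" if "g X \<xi> = 0" for X
    using that A_sym[of X \<xi>] by (simp add: B_def ip_simps \<xi>_unit Ax)
  have gB: "g (B X) Y = g (A X) Y" if "g Y \<xi> = 0" for X Y
    using that sym[of \<xi> Y] by (simp add: B_def ip_simps)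
  have B2: "B (B X) = h *\<^sub>R B X - k *\<^sub>R X - (\<beta>\<^sup>2 * g X U) *\<^sub>R U" if X: "g X \<xi> = 0" for X
  proof (rule eqI)
    fix Y0
    define Y where "Y = Y0 - g Y0 \<xi> *\<^sub>R \<xi>"
    have Y: "g Y \<xi> = 0" by (simp add: Y_def ip_simps \<xi>_unit)
    have z: "g Z Y0 = g Z Y" if "g Z \<xi> = 0" for Z using that by (simp add: Y_def ip_simps)
    have "g (B (B X)) Y = g (A (B X)) Y" by (rule gB[OF Y])
    also have "\<dots> = g (B X) (A Y)" by (rule A_sym)
    also have "\<dots> = g (A X) (A Y) - \<beta>\<^sup>2 * g X U * g U Y"
    proof -
      have "g \<xi> (A Y) = \<beta> * g U Y" using A_sym[of \<xi> Y] Y sym[of \<xi> Y] by (simp add: Ax ip_simps)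
      then show ?thesis by (simp add: B_def ip_simps power2_eq_square)
    qed
    also have "\<dots> = h * g (B X) Y - k * g X Y - \<beta>\<^sup>2 * g X U * g U Y"
      using ricci_H[OF X Y] gB[OF Y, of X] by simp
    finally have "g (B (B X)) Y = g (h *\<^sub>R B X - k *\<^sub>R X - (\<beta>\<^sup>2 * g X U) *\<^sub>R U) Y" by (simp add: ip_simps)
    then show "g (B (B X)) Y0 = g (h *\<^sub>R B X - k *\<^sub>R X - (\<beta>\<^sup>2 * g X U) *\<^sub>R U) Y0"
      using z[of "B (B X)"] z[of "h *\<^sub>R B X - k *\<^sub>R X - (\<beta>\<^sup>2 * g X U) *\<^sub>R U"] BH[OF X] BH[OF BH[OF X]] X Ux
      by (simp add: ip_simps)
  qed
  have Bl: "B (X + Y) = B X + B Y" "B (X - Y) = B X - B Y" "B (r *\<^sub>R X) = r *\<^sub>R B X" for X Y r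
    by (simp_all add: B_def A_simps ip_simps algebra_simps)
  define \<gamma> where "\<gamma> = g (A U) U"
  \<comment> \<open>\<open>B\<close> commutes with \<open>B\<^sup>2\<close>, hence with the rank one
    term of \<open>B2\<close>. Computing the cube of \<open>B\<close> on \<open>U\<close> in both
    orders therefore makes \<open>U\<close> an eigenvector of \<open>B\<close>.\<close>
  have "B (B (B U)) = h *\<^sub>R B (B U) - k *\<^sub>R B U - (\<beta>\<^sup>2 * g (B U) U) *\<^sub>R U" by (rule B2[OF BH[OF Ux(1)]])
  moreover have "B (B (B U)) = h *\<^sub>R B (B U) - k *\<^sub>R B U - \<beta>\<^sup>2 *\<^sub>R B U"
  proof -
    have "B (B (B U)) = B (h *\<^sub>R B U - k *\<^sub>R U - \<beta>\<^sup>2 *\<^sub>R U)" using B2[OF Ux(1)] by (simp add: UU)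
    then show ?thesis by (simp only: Bl)
  qed
  ultimately have "\<beta>\<^sup>2 *\<^sub>R B U = \<beta>\<^sup>2 *\<^sub>R (g (B U) U *\<^sub>R U)" by simp
  then have BU: "B U = \<gamma> *\<^sub>R U" using b gB[OF Ux(1), of U] unfolding scaleR_cancel_left by (simp add: \<gamma>_def)
  have AU: "A U = \<gamma> *\<^sub>R U + \<beta> *\<^sub>R \<xi>" using BU by (simp add: B_def UU algebra_simps)
  have "g (B (B U)) U = g (h *\<^sub>R B U - k *\<^sub>R U - (\<beta>\<^sup>2 * g U U) *\<^sub>R U) U" by (simp add: B2[OF Ux(1)])
  then have b2: "\<beta>\<^sup>2 = h * \<gamma> - k - \<gamma>\<^sup>2" by (simp add: BU Bl ip_simps UU power2_eq_square)
  \<comment> \<open>The discriminant equals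
    \<open>(h - 2 * \<gamma>)\<^sup>2 + 4 * \<beta>\<^sup>2\<close> and is positive, so the roots
    are real and distinct.\<close>
  define d where "d = sqrt (h\<^sup>2 - 4 * k)"
  have "h\<^sup>2 - 4 * k = (h - 2 * \<gamma>)\<^sup>2 + 4 * \<beta>\<^sup>2" unfolding b2 by (simp add: power2_eq_square algebra_simps)
  then have dd: "d > 0" "d\<^sup>2 = h\<^sup>2 - 4 * k" using b by (simp_all add: d_def add_nonneg_pos)
  define l1 where "l1 = (h + d) / 2"
  define l2 where "l2 = (h - d) / 2"
  have r: "l1 + l2 = h" "l1 * l2 = k" "l1 \<noteq> l2"
    using dd by (auto simp: l1_def l2_def field_simps power2_eq_square)
  have r3: "\<beta>\<^sup>2 = (l1 - \<gamma>) * (\<gamma> - l2)" unfolding b2 r(1,2)[symmetric] by (simp add: power2_eq_square algebra_simps)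
  have ne: "\<xi> \<noteq> U" using \<xi>_unit Ux by auto
  obtain E1 E2 where E: "finite E1" "finite E2" "ON E1" "ON E2"
    "\<And>e. e \<in> E1 \<Longrightarrow> A e = l1 *\<^sub>R e" "\<And>e. e \<in> E2 \<Longrightarrow> A e = l2 *\<^sub>R e"
    "\<And>e z. e \<in> E1 \<union> E2 \<Longrightarrow> z \<in> {\<xi>, U} \<Longrightarrow> g e z = 0"
    "\<And>v. v = (\<Sum>e\<in>{\<xi>, U}. g v e *\<^sub>R e) + (\<Sum>e\<in>E1. g v e *\<^sub>R e) + (\<Sum>e\<in>E2. g v e *\<^sub>R e)"
  proof (rule adapted_basis[of "{\<xi>, U}" A l1 l2])
    show "ON {\<xi>, U}" using ne by (auto simp: ON_def \<xi>_unit UU Ux)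
    show "linear A" "g (A v) w = g v (A w)" for v w by (rule A_linear A_sym)+
    show "l1 \<noteq> l2" by (rule r)
    show "g (A v) z = 0" if v: "\<And>z. z \<in> {\<xi>, U} \<Longrightarrow> g v z = 0" and z: "z \<in> {\<xi>, U}" for v z
      using v z by (auto simp: A_sym Ax AU ip_simps)
    show "A (A v) = (l1 + l2) *\<^sub>R A v - (l1 * l2) *\<^sub>R v" if v: "\<And>z. z \<in> {\<xi>, U} \<Longrightarrow> g v z = 0" for v
    proof -
      have v': "g v \<xi> = 0" "g v U = 0" using v by auto
      have "B v = A v" using v' by (simp add: B_def)
      moreover have "g (A v) U = 0" using v' by (simp add: A_sym AU ip_simps)
      ultimately have "B (B v) = A (A v)" by (simp add: B_def[of "A v"])
      then show ?thesis using B2[OF v'(1)] v' \<open>B v = A v\<close> r by simp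
    qed
  qed auto
  have "nonhopf g A \<phi> \<xi> k h U \<alpha> \<beta> \<gamma> l1 l2 E1 E2"
  proof
    show "v = g v \<xi> *\<^sub>R \<xi> + g v U *\<^sub>R U + (\<Sum>e\<in>E1. g v e *\<^sub>R e) + (\<Sum>e\<in>E2. g v e *\<^sub>R e)" for v
      using E(8)[of v] ne by simp
  qed (use Ax AU UU Ux b r r3 E in auto)
  then show ?thesis using that by blast
qed

end

text \<open>At a point of the hypersurface, \<open>N X Y\<close> is \<open>(\<nabla>\<^sub>X A) Y\<close>, and \<open>dh\<close> is the differential of the mean
  curvature \<open>h\<close>. The last assumption is the derivative of \<open>h A - A\<^sup>2 = k\<close> on \<open>\<xi>\<^sup>\<bottom>\<close>.\<close>

locale jet = pointwise g A \<phi> \<xi> k h for g :: "'a::euclidean_space \<Rightarrow> 'a \<Rightarrow> real" and A \<phi> \<xi> k h +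
  fixes N :: "'a \<Rightarrow> 'a \<Rightarrow> 'a" and c :: real and dh :: "'a \<Rightarrow> real"
  assumes N_linear: "linear (N X)" "linear (\<lambda>X. N X Y)" and N_sym: "g (N X Y) Z = g Y (N X Z)"
    and codazzi: "N X Y - N Y X = c *\<^sub>R (g X \<xi> *\<^sub>R \<phi> Y - g Y \<xi> *\<^sub>R \<phi> X - (2 * g (\<phi> X) Y) *\<^sub>R \<xi>)"
    and dh_eq: "dh X = trace_lin (N X)"
    and ricci_H_deriv: "\<And>X Y Z. g Y \<xi> = 0 \<Longrightarrow> g Z \<xi> = 0 \<Longrightarrow>
      dh X * g (A Y) Z + h * g (N X Y) Z - g (N X Y) (A Z) - g (N X Z) (A Y)
      = (h * g (A \<xi>) Y - g (A \<xi>) (A Y)) * g (\<phi> (A X)) Z + (h * g (A \<xi>) Z - g (A \<xi>) (A Z)) * g (\<phi> (A X)) Y"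
begin

lemma C_sym: "g (N X Y) Z = g (N X Z) Y" using N_sym sym by metis

lemma cod: "g (N X Y) Z - g (N Y X) Z = c * (g X \<xi> * g (\<phi> Y) Z - g Y \<xi> * g (\<phi> X) Z - 2 * g (\<phi> X) Y * g \<xi> Z)"
  using arg_cong[OF codazzi[of X Y], of "\<lambda>v. g v Z"] by (simp add: ip_simps)

lemmas N_simps = linear_add[OF N_linear(1)] linear_scale[OF N_linear(1)] linear_add[OF N_linear(2)] linear_scale[OF N_linear(2)]
  linear_neg[OF N_linear(1)] linear_neg[OF N_linear(2)]

text \<open>The covariant derivative of the field \<open>\<phi> A \<xi>\<close>.\<close>

definition E :: "'a \<Rightarrow> 'a" where
  "E Y = g (A \<xi>) \<xi> *\<^sub>R A Y - g (A Y) (A \<xi>) *\<^sub>R \<xi> + \<phi> (N Y \<xi>) + \<phi> (A (\<phi> (A Y)))"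

lemma E_scale: "E (r *\<^sub>R Y) = r *\<^sub>R E Y"
  unfolding E_def
  by (simp only: A_simps N_simps \<phi>_simps scale_l scaleR_add_right scaleR_diff_right scaleR_scaleR mult.commute)

end

section \<open>The first jet of the shape operator at a point where \<open>\<xi>\<close> is not
  principal\<close>

locale nonhopf_jet = nonhopf g A \<phi> \<xi> k h U \<alpha> \<beta> \<gamma> l1 l2 E1 E2 + jet g A \<phi> \<xi> k h N c dh
  for g :: "'a::euclidean_space \<Rightarrow> 'a \<Rightarrow> real" and A \<phi> \<xi> k h U \<alpha> \<beta> \<gamma> l1 l2 E1 E2 N c dh
begin

lemma swap_jet: "nonhopf_jet g A \<phi> \<xi> k h U \<alpha> \<beta> \<gamma> l2 l1 E2 E1 N c dh"
  using swap jet_axioms by (rule nonhopf_jet.intro)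

lemma \<phi>_A_\<xi>: "\<phi> (A \<xi>) = \<beta> *\<^sub>R P" by (simp add: A_\<xi> \<phi>_simps \<phi>_\<xi> P_def)

lemma \<phi>_A_U: "\<phi> (A U) = \<gamma> *\<^sub>R P" by (simp add: A_U \<phi>_simps \<phi>_\<xi> P_def)

lemma \<phi>_A_ev: "ev l X \<Longrightarrow> \<phi> (A X) = l *\<^sub>R \<phi> X" by (simp add: ev_def \<phi>_simps)

lemma g_\<phi>_U: "g (\<phi> X) U = - g X P" using \<phi>_skew[of X U] by (simp add: P_def)

text \<open>The left hand side is the mixed Ricci component \<open>S(\<xi>, U)\<close>, which is the
  source term in \<open>ricci_H_deriv\<close>. Together with \<open>w_ev\<close> this shows that
  \<open>S(\<xi>, Y)\<close> is \<open>\<tau> * \<beta> * g U Y\<close> on \<open>H\<close>.\<close>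

lemma w_U: "h * g (A \<xi>) U - g (A \<xi>) (A U) = \<tau> * \<beta>"
  by (simp add: A_\<xi> A_U ip_simps U_unit \<xi>_unit U_\<xi> U_\<xi>' \<tau>_def algebra_simps)

lemma w_ev: "ev l Y \<Longrightarrow> h * g (A \<xi>) Y - g (A \<xi>) (A Y) = 0"
  using ev_sym[of l Y] by (simp add: A_\<xi> ip_simps) (simp add: ev_def ip_simps)

text \<open>The differentiated condition is evaluated on the pairs \<open>(Y, U)\<close>,
  \<open>(U, U)\<close> and \<open>(Y, Z)\<close> in \<open>R1\<close>, \<open>R2\<close> and
  \<open>R3\<close>, with \<open>Y\<close> and \<open>Z\<close> eigenvectors.\<close>

lemma R1: "ev l Y \<Longrightarrow> (h - \<gamma> - l) * g (N X Y) U - \<beta> * g (N X Y) \<xi> = \<tau> * \<beta> * g (\<phi> (A X)) Y"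
  using ricci_H_deriv[of Y U X, unfolded w_U] C_sym[of X U Y]
  by (simp add: w_ev) (simp add: ev_def U_\<xi> A_U ip_simps algebra_simps)

lemma R2: "dh X * \<gamma> + (h - 2 * \<gamma>) * g (N X U) U - 2 * \<beta> * g (N X U) \<xi> = 2 * \<tau> * \<beta> * g (\<phi> (A X)) U"
  using ricci_H_deriv[of U U X, unfolded w_U]
  by (simp add: U_\<xi> U_\<xi>' U_unit A_U ip_simps algebra_simps)

lemma R3: "ev l Y \<Longrightarrow> ev l' Z \<Longrightarrow> dh X * l * g Y Z + (h - l - l') * g (N X Y) Z = 0"
  using ricci_H_deriv[of Y Z X] C_sym[of X Z Y]
  by (simp add: w_ev) (simp add: ev_def ip_simps algebra_simps)

text \<open>\<open>R1\<close> for \<open>(X, Y)\<close> and for \<open>(Y, X)\<close> has right hand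
  sides of opposite sign, while by Codazzi the left hand sides differ only by a multiple of
  \<open>c\<close>. Subtraction gives \<open>(c - \<tau> l) g(\<phi> X, Y) = 0\<close>.\<close>

lemma not_totally_real:
  assumes "ev l X" "ev l Y" "g (\<phi> X) Y \<noteq> 0"
  shows "c = \<tau> * l"
proof -
  have e: "g (N Y X) U = g (N X Y) U" "g (N Y X) \<xi> = g (N X Y) \<xi> + 2 * c * g (\<phi> X) Y"
    using cod[of X Y U] cod[of X Y \<xi>] assms by (simp_all add: ev_def U_\<xi>' \<xi>_unit \<phi>_H)
  have q: "g (\<phi> Y) X = - g (\<phi> X) Y" using \<phi>_skew[of Y X] sym[of Y] by simp
  have "(h - \<gamma> - l) * g (N X Y) U - \<beta> * g (N X Y) \<xi> = \<tau> * \<beta> * (l * g (\<phi> X) Y)"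
    using R1[OF assms(2), of X] unfolding \<phi>_A_ev[OF assms(1)] scale_l .
  moreover have "(h - \<gamma> - l) * g (N X Y) U - \<beta> * (g (N X Y) \<xi> + 2 * c * g (\<phi> X) Y) = \<tau> * \<beta> * (l * - g (\<phi> X) Y)"
    using R1[OF assms(1), of Y] unfolding \<phi>_A_ev[OF assms(2)] scale_l e q .
  ultimately have "2 * \<beta> * (c * g (\<phi> X) Y) = 2 * \<beta> * (\<tau> * l * g (\<phi> X) Y)" by algebra
  then show ?thesis using assms(3) \<beta>0 by simp
qed

text \<open>The same comparison of \<open>R1\<close> in both orders, now with different eigenvalues,
  so that the component along \<open>U\<close> survives and is determined.\<close>

lemma mixed:
  assumes "ev l1 X" "ev l2 Y"
  shows "(l1 - l2) * g (N X Y) U = \<beta> * (\<tau> * h - 2 * c) * g (\<phi> X) Y" "g (N Y X) U = g (N X Y) U"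
proof -
  show e: "g (N Y X) U = g (N X Y) U"
    using cod[of X Y U] assms by (simp add: ev_def U_\<xi>')
  have f: "g (N Y X) \<xi> = g (N X Y) \<xi> + 2 * c * g (\<phi> X) Y"
    using cod[of X Y \<xi>] assms by (simp add: ev_def \<xi>_unit \<phi>_H)
  have q: "g (\<phi> Y) X = - g (\<phi> X) Y" using \<phi>_skew[of Y X] sym[of Y] by simp
  have "(h - \<gamma> - l2) * g (N X Y) U - \<beta> * g (N X Y) \<xi> = \<tau> * \<beta> * (l1 * g (\<phi> X) Y)"
    using R1[OF assms(2), of X] unfolding \<phi>_A_ev[OF assms(1)] scale_l .
  moreover have "(h - \<gamma> - l1) * g (N X Y) U - \<beta> * (g (N X Y) \<xi> + 2 * c * g (\<phi> X) Y) = \<tau> * \<beta> * (l2 * - g (\<phi> X) Y)"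
    using R1[OF assms(1), of Y] unfolding \<phi>_A_ev[OF assms(2)] scale_l e f q .
  ultimately show "(l1 - l2) * g (N X Y) U = \<beta> * (\<tau> * h - 2 * c) * g (\<phi> X) Y"
    unfolding roots(1)[symmetric] by algebra
qed

text \<open>Four linear equations for \<open>dh X\<close> and the entries of \<open>N X\<close> on
  the plane of \<open>\<xi>\<close> and \<open>U\<close>. They come from \<open>R2\<close>, from
  \<open>R1\<close> differentiated along \<open>U\<close> and along \<open>\<xi>\<close> and moved
  to the direction \<open>X\<close> by Codazzi, and from the trace of \<open>N X\<close>, whose
  entries on the eigenspaces are given by \<open>R3\<close>.\<close>

lemma ev_N_equations:
  assumes "ev l X"
  shows "dh X * \<gamma> + (h - 2 * \<gamma>) * g (N X U) U - 2 * \<beta> * g (N X U) \<xi> = - 2 * \<tau> * \<beta> * l * g X P"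
    "(h - \<gamma> - l) * g (N X U) U - \<beta> * (g (N X U) \<xi> - 2 * c * g X P) = \<tau> * \<beta> * \<gamma> * g X P"
    "(h - \<gamma> - l) * (g (N X U) \<xi> - c * g X P) - \<beta> * g (N X \<xi>) \<xi> = \<tau> * \<beta>\<^sup>2 * g X P"
    "(l2 - l1) * (dh X - g (N X U) U - g (N X \<xi>) \<xi>) = dh X * (l2 * card E2 - l1 * card E1)"
proof -
  have X: "g X \<xi> = 0" "g X U = 0" using assms by (auto simp: ev_def)
  show "dh X * \<gamma> + (h - 2 * \<gamma>) * g (N X U) U - 2 * \<beta> * g (N X U) \<xi> = - 2 * \<tau> * \<beta> * l * g X P"
    using R2[of X] by (simp add: \<phi>_A_ev[OF assms] ip_simps g_\<phi>_U)
  have 1: "g (N U X) U = g (N X U) U" "g (N U X) \<xi> = g (N X U) \<xi> - 2 * c * g X P"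
    using cod[of X U U] cod[of X U \<xi>] X
    by (simp_all add: U_\<xi> U_\<xi>' \<phi>_H \<xi>_unit g_\<phi>_U)
  have 2: "g (N \<xi> X) U = g (N X U) \<xi> - c * g X P" "g (N \<xi> X) \<xi> = g (N X \<xi>) \<xi>"
    using cod[of X \<xi> U] cod[of X \<xi> \<xi>] X C_sym[of X U \<xi>]
    by (simp_all add: U_\<xi>' \<phi>_H \<xi>_unit \<phi>_\<xi> zero_l g_\<phi>_U)
  show "(h - \<gamma> - l) * g (N X U) U - \<beta> * (g (N X U) \<xi> - 2 * c * g X P) = \<tau> * \<beta> * \<gamma> * g X P"
    using R1[OF assms, of U] by (simp add: 1 \<phi>_A_U ip_simps sym[of P])
  show "(h - \<gamma> - l) * (g (N X U) \<xi> - c * g X P) - \<beta> * g (N X \<xi>) \<xi> = \<tau> * \<beta>\<^sup>2 * g X P"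
    using R1[OF assms, of \<xi>] by (simp add: 2 \<phi>_A_\<xi> ip_simps sym[of P] power2_eq_square)
  have s1: "(l2 - l1) * (\<Sum>e\<in>E1. g (N X e) e) = - (dh X * l1) * card E1"
  proof -
    have "(l2 - l1) * g (N X e) e = - (dh X * l1)" if "e \<in> E1" for e
      using R3[OF ev_E(1) ev_E(1), OF that that, of X] that onE(1) roots(1)[symmetric] by (simp add: ON_def)
    then show ?thesis by (simp add: sum_distrib_left)
  qed
  have s2: "(l2 - l1) * (\<Sum>e\<in>E2. g (N X e) e) = (dh X * l2) * card E2"
  proof -
    have "(l2 - l1) * g (N X e) e = dh X * l2" if "e \<in> E2" for e
      using R3[OF ev_E(2) ev_E(2), OF that that, of X] that onE(2) roots(1)[symmetric]
      by (simp add: ON_def algebra_simps)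
    then show ?thesis by (simp add: sum_distrib_left)
  qed
  have d: "dh X - g (N X U) U - g (N X \<xi>) \<xi> = (\<Sum>e\<in>E1. g (N X e) e) + (\<Sum>e\<in>E2. g (N X e) e)"
    unfolding dh_eq trace_eq[OF N_linear(1)] by simp
  show "(l2 - l1) * (dh X - g (N X U) U - g (N X \<xi>) \<xi>) = dh X * (l2 * card E2 - l1 * card E1)"
    unfolding d distrib_left s1 s2 by (simp add: algebra_simps)
qed

lemma h_minus: "h - \<gamma> - l1 = l2 - \<gamma>" using roots(1) by auto

text \<open>If \<open>dh X = 0\<close>, the four equations of \<open>ev_N_equations\<close>
  overdetermine the three entries of \<open>N X\<close>. Consistency is
  \<open>(c - \<tau> l1) g(X, P) = 0\<close>, and the remaining claims describe the
  solution.\<close>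

lemma ev1_dh0:
  assumes X: "ev l1 X" and dh: "dh X = 0"
  shows "g X P \<noteq> 0 \<Longrightarrow> c = \<tau> * l1"
    "(c = \<tau> * l1 \<or> g X P = 0) \<Longrightarrow> (l1 - l2) * g (N X U) U = 2 * \<beta> * \<tau> * (l1 - \<gamma>) * g X P"
    "g (N X \<xi>) \<xi> = - g (N X U) U"
    "g X P = 0 \<Longrightarrow> g (N X U) \<xi> = 0"
proof -
  define a1 where "a1 = g (N X U) U"
  define a2 where "a2 = g (N X U) \<xi>"
  define x where "x = g X P"
  note eq = ev_N_equations[OF X, folded a1_def a2_def x_def, unfolded dh h_minus]
  have "(l2 - l1) * (- a1 - g (N X \<xi>) \<xi>) = 0" using eq(4) by simp
  then show a3: "g (N X \<xi>) \<xi> = - g (N X U) U" using l1_l2 by (simp add: a1_def)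
  have y: "(l2 - \<gamma>) * (a2 - c * x) + \<beta> * a1 = \<tau> * \<beta>\<^sup>2 * x"
    using eq(3) unfolding a3 a1_def[symmetric] by simp
  have h2: "h - 2 * \<gamma> = (l1 - \<gamma>) + (l2 - \<gamma>)" using roots(1) by simp
  have z: "(l1 - \<gamma>) * a1 = \<beta> * (a2 - (2 * \<tau> * l1 + \<tau> * \<gamma> - 2 * c) * x)"
    using eq(1,2) unfolding h2 by (simp add: algebra_simps)
  have "(l2 - \<gamma>) * ((l1 - \<gamma>) * a1) = - \<beta>\<^sup>2 * a1" unfolding roots(3) by (simp add: algebra_simps)
  then have "\<beta> * (- \<beta> * a1) = \<beta> * ((l2 - \<gamma>) * (a2 - (2 * \<tau> * l1 + \<tau> * \<gamma> - 2 * c) * x))"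
    unfolding z by (simp add: power2_eq_square algebra_simps)
  then have zz: "- \<beta> * a1 = (l2 - \<gamma>) * (a2 - (2 * \<tau> * l1 + \<tau> * \<gamma> - 2 * c) * x)" unfolding mult_left_cancel[OF \<beta>0] .
  have "(l2 - \<gamma>) * (3 * (c - \<tau> * l1) * x) = (l2 - \<gamma>) * (a2 - (2 * \<tau> * l1 + \<tau> * \<gamma> - 2 * c) * x)
     - (l2 - \<gamma>) * (a2 - c * x) - \<tau> * ((l1 - \<gamma>) * (l2 - \<gamma>)) * x" by (simp add: algebra_simps)
  also have "\<dots> = - \<beta> * a1 - (\<tau> * \<beta>\<^sup>2 * x - \<beta> * a1) - \<tau> * (- \<beta>\<^sup>2) * x"
    using zz y unfolding roots(3) by (simp add: algebra_simps)
  finally have "(l2 - \<gamma>) * (3 * (c - \<tau> * l1) * x) = 0" by simp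
  then have cx: "(c - \<tau> * l1) * x = 0" using l1_l2 by simp
  then show "g X P \<noteq> 0 \<Longrightarrow> c = \<tau> * l1" by (simp add: x_def)
  have f: "(l1 - l2) * a1 = 2 * \<beta> * (c * x - \<tau> * \<gamma> * x) + 2 * \<beta> * (\<tau> * l1 * x - c * x)"
    using z eq(2) cx by algebra
  show "(c = \<tau> * l1 \<or> g X P = 0) \<Longrightarrow> (l1 - l2) * g (N X U) U = 2 * \<beta> * \<tau> * (l1 - \<gamma>) * g X P"
    using f unfolding a1_def x_def by (simp add: algebra_simps)
  show "g X P = 0 \<Longrightarrow> g (N X U) \<xi> = 0"
    using f l1_l2 eq(2) \<beta>0 unfolding x_def a1_def a2_def by auto
qed

text \<open>For orthonormal \<open>X\<close>, \<open>Y\<close> in the eigenspace Codazzi equates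
  \<open>g (N X Y) Y\<close> with \<open>g (N Y X) Y\<close>. By \<open>R3\<close> the former is a
  nonzero multiple of \<open>l1 * dh X\<close>, and the latter vanishes because
  \<open>g X Y = 0\<close>.\<close>

lemma large_eigenspace:
  assumes "X \<in> E1" "card E1 \<ge> 2"
  shows "l1 * dh X = 0"
proof -
  have "E1 \<noteq> {X}" using assms(2) by auto
  then obtain Y where Y: "Y \<in> E1" "Y \<noteq> X" using assms by auto
  have "g (N X Y) Y = g (N Y X) Y" using cod[of X Y Y] ev_E(1)[OF Y(1)] ev_E(1)[OF assms(1)] ev_sym(1)[OF ev_E(1)[OF Y(1)]]
    by (simp add: ev_def)
  moreover have "(l2 - l1) * g (N X Y) Y = - (dh X * l1)"
    using R3[OF ev_E(1) ev_E(1), OF Y(1) Y(1), of X] Y onE(1) roots(1)[symmetric] by (simp add: ON_def)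
  moreover have "(l2 - l1) * g (N Y X) Y = 0"
    using R3[OF ev_E(1) ev_E(1), OF assms(1) Y(1), of Y] Y assms onE(1) roots(1)[symmetric] by (simp add: ON_def)
  ultimately show ?thesis using l1_l2(1) by auto
qed

lemma large_eigenspace_ev:
  assumes X: "ev l1 X" and "card E1 \<ge> 2"
  shows "l1 * dh X = 0"
proof -
  have dl: "linear dh"
  proof (rule linearI)
    have "N (a + b) = (\<lambda>Y. N a Y + N b Y)" "N (r *\<^sub>R a) = (\<lambda>Y. r *\<^sub>R N a Y)" for a b r
      by (auto simp: N_simps)
    then show "dh (a + b) = dh a + dh b" "dh (r *\<^sub>R a) = r *\<^sub>R dh a" for a b r
      by (simp_all add: dh_eq trace_add trace_scale)
  qed
  have "g X e = 0" if "e \<in> E2" for e using ev_orth[OF X ev_E(2)[OF that]] .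
  then have "X = (\<Sum>e\<in>E1. g X e *\<^sub>R e)" using expand[of X] X by (simp add: ev_def)
  then have "l1 * dh X = l1 * dh (\<Sum>e\<in>E1. g X e *\<^sub>R e)" by simp
  also have "\<dots> = (\<Sum>e\<in>E1. g X e * (l1 * dh e))"
    by (simp add: linear_sum[OF dl] linear_scale[OF dl] sum_distrib_left mult.left_commute)
  also have "\<dots> = 0" using large_eigenspace assms(2) by (simp add: sum.neutral)
  finally show ?thesis .
qed

lemma ev_of_orth:
  assumes "g v \<xi> = 0" "g v U = 0" "\<And>e. ev l2 e \<Longrightarrow> g v e = 0" shows "ev l1 v"
proof -
  have "v = (\<Sum>e\<in>E1. g v e *\<^sub>R e)" using expand[of v] assms ev_E by simp
  moreover have "A (\<Sum>e\<in>E1. g v e *\<^sub>R e) = l1 *\<^sub>R (\<Sum>e\<in>E1. g v e *\<^sub>R e)"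
    by (simp add: linear_sum[OF A_linear] A_simps eig scaleR_sum_right mult.commute)
  ultimately have "A v = l1 *\<^sub>R v" by simp
  then show ?thesis using assms by (simp add: ev_def)
qed

text \<open>\<open>A - l1\<close> kills the eigenspace of \<open>l1\<close>, so it maps the part of
  \<open>v\<close> off \<open>\<xi>\<close> and \<open>U\<close> into that of \<open>l2\<close>.
  Being an explicit formula, it later extends an eigenvector to a smooth field.\<close>

lemma ev2_projection:
  "ev l2 (A (v - g v \<xi> *\<^sub>R \<xi> - g v U *\<^sub>R U) - l1 *\<^sub>R (v - g v \<xi> *\<^sub>R \<xi> - g v U *\<^sub>R U))"
proof -
  define v1 where "v1 = (\<Sum>e\<in>E1. g v e *\<^sub>R e)"
  define v2 where "v2 = (\<Sum>e\<in>E2. g v e *\<^sub>R e)"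
  have 1: "v - g v \<xi> *\<^sub>R \<xi> - g v U *\<^sub>R U = v1 + v2"
    using expand[of v, folded v1_def v2_def] by (simp only: diff_eq_eq ac_simps)
  have "A v1 = l1 *\<^sub>R v1" "A v2 = l2 *\<^sub>R v2"
    unfolding v1_def v2_def
    by (simp_all add: linear_sum[OF A_linear] A_simps eig scaleR_sum_right mult.commute)
  then have 2: "A (v1 + v2) - l1 *\<^sub>R (v1 + v2) = (l2 - l1) *\<^sub>R v2" "A v2 = l2 *\<^sub>R v2"
    by (simp_all add: A_simps algebra_simps)
  moreover have "g v2 \<xi> = 0" "g v2 U = 0" unfolding v2_def sum_l scale_l by (simp_all add: orth\<xi> orthU)
  ultimately show ?thesis unfolding 1 2(1) by (simp add: A_simps ev_def ip_simps 2(2))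
qed

lemma ev_\<phi>:
  assumes W: "ev l2 W" and P: "ev l1 P" and tr: "\<And>X Y. ev l2 X \<Longrightarrow> ev l2 Y \<Longrightarrow> g (\<phi> X) Y = 0"
  shows "ev l1 (\<phi> W)"
proof (rule ev_of_orth)
  show "g (\<phi> W) U = 0" using ev_orth[OF P W] sym[of W P] by (simp add: g_\<phi>_U)
qed (use W tr \<phi>_H in auto)

lemma g_E: "ev l Y \<Longrightarrow> g (E Y) W = \<alpha> * l * g Y W + g (\<phi> (N Y \<xi>)) W + l * g (\<phi> (A (\<phi> Y))) W"
  using ev_sym[of l Y]
  by (simp add: E_def A_\<xi> ip_simps \<xi>_unit U_\<xi> \<phi>_A_ev A_simps \<phi>_simps) (simp add: ev_def ip_simps)

text \<open>The hypothesis \<open>eq\<close> is the derivative of \<open>A (\<phi> A \<xi>) = l1 (\<phi> A \<xi>)\<close> for locally constant \<open>l1\<close>.\<close>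

lemma eigenfield_deriv:
  assumes Y: "ev l2 Y" "ev l2 W" and P: "ev l1 P" and tr: "\<And>X Y. ev l2 X \<Longrightarrow> ev l2 Y \<Longrightarrow> g (\<phi> X) Y = 0"
    and eq: "N Y (\<phi> (A \<xi>)) + A (E Y) = l1 *\<^sub>R E Y"
  shows "(l1 - l2) * (g (N Y \<xi>) (\<phi> W)) = - ((l2 - \<gamma>) * (\<tau> * h - 2 * c) + \<tau> * l2 * (l1 - l2)) * g Y W"
    "\<beta> * g (N Y P) W = ((l1 - l2) * (\<alpha> * l2 - l1 * l2 + \<tau> * l2) + (l2 - \<gamma>) * (\<tau> * h - 2 * c)) * g Y W"
proof -
  have fW: "ev l1 (\<phi> W)" by (rule ev_\<phi>[OF Y(2) P tr])
  have YW: "g Y \<xi> = 0" "g W \<xi> = 0" using Y by (auto simp: ev_def)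
  define e where "e = g (N Y (\<phi> W)) U"
  have m: "(l1 - l2) * e = - \<beta> * (\<tau> * h - 2 * c) * g Y W"
    using mixed[OF fW Y(1)] YW sym[of W Y] by (simp add: e_def \<phi>_\<phi> ip_simps)
  have r: "(l2 - \<gamma>) * e - \<beta> * g (N Y \<xi>) (\<phi> W) = \<tau> * \<beta> * l2 * g Y W"
    using R1[OF fW, of Y] YW C_sym[of Y "\<phi> W" \<xi>]
    by (simp add: \<phi>_A_ev[OF Y(1)] ip_simps g_\<phi>_\<phi> e_def h_minus)
  have "\<beta> * ((l1 - l2) * g (N Y \<xi>) (\<phi> W)) = \<beta> * (- ((l2 - \<gamma>) * (\<tau> * h - 2 * c) + \<tau> * l2 * (l1 - l2)) * g Y W)"
    using m r by algebra
  then show n: "(l1 - l2) * g (N Y \<xi>) (\<phi> W) = - ((l2 - \<gamma>) * (\<tau> * h - 2 * c) + \<tau> * l2 * (l1 - l2)) * g Y W"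
    unfolding mult_left_cancel[OF \<beta>0] .
  have "g (\<phi> (A (\<phi> Y))) W = - g (\<phi> Y) (A (\<phi> W))" by (simp add: \<phi>_skew A_sym)
  also have "\<dots> = - l1 * g Y W" using fW YW by (simp add: ev_def ip_simps g_\<phi>_\<phi>)
  finally have EW: "g (E Y) W = (\<alpha> * l2 - l1 * l2) * g Y W - g (N Y \<xi>) (\<phi> W)"
    using g_E[OF Y(1), of W] by (simp add: \<phi>_skew algebra_simps)
  have "g (N Y (\<phi> (A \<xi>)) + A (E Y)) W = g (l1 *\<^sub>R E Y) W" unfolding eq ..
  then have "\<beta> * g (N Y P) W + l2 * g (E Y) W = l1 * g (E Y) W"
    using Y(2) by (simp add: \<phi>_A_\<xi> linear_scale[OF N_linear(1)] ip_simps A_sym ev_def)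
  then show "\<beta> * g (N Y P) W = ((l1 - l2) * (\<alpha> * l2 - l1 * l2 + \<tau> * l2) + (l2 - \<gamma>) * (\<tau> * h - 2 * c)) * g Y W"
    unfolding EW using n by algebra
qed

text \<open>A second evaluation of the component found in \<open>eigenfield_deriv\<close>, from
  Codazzi and \<open>R3\<close>. Comparing the two constrains the principal curvatures.\<close>

lemma N_P_ev2:
  assumes Y: "ev l2 Y" "ev l2 W" and P: "ev l1 P"
  shows "(l1 - l2) * g (N Y P) W = - (dh P * l2 * g Y W)"
proof -
  have "g (N Y P) W = g (N P Y) W"
    using cod[of Y P W] Y by (simp add: ev_def P_H ev_sym(1)[OF Y(2)])
  then show ?thesis using R3[OF Y(1,2), of P] unfolding roots(1)[symmetric] by (simp add: algebra_simps)
qed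

text \<open>The mean curvature is thus confined to finitely many values, hence locally constant.\<close>

lemma totally_real_zero:
  assumes P: "ev l1 P" and tr: "\<And>X Y. ev l2 X \<Longrightarrow> ev l2 Y \<Longrightarrow> g (\<phi> X) Y = 0"
    and eq: "\<And>Y. ev l2 Y \<Longrightarrow> N Y (\<phi> (A \<xi>)) + A (E Y) = l1 *\<^sub>R E Y"
    and l1: "l1 = 0" and card: "card E1 = card E2 + 1" "E2 \<noteq> {}"
  shows "(3 + 2 * real (card E2)) * c + (1 - real (card E2)) * real (card E2) * h\<^sup>2 = 0"
proof -
  define m where "m = real (card E2)"
  define \<rho> where "\<rho> = dh P"
  define a1 where "a1 = g (N P U) U"
  define a2 where "a2 = g (N P U) \<xi>"
  define a3 where "a3 = g (N P \<xi>) \<xi>"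
  have hl: "h = l2" using roots(1) l1 by simp
  have l2: "l2 \<noteq> 0" using l1_l2 l1 by simp
  have b2: "\<beta>\<^sup>2 = \<gamma> * (l2 - \<gamma>)" using roots(3) l1 by (simp add: algebra_simps)
  have t: "\<tau> = m * l2" using \<tau>_eq l1 by (simp add: m_def)
  have al: "\<alpha> = l2 - \<gamma> - m * l2" using \<tau>_def hl t by simp
  obtain Y where "Y \<in> E2" using card by blast
  then have Y: "ev l2 Y" "g Y Y = 1" using ev_E onE(2) by (auto simp: ON_def)
  \<comment> \<open>Both evaluations of \<open>g (N Y P) Y\<close> agree, which determines
    \<open>\<rho>\<close>, the derivative of \<open>h\<close> along \<open>P\<close>.\<close>
  have "- l2 * (\<beta> * g (N Y P) Y) = \<beta> * (- \<rho> * l2)"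
    using N_P_ev2[OF Y(1) Y(1) P] unfolding Y(2) l1 \<rho>_def by algebra
  moreover have "\<beta> * g (N Y P) Y = (- l2 * (\<alpha> * l2 + \<tau> * l2) + (l2 - \<gamma>) * (\<tau> * l2 - 2 * c))"
    using eigenfield_deriv(2)[OF Y(1) Y(1) P tr eq[OF Y(1)]] Y l1 hl by simp
  ultimately have "l2 * (\<beta> * \<rho>) = l2 * (- l2 * (\<alpha> * l2 + \<tau> * l2) + (l2 - \<gamma>) * (\<tau> * l2 - 2 * c))"
    by algebra
  then have "\<beta> * \<rho> = - l2 * (\<alpha> * l2 + \<tau> * l2) + (l2 - \<gamma>) * (\<tau> * l2 - 2 * c)"
    unfolding mult_left_cancel[OF l2] .
  then have r: "\<beta> * \<rho> = - (l2 - \<gamma>) * ((1 - m) * l2\<^sup>2 + 2 * c)"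
    using al t by algebra
  \<comment> \<open>With \<open>X = P\<close>, and \<open>\<rho>\<close> known from
    \<open>r\<close>, these are four equations for \<open>a1\<close>, \<open>a2\<close>,
    \<open>a3\<close>. Their consistency condition is \<open>z = 0\<close>, with \<open>z\<close> as
    defined below.\<close>
  note eqs = ev_N_equations[OF P, folded a1_def a2_def a3_def \<rho>_def, unfolded P_H t, unfolded hl l1]
  have f1: "\<rho> * \<gamma> + (l2 - 2 * \<gamma>) * a1 - 2 * \<beta> * a2 = 0" using eqs(1) by simp
  have f2: "(l2 - \<gamma>) * a1 - \<beta> * (a2 - 2 * c) = m * l2 * \<beta> * \<gamma>" using eqs(2) by simp
  have f3: "(l2 - \<gamma>) * (a2 - c) - \<beta> * a3 = m * l2 * \<beta>\<^sup>2" using eqs(3) by simp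
  have "l2 * (\<rho> - a1 - a3) = l2 * (\<rho> * m)" using eqs(4) card by (simp add: m_def algebra_simps)
  then have f4: "\<rho> - a1 - a3 = \<rho> * m" unfolding mult_left_cancel[OF l2] .
  have ne: "\<gamma> \<noteq> 0" "l2 - \<gamma> \<noteq> 0" using b2 \<beta>0 by auto
  define z where "z = (3 + 2 * m) * c + (1 - m) * m * l2\<^sup>2"
  have "z = 0"
  proof -
    have 2: "a3 = (1 - m) * \<rho> - a1" using f4 by (simp add: algebra_simps)
    have g1: "2 * (\<beta> * a2) = \<rho> * \<gamma> + (l2 - 2 * \<gamma>) * a1" using f1 by simp
    have g2: "\<beta> * a2 = (l2 - \<gamma>) * a1 + 2 * c * \<beta> - m * l2 * \<beta> * \<gamma>" using f2 by (simp add: algebra_simps)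
    have g4: "l2 * a1 = \<rho> * \<gamma> - 4 * c * \<beta> + 2 * m * l2 * \<beta> * \<gamma>"
      using g1 unfolding g2 by (simp add: algebra_simps)
    have "\<beta> * ((l2 - \<gamma>) * (a2 - c) - \<beta> * a3) = \<beta> * (m * l2 * \<beta>\<^sup>2)" using f3 by simp
    then have "(l2 - \<gamma>) * (\<beta> * a2 - c * \<beta>) - \<beta>\<^sup>2 * a3 = m * l2 * \<beta> * \<beta>\<^sup>2" by (simp add: algebra_simps power2_eq_square)
    then have "(l2 - \<gamma>) * (\<beta> * a2 - c * \<beta> - \<gamma> * a3 - m * l2 * \<beta> * \<gamma>) = 0" unfolding b2 by algebra
    then have "\<beta> * a2 - c * \<beta> - \<gamma> * a3 - m * l2 * \<beta> * \<gamma> = 0" using ne by simp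
    then have g5: "l2 * a1 + c * \<beta> - 2 * m * l2 * \<beta> * \<gamma> - \<gamma> * (1 - m) * \<rho> = 0"
      unfolding g2 2 by (simp add: algebra_simps)
    then have "m * (\<gamma> * \<rho>) = 3 * c * \<beta>" unfolding g4 by (simp add: algebra_simps)
    then have "m * (\<gamma> * (\<beta> * \<rho>)) = 3 * c * \<beta>\<^sup>2" by algebra
    then have "(\<gamma> * (l2 - \<gamma>)) * (- m * ((1 - m) * l2\<^sup>2 + 2 * c)) = (\<gamma> * (l2 - \<gamma>)) * (3 * c)" unfolding b2 r by algebra
    moreover have "\<gamma> * (l2 - \<gamma>) \<noteq> 0" using ne by simp
    ultimately have "- m * ((1 - m) * l2\<^sup>2 + 2 * c) = 3 * c" by (metis mult_left_cancel)
    then show ?thesis by (simp add: z_def algebra_simps)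
  qed
  then show ?thesis by (simp add: z_def m_def hl)
qed

end

section \<open>Stationary mean curvature and \<open>c = \<tau> l1\<close>\<close>

locale nonhopf_stationary = nonhopf_jet +
  assumes dh0: "dh X = 0" and c_eq: "c = \<tau> * l1" and c0: "c \<noteq> 0"
begin

lemma l2_ne: "c \<noteq> \<tau> * l2" using c_eq c0 l1_l2 by auto

lemma P_ev2: "ev l2 W \<Longrightarrow> g W P = 0"
  using nonhopf_jet.ev1_dh0(1)[OF swap_jet _ dh0, of W] l2_ne by blast

lemma P_ev1: "ev l1 P"
  by (rule ev_of_orth) (use P_H P_ev2 sym in auto)

lemma totally_real2: "ev l2 X \<Longrightarrow> ev l2 Y \<Longrightarrow> g (\<phi> X) Y = 0"
  using not_totally_real l2_ne by blast

lemma N_ev1: "ev l1 X \<Longrightarrow> ev l1 Y \<Longrightarrow> g (N Z X) Y = 0" and N_ev2: "ev l2 X \<Longrightarrow> ev l2 Y \<Longrightarrow> g (N Z X) Y = 0"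
  using R3[of l1 X l1 Y Z] R3[of l2 X l2 Y Z] l1_l2 dh0 roots(1)[symmetric] by auto

text \<open>With \<open>dh P = 0\<close> the two evaluations of \<open>g (N W P) W\<close> leave
  \<open>(l1 - l2) (l2 - \<gamma>) (l2 - \<tau>) = 0\<close>, and the first two factors are
  nonzero.\<close>

lemma \<tau>_l2:
  assumes W: "W \<in> E2" and eq: "N W (\<phi> (A \<xi>)) + A (E W) = l1 *\<^sub>R E W"
  shows "\<tau> = l2" "c = k"
proof -
  have W': "ev l2 W" "g W W = 1" using W ev_E onE(2) by (auto simp: ON_def)
  have "g (N W P) W = 0" using N_P_ev2[OF W'(1) W'(1) P_ev1] dh0 l1_l2 by simp
  then have "(l1 - l2) * (\<alpha> * l2 - l1 * l2 + \<tau> * l2) + (l2 - \<gamma>) * (\<tau> * h - 2 * c) = 0"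
    using eigenfield_deriv(2)[OF W'(1) W'(1) P_ev1 totally_real2 eq] W' by simp
  moreover have "\<alpha> = l1 + l2 - \<tau> - \<gamma>" using \<tau>_def roots(1) by simp
  ultimately have "(l1 - l2) * (l2 - \<gamma>) * (l2 - \<tau>) = 0"
    unfolding c_eq roots(1)[symmetric] by algebra
  then show "\<tau> = l2" using l1_l2 by simp
  then show "c = k" using c_eq roots(2) by (simp add: mult.commute)
qed

text \<open>The components of \<open>N W \<xi>\<close> along \<open>\<xi>\<close>, \<open>U\<close>
  and both eigenspaces add up to \<open>- (\<gamma> * l2) *\<^sub>R \<phi> W\<close>. Hence the
  derivative of \<open>Q\<close> along \<open>W\<close> is \<open>l2 (h - \<tau> - l1) W\<close>,
  and the bracket vanishes since \<open>h = l1 + l2\<close> and \<open>\<tau> = l2\<close>.\<close>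

lemma E_ev2:
  assumes W: "ev l2 W" and t: "\<tau> = l2" and eq: "N W (\<phi> (A \<xi>)) + A (E W) = l1 *\<^sub>R E W"
  shows "E W = 0"
proof -
  have ck: "c = l1 * l2" using c_eq t by simp
  have z1: "g (N W \<xi>) U = 0" "g (N W \<xi>) \<xi> = 0"
  proof -
    note s = nonhopf_jet.ev1_dh0[OF swap_jet W dh0]
    have "(l2 - l1) * g (N W U) U = 0" using s(2) P_ev2[OF W] by simp
    then show "g (N W \<xi>) \<xi> = 0" using s(3) l1_l2 by simp
    show "g (N W \<xi>) U = 0" using s(4) P_ev2[OF W] C_sym[of W U \<xi>] by simp
  qed
  have z2: "g (N W \<xi>) Y = 0" if Y: "ev l2 Y" for Y
  proof -
    have "g (N W Y) U = g (N U W) Y"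
      using cod[of W U Y] W ev_sym[OF Y] C_sym[of W Y U] by (simp add: ev_def U_\<xi>)
    then have "g (N W Y) U = 0" using N_ev2[OF W Y] by simp
    then show ?thesis using R1[OF Y, of W] totally_real2[OF W Y] C_sym[of W Y \<xi>] \<beta>0
      by (simp add: \<phi>_A_ev[OF W] ip_simps)
  qed
  have z3: "g (N W \<xi>) Z = - \<gamma> * l2 * g (\<phi> W) Z" if Z: "ev l1 Z" for Z
  proof -
    have "g (\<phi> Z) W = - g (\<phi> W) Z" using \<phi>_skew[of Z W] sym[of Z] by simp
    then have "(l1 - l2) * g (N W Z) U = (l1 - l2) * (\<beta> * l2 * g (\<phi> W) Z)"
      using mixed(1)[OF Z W, unfolded t ck] mixed(2)[OF Z W] roots(1) by algebra
    then have "g (N W Z) U = \<beta> * l2 * g (\<phi> W) Z" using l1_l2 by simp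
    then have "\<beta> * g (N W Z) \<xi> = \<beta> * (- \<gamma> * l2 * g (\<phi> W) Z)"
      using R1[OF Z, of W] unfolding t \<phi>_A_ev[OF W] scale_l h_minus by (simp add: algebra_simps)
    then show ?thesis unfolding mult_left_cancel[OF \<beta>0] C_sym[of W Z \<xi>] .
  qed
  have fW: "ev l1 (\<phi> W)" by (rule ev_\<phi>[OF W P_ev1 totally_real2])
  have n: "N W \<xi> = - (\<gamma> * l2) *\<^sub>R \<phi> W"
  proof (rule eqI_basis)
    show "g (N W \<xi>) \<xi> = g (- (\<gamma> * l2) *\<^sub>R \<phi> W) \<xi>" using z1 \<phi>_H by (simp add: ip_simps)
    show "g (N W \<xi>) U = g (- (\<gamma> * l2) *\<^sub>R \<phi> W) U" using z1 P_ev2[OF W] by (simp add: ip_simps g_\<phi>_U)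
    show "g (N W \<xi>) e = g (- (\<gamma> * l2) *\<^sub>R \<phi> W) e" if "ev l1 e" for e using z3[OF that] by (simp add: ip_simps)
    show "g (N W \<xi>) e = g (- (\<gamma> * l2) *\<^sub>R \<phi> W) e" if "ev l2 e" for e
      using z2[OF that] totally_real2[OF W that] by (simp add: ip_simps)
  qed
  have W0: "g W \<xi> = 0" "A W = l2 *\<^sub>R W" using W by (auto simp: ev_def)
  have "E W = (\<alpha> * l2 - l1 * l2 + \<gamma> * l2) *\<^sub>R W"
    using ev_sym[OF W] fW W0
    by (simp add: E_def n A_\<xi> ip_simps \<xi>_unit U_\<xi> A_simps \<phi>_simps \<phi>_\<phi> ev_def algebra_simps)
       (use W in \<open>simp add: ev_def\<close>)
  also have "\<alpha> * l2 - l1 * l2 + \<gamma> * l2 = l2 * (h - \<tau> - l1)" by (simp add: \<tau>_def algebra_simps)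
  also have "\<dots> = 0" using t roots(1) by simp
  finally show ?thesis by simp
qed

lemma N_P_W:
  assumes W: "ev l2 W"
  shows "ev l1 Z \<Longrightarrow> g (N P W) Z = 0" "g (N P \<xi>) W = 0" "g (N P U) W = 0"
proof -
  have fP: "g (\<phi> P) W = 0" using ev_sym[OF W] by (simp add: \<phi>_P ip_simps)
  show "g (N P W) Z = 0" if Z: "ev l1 Z"
    using cod[of P W Z] W ev_sym[OF Z] N_ev1[OF P_ev1 Z, of W] by (simp add: P_H ev_def)
  have 1: "g (N P W) U = 0" using mixed[OF P_ev1 W] fP l1_l2 by simp
  then show "g (N P U) W = 0" using C_sym by simp
  show "g (N P \<xi>) W = 0" using R1[OF W, of P] 1 fP C_sym[of P W \<xi>] \<beta>0
    by (simp add: \<phi>_A_ev[OF P_ev1] ip_simps)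
qed

text \<open>\<open>N P \<xi>\<close> lies in the plane of \<open>\<xi>\<close> and \<open>U\<close>,
  which \<open>\<phi>\<close> maps to multiples of \<open>P\<close>. Geometrically, the integral
  curves of \<open>Q\<close> are geodesics up to parametrisation.\<close>

lemma E_Q: "\<exists>\<theta>. E (\<phi> (A \<xi>)) = \<theta> *\<^sub>R \<phi> (A \<xi>)"
proof -
  have AP: "A P = l1 *\<^sub>R P" using P_ev1 by (simp add: ev_def)
  have z: "g (N P \<xi>) Z = 0" if Z: "ev l1 Z" for Z
  proof -
    have "g (N P Z) U = g (N U P) Z"
      using cod[of P U Z] ev_sym[OF Z] C_sym[of P Z U] by (simp add: P_H U_\<xi>)
    then have "g (N P Z) U = 0" using N_ev1[OF P_ev1 Z] by simp
    moreover have "g U Z = 0" using ev_sym[OF Z] by simp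
    ultimately show ?thesis using R1[OF Z, of P] C_sym[of P Z \<xi>] \<beta>0
      by (simp add: \<phi>_A_ev[OF P_ev1] ip_simps \<phi>_P)
  qed
  have n: "N P \<xi> = g (N P \<xi>) \<xi> *\<^sub>R \<xi> + g (N P \<xi>) U *\<^sub>R U"
    by (rule eqI_basis) (auto simp: ip_simps \<xi>_unit U_unit U_\<xi> U_\<xi>' z ev_sym N_P_W)
  have f: "\<phi> (N P \<xi>) = g (N P \<xi>) U *\<^sub>R P"
    by (subst n) (simp only: \<phi>_simps \<phi>_\<xi> P_def scaleR_zero_right add_0_left)
  have "E P = (\<alpha> * l1 + g (N P \<xi>) U - l1 * \<gamma>) *\<^sub>R P"
    unfolding E_def f AP
    by (simp add: A_\<xi> ip_simps \<xi>_unit U_\<xi> P_H A_simps \<phi>_simps \<phi>_P A_U \<phi>_\<xi> P_def[symmetric] algebra_simps)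
  then have "E (\<phi> (A \<xi>)) = (\<alpha> * l1 + g (N P \<xi>) U - l1 * \<gamma>) *\<^sub>R \<phi> (A \<xi>)"
    unfolding \<phi>_A_\<xi> E_scale by (simp add: mult.commute)
  then show ?thesis by blast
qed

text \<open>Keeps the derivative along \<open>Q\<close> of an eigenfield for \<open>l2\<close>
  inside the eigenspace.\<close>

lemma N_P_ev2_eq_0: assumes W: "ev l2 W" shows "N P W = 0"
proof (rule eqI_basis)
  show "g (N P W) \<xi> = g 0 \<xi>" "g (N P W) U = g 0 U"
    using N_P_W(2,3)[OF W] C_sym[of P W] by (simp_all add: zero_l)
qed (use N_P_W(1)[OF W] N_ev2[OF W] in \<open>simp_all add: zero_l\<close>)

text \<open>\<open>R2\<close> in the directions \<open>\<xi>\<close> and \<open>U\<close> is a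
  homogeneous linear system for \<open>q1\<close> and \<open>q2\<close> with determinant
  \<open>(h - 2 * \<gamma>)\<^sup>2 + (2 * \<beta>)\<^sup>2 > 0\<close>. The other entries reduce to
  these by Codazzi and because \<open>N X\<close> has trace 0.\<close>

lemma N_\<xi>_U: "g (N \<xi> U) U = 0" "g (N U \<xi>) \<xi> = 0" "g (N \<xi> \<xi>) \<xi> = 0" "g (N U U) U = 0" "g (N U U) \<xi> = 0"
proof -
  define q1 where "q1 = g (N \<xi> U) U"
  define q2 where "q2 = g (N U \<xi>) \<xi>"
  have tr: "g (N X \<xi>) \<xi> = - g (N X U) U" for X
  proof -
    have 1: "(\<Sum>e\<in>E1. g (N X e) e) = 0" using N_ev1 ev_E by (simp add: sum.neutral)
    have 2: "(\<Sum>e\<in>E2. g (N X e) e) = 0" using N_ev2 ev_E by (simp add: sum.neutral)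
    show ?thesis using dh0[of X] unfolding dh_eq trace_eq[OF N_linear(1)] 1 2 by simp
  qed
  have 1: "g (N U U) \<xi> = q1"
    using cod[of U \<xi> U] C_sym[of U U \<xi>] by (simp add: q1_def \<phi>_\<xi> zero_l U_\<xi> U_\<xi>' \<xi>_unit g_\<phi>_self)
  have 2: "g (N \<xi> U) \<xi> = q2"
    using cod[of U \<xi> \<xi>] by (simp add: q2_def \<phi>_\<xi> zero_l U_\<xi> U_\<xi>' \<xi>_unit \<phi>_H)
  have 3: "g (N U U) U = - q2" using tr[of U] by (simp add: q2_def)
  have r1: "(h - 2 * \<gamma>) * q1 = 2 * \<beta> * q2"
    using R2[of \<xi>] dh0 by (simp add: q1_def[symmetric] 2 \<phi>_A_\<xi> ip_simps P_H)
  have r2: "- (h - 2 * \<gamma>) * q2 = 2 * \<beta> * q1"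
    using R2[of U] dh0 by (simp add: 1 3 \<phi>_A_U ip_simps P_H algebra_simps)
  have "((h - 2 * \<gamma>)\<^sup>2 + (2 * \<beta>)\<^sup>2) * q1 = 0" using r1 r2 by algebra
  moreover have "(h - 2 * \<gamma>)\<^sup>2 + (2 * \<beta>)\<^sup>2 > 0" using \<beta>0 by (intro add_nonneg_pos) auto
  ultimately have q1: "q1 = 0" by simp
  then have q2: "q2 = 0" using r1 \<beta>0 by simp
  show "g (N \<xi> U) U = 0" "g (N U \<xi>) \<xi> = 0" "g (N \<xi> \<xi>) \<xi> = 0" "g (N U U) U = 0" "g (N U U) \<xi> = 0"
    using q1 q2 1 3 tr[of \<xi>] by (simp_all add: q1_def q2_def)
qed

text \<open>Coefficient of the dual form of \<open>Q\<close> in the differential of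
  \<open>\<alpha>\<close>. The first summand comes from the derivative of \<open>A\<close>, see
  \<open>N_\<xi>_\<xi>_ev1\<close>, the second from that of \<open>\<xi>\<close>.\<close>

definition slope :: real where "slope = - 2 * (\<tau> * (l1 - \<gamma>) / (l1 - l2) + l1)"

lemma N_\<xi>_\<xi>_ev1: assumes X: "ev l1 X" shows "g (N X \<xi>) \<xi> = - 2 * \<beta> * \<tau> * (l1 - \<gamma>) / (l1 - l2) * g X P"
proof -
  have "(l1 - l2) * g (N X U) U = 2 * \<beta> * \<tau> * (l1 - \<gamma>) * g X P" using ev1_dh0(2)[OF X dh0] c_eq by blast
  then have "g (N X U) U = 2 * \<beta> * \<tau> * (l1 - \<gamma>) * g X P / (l1 - l2)" using l1_l2 by (simp add: field_simps)
  then show ?thesis using ev1_dh0(3)[OF X dh0] by simp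
qed

text \<open>The left hand side is the differential of \<open>\<alpha>\<close>.\<close>

lemma d\<alpha>: "g (N X \<xi>) \<xi> + 2 * g (A \<xi>) (\<phi> (A X)) = slope * g (\<phi> (A \<xi>)) X"
proof -
  define D where "D X = g (N X \<xi>) \<xi> + 2 * g (A \<xi>) (\<phi> (A X)) - slope * g (\<phi> (A \<xi>)) X" for X
  have l: "linear D" unfolding D_def by (rule linearI) (simp_all add: N_simps A_simps \<phi>_simps ip_simps algebra_simps)
  have gA: "g (A \<xi>) (\<phi> Y) = - \<beta> * g P Y" for Y
    using \<phi>_skew[of "A \<xi>" Y] by (simp add: \<phi>_A_\<xi> ip_simps)
  have gP: "g (A \<xi>) P = 0" "g P \<xi> = 0" "g P U = 0" by (simp_all add: A_\<xi> ip_simps P_H)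
  have D3: "D \<xi> = 0" using N_\<xi>_U by (simp add: D_def \<phi>_A_\<xi> ip_simps gP)
  have D4: "D U = 0" using N_\<xi>_U by (simp add: D_def \<phi>_A_\<xi> \<phi>_A_U ip_simps gP)
  have D1: "D e = 0" if "ev l1 e" for e
  proof -
    have "g (A \<xi>) (\<phi> (A e)) = - \<beta> * l1 * g e P" using that sym[of P e] by (simp add: gA ev_def ip_simps)
    then show ?thesis
      using sym[of P e] by (simp add: D_def N_\<xi>_\<xi>_ev1[OF that] \<phi>_A_\<xi> ip_simps slope_def algebra_simps)
  qed
  have D2: "D e = 0" if e: "ev l2 e" for e
  proof -
    note s = nonhopf_jet.ev1_dh0[OF swap_jet e dh0]
    have "(l2 - l1) * g (N e U) U = 0" using s(2) P_ev2[OF e] by simp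
    then have "g (N e \<xi>) \<xi> = 0" using s(3) l1_l2 by simp
    moreover have "g (A \<xi>) (\<phi> (A e)) = 0" using P_ev2[OF e] sym[of P e] e by (simp add: gA ev_def ip_simps)
    ultimately show ?thesis using sym[of P e] P_ev2[OF e] by (simp add: D_def \<phi>_A_\<xi> ip_simps)
  qed
  have "D X = D (g X \<xi> *\<^sub>R \<xi> + g X U *\<^sub>R U + (\<Sum>e\<in>E1. g X e *\<^sub>R e) + (\<Sum>e\<in>E2. g X e *\<^sub>R e))"
    using expand[of X] by metis
  also have "\<dots> = 0" using D1 D2 D3 D4 ev_E
    by (simp add: linear_add[OF l] linear_scale[OF l] linear_sum[OF l] sum.neutral)
  finally show ?thesis by (simp add: D_def)
qed

text \<open>The hypothesis says that the exterior derivative of the dual form of \<open>Q\<close>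
  vanishes on \<open>U\<close> and \<open>\<xi>\<close>. It supplies the relation that finally fixes
  \<open>\<gamma>\<close>.\<close>

lemma curl_E:
  assumes "g (E U) \<xi> = g (E \<xi>) U"
  shows "(h - \<tau> - l1) * (l1 - l2) = - 2 * \<tau> * (l1 - \<gamma>)"
proof -
  have EU: "g (E U) \<xi> = - \<beta> * \<gamma>"
    by (simp add: E_def A_\<xi> A_U ip_simps \<xi>_unit U_unit U_\<xi> U_\<xi>' \<phi>_H algebra_simps)
  have "g (N \<xi> \<xi>) P = g (N P \<xi>) \<xi>"
    using cod[of \<xi> P \<xi>] C_sym[of \<xi> \<xi> P] by (simp add: P_H \<phi>_H \<phi>_\<xi> zero_l \<xi>_unit)
  then have n: "g (\<phi> (N \<xi> \<xi>)) U = - g (N P \<xi>) \<xi>" by (simp add: g_\<phi>_U)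
  have AP: "A P = l1 *\<^sub>R P" using P_ev1 by (simp add: ev_def)
  have E\<xi>: "g (E \<xi>) U = \<alpha> * \<beta> - g (N P \<xi>) \<xi> - \<beta> * l1"
    unfolding E_def \<phi>_A_\<xi> by (simp add: ip_simps n A_simps AP \<phi>_simps \<phi>_P A_\<xi> \<xi>_unit U_unit U_\<xi> U_\<xi>')
  define y where "y = 2 * \<tau> * (l1 - \<gamma>) / (l1 - l2)"
  have "g (N P \<xi>) \<xi> = - (\<beta> * y)" using N_\<xi>_\<xi>_ev1[OF P_ev1] P_H by (simp add: y_def)
  then have "\<beta> * (\<alpha> + \<gamma> - l1) = \<beta> * (- y)" using assms EU E\<xi> by (simp add: algebra_simps)
  then have "\<alpha> + \<gamma> - l1 = - y" unfolding mult_left_cancel[OF \<beta>0] .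
  then have "h - \<tau> - l1 = - y" by (simp add: \<tau>_def)
  then show ?thesis using l1_l2 by (simp add: y_def)
qed

text \<open>With \<open>\<tau> = card E1 * l1\<close>, a zero slope would make
  \<open>\<gamma> - l2\<close> a negative multiple of \<open>l1 - \<gamma>\<close>, against
  \<open>\<beta>\<^sup>2 > 0\<close>.\<close>

lemma slope_ne_0: assumes "E2 = {}" shows "slope \<noteq> 0"
proof
  assume "slope = 0"
  then have z: "\<tau> * (l1 - \<gamma>) + l1 * (l1 - l2) = 0" using l1_l2 by (simp add: slope_def field_simps)
  have t: "\<tau> = card E1 * l1" using \<tau>_eq assms by simp
  have "l1 \<noteq> 0" using c_eq c0 by auto
  moreover have "l1 * (card E1 * (l1 - \<gamma>) + ((l1 - \<gamma>) + (\<gamma> - l2))) = 0" using z unfolding t by (simp add: algebra_simps)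
  ultimately have "card E1 * (l1 - \<gamma>) + ((l1 - \<gamma>) + (\<gamma> - l2)) = 0" by (metis mult_eq_0_iff)
  then have g: "\<gamma> - l2 = - (real (card E1) + 1) * (l1 - \<gamma>)" by (simp add: algebra_simps)
  have "\<beta>\<^sup>2 = - ((real (card E1) + 1) * (l1 - \<gamma>)\<^sup>2)" using roots(3) g by algebra
  moreover have "(real (card E1) + 1) * (l1 - \<gamma>)\<^sup>2 \<ge> 0" by simp
  moreover have "\<beta>\<^sup>2 > 0" using \<beta>0 by simp
  ultimately show False by linarith
qed

end

section \<open>Points where \<open>\<xi>\<close> is principal\<close>

context pointwise begin

text \<open>For eigenvectors \<open>X\<close>, \<open>Y\<close> in \<open>H\<close> with
  \<open>g (\<phi> X) Y \<noteq> 0\<close>, \<open>hopf\<close> is a quadratic relation between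
  their eigenvalues. Whether \<open>\<phi>\<close> preserves the eigenspaces, swaps them or mixes
  them decides which relations hold, and each case gives one of the listed values. Adding
  \<open>(2 n - 2) c\<close> yields \<open>S(\<xi>, \<xi>)\<close>.\<close>

lemma hopf_value:
  assumes n: "DIM('a) = 2 * n - 1" "n \<ge> 2"
    and A\<xi>: "A \<xi> = \<alpha> *\<^sub>R \<xi>"
    and hopf: "\<And>X Y. g X \<xi> = 0 \<Longrightarrow> g Y \<xi> = 0 \<Longrightarrow>
      2 * g (A (\<phi> (A X))) Y = \<alpha> * (g (\<phi> (A X)) Y + g (A (\<phi> X)) Y) + 2 * c * g (\<phi> X) Y"
  shows "\<alpha> * (h - \<alpha>) \<in> {c + k - (2 * real n - 2) * c, 0, 2 * (real n - 1) * (k - c), 2 * (k + c)}"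
proof -
  have A2: "A (A v) = h *\<^sub>R A v - k *\<^sub>R v" if v: "g v \<xi> = 0" for v
  proof (rule eqI)
    fix Y0
    define Y where "Y = Y0 - g Y0 \<xi> *\<^sub>R \<xi>"
    have Y: "g Y \<xi> = 0" "Y0 = Y + g Y0 \<xi> *\<^sub>R \<xi>" by (simp_all add: Y_def ip_simps \<xi>_unit)
    have Av: "g (A v) \<xi> = 0" "g (A (A v)) \<xi> = 0" using v by (simp_all add: A_sym A\<xi> ip_simps A_simps)
    have "g (A (A v)) Y = g (h *\<^sub>R A v - k *\<^sub>R v) Y"
      using ricci_H[OF v Y(1)] by (simp add: A_sym[of "A v"] ip_simps)
    then show "g (A (A v)) Y0 = g (h *\<^sub>R A v - k *\<^sub>R v) Y0"
      using Av v by (subst (1 2) Y(2)) (simp add: ip_simps)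
  qed
  obtain E1 E2 l1 l2 where E: "finite E1" "finite E2" "ON E1" "ON E2"
    "\<And>e. e \<in> E1 \<Longrightarrow> A e = l1 *\<^sub>R e" "\<And>e. e \<in> E2 \<Longrightarrow> A e = l2 *\<^sub>R e"
    "\<And>e. e \<in> E1 \<union> E2 \<Longrightarrow> g e \<xi> = 0"
    "\<And>v. v = g v \<xi> *\<^sub>R \<xi> + (\<Sum>e\<in>E1. g v e *\<^sub>R e) + (\<Sum>e\<in>E2. g v e *\<^sub>R e)"
    and l: "l1 + l2 = h" "l1 * l2 = k" "E2 = {} \<or> l1 \<noteq> l2"
  proof -
    \<comment> \<open>By \<open>sq\<close> the discriminant \<open>d\<close> cannot be negative. If
      it is 0, then \<open>A\<close> is a multiple of the identity on \<open>H\<close>, which is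
      represented by \<open>E2 = {}\<close> and \<open>l1 = l2 = h / 2\<close>.\<close>
    define d where "d = h\<^sup>2 - 4 * k"
    have sq: "4 * g (A v - (h / 2) *\<^sub>R v) (A v - (h / 2) *\<^sub>R v) = d * g v v" if "g v \<xi> = 0" for v
      using ricci_H[OF that that] sym[of v "A v"]
      by (simp add: ip_simps d_def power2_eq_square algebra_simps)
    have onx: "ON {\<xi>}" by (simp add: ON_def \<xi>_unit)
    show ?thesis
    proof (cases "d > 0")
      case True
      define l1 where "l1 = (h + sqrt d) / 2"
      define l2 where "l2 = (h - sqrt d) / 2"
      have r: "l1 + l2 = h" "l1 * l2 = k" "l1 \<noteq> l2"
        using True real_sqrt_pow2[of d] by (auto simp: l1_def l2_def d_def field_simps power2_eq_square)
      obtain E1 E2 where E: "finite E1" "finite E2" "ON E1" "ON E2"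
        "\<And>e. e \<in> E1 \<Longrightarrow> A e = l1 *\<^sub>R e" "\<And>e. e \<in> E2 \<Longrightarrow> A e = l2 *\<^sub>R e"
        "\<And>e z. e \<in> E1 \<union> E2 \<Longrightarrow> z \<in> {\<xi>} \<Longrightarrow> g e z = 0"
        "\<And>v. v = (\<Sum>e\<in>{\<xi>}. g v e *\<^sub>R e) + (\<Sum>e\<in>E1. g v e *\<^sub>R e) + (\<Sum>e\<in>E2. g v e *\<^sub>R e)"
      proof (rule adapted_basis[of "{\<xi>}" A l1 l2])
        show "A (A v) = (l1 + l2) *\<^sub>R A v - (l1 * l2) *\<^sub>R v" if "\<And>z. z \<in> {\<xi>} \<Longrightarrow> g v z = 0" for v
          using A2[of v] that r by simp
        show "g (A v) z = 0" if "\<And>z. z \<in> {\<xi>} \<Longrightarrow> g v z = 0" "z \<in> {\<xi>}" for v z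
          using that by (simp add: A_sym A\<xi> ip_simps)
      qed (use onx A_linear A_sym r in auto)
      show ?thesis by (rule that[of E1 E2 l1 l2]) (use E(1-7) E(8)[simplified] r in auto)
    next
      case False
      have sub: "subspace {v. g v \<xi> = 0}" by (auto simp: subspace_def ip_simps)
      obtain E1 where E: "E1 \<subseteq> {v. g v \<xi> = 0}" "ON E1" "finite E1"
        "\<And>v. v \<in> {v. g v \<xi> = 0} \<Longrightarrow> v = (\<Sum>e\<in>E1. g v e *\<^sub>R e)"
        using ON_basis_subspace[OF sub] by blast
      have Ah: "A v = (h / 2) *\<^sub>R v" if v: "g v \<xi> = 0" for v
      proof -
        have "d * g v v \<le> 0" using False nonneg[of v] by (simp add: mult_nonpos_nonneg)
        then have "g (A v - (h / 2) *\<^sub>R v) (A v - (h / 2) *\<^sub>R v) \<le> 0" using sq[OF v] by simp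
        then have "g (A v - (h / 2) *\<^sub>R v) (A v - (h / 2) *\<^sub>R v) = 0" using nonneg by (rule antisym)
        then show ?thesis by (simp add: eq_0_iff)
      qed
      have ex: "v = g v \<xi> *\<^sub>R \<xi> + (\<Sum>e\<in>E1. g v e *\<^sub>R e)" for v
      proof -
        define w where "w = v - g v \<xi> *\<^sub>R \<xi>"
        have w: "g w \<xi> = 0" by (simp add: w_def ip_simps \<xi>_unit)
        have "g w e = g v e" if "e \<in> E1" for e using that E(1) sym[of \<xi> e] by (auto simp: w_def ip_simps)
        then have "w = (\<Sum>e\<in>E1. g v e *\<^sub>R e)" using E(4)[of w] w by (simp cong: sum.cong)
        then show ?thesis by (simp add: w_def algebra_simps)
      qed
      have "\<exists>v. v \<noteq> 0 \<and> g v \<xi> = 0"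
      proof (rule ccontr)
        assume "\<not> ?thesis"
        then have z: "v = 0" if "g v \<xi> = 0" for v using that by blast
        have "e \<notin> E1" for e
        proof
          assume e: "e \<in> E1"
          then have "g e e = 1" "e = 0" using E(1,2) z[of e] by (auto simp: ON_def)
          then show False using zero_l[of e] by simp
        qed
        then have "E1 = {}" by blast
        then have "v \<in> span {\<xi>}" for v by (subst ex) (simp add: span_base span_scale)
        then have "span {\<xi>} = UNIV" by blast
        then have "DIM('a) \<le> 1" using dim_le_card[of "UNIV::'a set" "{\<xi>}"] by simp
        then show False using n by simp
      qed
      then obtain v where v: "v \<noteq> 0" "g v \<xi> = 0" by blast
      then have "d * g v v = 0" using sq[OF v(2)] Ah[OF v(2)] zero_l by simp
      then have "d = 0" using pos[OF v(1)] by simp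
      then have "h / 2 * (h / 2) = k" by (simp add: d_def power2_eq_square)
      then show ?thesis using that[of E1 "{}" "h / 2" "h / 2"] E Ah ex by (auto simp: ON_def)
    qed
  qed
  have on: "g e e' = 0" if "e \<in> E1" "e' \<in> E2" for e e'
    using A_sym[of e e'] E(5)[OF that(1)] E(6)[OF that(2)] l(3) that by (auto simp: ip_simps)
  have dis: "E1 \<inter> E2 = {}" using on E(3) unfolding ON_def by fastforce
  have nx: "\<xi> \<notin> E1 \<union> E2" using E(7)[of \<xi>] \<xi>_unit by auto
  have sm: "sum f (insert \<xi> (E1 \<union> E2)) = f \<xi> + sum f E1 + sum f E2" for f :: "'a \<Rightarrow> 'b::comm_monoid_add"
    using nx E(1,2) dis by (simp add: sum.union_disjoint add.assoc)
  have tr: "trace_lin L = g (L \<xi>) \<xi> + (\<Sum>e\<in>E1. g (L e) e) + (\<Sum>e\<in>E2. g (L e) e)" if "linear L" for L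
    using trace_ON[OF that, of "insert \<xi> (E1 \<union> E2)"] E(1,2,8) unfolding sm by blast
  define m1 where "m1 = real (card E1)"
  define m2 where "m2 = real (card E2)"
  have "real (DIM('a)) = 1 + m1 + m2"
    unfolding trace_id[symmetric, where 'a='a] tr[OF linear_ident] using E(3,4) by (simp add: ON_def \<xi>_unit m1_def m2_def)
  then have m: "m1 + m2 = 2 * real n - 2" using n by simp
  have h: "h = \<alpha> + m1 * l1 + m2 * l2"
    unfolding h_eq tr[OF A_linear] using E(3,4) by (simp add: ON_def A\<xi> ip_simps \<xi>_unit E(5,6) m1_def m2_def)
  have pv: "g v w = g v \<xi> * g w \<xi> + (\<Sum>e\<in>E1. g v e * g w e) + (\<Sum>e\<in>E2. g v e * g w e)" for v w
  proof -
    have "g v w = g (g v \<xi> *\<^sub>R \<xi> + (\<Sum>e\<in>E1. g v e *\<^sub>R e) + (\<Sum>e\<in>E2. g v e *\<^sub>R e)) w" using E(8)[of v] by metis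
    then show ?thesis unfolding add_l scale_l sum_l by (simp add: sym[of w])
  qed
  have n1: "1 = (\<Sum>Y\<in>E1. g (\<phi> X) Y * g (\<phi> X) Y) + (\<Sum>Y\<in>E2. g (\<phi> X) Y * g (\<phi> X) Y)" if "X \<in> E1 \<union> E2" for X
    using pv[of "\<phi> X" "\<phi> X"] that E(3,4) by (auto simp: g_\<phi>_\<phi> E(7) \<phi>_H ON_def)
  have eq: "2 * (la * lb) * g (\<phi> X) Y = (\<alpha> * (la + lb) + 2 * c) * g (\<phi> X) Y"
    if "A X = la *\<^sub>R X" "A Y = lb *\<^sub>R Y" "X \<in> E1 \<union> E2" "Y \<in> E1 \<union> E2" for X Y la lb
    using hopf[of X Y] E(7) that by (simp add: A_sym[of _ Y] ip_simps \<phi>_simps A_simps algebra_simps)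
  have e11: "l1 * l1 = \<alpha> * l1 + c" if "X \<in> E1" "Y \<in> E1" "g (\<phi> X) Y \<noteq> 0" for X Y
    using eq[of X l1 Y l1] that E(5) by simp
  have e22: "l2 * l2 = \<alpha> * l2 + c" if "X \<in> E2" "Y \<in> E2" "g (\<phi> X) Y \<noteq> 0" for X Y
    using eq[of X l2 Y l2] that E(6) by simp
  have e12: "2 * k = \<alpha> * h + 2 * c" if "X \<in> E1" "Y \<in> E2" "g (\<phi> X) Y \<noteq> 0" for X Y
    using eq[of X l1 Y l2] that E(5,6) l by simp
  have sw: "g (\<phi> Y) X * g (\<phi> Y) X = g (\<phi> X) Y * g (\<phi> X) Y" for X Y using \<phi>_skew[of Y X] sym[of Y "\<phi> X"] by simp
  have s0: "(\<Sum>Y\<in>F. g (\<phi> X) Y * g (\<phi> X) Y) = 0" if "\<And>Y. Y \<in> F \<Longrightarrow> g (\<phi> X) Y = 0" for X F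
    using that by (simp add: sum.neutral)
  \<comment> \<open>One eigenspace is all of \<open>H\<close>, so \<open>la\<close> has multiplicity
    \<open>2 n - 2\<close>.\<close>
  have v1: "\<alpha> * (h - \<alpha>) = c + k - (2 * real n - 2) * c"
    if "la * la = \<alpha> * la + c" "h = \<alpha> + (2 * real n - 2) * la" "la + lb = h" "la * lb = k" for la lb
  proof -
    have "c + k = (2 * real n - 2) * (la * la)" using that by algebra
    then show ?thesis using that by algebra
  qed
  \<comment> \<open>\<open>\<phi>\<close> mixes the eigenspaces: a relation inside one and the
    relation between both hold, and they force \<open>\<alpha> = 2 * la\<close>.\<close>
  have v3: "\<alpha> * (h - \<alpha>) = 2 * (k + c)"
    if "la * la = \<alpha> * la + c" "2 * k = \<alpha> * h + 2 * c" "la + lb = h" "la * lb = k" "la \<noteq> lb" for la lb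
  proof -
    have "(\<alpha> - 2 * la) * (lb - la) = 0" using that by algebra
    then have "\<alpha> = 2 * la" using that(5) by simp
    then show ?thesis using that by algebra
  qed
  show ?thesis
  proof (cases "\<exists>X\<in>E1. \<exists>Y\<in>E2. g (\<phi> X) Y \<noteq> 0")
    case True
    then have k: "2 * k = \<alpha> * h + 2 * c" and ne: "E2 \<noteq> {}" using e12 by auto
    then have ll: "l1 \<noteq> l2" using l by blast
    consider "\<exists>X\<in>E1. \<exists>Y\<in>E1. g (\<phi> X) Y \<noteq> 0" | "\<exists>X\<in>E2. \<exists>Y\<in>E2. g (\<phi> X) Y \<noteq> 0"
      | "\<forall>X\<in>E1. \<forall>Y\<in>E1. g (\<phi> X) Y = 0" "\<forall>X\<in>E2. \<forall>Y\<in>E2. g (\<phi> X) Y = 0" by blast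
    then show ?thesis
    proof cases
      case 1
      then have "\<alpha> * (h - \<alpha>) = 2 * (k + c)" using v3[OF _ k l(1,2) ll] e11 by blast
      then show ?thesis by simp
    next
      case 2
      then have "\<alpha> * (h - \<alpha>) = 2 * (k + c)" using v3[OF _ k, of l2 l1] e22 l ll by (metis add.commute mult.commute)
      then show ?thesis by simp
    next
      case 3
      \<comment> \<open>\<open>\<phi>\<close> swaps the eigenspaces isometrically, so their
        dimensions agree.\<close>
      have "m1 = (\<Sum>X\<in>E1. (\<Sum>Y\<in>E2. g (\<phi> X) Y * g (\<phi> X) Y))"
      proof -
        have "(\<Sum>Y\<in>E2. g (\<phi> X) Y * g (\<phi> X) Y) = 1" if "X \<in> E1" for X using n1[of X] s0[of E1 X] 3 that by simp
        then show ?thesis by (simp add: m1_def)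
      qed
      moreover have "m2 = (\<Sum>Y\<in>E2. (\<Sum>X\<in>E1. g (\<phi> X) Y * g (\<phi> X) Y))"
      proof -
        have "(\<Sum>X\<in>E1. g (\<phi> X) Y * g (\<phi> X) Y) = 1" if "Y \<in> E2" for Y
          using n1[of Y] s0[of E2 Y] 3 that by (simp add: sw[of Y])
        then show ?thesis by (simp add: m2_def)
      qed
      ultimately have "m1 = m2" using sum.swap[of "\<lambda>X Y. g (\<phi> X) Y * g (\<phi> X) Y" E2 E1] by simp
      then have "m1 = real n - 1" "m2 = real n - 1" using m by auto
      then have "\<alpha> = (2 - real n) * h" using h l(1) by algebra
      then have "\<alpha> * (h - \<alpha>) = 2 * (real n - 1) * (k - c)" using k by algebra
      then show ?thesis by simp
    qed
  next
    case False
    then have f: "g (\<phi> X) Y = 0" "g (\<phi> Y) X = 0" if "X \<in> E1" "Y \<in> E2" for X Y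
      using that sw[of Y X] by auto
    have k1: "l1 * l1 = \<alpha> * l1 + c" if ne: "E1 \<noteq> {}"
    proof -
      obtain X where X: "X \<in> E1" using ne by blast
      then have "\<exists>Y\<in>E1. g (\<phi> X) Y \<noteq> 0" using n1[of X] s0[of E1 X] s0[of E2 X] f by fastforce
      then show ?thesis using e11 X by blast
    qed
    have k2: "l2 * l2 = \<alpha> * l2 + c" if ne: "E2 \<noteq> {}"
    proof -
      obtain X where X: "X \<in> E2" using ne by blast
      then have "\<exists>Y\<in>E2. g (\<phi> X) Y \<noteq> 0" using n1[of X] s0[of E1 X] s0[of E2 X] f by fastforce
      then show ?thesis using e22 X by blast
    qed
    consider "E2 = {}" | "E1 = {}" "E2 \<noteq> {}" | "E1 \<noteq> {}" "E2 \<noteq> {}" by blast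
    then show ?thesis
    proof cases
      case 1
      then have z: "m2 = 0" "m1 = 2 * real n - 2" using m by (simp_all add: m2_def)
      then have "E1 \<noteq> {}" using n by (auto simp: m1_def)
      then show ?thesis using v1[OF k1 _ l(1,2)] h z by simp
    next
      case 2
      then have z: "m1 = 0" "m2 = 2 * real n - 2" using m by (simp_all add: m1_def)
      then show ?thesis using v1[OF k2, of l1] 2 h l by (simp add: add.commute mult.commute)
    next
      case 3
      then have "l1 \<noteq> l2" using l by blast
      \<comment> \<open>\<open>\<phi>\<close> preserves both eigenspaces, so \<open>l1\<close> and
        \<open>l2\<close> are the two roots of \<open>t\<^sup>2 = \<alpha> t + c\<close> and their
        sum is \<open>\<alpha>\<close>.\<close>
      moreover have "(l1 - l2) * (l1 + l2 - \<alpha>) = 0" using k1[OF 3(1)] k2[OF 3(2)] by algebra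
      ultimately have "\<alpha> = h" using l by simp
      then show ?thesis by simp
    qed
  qed
qed

end

section \<open>Hypersurfaces whose Ricci tensor is constant on the holomorphic distribution\<close>

context hypersurface_eqs begin

abbreviation cd :: "('b \<Rightarrow> 'b) \<Rightarrow> 'b \<Rightarrow> 'b \<Rightarrow> 'b" where "cd \<equiv> cov \<Gamma> (\<lambda>x. x)"

definition nabA :: "'b \<Rightarrow> 'b \<Rightarrow> 'b \<Rightarrow> 'b" where
  "nabA x X Y = cd (\<lambda>y. A y Y) x X - A x (\<Gamma> x X Y)"

definition h :: "'b \<Rightarrow> real" where "h x = trace_lin (A x)"

lemma cd_metric:
  assumes "smooth_on W Y" "smooth_on W Z" "x \<in> W"
  shows "fd (\<lambda>y. g y (Y y) (Z y)) x u = g x (cd Y x u) (Z x) + g x (Y x) (cd Z x u)"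
  using metric_deriv_along[OF op smooth_on_id[OF op] _ assms] by simp

lemma cd_const: "cd (\<lambda>y. v) x u = \<Gamma> x u v" by (simp add: cov_def)

lemma cd_endo:
  assumes L: "\<And>x. x \<in> W \<Longrightarrow> linear (L x)" "\<And>v. smooth_on W (\<lambda>x. L x v)"
    and Y: "Y differentiable (at x)" and x: "x \<in> W"
  shows "cd (\<lambda>y. L y (Y y)) x u = (cd (\<lambda>y. L y (Y x)) x u - L x (\<Gamma> x u (Y x))) + L x (cd Y x u)"
proof -
  have "fd (\<lambda>y. L y (Y y)) x u = fd (\<lambda>y. L y (Y x)) x u + L x (fd Y x u)"
    by (rule fd_linear_family[where \<beta>=L, OF op L x Y])
  then show ?thesis by (simp add: cov_def linear_add[OF L(1)[OF x]])
qed

lemma cd_A: "Y differentiable (at x) \<Longrightarrow> x \<in> W \<Longrightarrow> cd (\<lambda>y. A y (Y y)) x u = nabA x u (Y x) + A x (cd Y x u)"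
  unfolding nabA_def by (rule cd_endo[where L=A, OF A_linear A_smooth])

lemma cd_\<phi>: "Y differentiable (at x) \<Longrightarrow> x \<in> W \<Longrightarrow> cd (\<lambda>y. \<phi> y (Y y)) x u
    = g x (Y x) (\<xi> x) *\<^sub>R A x u - g x (A x u) (Y x) *\<^sub>R \<xi> x + \<phi> x (cd Y x u)"
  using cd_endo[where L=\<phi>, OF \<phi>_linear \<phi>_smooth, of Y x u] nabla_\<phi>[of x "Y x" u] by simp

lemma smooth_A: "smooth_on W Y \<Longrightarrow> smooth_on W (\<lambda>y. A y (Y y))"
  by (rule smooth_on_linear_family[where \<beta>=A, OF op A_linear A_smooth])

lemma smooth_\<phi>: "smooth_on W Y \<Longrightarrow> smooth_on W (\<lambda>y. \<phi> y (Y y))"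
  by (rule smooth_on_linear_family[where \<beta>=\<phi>, OF op \<phi>_linear \<phi>_smooth])

lemma smooth_h: "smooth_on W h"
  unfolding h_def trace_lin_def by (intro smooth_on_sum smooth_on_inner smooth_on_const A_smooth op)

lemma nabA_sym: assumes x: "x \<in> W" shows "g x (nabA x X Y) Z = g x Y (nabA x X Z)"
proof -
  interpret p: ips "g x" by (rule ips[OF x])
  have "fd (\<lambda>y. g y (A y Y) Z) x X = fd (\<lambda>y. g y Y (A y Z)) x X"
    by (rule fun_cong[OF fd_cong[OF op x]]) (rule A_sym)
  then show ?thesis
    using cd_metric[OF smooth_A[OF smooth_on_const[of _ Y]] smooth_on_const[of _ Z] x, of X]
      cd_metric[OF smooth_on_const[of _ Y] smooth_A[OF smooth_on_const[of _ Z]] x, of X]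
    by (simp add: cd_A[OF differentiable_const x] cd_const p.ip_simps A_sym[OF x])
qed

text \<open>\<open>nabA\<close> differs from the coordinate derivative of \<open>A\<close> by a
  commutator with the Christoffel term, which has trace 0.\<close>

lemma fd_h: assumes x: "x \<in> W" shows "fd h x X = trace_lin (nabA x X)"
proof -
  have "(h has_derivative (\<lambda>X. \<Sum>b\<in>Basis. fd (\<lambda>y. A y b) x X \<bullet> b)) (at x)"
    unfolding h_def trace_lin_def
    by (intro has_derivative_sum has_derivative_inner_left smooth_on_has_derivative[OF A_smooth x])
  then have "fd h x X = trace_lin (\<lambda>Y. fd (\<lambda>y. A y Y) x X)" by (simp add: fd_eq trace_lin_def)
  moreover have "trace_lin (\<lambda>Y. \<Gamma> x X (A x Y)) = trace_lin (\<lambda>Y. A x (\<Gamma> x X Y))"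
    by (rule trace_comm[OF bilinear_linears(1)[OF bil_christoffel[OF x]] A_linear[OF x]])
  ultimately show ?thesis
    unfolding nabA_def cov_def fd_ident trace_diff trace_add by simp
qed

lemma cd_linear: assumes Y: "smooth_on W Y" and x: "x \<in> W" shows "linear (cd Y x)"
  unfolding cov_def fd_ident
  by (intro linear_compose_add smooth_on_linear_fd[OF Y x] bilinear_linears(2)[OF bil_christoffel[OF x]])

lemma nabA_linear: assumes x: "x \<in> W" shows "linear (nabA x X)" "linear (\<lambda>X. nabA x X Y)"
proof -
  note l = linear_compose[OF bilinear_linears(1)[OF bil_christoffel[OF x]] A_linear[OF x], unfolded o_def]
    linear_compose[OF A_linear[OF x] bilinear_linears(1)[OF bil_christoffel[OF x]], unfolded o_def]
    linear_compose[OF bilinear_linears(2)[OF bil_christoffel[OF x]] A_linear[OF x], unfolded o_def]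
  have "linear (\<lambda>Y. fd (\<lambda>y. A y Y) x X)"
    by (rule linear_fd_family[where \<beta>=A, OF op A_linear A_smooth x])
  then show "linear (nabA x X)" unfolding nabA_def[abs_def] cov_def fd_ident
    by (intro linear_compose_sub linear_compose_add l)
  show "linear (\<lambda>X. nabA x X Y)" unfolding nabA_def
    by (intro linear_compose_sub cd_linear A_smooth x l)
qed

lemma codazzi_nabA: "x \<in> W \<Longrightarrow> nabA x X Y - nabA x Y X
    = c *\<^sub>R (g x X (\<xi> x) *\<^sub>R \<phi> x Y - g x Y (\<xi> x) *\<^sub>R \<phi> x X - (2 * g x (\<phi> x X) Y) *\<^sub>R \<xi> x)"
  using codazzi[of x Y X] christoffel_sym[of x X Y] by (simp add: nabA_def)

text \<open>In the trace of the Gauss equation the metric terms give \<open>2 n - 2\<close>. The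
  terms in \<open>\<phi>\<^sup>2\<close>, with weights 1 and 2, add 3 to this and produce the
  \<open>- 3\<close> in front of the product of the \<open>\<xi>\<close>-components. The term with
  the trace of \<open>\<phi>\<close> vanishes by skewness.\<close>

lemma ricci_formula:
  assumes x: "x \<in> W" and n: "DIM('b) = 2 * n - 1" "n \<ge> 1"
  shows "trace_lin (\<lambda>Z. local_curvature g x Z X Y)
    = c * ((2 * real n + 1) * g x X Y - 3 * g x X (\<xi> x) * g x Y (\<xi> x))
      + h x * g x (A x X) Y - g x (A x X) (A x Y)"
proof -
  interpret p: ips "g x" by (rule ips[OF x])
  note Al = linear_add[OF A_linear[OF x]] linear_scale[OF A_linear[OF x]]
  note \<phi>l = linear_add[OF \<phi>_linear[OF x]] linear_scale[OF \<phi>_linear[OF x]]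
  have t1: "trace_lin (\<lambda>Z. g x Z Y *\<^sub>R X) = g x X Y"
    by (rule trace_rank_one) (auto intro!: linearI simp: p.ip_simps)
  have t2: "trace_lin (\<lambda>Z. g x (\<phi> x Z) Y *\<^sub>R \<phi> x X) = g x (\<phi> x (\<phi> x X)) Y"
    by (rule trace_rank_one) (auto intro!: linearI simp: p.ip_simps \<phi>l)
  have t3: "trace_lin (\<lambda>Z. (2 * g x (\<phi> x Z) X) *\<^sub>R \<phi> x Y) = 2 * g x (\<phi> x (\<phi> x Y)) X"
    by (rule trace_rank_one) (auto intro!: linearI simp: p.ip_simps \<phi>l algebra_simps)
  have t4: "trace_lin (\<lambda>Z. g x (A x Z) Y *\<^sub>R A x X) = g x (A x (A x X)) Y"
    by (rule trace_rank_one) (auto intro!: linearI simp: p.ip_simps Al)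
  have t5: "trace_lin (\<phi> x) = 0" by (rule p.trace_skew[OF \<phi>_linear[OF x] \<phi>_skew[OF x]])
  have "trace_lin (\<lambda>Z. local_curvature g x Z X Y)
    = c * (g x X Y * DIM('b) - g x X Y + g x (\<phi> x X) Y * trace_lin (\<phi> x) - g x (\<phi> x (\<phi> x X)) Y
        - 2 * g x (\<phi> x (\<phi> x Y)) X) + g x (A x X) Y * h x - g x (A x (A x X)) Y"
    unfolding gauss[OF x] trace_diff trace_add trace_scale trace_id t1 t2 t3 t4 h_def by simp
  also have "\<dots> = c * ((2 * real n + 1) * g x X Y - 3 * g x X (\<xi> x) * g x Y (\<xi> x))
      + h x * g x (A x X) Y - g x (A x X) (A x Y)"
    using n by (simp add: t5 \<phi>_\<phi>[OF x] p.ip_simps A_sym[OF x, of "A x X"] p.sym[of Y X] p.sym[of "\<xi> x"] algebra_simps of_nat_diff)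
  finally show ?thesis .
qed

end

section \<open>From pointwise algebra to smooth data\<close>

locale ricci_condition = hypersurface_eqs W g A \<phi> \<xi> c
  for W :: "'b::euclidean_space set" and g A \<phi> \<xi> c +
  fixes n :: nat and k :: real
  assumes dim: "DIM('b) = 2 * n - 1" and n3: "n \<ge> 3" and c0: "c \<noteq> 0"
    and ricci_H: "x \<in> W \<Longrightarrow> g x X (\<xi> x) = 0 \<Longrightarrow> g x Y (\<xi> x) = 0 \<Longrightarrow>
      h x * g x (A x X) Y - g x (A x X) (A x Y) = k * g x X Y"
begin

text \<open>The substance is \<open>ricci_H_deriv\<close>. Since \<open>ricci_H\<close> holds for
  vectors in \<open>H\<close>, constant vectors are first projected to \<open>H\<close>; the
  derivative of the projection produces the right hand side.\<close>

lemma jet_at: assumes x: "x \<in> W" shows "jet (g x) (A x) (\<phi> x) (\<xi> x) k (h x) (nabA x) c (fd h x)"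
proof -
  interpret p: ips "g x" by (rule ips[OF x])
  interpret pt: pointwise "g x" "A x" "\<phi> x" "\<xi> x" k "h x"
    by unfold_locales (auto simp: linear_add[OF A_linear[OF x]] linear_scale[OF A_linear[OF x]]
      linear_add[OF \<phi>_linear[OF x]] linear_scale[OF \<phi>_linear[OF x]] \<phi>_\<phi>[OF x]
      \<xi>_unit[OF x] h_def[symmetric] intro: A_sym[OF x] \<phi>_skew[OF x] ricci_H[OF x])
  show ?thesis
  proof (intro jet.intro jet_axioms.intro pt.pointwise_axioms)
    fix X Y Z
    show "linear (nabA x X)" "linear (\<lambda>X. nabA x X Y)" by (rule nabA_linear[OF x])+
    show "g x (nabA x X Y) Z = g x Y (nabA x X Z)" by (rule nabA_sym[OF x])
    show "nabA x X Y - nabA x Y X = c *\<^sub>R (g x X (\<xi> x) *\<^sub>R \<phi> x Y - g x Y (\<xi> x) *\<^sub>R \<phi> x X - (2 * g x (\<phi> x X) Y) *\<^sub>R \<xi> x)"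
      by (rule codazzi_nabA[OF x])
    show "fd h x X = trace_lin (nabA x X)" by (rule fd_h[OF x])
    assume Y: "g x Y (\<xi> x) = 0" and Z: "g x Z (\<xi> x) = 0"
    define H where "H Y y = Y - g y Y (\<xi> y) *\<^sub>R \<xi> y" for Y y
    have sH: "smooth_on W (H Y)" for Y unfolding H_def
      by (intro smooth_on_diff' smooth_on_scaleR smooth_metric \<xi>_smooth smooth_on_const op)
    have Hx: "H Y x = Y" "H Z x = Z" using Y Z by (simp_all add: H_def)
    have HH: "g y (H Y y) (\<xi> y) = 0" if "y \<in> W" for y Y
      using ips.diff_l[OF ips[OF that]] ips.scale_l[OF ips[OF that]] \<xi>_unit[OF that] by (simp add: H_def)
    note sA = smooth_A[OF sH]
    \<comment> \<open>\<open>T\<close> is the tensor that vanishes on \<open>H\<close>. The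
      derivative of a field in \<open>H\<close> enters it only through its
      \<open>\<xi>\<close>-component, which \<open>nabla_\<xi>\<close> computes: this is
      \<open>cH\<close>.\<close>
    define T where "T v w = h x * g x (A x v) w - g x (A x v) (A x w) - k * g x v w" for v w
    have T_H: "T v w = 0" if "g x v (\<xi> x) = 0" "g x w (\<xi> x) = 0" for v w
      using ricci_H[OF x that] by (simp add: T_def)
    have Tl: "T (a + b) w = T a w + T b w" "T (r *\<^sub>R a) w = r * T a w" for a b w r
      by (simp_all add: T_def pt.A_simps p.ip_simps algebra_simps)
    have Ts: "T a w = T w a" for a w
      using p.sym[of a w] p.sym[of "A x a" "A x w"] A_sym[OF x, of a w] p.sym[of a "A x w"] by (simp add: T_def)
    have cH: "T (cd (H v) x X) w = - g x v (\<phi> x (A x X)) * T (\<xi> x) w"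
      if "g x v (\<xi> x) = 0" "g x w (\<xi> x) = 0" "H v x = v" for v w
    proof -
      define a where "a = g x (cd (H v) x X) (\<xi> x)"
      have "fd (\<lambda>y. g y (H v y) (\<xi> y)) x X = fd (\<lambda>y. 0) x X"
        by (rule fun_cong[OF fd_cong[OF op x]]) (rule HH)
      then have a: "a = - g x v (\<phi> x (A x X))"
        using cd_metric[OF sH \<xi>_smooth x, of v X] by (simp add: a_def nabla_\<xi>[OF x] that)
      have "g x (cd (H v) x X - a *\<^sub>R \<xi> x) (\<xi> x) = 0" by (simp add: a_def p.ip_simps \<xi>_unit[OF x])
      then have "T (cd (H v) x X - a *\<^sub>R \<xi> x) w = 0" using T_H that(2) by blast
      then show ?thesis using Tl(1)[of "cd (H v) x X - a *\<^sub>R \<xi> x" "a *\<^sub>R \<xi> x" w] Tl(2)[of a "\<xi> x" w] by (simp add: a)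
    qed
    have "fd (\<lambda>y. h y * g y (A y (H Y y)) (H Z y)) x X
       = fd (\<lambda>y. g y (A y (H Y y)) (A y (H Z y)) + k * g y (H Y y) (H Z y)) x X"
      by (rule fun_cong[OF fd_cong[OF op x]]) (use ricci_H HH in \<open>force simp: algebra_simps\<close>)
    moreover have "fd (\<lambda>y. h y * g y (A y (H Y y)) (H Z y)) x X
      = h x * fd (\<lambda>y. g y (A y (H Y y)) (H Z y)) x X + fd h x X * g x (A x Y) Z"
      using fd_eq[OF has_derivative_mult[OF smooth_on_has_derivative[OF smooth_h x]
          smooth_on_has_derivative[OF smooth_metric[OF sA sH] x]], of Y Z] by (simp add: Hx)
    moreover have "fd (\<lambda>y. g y (A y (H Y y)) (A y (H Z y)) + k * g y (H Y y) (H Z y)) x X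
      = fd (\<lambda>y. g y (A y (H Y y)) (A y (H Z y))) x X + k * fd (\<lambda>y. g y (H Y y) (H Z y)) x X"
      using fd_eq[OF has_derivative_add[OF smooth_on_has_derivative[OF smooth_metric[OF sA sA] x]
          has_derivative_mult_right[OF smooth_on_has_derivative[OF smooth_metric[OF sH sH] x]]], of Y Z k Y Z] by simp
    ultimately have "fd h x X * g x (A x Y) Z + h x * g x (nabA x X Y) Z - g x (nabA x X Y) (A x Z) - g x (A x Y) (nabA x X Z)
       + T (cd (H Y) x X) Z + T Y (cd (H Z) x X) = 0"
      unfolding cd_metric[OF sA sH x] cd_metric[OF sA sA x] cd_metric[OF sH sH x] cd_A[OF smooth_on_diff[OF sH x] x] Hx T_def
      by (simp add: p.ip_simps algebra_simps)
    moreover have "T (cd (H Y) x X) Z = - g x Y (\<phi> x (A x X)) * T (\<xi> x) Z"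
      using cH[OF Y Z] Hx by simp
    moreover have "T Y (cd (H Z) x X) = - g x Z (\<phi> x (A x X)) * T (\<xi> x) Y"
      using cH[OF Z Y] Hx Ts[of Y] by simp
    moreover have "T (\<xi> x) v = h x * g x (A x (\<xi> x)) v - g x (A x (\<xi> x)) (A x v)" if "g x v (\<xi> x) = 0" for v
      using that p.sym[of "\<xi> x" v] by (simp add: T_def)
    ultimately show "fd h x X * g x (A x Y) Z + h x * g x (nabA x X Y) Z - g x (nabA x X Y) (A x Z) - g x (nabA x X Z) (A x Y)
      = (h x * g x (A x (\<xi> x)) Y - g x (A x (\<xi> x)) (A x Y)) * g x (\<phi> x (A x X)) Z
       + (h x * g x (A x (\<xi> x)) Z - g x (A x (\<xi> x)) (A x Z)) * g x (\<phi> x (A x X)) Y"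
      using Y Z p.sym[of Y "\<phi> x (A x X)"] p.sym[of Z "\<phi> x (A x X)"] p.sym[of "A x Y"] by (simp add: algebra_simps)
  qed
qed

definition al :: "'b \<Rightarrow> real" where "al x = g x (A x (\<xi> x)) (\<xi> x)"
text \<open>\<open>U\<close>, \<open>\<beta>\<close> and \<open>P\<close> are choices at one point.
  The fields \<open>V = \<beta> U\<close> and \<open>Q = \<beta> P\<close> are smooth substitutes on
  \<open>W\<close>, and so is \<open>gam\<close> on the open set \<open>\<Omega>\<close> where
  \<open>\<xi>\<close> is not principal.\<close>

definition V :: "'b \<Rightarrow> 'b" where "V x = A x (\<xi> x) - al x *\<^sub>R \<xi> x"
definition gam :: "'b \<Rightarrow> real" where "gam x = g x (A x (V x)) (V x) / g x (V x) (V x)"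
definition tau :: "'b \<Rightarrow> real" where "tau x = h x - al x - gam x"
definition Q :: "'b \<Rightarrow> 'b" where "Q x = \<phi> x (A x (\<xi> x))"
definition \<Omega> :: "'b set" where "\<Omega> = {x \<in> W. V x \<noteq> 0}"

lemma smooth_al: "smooth_on W al" unfolding al_def by (intro smooth_metric smooth_A \<xi>_smooth)
lemma smooth_V: "smooth_on W V" unfolding V_def
  by (intro smooth_on_diff' smooth_on_scaleR smooth_A \<xi>_smooth smooth_al op)
lemma smooth_Q: "smooth_on W Q" unfolding Q_def by (intro smooth_\<phi> smooth_A \<xi>_smooth)

lemma \<Omega>_open: "open \<Omega>"
proof -
  have "\<Omega> = W \<inter> V -` (- {0})" by (auto simp: \<Omega>_def)
  then show ?thesis using continuous_open_preimage[OF smooth_on_continuous[OF smooth_V] op, of "- {0}"] by (simp add: open_Compl)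
qed

lemma smooth_gam: "smooth_on \<Omega> gam"
  unfolding gam_def
proof (rule smooth_on_divide[OF \<Omega>_open])
  have s: "\<Omega> \<subseteq> W" by (auto simp: \<Omega>_def)
  show "g x (V x) (V x) \<noteq> 0" if "x \<in> \<Omega>" for x
    using ips.eq_0_iff[OF ips, of x "V x"] that by (auto simp: \<Omega>_def)
  show "smooth_on \<Omega> (\<lambda>x. g x (A x (V x)) (V x))" "smooth_on \<Omega> (\<lambda>x. g x (V x) (V x))"
    by (rule smooth_on_subset[OF _ s], intro smooth_metric smooth_A smooth_V)+
qed

lemma smooth_tau: "smooth_on \<Omega> tau"
proof -
  have s: "\<Omega> \<subseteq> W" by (auto simp: \<Omega>_def)
  show ?thesis unfolding tau_def
    by (intro smooth_on_diff' \<Omega>_open smooth_gam smooth_on_subset[OF smooth_h s] smooth_on_subset[OF smooth_al s])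
qed

text \<open>Ties the pointwise locale to the smooth functions: \<open>\<alpha>\<close> and
  \<open>\<gamma>\<close> are values of \<open>al\<close> and \<open>gam\<close>, whereas
  \<open>U\<close>, \<open>b\<close>, the eigenvalues and the bases are chosen at each
  point.\<close>

definition NH :: "'b \<Rightarrow> 'b \<Rightarrow> real \<Rightarrow> real \<Rightarrow> real \<Rightarrow> 'b set \<Rightarrow> 'b set \<Rightarrow> bool" where
  "NH x U b l1 l2 E1 E2 \<longleftrightarrow>
    nonhopf_jet (g x) (A x) (\<phi> x) (\<xi> x) k (h x) U (al x) b (gam x) l1 l2 E1 E2 (nabA x) c (fd h x)"

lemma NH_swap: "NH x U b l1 l2 E1 E2 \<Longrightarrow> NH x U b l2 l1 E2 E1"
  unfolding NH_def by (rule nonhopf_jet.swap_jet)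

lemma NH_exists:
  assumes "x \<in> \<Omega>" obtains U b l1 l2 E1 E2 where "NH x U b l1 l2 E1 E2"
proof -
  have x: "x \<in> W" and V: "V x \<noteq> 0" using assms by (auto simp: \<Omega>_def)
  interpret j: jet "g x" "A x" "\<phi> x" "\<xi> x" k "h x" "nabA x" c "fd h x" by (rule jet_at[OF x])
  have "A x (\<xi> x) \<noteq> g x (A x (\<xi> x)) (\<xi> x) *\<^sub>R \<xi> x" using V by (simp add: V_def al_def)
  then obtain U a b ga l1 l2 E1 E2 where n: "nonhopf (g x) (A x) (\<phi> x) (\<xi> x) k (h x) U a b ga l1 l2 E1 E2"
    by (rule j.nonhopf_exists)
  interpret m: nonhopf "g x" "A x" "\<phi> x" "\<xi> x" k "h x" U a b ga l1 l2 E1 E2 by (rule n)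
  have a: "a = al x" by (simp add: al_def m.A_\<xi> j.ip_simps j.\<xi>_unit m.U_\<xi>)
  have "V x = b *\<^sub>R U" using m.A_\<xi> by (simp add: V_def a)
  then have "ga = gam x" using m.\<beta>0
    by (simp add: gam_def j.A_simps m.A_U j.ip_simps m.U_unit m.U_\<xi>')
  then have "NH x U b l1 l2 E1 E2" using n a j.jet_axioms unfolding NH_def by (simp add: nonhopf_jet.intro)
  then show ?thesis using that by blast
qed

lemma NH_facts:
  assumes "NH x U b l1 l2 E1 E2"
  shows "nonhopf.\<tau> (h x) (al x) (gam x) = tau x" "Q x = b *\<^sub>R nonhopf.P (\<phi> x) U"
    "V x = b *\<^sub>R U" "card E1 + card E2 = 2 * n - 3"
proof -
  interpret m: nonhopf_jet "g x" "A x" "\<phi> x" "\<xi> x" k "h x" U "al x" b "gam x" l1 l2 E1 E2 "nabA x" c "fd h x"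
    using assms by (simp add: NH_def)
  show "m.\<tau> = tau x" by (simp add: m.\<tau>_def tau_def)
  show "Q x = b *\<^sub>R m.P" by (simp add: Q_def m.\<phi>_A_\<xi>)
  show "V x = b *\<^sub>R U" by (simp add: V_def m.A_\<xi>)
  show "card E1 + card E2 = 2 * n - 3" using m.card_eq dim by simp
qed

lemma cd_Q: assumes x: "x \<in> W" shows "cd Q x u = jet.E (g x) (A x) (\<phi> x) (\<xi> x) (nabA x) u"
proof -
  interpret j: jet "g x" "A x" "\<phi> x" "\<xi> x" k "h x" "nabA x" c "fd h x" by (rule jet_at[OF x])
  show ?thesis
    unfolding Q_def cd_\<phi>[OF smooth_on_diff[OF smooth_A[OF \<xi>_smooth] x] x] cd_A[OF smooth_on_diff[OF \<xi>_smooth x] x] nabla_\<xi>[OF x]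
    by (simp add: j.E_def j.\<phi>_simps)
qed

lemma eigenfield:
  assumes "open O'" "O' \<subseteq> W" "\<And>y. y \<in> O' \<Longrightarrow> A y (Q y) = l *\<^sub>R Q y" and x: "x \<in> O'"
  shows "nabA x Y (\<phi> x (A x (\<xi> x))) + A x (jet.E (g x) (A x) (\<phi> x) (\<xi> x) (nabA x) Y)
    = l *\<^sub>R jet.E (g x) (A x) (\<phi> x) (\<xi> x) (nabA x) Y"
proof -
  have xW: "x \<in> W" using assms by blast
  have "cd (\<lambda>y. A y (Q y)) x Y = cd (\<lambda>y. l *\<^sub>R Q y) x Y"
    by (rule cov_cong[OF assms(1) x]) (rule assms(3))
  also have "\<dots> = l *\<^sub>R cd Q x Y"
    using cov_scale[where F="\<lambda>x. x" and f="\<lambda>x. l" and Z=Q and x=x and u=Y] smooth_on_diff[OF smooth_Q xW] xW by simp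
  finally show ?thesis unfolding cd_A[OF smooth_on_diff[OF smooth_Q xW] xW] cd_Q[OF xW] by (simp only: Q_def)
qed

text \<open>The cardinalities give \<open>card E1 = n - 1 \<ge> 2\<close>. If
  \<open>l1 \<noteq> 0\<close>, then \<open>large_eigenspace_ev\<close> shows that \<open>h\<close>
  is stationary along \<open>P\<close>, and \<open>ev1_dh0\<close> for \<open>P\<close> yields
  \<open>c = tau y * l1\<close>.\<close>

lemma large_totally_real:
  assumes "NH y U b l1 l2 E1 E2" "nonhopf.ev (g y) (A y) (\<xi> y) U l1 (nonhopf.P (\<phi> y) U)"
    "card E1 = card E2 + 1" "c \<noteq> tau y * l1"
  shows "l1 = 0"
proof (rule ccontr)
  interpret m: nonhopf_jet "g y" "A y" "\<phi> y" "\<xi> y" k "h y" U "al y" b "gam y" l1 l2 E1 E2 "nabA y" c "fd h y"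
    using assms(1) by (simp add: NH_def)
  assume "l1 \<noteq> 0"
  moreover have "card E1 \<ge> 2" using NH_facts(4)[OF assms(1)] assms(3) n3 by linarith
  ultimately have "fd h y m.P = 0" using m.large_eigenspace_ev[OF assms(2)] by simp
  then show False using m.ev1_dh0(1)[OF assms(2)] assms(4) NH_facts(1)[OF assms(1)] by (simp add: m.P_H)
qed

text \<open>The product of \<open>c - tau x * l1\<close> and \<open>c - tau x * l2\<close>, written
  symmetrically so that it is continuous on \<open>\<Omega>\<close>.\<close>

definition disc :: "'b \<Rightarrow> real" where "disc x = c\<^sup>2 - c * tau x * h x + k * (tau x)\<^sup>2"

lemma disc_NH: assumes "NH y U b l1 l2 E1 E2" shows "disc y = (c - tau y * l1) * (c - tau y * l2)"
proof -
  interpret m: nonhopf_jet "g y" "A y" "\<phi> y" "\<xi> y" k "h y" U "al y" b "gam y" l1 l2 E1 E2 "nabA y" c "fd h y"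
    using assms(1) by (simp add: NH_def)
  have "disc y = c\<^sup>2 - c * tau y * (l1 + l2) + l1 * l2 * (tau y)\<^sup>2" by (simp add: disc_def m.roots)
  then show ?thesis by (simp add: algebra_simps power2_eq_square)
qed

text \<open>Neither eigenvalue satisfies \<open>c = \<tau> l\<close>, so both eigenspaces are
  totally real. The count puts \<open>P\<close> into the larger one, listed first here, and
  \<open>large_totally_real\<close> makes its eigenvalue 0.\<close>

lemma disc_ne_0:
  assumes y: "y \<in> \<Omega>" "disc y \<noteq> 0"
  shows "\<exists>U b l2 E1 E2. NH y U b 0 l2 E1 E2 \<and>
    nonhopf.ev (g y) (A y) (\<xi> y) U 0 (nonhopf.P (\<phi> y) U) \<and> card E1 = card E2 + 1 \<and>
    (\<forall>X Y. nonhopf.ev (g y) (A y) (\<xi> y) U l2 X \<longrightarrow> nonhopf.ev (g y) (A y) (\<xi> y) U l2 Y \<longrightarrow> g y (\<phi> y X) Y = 0)"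
proof -
  obtain U b l1 l2 E1 E2 where nh: "NH y U b l1 l2 E1 E2" using NH_exists[OF y(1)] .
  interpret m: nonhopf_jet "g y" "A y" "\<phi> y" "\<xi> y" k "h y" U "al y" b "gam y" l1 l2 E1 E2 "nabA y" c "fd h y"
    using nh by (simp add: NH_def)
  have c: "c \<noteq> m.\<tau> * l1" "c \<noteq> m.\<tau> * l2" using y(2) disc_NH[OF nh] NH_facts(1)[OF nh] by auto
  have tr1: "g y (\<phi> y X) Y = 0" if "m.ev l1 X" "m.ev l1 Y" for X Y
    using m.not_totally_real[OF that] c(1) by blast
  have tr2: "g y (\<phi> y X) Y = 0" if "m.ev l2 X" "m.ev l2 Y" for X Y
    using m.not_totally_real[OF that] c(2) by blast
  have "odd (DIM('b))" using dim n3 by simp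
  then consider "card E1 = card E2 + 1" "m.ev l1 m.P" | "card E2 = card E1 + 1" "m.ev l2 m.P"
    using m.totally_real_count[OF tr1 tr2] m.ev_E by blast
  then show ?thesis
  proof cases
    case 1
    then have "l1 = 0" using large_totally_real[OF nh] c NH_facts(1)[OF nh] by simp
    then show ?thesis using nh 1 tr2 by blast
  next
    case 2
    then have "l2 = 0" using large_totally_real[OF NH_swap[OF nh]] c NH_facts(1)[OF nh] by simp
    then show ?thesis using NH_swap[OF nh] 2 tr1 by blast
  qed
qed

text \<open>On the open set where \<open>disc\<close> is nonzero, \<open>A Q = 0\<close> throughout,
  so this equation may be differentiated and \<open>totally_real_zero\<close> applies. It makes
  \<open>h\<close> stationary, and then \<open>ev1_dh0\<close> with eigenvalue 0 gives
  \<open>c = 0\<close>.\<close>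

lemma disc_eq_0: assumes x: "x \<in> \<Omega>" shows "disc x = 0"
proof (rule ccontr)
  assume d: "disc x \<noteq> 0"
  define O' where "O' = {y \<in> \<Omega>. disc y \<noteq> 0}"
  have s: "\<Omega> \<subseteq> W" by (auto simp: \<Omega>_def)
  have "continuous_on \<Omega> disc"
    unfolding disc_def
    by (intro continuous_intros smooth_on_continuous[OF smooth_tau] continuous_on_subset[OF smooth_on_continuous[OF smooth_h] s])
  moreover have "O' = \<Omega> \<inter> disc -` (- {0})" by (auto simp: O'_def)
  ultimately have O: "open O'" "O' \<subseteq> \<Omega>"
    using continuous_open_preimage[OF _ \<Omega>_open, of disc "- {0}"] by (auto simp: open_Compl O'_def)
  have OW: "O' \<subseteq> W" using O s by blast
  have AQ: "A y (Q y) = 0 *\<^sub>R Q y" if "y \<in> O'" for y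
  proof -
    have "y \<in> \<Omega>" "disc y \<noteq> 0" using that by (auto simp: O'_def)
    then obtain U b l2 E1 E2 where nh: "NH y U b 0 l2 E1 E2"
      "nonhopf.ev (g y) (A y) (\<xi> y) U 0 (nonhopf.P (\<phi> y) U)" using disc_ne_0 by blast
    interpret m: nonhopf_jet "g y" "A y" "\<phi> y" "\<xi> y" k "h y" U "al y" b "gam y" 0 l2 E1 E2 "nabA y" c "fd h y"
      using nh by (simp add: NH_def)
    show ?thesis using nh(2) NH_facts(2)[OF nh(1)] by (simp add: m.A_simps m.ev_def)
  qed
  define m where "m = real n - 2"
  have hh: "(3 + 2 * m) * c + (1 - m) * m * (h y)\<^sup>2 = 0" if y: "y \<in> O'" for y
  proof -
    have "y \<in> \<Omega>" "disc y \<noteq> 0" using y by (auto simp: O'_def)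
    then obtain U b l2 E1 E2 where nh: "NH y U b 0 l2 E1 E2"
      "nonhopf.ev (g y) (A y) (\<xi> y) U 0 (nonhopf.P (\<phi> y) U)" "card E1 = card E2 + 1"
      "\<And>X Y. nonhopf.ev (g y) (A y) (\<xi> y) U l2 X \<Longrightarrow> nonhopf.ev (g y) (A y) (\<xi> y) U l2 Y \<Longrightarrow> g y (\<phi> y X) Y = 0"
      using disc_ne_0 by blast
    interpret m: nonhopf_jet "g y" "A y" "\<phi> y" "\<xi> y" k "h y" U "al y" b "gam y" 0 l2 E1 E2 "nabA y" c "fd h y"
      using nh by (simp add: NH_def)
    have "card E2 = n - 2" using NH_facts(4)[OF nh(1)] nh(3) n3 by linarith
    then have c2: "real (card E2) = m" "E2 \<noteq> {}" using n3 by (auto simp: m_def)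
    show ?thesis
      using m.totally_real_zero[OF nh(2) nh(4) _ refl nh(3) c2(2)] eigenfield[OF O(1) OW AQ y] c2(1) by simp
  qed
  have xO: "x \<in> O'" using x d by (simp add: O'_def)
  \<comment> \<open>For \<open>n = 3\<close> one has \<open>m = 1\<close>, and the equation is
    already \<open>5 c = 0\<close>. Otherwise both coefficients are nonzero, so
    \<open>h\<^sup>2\<close> is a nonzero constant.\<close>
  have "n \<noteq> 3" using hh[OF xO] c0 by (auto simp: m_def)
  then have mm: "(1 - m) * m \<noteq> 0" "3 + 2 * m \<noteq> 0" using n3 by (auto simp: m_def)
  define r where "r = - ((3 + 2 * m) * c) / ((1 - m) * m)"
  have hr: "h y * h y = r" if "y \<in> O'" for y
    using hh[OF that] mm by (simp add: r_def field_simps power2_eq_square)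
  have "r \<noteq> 0" using mm c0 by (simp add: r_def)
  then have h0: "h x \<noteq> 0" using hr[OF xO] by auto
  have dh: "fd h x u = 0" for u
  proof -
    have hd: "(h has_derivative fd h x) (at x)" using smooth_on_has_derivative[OF smooth_h] xO OW by blast
    have "fd (\<lambda>y. h y * h y) x u = fd (\<lambda>y. r) x u"
      by (rule fun_cong[OF fd_cong[OF O(1) xO]]) (rule hr)
    then show ?thesis using fd_eq[OF has_derivative_mult[OF hd hd]] h0 by simp
  qed
  obtain U b l2 E1 E2 where nh: "NH x U b 0 l2 E1 E2"
    "nonhopf.ev (g x) (A x) (\<xi> x) U 0 (nonhopf.P (\<phi> x) U)" using disc_ne_0[OF x d] by blast
  interpret m: nonhopf_jet "g x" "A x" "\<phi> x" "\<xi> x" k "h x" U "al x" b "gam x" 0 l2 E1 E2 "nabA x" c "fd h x"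
    using nh by (simp add: NH_def)
  show False using m.ev1_dh0(1)[OF nh(2) dh] c0 by (simp add: m.P_H)
qed

text \<open>If \<open>l1 = c / \<tau>\<close> and \<open>l2 = k \<tau> / c\<close> have multiplicities \<open>i\<close> and \<open>j\<close>, then
  \<open>\<tau> = i l1 + j l2\<close> reads \<open>\<tau>\<^sup>2 = i c\<^sup>2 / (c - j k)\<close>.\<close>

definition tau_values :: "real set" where
  "tau_values = (\<Union>i\<in>{..2 * n}. \<Union>j\<in>{..2 * n}. {t. t\<^sup>2 = real i * c\<^sup>2 / (c - real j * k)})"

lemma finite_tau_values: "finite tau_values"
proof -
  have "finite {t::real. t\<^sup>2 = r}" for r
  proof (rule finite_subset)
    show "{t::real. t\<^sup>2 = r} \<subseteq> {sqrt r, - sqrt r}"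
      by (auto simp: real_sqrt_abs abs_if split: if_splits)
  qed simp
  then show ?thesis unfolding tau_values_def by blast
qed

text \<open>A vanishing \<open>disc\<close> makes one eigenvalue equal to \<open>c / \<tau>\<close>,
  and \<open>l1 l2 = k\<close> gives the other. Inserting both in \<open>\<tau>_eq\<close> puts
  \<open>\<tau>\<close> into the finite set.\<close>

lemma principal_root:
  assumes y: "y \<in> \<Omega>"
  shows "\<exists>U b E1 E2. NH y U b (c / tau y) (k * tau y / c) E1 E2" "tau y \<in> tau_values" "tau y \<noteq> 0"
    "h y = c / tau y + k * tau y / c"
proof -
  have "\<exists>U b l1 l2 E1 E2. NH y U b l1 l2 E1 E2 \<and> c = tau y * l1"
  proof -
    obtain U b l1 l2 E1 E2 where nh: "NH y U b l1 l2 E1 E2" using NH_exists[OF y] .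
    then have "c = tau y * l1 \<or> c = tau y * l2" using disc_NH[OF nh] disc_eq_0[OF y] by simp
    then show ?thesis using nh NH_swap[OF nh] by blast
  qed
  then obtain U b l1 l2 E1 E2 where nh: "NH y U b l1 l2 E1 E2" and c: "c = tau y * l1" by blast
  interpret m: nonhopf_jet "g y" "A y" "\<phi> y" "\<xi> y" k "h y" U "al y" b "gam y" l1 l2 E1 E2 "nabA y" c "fd h y"
    using nh by (simp add: NH_def)
  note t = NH_facts(1)[OF nh]
  have t0: "tau y \<noteq> 0" using c c0 by auto
  have l1: "l1 = c / tau y" using c t0 by (simp add: field_simps)
  have l2: "l2 = k * tau y / c" using c c0 m.roots(2) by (simp add: field_simps)
  \<comment> \<open>An empty \<open>E1\<close> would leave a totally real \<open>E2\<close> with at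
    least 3 elements, while the count allows a difference of 1 only. Nonemptiness then excludes
    \<open>c = card E2 * k\<close> in the division below.\<close>
  have ne: "E1 \<noteq> {}"
  proof
    assume e: "E1 = {}"
    then have "card E2 \<ge> 3" using NH_facts(4)[OF nh] n3 by simp
    moreover have "c \<noteq> m.\<tau> * l2" using m.l1_l2 c t t0 by auto
    then have "\<And>X Y. X \<in> E2 \<Longrightarrow> Y \<in> E2 \<Longrightarrow> g y (\<phi> y X) Y = 0" using m.not_totally_real m.ev_E by blast
    moreover have "odd (DIM('b))" using dim n3 by simp
    ultimately show False using m.totally_real_count e by fastforce
  qed
  have "tau y = real (card E1) * (c / tau y) + real (card E2) * (k * tau y / c)"
    using m.\<tau>_eq t l1 l2 by simp
  then have "(tau y)\<^sup>2 * (c - card E2 * k) = card E1 * c\<^sup>2"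
    using t0 c0 by (simp add: field_simps power2_eq_square)
  moreover have "card E1 * c\<^sup>2 \<noteq> 0" using ne m.fin c0 by simp
  ultimately have "(tau y)\<^sup>2 = card E1 * c\<^sup>2 / (c - card E2 * k)"
    by (metis mult_eq_0_iff nonzero_eq_divide_eq)
  moreover have "card E1 \<le> 2 * n" "card E2 \<le> 2 * n" using NH_facts(4)[OF nh] by linarith+
  ultimately show "tau y \<in> tau_values" unfolding tau_values_def by blast
  show "h y = c / tau y + k * tau y / c" using m.roots(1) l1 l2 by simp
  show "\<exists>U b E1 E2. NH y U b (c / tau y) (k * tau y / c) E1 E2" using nh unfolding l1 l2 by blast
  show "tau y \<noteq> 0" by (rule t0)
qed

definition ST :: "real \<Rightarrow> 'b \<Rightarrow> 'b \<Rightarrow> real \<Rightarrow> 'b set \<Rightarrow> 'b set \<Rightarrow> bool" where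
  "ST t y U b E1 E2 \<longleftrightarrow> nonhopf_stationary (g y) (A y) (\<phi> y) (\<xi> y) k (h y) U (al y) b (gam y)
    (c / t) (k * t / c) E1 E2 (nabA y) c (fd h y)"

text \<open>A continuous function with finite range is constant on a ball, and \<open>h\<close> is a
  function of \<open>\<tau>\<close>. So \<open>h\<close> is stationary near
  \<open>x\<close>.\<close>

lemma stationary_near:
  assumes x: "x \<in> \<Omega>"
  obtains O' t where "open O'" "x \<in> O'" "O' \<subseteq> \<Omega>" "t \<noteq> 0"
    "\<And>y. y \<in> O' \<Longrightarrow> tau y = t" "\<And>y. y \<in> O' \<Longrightarrow> \<exists>U b E1 E2. ST t y U b E1 E2"
proof -
  obtain e where e: "e > 0" "ball x e \<subseteq> \<Omega>" using \<Omega>_open x openE by blast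
  have s: "\<Omega> \<subseteq> W" by (auto simp: \<Omega>_def)
  define t where "t = tau x"
  have t0: "t \<noteq> 0" using principal_root(3)[OF x] by (simp add: t_def)
  have "tau ` ball x e \<subseteq> tau_values"
  proof
    fix r assume "r \<in> tau ` ball x e"
    then obtain y where y: "y \<in> \<Omega>" "r = tau y" using e by blast
    show "r \<in> tau_values" using principal_root(2)[OF y(1)] by (simp add: y)
  qed
  then have "finite (tau ` ball x e)" using finite_tau_values finite_subset by blast
  then have "tau constant_on ball x e"
    using continuous_finite_range_constant[of "ball x e" tau] e
      continuous_on_subset[OF smooth_on_continuous[OF smooth_tau]] by simp
  then have tt: "tau y = t" if "y \<in> ball x e" for y
    using that e unfolding constant_on_def t_def by (metis centre_in_ball)
  have hc: "h y = c / t + k * t / c" if "y \<in> ball x e" for y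
    using principal_root(4)[of y] that e tt by auto
  have dh: "fd h y u = 0" if y: "y \<in> ball x e" for y u
    using fd_cong[OF open_ball y hc] by simp
  have "\<exists>U b E1 E2. ST t y U b E1 E2" if y: "y \<in> ball x e" for y
  proof -
    obtain U b E1 E2 where nh: "NH y U b (c / tau y) (k * tau y / c) E1 E2"
      using principal_root(1)[of y] y e by blast
    then have "ST t y U b E1 E2" unfolding ST_def
      using dh[OF y] tt[OF y] t0 c0 NH_facts(1)[OF nh]
      by (intro nonhopf_stationary.intro nonhopf_stationary_axioms.intro) (auto simp: NH_def)
    then show ?thesis by blast
  qed
  then show ?thesis using that[of "ball x e" t] e t0 tt by simp
qed

end

section \<open>No open region of points where \<open>\<xi>\<close> is not principal\<close>

locale stationary_region = ricci_condition W g A \<phi> \<xi> c n k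
  for W :: "'b::euclidean_space set" and g A \<phi> \<xi> c n k +
  fixes R :: "'b set" and t :: real
  assumes R: "open R" "R \<subseteq> \<Omega>" and t0: "t \<noteq> 0" and tau_t: "y \<in> R \<Longrightarrow> tau y = t"
    and ST: "y \<in> R \<Longrightarrow> \<exists>U b E1 E2. ST t y U b E1 E2"
begin

abbreviation "l1 \<equiv> c / t"
abbreviation "l2 \<equiv> k * t / c"

lemma R_W: "y \<in> R \<Longrightarrow> y \<in> W" using R by (auto simp: \<Omega>_def)

lemma metric_on_R: "metric_on R g"
  by (intro metric_on.intro R(1) ips R_W smooth_on_subset[OF smooth]) (use R_W in auto)

lemma cd_metric_R:
  assumes "smooth_on R Y" "smooth_on R Z" "x \<in> R"
  shows "fd (\<lambda>y. g y (Y y) (Z y)) x u = g x (cd Y x u) (Z x) + g x (Y x) (cd Z x u)"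
  using metric_on.metric_deriv_along[OF metric_on_R R(1) smooth_on_id[OF R(1)] _ assms] by simp

lemma ST_NH: "ST t y U b E1 E2 \<Longrightarrow> NH y U b l1 l2 E1 E2"
  unfolding ST_def NH_def by (rule nonhopf_stationary.axioms)

lemma A_Q: assumes y: "y \<in> R" shows "A y (Q y) = l1 *\<^sub>R Q y"
proof -
  obtain U b E1 E2 where st: "ST t y U b E1 E2" using ST[OF y] by blast
  interpret m: nonhopf_stationary "g y" "A y" "\<phi> y" "\<xi> y" k "h y" U "al y" b "gam y" l1 l2 E1 E2 "nabA y" c "fd h y"
    using st by (simp add: ST_def)
  show ?thesis using m.P_ev1 by (simp add: NH_facts(2)[OF ST_NH[OF st]] m.ev_def m.A_simps)
qed

lemma eigen: "y \<in> R \<Longrightarrow> nabA y Y (\<phi> y (A y (\<xi> y))) + A y (jet.E (g y) (A y) (\<phi> y) (\<xi> y) (nabA y) Y)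
    = l1 *\<^sub>R jet.E (g y) (A y) (\<phi> y) (\<xi> y) (nabA y) Y"
  using eigenfield[OF R(1) _ A_Q] R_W by blast

lemma cd_zero: "x \<in> W \<Longrightarrow> cd (\<lambda>y. 0) x u = 0"
  by (simp add: cd_const bilinear_rzero[OF bil_christoffel])

lemma smooth_on_R: "smooth_on W f \<Longrightarrow> smooth_on R f" using smooth_on_subset R_W by blast

lemma V_ne: "y \<in> R \<Longrightarrow> g y (V y) (V y) \<noteq> 0"
  using ips.eq_0_iff[OF ips[OF R_W]] R by (auto simp: \<Omega>_def)

text \<open>If the eigenspace of \<open>l2\<close> were nonzero, a unit eigenvector \<open>W0\<close> would satisfy
  \<open>\<langle>R(W0, Q) Q, W0\<rangle> = 0\<close>, while the Gauss equation gives \<open>2 c \<langle>Q, Q\<rangle>\<close>.\<close>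

lemma E2_empty:
  assumes x: "x \<in> R" and st: "ST t x U b E1 E2"
  shows "E2 = {}"
proof (rule ccontr)
  assume "E2 \<noteq> {}"
  then obtain W0 where W0: "W0 \<in> E2" by blast
  have xW: "x \<in> W" using R_W x .
  interpret m: nonhopf_stationary "g x" "A x" "\<phi> x" "\<xi> x" k "h x" U "al x" b "gam x" l1 l2 E1 E2 "nabA x" c "fd h x"
    using st by (simp add: ST_def)
  note F = NH_facts[OF ST_NH[OF st]]
  have W: "m.ev l2 W0" "g x W0 W0 = 1" using W0 m.ev_E m.onE(2) by (auto simp: m.ON_def)
  have tl: "t = l2" and ck: "c = k" using m.\<tau>_l2[OF W0 eigen[OF x]] F(1) tau_t[OF x] by simp_all
  have E0: "cd Q y Z = 0" if y: "y \<in> R" and s: "ST t y U' b' E1' E2'" and Z: "nonhopf.ev (g y) (A y) (\<xi> y) U' l2 Z" for y U' b' E1' E2' Z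
  proof -
    interpret m': nonhopf_stationary "g y" "A y" "\<phi> y" "\<xi> y" k "h y" U' "al y" b' "gam y" l1 l2 E1' E2' "nabA y" c "fd h y"
      using s by (simp add: ST_def)
    have "m'.\<tau> = l2" using NH_facts(1)[OF ST_NH[OF s]] tau_t[OF y] tl by simp
    then show ?thesis using m'.E_ev2[OF Z _ eigen[OF y]] cd_Q[OF R_W[OF y]] by simp
  qed
  \<comment> \<open>\<open>v\<close> is \<open>W0\<close> without its components along
    \<open>\<xi>\<close> and \<open>U\<close>, the latter written through \<open>V\<close>;
    \<open>Wf\<close> applies \<open>ev2_projection\<close> to it. The factor in \<open>Wf\<close>
    makes \<open>Wf x = W0\<close>.\<close>
  define v where "v y = W0 - g y W0 (\<xi> y) *\<^sub>R \<xi> y - (g y W0 (V y) / g y (V y) (V y)) *\<^sub>R V y" for y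
  define Wf where "Wf y = (1 / (l2 - l1)) *\<^sub>R (A y (v y) - l1 *\<^sub>R v y)" for y
  have sm: "smooth_on R \<xi>" "smooth_on R V" "smooth_on R Q" using \<xi>_smooth smooth_V smooth_Q smooth_on_R by auto
  have smg: "smooth_on R (\<lambda>y. g y (Y y) (Z y))" if "smooth_on R Y" "smooth_on R Z" for Y Z
    using metric_on.smooth_metric[OF metric_on_R that] .
  have sv: "smooth_on R v" unfolding v_def
    by (intro smooth_on_diff' smooth_on_scaleR smooth_on_divide smg smooth_on_const sm R(1) V_ne)
  have sW: "smooth_on R Wf" unfolding Wf_def
    by (intro smooth_on_scaleR smooth_on_diff' smooth_on_const R(1) sv
        smooth_on_linear_family[where \<beta>=A, OF R(1) A_linear[OF R_W] smooth_on_R[OF A_smooth] sv])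
  have Wf: "nonhopf.ev (g y) (A y) (\<xi> y) U' l2 (Wf y)" if y: "y \<in> R" and s: "ST t y U' b' E1' E2'" for y U' b' E1' E2'
  proof -
    interpret m': nonhopf_stationary "g y" "A y" "\<phi> y" "\<xi> y" k "h y" U' "al y" b' "gam y" l1 l2 E1' E2' "nabA y" c "fd h y"
      using s by (simp add: ST_def)
    have "(g y W0 (V y) / g y (V y) (V y)) *\<^sub>R V y = g y W0 U' *\<^sub>R U'"
      using m'.\<beta>0 by (simp add: NH_facts(3)[OF ST_NH[OF s]] m'.ip_simps m'.U_unit)
    then have "v y = W0 - g y W0 (\<xi> y) *\<^sub>R \<xi> y - g y W0 U' *\<^sub>R U'" by (simp add: v_def)
    then show ?thesis using m'.ev2_projection[of W0]
      by (simp add: Wf_def m'.ev_def m'.ip_simps m'.A_simps)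
  qed
  have Wx: "Wf x = W0"
  proof -
    have "v x = W0" using W(1) m.ev_sym[OF W(1)] F(3) by (simp add: v_def m.ev_def m.ip_simps)
    then have "Wf x = (1 / (l2 - l1)) *\<^sub>R ((l2 - l1) *\<^sub>R W0)" using W(1) by (simp add: Wf_def m.ev_def algebra_simps)
    then show ?thesis using m.l1_l2 by simp
  qed
  have EW: "cd Q y (Wf y) = 0" if "y \<in> R" for y using E0[OF that _ Wf[OF that]] ST[OF that] by blast
  have QW: "g y (Q y) (Wf y) = 0" "g y (cd Q y (Q y)) (Wf y) = 0" "A y (Wf y) = l2 *\<^sub>R Wf y" "g y (Wf y) (\<xi> y) = 0" if y: "y \<in> R" for y
  proof -
    obtain U' b' E1' E2' where s: "ST t y U' b' E1' E2'" using ST[OF y] by blast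
    interpret m': nonhopf_stationary "g y" "A y" "\<phi> y" "\<xi> y" k "h y" U' "al y" b' "gam y" l1 l2 E1' E2' "nabA y" c "fd h y"
      using s by (simp add: ST_def)
    have ew: "m'.ev l2 (Wf y)" using Wf[OF y s] .
    show q: "g y (Q y) (Wf y) = 0"
      using m'.P_ev2[OF ew] m'.sym[of "Wf y"] by (simp add: NH_facts(2)[OF ST_NH[OF s]] m'.ip_simps)
    obtain th where "m'.E (Q y) = th *\<^sub>R Q y" using m'.E_Q unfolding Q_def by blast
    then show "g y (cd Q y (Q y)) (Wf y) = 0" using q by (simp add: cd_Q[OF R_W[OF y]] m'.ip_simps)
    show "A y (Wf y) = l2 *\<^sub>R Wf y" "g y (Wf y) (\<xi> y) = 0" using ew by (auto simp: m'.ev_def)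
  qed
  have Ql: "linear (cd Q y)" if "y \<in> W" for y by (rule cd_linear[OF smooth_Q that])
  have Qs: "smooth_on W (\<lambda>y. cd Q y u)" for u
    by (rule smooth_cov[OF op smooth_on_id[OF op] _ smooth_Q smooth_on_const])
  have dW: "Wf differentiable (at x)" by (rule smooth_on_diff[OF sW x])
  define u where "u = W0"
  define q where "q = Q x"
  have cu: "cd Q x u = 0" using EW[OF x] by (simp add: Wx u_def)
  \<comment> \<open>\<open>D1\<close> and \<open>D2\<close> expand the derivatives of the fields
    \<open>cd Q y (Q y)\<close> and \<open>cd Q y (Wf y)\<close>, the second of which is 0. Their
    difference turns \<open>R(u, q) q\<close> into the derivative of the first along
    \<open>u\<close>.\<close>
  have D1: "cd (\<lambda>y. cd Q y (Q y)) x u = cd (\<lambda>y. cd Q y q) x u - cd Q x (\<Gamma> x u q)"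
    using cd_endo[where L="cd Q", OF Ql Qs smooth_on_diff[OF smooth_Q xW] xW, of u]
    by (simp add: cu linear_0[OF Ql[OF xW]] q_def)
  have D2: "cd (\<lambda>y. cd Q y u) x q - cd Q x (\<Gamma> x q u) + cd Q x (cd Wf x q) = 0"
  proof -
    have "cd (\<lambda>y. cd Q y (Wf y)) x q = cd (\<lambda>y. 0) x q" by (rule cov_cong[OF R(1) x]) (rule EW)
    then show ?thesis using cd_endo[where L="cd Q", OF Ql Qs dW xW, of q]
      by (simp add: Wx u_def cd_zero[OF xW])
  qed
  \<comment> \<open>The derivative of \<open>Wf\<close> along \<open>Q\<close> stays in the
    eigenspace of \<open>l2\<close>, where \<open>cd Q x\<close> vanishes; this removes the last
    term of \<open>D2\<close>.\<close>
  have ez: "m.ev l2 (cd Wf x q)"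
  proof -
    define z where "z = cd Wf x q"
    have qP: "q = b *\<^sub>R m.P" using F(2) by (simp add: q_def)
    have "cd (\<lambda>y. A y (Wf y)) x q = cd (\<lambda>y. l2 *\<^sub>R Wf y) x q" by (rule cov_cong[OF R(1) x]) (rule QW)
    moreover have "cd (\<lambda>y. l2 *\<^sub>R Wf y) x q = l2 *\<^sub>R z"
      using cov_scale[where F="\<lambda>x. x" and f="\<lambda>x. l2" and Z=Wf and x=x and u=q] dW xW by (simp add: z_def)
    moreover have "nabA x q W0 = 0" using m.N_P_ev2_eq_0[OF W(1)] by (simp add: qP m.N_simps)
    ultimately have Az: "A x z = l2 *\<^sub>R z" by (simp add: cd_A[OF dW xW] Wx z_def)
    have "fd (\<lambda>y. g y (Wf y) (\<xi> y)) x q = fd (\<lambda>y. 0) x q"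
      by (rule fun_cong[OF fd_cong[OF R(1) x]]) (rule QW)
    then have "g x z (\<xi> x) + g x W0 (\<phi> x (A x q)) = 0"
      using cd_metric_R[OF sW sm(1) x, of q] by (simp add: z_def Wx nabla_\<xi>[OF xW])
    moreover have "g x W0 (\<phi> x (A x q)) = 0"
      using A_Q[OF x] W(1) by (simp add: q_def[symmetric] m.\<phi>_simps m.ip_simps) (simp add: qP m.\<phi>_simps m.\<phi>_P m.ip_simps m.ev_def)
    ultimately have z1: "g x z (\<xi> x) = 0" by simp
    have "g x (A x z) (\<xi> x) = g x z (A x (\<xi> x))" by (rule A_sym[OF xW])
    then have "g x z U = 0" using z1 m.\<beta>0 by (simp add: Az m.A_\<xi> m.ip_simps)
    then show ?thesis using Az z1 by (simp add: m.ev_def z_def)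
  qed
  have "local_curvature g x u q q = cd (\<lambda>y. cd Q y q) x u - cd (\<lambda>y. cd Q y u) x q"
    using cov_commutator[OF op smooth_on_id[OF op] _ smooth_Q xW, of q u] by (simp add: q_def)
  also have "\<dots> = cd (\<lambda>y. cd Q y (Q y)) x u"
    using D1 D2 E0[OF x st ez] christoffel_sym[OF xW, of q u] by simp
  finally have Rc: "local_curvature g x u q q = cd (\<lambda>y. cd Q y (Q y)) x u" .
  \<comment> \<open>The derivative of \<open>Q\<close> along itself is parallel to \<open>Q\<close>,
    and both are orthogonal to \<open>Wf\<close>. Differentiating these orthogonality relations
    along \<open>u\<close>, where \<open>cd Q x u = 0\<close>, leaves no component along
    \<open>W0\<close>.\<close>
  have "g x (cd (\<lambda>y. cd Q y (Q y)) x u) W0 = 0"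
  proof -
    have sQQ: "smooth_on R (\<lambda>y. cd Q y (Q y))"
      by (rule smooth_on_R, rule smooth_cov[OF op smooth_on_id[OF op] _ smooth_Q smooth_Q])
    have "fd (\<lambda>y. g y (cd Q y (Q y)) (Wf y)) x u = fd (\<lambda>y. 0) x u"
      by (rule fun_cong[OF fd_cong[OF R(1) x]]) (rule QW)
    then have 1: "g x (cd (\<lambda>y. cd Q y (Q y)) x u) W0 + g x (cd Q x (Q x)) (cd Wf x u) = 0"
      using cd_metric_R[OF sQQ sW x, of u] by (simp add: Wx)
    have "fd (\<lambda>y. g y (Q y) (Wf y)) x u = fd (\<lambda>y. 0) x u"
      by (rule fun_cong[OF fd_cong[OF R(1) x]]) (rule QW)
    then have 2: "g x (Q x) (cd Wf x u) = 0"
      using cd_metric_R[OF sm(3) sW x, of u] cu by (simp add: m.zero_l)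
    obtain th where "m.E (Q x) = th *\<^sub>R Q x" using m.E_Q unfolding Q_def by blast
    then show ?thesis using 1 2 by (simp add: cd_Q[OF xW] m.ip_simps)
  qed
  then have "g x (local_curvature g x u q q) W0 = 0" using Rc by simp
  moreover have "g x (local_curvature g x u q q) W0 = (c + l1 * l2) * g x q q"
  proof -
    have "g x W0 q = 0" using QW(1)[OF x] m.sym[of W0] by (simp add: Wx q_def)
    moreover have "g x (\<phi> x q) W0 = 0" using F(2) m.ev_sym[OF W(1)] by (simp add: q_def m.\<phi>_simps m.\<phi>_P m.ip_simps)
    moreover have "A x q = l1 *\<^sub>R q" "A x W0 = l2 *\<^sub>R W0" using A_Q[OF x] W(1) by (auto simp: q_def m.ev_def)
    ultimately show ?thesis unfolding gauss[OF xW] u_def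
      using W(2) m.sym[of q W0] by (simp add: m.ip_simps m.g_\<phi>_self algebra_simps)
  qed
  moreover have "l1 * l2 = c" using ck c0 t0 by simp
  moreover have "g x q q = b * b" using F(2) by (simp add: q_def m.ip_simps m.P_H)
  ultimately show False using c0 m.\<beta>0 by simp
qed

definition sl :: "'b \<Rightarrow> real" where "sl y = - 2 * (t * (l1 - gam y) / (l1 - l2) + l1)"

lemma fd_al: assumes y: "y \<in> R" shows "fd al y u = sl y * g y (Q y) u"
proof -
  have yW: "y \<in> W" using R_W y .
  obtain U b E1 E2 where s: "ST t y U b E1 E2" using ST[OF y] by blast
  interpret m: nonhopf_stationary "g y" "A y" "\<phi> y" "\<xi> y" k "h y" U "al y" b "gam y" l1 l2 E1 E2 "nabA y" c "fd h y"
    using s by (simp add: ST_def)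
  have "m.slope = sl y" using NH_facts(1)[OF ST_NH[OF s]] tau_t[OF y] by (simp add: m.slope_def sl_def)
  moreover have "fd al y u = g y (cd (\<lambda>y. A y (\<xi> y)) y u) (\<xi> y) + g y (A y (\<xi> y)) (cd \<xi> y u)"
    unfolding al_def by (rule cd_metric[OF smooth_A[OF \<xi>_smooth] \<xi>_smooth yW])
  ultimately show ?thesis
    using m.d\<alpha>[of u] m.sym[of "\<phi> y (A y u)" "A y (\<xi> y)"]
    by (simp add: cd_A[OF smooth_on_diff[OF \<xi>_smooth yW] yW] nabla_\<xi>[OF yW] m.ip_simps A_sym[OF yW, of "\<phi> y (A y u)"] Q_def)
qed

text \<open>The second derivatives of \<open>al\<close> in the directions \<open>U\<close> and
  \<open>\<xi>\<close> commute. By \<open>fd_al\<close> its differential is \<open>sl\<close> times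
  the dual of \<open>Q\<close>, to which both vectors are orthogonal, so the derivative of
  \<open>sl\<close> drops out. As \<open>sl\<close> is nonzero, \<open>curl_E\<close>
  applies.\<close>

lemma gam_const: assumes x: "x \<in> R" shows "(l2 - t) * (l1 - l2) = - 2 * t * (l1 - gam x)"
proof -
  have xW: "x \<in> W" using R_W x .
  obtain U b E1 E2 where s: "ST t x U b E1 E2" using ST[OF x] by blast
  interpret m: nonhopf_stationary "g x" "A x" "\<phi> x" "\<xi> x" k "h x" U "al x" b "gam x" l1 l2 E1 E2 "nabA x" c "fd h x"
    using s by (simp add: ST_def)
  note F = NH_facts[OF ST_NH[OF s]]
  have tt: "m.\<tau> = t" using F(1) tau_t[OF x] by simp
  have "m.slope = sl x" using tt by (simp add: m.slope_def sl_def)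
  then have s0: "sl x \<noteq> 0" using m.slope_ne_0[OF E2_empty[OF x s]] by simp
  have ssl: "smooth_on R sl" unfolding sl_def
    by (intro smooth_on_mult smooth_on_add smooth_on_divide smooth_on_diff' smooth_on_const R(1)
        smooth_on_subset[OF smooth_gam R(2)]) (use m.l1_l2 in auto)
  have d: "fd (\<lambda>y. fd al y v) x u = sl x * (g x (cd Q x u) v + g x (Q x) (\<Gamma> x u v))" if "g x (Q x) v = 0" for u v
  proof -
    have sg: "smooth_on R (\<lambda>y. g y (Q y) v)" by (rule smooth_on_R) (intro smooth_metric smooth_Q smooth_on_const)
    have "fd (\<lambda>y. fd al y v) x u = fd (\<lambda>y. sl y * g y (Q y) v) x u"
      by (rule fun_cong[OF fd_cong[OF R(1) x]]) (rule fd_al)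
    also have "\<dots> = sl x * fd (\<lambda>y. g y (Q y) v) x u"
      using fd_eq[OF has_derivative_mult[OF smooth_on_has_derivative[OF ssl x] smooth_on_has_derivative[OF sg x]]] that
      by simp
    finally show ?thesis using cd_metric[OF smooth_Q smooth_on_const xW, of v u] by (simp add: cd_const)
  qed
  have z: "g x (Q x) U = 0" "g x (Q x) (\<xi> x) = 0" using F(2) by (simp_all add: m.ip_simps m.P_H)
  have "fd (\<lambda>y. fd al y (\<xi> x)) x U = fd (\<lambda>y. fd al y U) x (\<xi> x)"
    by (rule fd_fd_commute_real[OF op xW smooth_al])
  then have "g x (cd Q x U) (\<xi> x) = g x (cd Q x (\<xi> x)) U"
    using s0 christoffel_sym[OF xW, of U "\<xi> x"] by (simp add: d z)
  then have "g x (m.E U) (\<xi> x) = g x (m.E (\<xi> x)) U" by (simp add: cd_Q[OF xW])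
  then have "(h x - t - l1) * (l1 - l2) = - 2 * t * (l1 - gam x)" using m.curl_E unfolding tt by blast
  moreover have "h x - t - l1 = l2 - t" using m.roots(1) by linarith
  ultimately show ?thesis by (simp only:)
qed

text \<open>\<open>gam_const\<close> expresses \<open>gam\<close> by constants, hence also
  \<open>al = l1 + l2 - t - gam\<close>. But the derivative of \<open>al\<close> along
  \<open>Q\<close> is \<open>sl\<close> times the squared length of \<open>Q\<close>, which is
  nonzero.\<close>

lemma R_empty: "R = {}"
proof (rule ccontr)
  assume "R \<noteq> {}"
  then obtain x where x: "x \<in> R" by blast
  have xW: "x \<in> W" using R_W x .
  define a where "a = l1 + l2 - t - (l1 + (l2 - t) * (l1 - l2) / (2 * t))"
  have al: "al y = a" if y: "y \<in> R" for y
  proof -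
    obtain U b E1 E2 where s: "ST t y U b E1 E2" using ST[OF y] by blast
    interpret m: nonhopf_stationary "g y" "A y" "\<phi> y" "\<xi> y" k "h y" U "al y" b "gam y" l1 l2 E1 E2 "nabA y" c "fd h y"
      using s by (simp add: ST_def)
    have "l1 + l2 - al y - gam y = t" using tau_t[OF y] m.roots(1) by (simp add: tau_def)
    moreover have "gam y = l1 + (l2 - t) * (l1 - l2) / (2 * t)"
    proof -
      have "(l2 - t) * (l1 - l2) / (2 * t) = gam y - l1" unfolding gam_const[OF y] using t0 by (simp add: field_simps)
      then show ?thesis by simp
    qed
    ultimately show ?thesis by (simp add: a_def)
  qed
  obtain U b E1 E2 where s: "ST t x U b E1 E2" using ST[OF x] by blast
  interpret m: nonhopf_stationary "g x" "A x" "\<phi> x" "\<xi> x" k "h x" U "al x" b "gam x" l1 l2 E1 E2 "nabA x" c "fd h x"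
    using s by (simp add: ST_def)
  note F = NH_facts[OF ST_NH[OF s]]
  have "m.slope = sl x" using F(1) tau_t[OF x] by (simp add: m.slope_def sl_def)
  then have s0: "sl x \<noteq> 0" using m.slope_ne_0[OF E2_empty[OF x s]] by simp
  have "fd al x (Q x) = 0" using fd_cong[OF R(1) x al] by simp
  then have "g x (Q x) (Q x) = 0" using fd_al[OF x] s0 by simp
  then show False using F(2) m.\<beta>0 by (simp add: m.ip_simps m.P_H)
qed

end

section \<open>The Hopf condition and the values of \<open>S(\<xi>, \<xi>)\<close>\<close>

context ricci_condition begin

lemma \<Omega>_empty: "\<Omega> = {}"
proof (rule ccontr)
  assume "\<Omega> \<noteq> {}"
  then obtain x where x: "x \<in> \<Omega>" by blast
  show False
  proof (rule stationary_near[OF x])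
    fix R t assume R: "open R" "x \<in> R" "R \<subseteq> \<Omega>" "t \<noteq> 0"
      "\<And>y. y \<in> R \<Longrightarrow> tau y = t" "\<And>y. y \<in> R \<Longrightarrow> \<exists>U b E1 E2. ST t y U b E1 E2"
    have "stationary_region W g A \<phi> \<xi> c n k R t"
      using R ricci_condition_axioms by (intro stationary_region.intro stationary_region_axioms.intro) auto
    then show False using stationary_region.R_empty R by blast
  qed
qed

theorem hopf: "x \<in> W \<Longrightarrow> A x (\<xi> x) = al x *\<^sub>R \<xi> x"
  using \<Omega>_empty by (auto simp: \<Omega>_def V_def)

text \<open>Differentiating \<open>A \<xi> = \<alpha> \<xi>\<close> and pairing with
  \<open>H\<close>, where the derivative of \<open>\<alpha>\<close> drops out, determines the
  derivative of \<open>A\<close> on \<open>\<xi>\<close>. Antisymmetrising it with Codazzi gives the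
  quadratic relation that \<open>hopf_value\<close> requires.\<close>

theorem principal_curvature_values:
  assumes x: "x \<in> W"
  shows "al x * (h x - al x) \<in> {c + k - (2 * real n - 2) * c, 0, 2 * (real n - 1) * (k - c), 2 * (k + c)}"
proof -
  interpret j: jet "g x" "A x" "\<phi> x" "\<xi> x" k "h x" "nabA x" c "fd h x" by (rule jet_at[OF x])
  have C: "g x (nabA x X (\<xi> x)) Y = al x * g x (\<phi> x (A x X)) Y - g x (A x (\<phi> x (A x X))) Y" if "g x Y (\<xi> x) = 0" for X Y
  proof -
    have "cd (\<lambda>y. A y (\<xi> y)) x X = cd (\<lambda>y. al y *\<^sub>R \<xi> y) x X" by (rule cov_cong[OF op x]) (rule hopf)
    then have "nabA x X (\<xi> x) + A x (\<phi> x (A x X)) = al x *\<^sub>R \<phi> x (A x X) + fd al x X *\<^sub>R \<xi> x"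
      using cov_scale[where F="\<lambda>x. x" and f=al and Z=\<xi> and x=x and u=X] smooth_on_diff[OF smooth_al x] smooth_on_diff[OF \<xi>_smooth x] x
      by (simp add: cd_A[OF smooth_on_diff[OF \<xi>_smooth x] x] nabla_\<xi>[OF x])
    from arg_cong[OF this, of "\<lambda>v. g x v Y"] show ?thesis
      using that j.sym[of "\<xi> x" Y] by (simp add: j.ip_simps algebra_simps)
  qed
  show ?thesis
  proof (rule j.hopf_value[OF dim _ hopf[OF x]])
    show "2 \<le> n" using n3 by simp
    fix X Y assume X: "g x X (\<xi> x) = 0" and Y: "g x Y (\<xi> x) = 0"
    have "g x (nabA x X Y) (\<xi> x) - g x (nabA x Y X) (\<xi> x) = - 2 * c * g x (\<phi> x X) Y"
      using j.cod[of X Y "\<xi> x"] X Y by (simp add: j.\<xi>_unit)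
    moreover have "g x (nabA x X Y) (\<xi> x) = al x * g x (\<phi> x (A x X)) Y - g x (A x (\<phi> x (A x X))) Y"
      using C[OF Y, of X] j.C_sym[of X Y "\<xi> x"] by simp
    moreover have "g x (nabA x Y X) (\<xi> x) = - al x * g x (A x (\<phi> x X)) Y + g x (A x (\<phi> x (A x X))) Y"
    proof -
      have "g x (\<phi> x (A x Y)) X = - g x (A x (\<phi> x X)) Y"
        using j.\<phi>_skew[of "A x Y" X] j.A_sym[of Y "\<phi> x X"] j.sym[of Y "A x (\<phi> x X)"] by simp
      moreover have "g x (A x (\<phi> x (A x Y))) X = - g x (A x (\<phi> x (A x X))) Y"
        using j.A_sym[of "\<phi> x (A x Y)" X] j.\<phi>_skew[of "A x Y" "A x X"] j.A_sym[of Y "\<phi> x (A x X)"]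
          j.sym[of Y "A x (\<phi> x (A x X))"] by simp
      ultimately show ?thesis using C[OF X, of Y] j.C_sym[of Y X "\<xi> x"] by simp
    qed
    ultimately show "2 * g x (A x (\<phi> x (A x X))) Y = al x * (g x (\<phi> x (A x X)) Y + g x (A x (\<phi> x X)) Y) + 2 * c * g x (\<phi> x X) Y"
      by (simp add: algebra_simps)
  qed
qed

end

section \<open>Transfer to manifolds\<close>

locale manifold =
  fixes A :: "('m::{t2_space,second_countable_topology}, 'h::euclidean_space) chart set"
  assumes smooth_manifold: "smooth_manifold A"
begin

lemma chart:
  assumes "\<kappa> \<in> A"
  shows "open (chart_dom \<kappa>)" "open (chart_image \<kappa>)"
    "homeomorphism (chart_dom \<kappa>) (chart_image \<kappa>) (coords \<kappa>) (chart_inv \<kappa>)"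
  using smooth_manifold assms unfolding smooth_manifold_def by blast+

lemma inv_coords: "\<kappa> \<in> A \<Longrightarrow> p \<in> chart_dom \<kappa> \<Longrightarrow> chart_inv \<kappa> (coords \<kappa> p) = p"
  using chart(3) unfolding homeomorphism_def by blast

lemma coords_inv:
  assumes "\<kappa> \<in> A" "x \<in> chart_image \<kappa>"
  shows "coords \<kappa> (chart_inv \<kappa> x) = x" "chart_inv \<kappa> x \<in> chart_dom \<kappa>"
  using chart(3)[OF assms(1)] assms(2) unfolding homeomorphism_def by blast+

lemma chart_at: "chart_at A p \<in> A" "p \<in> chart_dom (chart_at A p)"
proof -
  have "\<exists>\<kappa>. \<kappa> \<in> A \<and> p \<in> chart_dom \<kappa>" using smooth_manifold unfolding smooth_manifold_def by blast
  then have "chart_at A p \<in> A \<and> p \<in> chart_dom (chart_at A p)" unfolding chart_at_def by (rule someI_ex)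
  then show "chart_at A p \<in> A" "p \<in> chart_dom (chart_at A p)" by auto
qed

lemma mem_image:
  assumes "\<kappa> \<in> A"
  shows "x \<in> coords \<kappa> ` (chart_dom \<kappa> \<inter> U) \<longleftrightarrow> x \<in> chart_image \<kappa> \<and> chart_inv \<kappa> x \<in> U"
proof
  assume "x \<in> coords \<kappa> ` (chart_dom \<kappa> \<inter> U)"
  then obtain p where "p \<in> chart_dom \<kappa>" "p \<in> U" "x = coords \<kappa> p" by blast
  then show "x \<in> chart_image \<kappa> \<and> chart_inv \<kappa> x \<in> U" using inv_coords[OF assms] by (auto simp: chart_image_def)
next
  assume "x \<in> chart_image \<kappa> \<and> chart_inv \<kappa> x \<in> U"
  then show "x \<in> coords \<kappa> ` (chart_dom \<kappa> \<inter> U)" using coords_inv[OF assms, of x] by (metis IntI image_eqI)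
qed

lemma open_image: assumes "\<kappa> \<in> A" "open U" shows "open (coords \<kappa> ` (chart_dom \<kappa> \<inter> U))"
proof -
  have "coords \<kappa> ` (chart_dom \<kappa> \<inter> U) = chart_image \<kappa> \<inter> chart_inv \<kappa> -` U" using mem_image[OF assms(1)] by blast
  moreover have "continuous_on (chart_image \<kappa>) (chart_inv \<kappa>)" using chart(3)[OF assms(1)] unfolding homeomorphism_def by blast
  ultimately show ?thesis using continuous_open_preimage[OF _ chart(2)[OF assms(1)] assms(2)] by simp
qed

lemma transition_at: "\<kappa> \<in> A \<Longrightarrow> p \<in> chart_dom \<kappa> \<Longrightarrow> transition \<kappa> \<kappa>' (coords \<kappa> p) = coords \<kappa>' p"
  by (simp add: transition_def inv_coords)

lemma smooth_transition:
  "\<kappa> \<in> A \<Longrightarrow> \<kappa>' \<in> A \<Longrightarrow> smooth_on (coords \<kappa> ` (chart_dom \<kappa> \<inter> chart_dom \<kappa>')) (transition \<kappa> \<kappa>')"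
  using smooth_manifold unfolding smooth_manifold_def by blast

lemma transition_diff:
  "\<kappa> \<in> A \<Longrightarrow> \<kappa>' \<in> A \<Longrightarrow> p \<in> chart_dom \<kappa> \<Longrightarrow> p \<in> chart_dom \<kappa>' \<Longrightarrow> transition \<kappa> \<kappa>' differentiable (at (coords \<kappa> p))"
  by (rule smooth_on_diff[OF smooth_transition]) auto

lemma fd_transition_comp:
  assumes A: "\<kappa> \<in> A" "\<kappa>' \<in> A" "\<kappa>'' \<in> A" and p: "p \<in> chart_dom \<kappa>" "p \<in> chart_dom \<kappa>'" "p \<in> chart_dom \<kappa>''"
  shows "fd (transition \<kappa>' \<kappa>'') (coords \<kappa>' p) (fd (transition \<kappa> \<kappa>') (coords \<kappa> p) v)
    = fd (transition \<kappa> \<kappa>'') (coords \<kappa> p) v"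
proof -
  define T where "T = coords \<kappa> ` (chart_dom \<kappa> \<inter> chart_dom \<kappa>')"
  have T: "open T" "coords \<kappa> p \<in> T" using open_image[OF A(1) chart(1)[OF A(2)]] p by (auto simp: T_def)
  have "fd (transition \<kappa> \<kappa>'') (coords \<kappa> p) v = fd (\<lambda>x. transition \<kappa>' \<kappa>'' (transition \<kappa> \<kappa>' x)) (coords \<kappa> p) v"
  proof (rule fun_cong[OF fd_cong[OF T]])
    fix y assume "y \<in> T"
    then obtain q where "q \<in> chart_dom \<kappa>" "q \<in> chart_dom \<kappa>'" "y = coords \<kappa> q" by (auto simp: T_def)
    then show "transition \<kappa> \<kappa>'' y = transition \<kappa>' \<kappa>'' (transition \<kappa> \<kappa>' y)" using A by (simp add: transition_at)
  qed
  also have "\<dots> = fd (transition \<kappa>' \<kappa>'') (transition \<kappa> \<kappa>' (coords \<kappa> p)) (fd (transition \<kappa> \<kappa>') (coords \<kappa> p) v)"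
    by (rule fd_chain) (use A p transition_at transition_diff in auto)
  finally show ?thesis using A p by (simp add: transition_at)
qed

lemma fd_transition_self:
  assumes "\<kappa> \<in> A" "p \<in> chart_dom \<kappa>" shows "fd (transition \<kappa> \<kappa>) (coords \<kappa> p) v = v"
proof -
  have "fd (transition \<kappa> \<kappa>) (coords \<kappa> p) = fd (\<lambda>x. x) (coords \<kappa> p)"
    by (rule fd_cong[OF chart(2)[OF assms(1)]]) (use assms coords_inv in \<open>auto simp: chart_image_def transition_def inv_coords\<close>)
  then show ?thesis by simp
qed

lemma linear_transition:
  "\<kappa> \<in> A \<Longrightarrow> \<kappa>' \<in> A \<Longrightarrow> p \<in> chart_dom \<kappa> \<Longrightarrow> p \<in> chart_dom \<kappa>' \<Longrightarrow> linear (fd (transition \<kappa> \<kappa>') (coords \<kappa> p))"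
  using linear_fd transition_diff by blast

lemma coord_vec_self: "\<kappa> \<in> A \<Longrightarrow> p \<in> chart_dom \<kappa> \<Longrightarrow> coord_vec A \<kappa> p v \<kappa> = v"
  by (simp add: coord_vec_def fd_transition_self)

lemma coord_vec_mem:
  assumes "\<kappa> \<in> A" "p \<in> chart_dom \<kappa>" shows "coord_vec A \<kappa> p v \<in> tangent_space A p"
  unfolding tangent_space_def coord_vec_def using assms fd_transition_comp by auto

lemma coord_vec_eq:
  assumes "\<kappa> \<in> A" "p \<in> chart_dom \<kappa>" "X \<in> tangent_space A p" shows "coord_vec A \<kappa> p (X \<kappa>) = X"
proof
  fix \<kappa>'
  show "coord_vec A \<kappa> p (X \<kappa>) \<kappa>' = X \<kappa>'"
  proof (cases "\<kappa>' \<in> A \<and> p \<in> chart_dom \<kappa>'")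
    case True
    then have "X \<kappa>' = fd (transition \<kappa> \<kappa>') (coords \<kappa> p) (X \<kappa>)"
      using assms unfolding tangent_space_def by blast
    then show ?thesis using True by (simp add: coord_vec_def)
  next
    case False
    then have "X \<kappa>' = 0" using assms unfolding tangent_space_def by blast
    then show ?thesis using False by (auto simp: coord_vec_def)
  qed
qed

lemma coord_vec_change:
  assumes "\<kappa> \<in> A" "p \<in> chart_dom \<kappa>" "\<kappa>' \<in> A" "p \<in> chart_dom \<kappa>'"
  shows "coord_vec A \<kappa>' p (fd (transition \<kappa> \<kappa>') (coords \<kappa> p) v) = coord_vec A \<kappa> p v"
proof -
  have "coord_vec A \<kappa> p v \<kappa>' = fd (transition \<kappa> \<kappa>') (coords \<kappa> p) v" using assms by (simp add: coord_vec_def)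
  then show ?thesis using coord_vec_eq[OF assms(3,4) coord_vec_mem[OF assms(1,2)], of v] by simp
qed

lemma coord_vec_inj: "\<kappa> \<in> A \<Longrightarrow> p \<in> chart_dom \<kappa> \<Longrightarrow> coord_vec A \<kappa> p v = coord_vec A \<kappa> p w \<Longrightarrow> v = w"
  by (metis coord_vec_self)

lemma coord_vec_uminus:
  assumes "\<kappa> \<in> A" "p \<in> chart_dom \<kappa>" shows "coord_vec A \<kappa> p (- v) = - coord_vec A \<kappa> p v"
  using linear_neg[OF linear_transition[OF assms(1) _ assms(2)]] by (auto simp: coord_vec_def fun_eq_iff)

lemma in_chart_at: "\<kappa> \<in> A \<Longrightarrow> p \<in> chart_dom \<kappa> \<Longrightarrow>
    in_chart A g \<kappa> (coords \<kappa> p) v w = g p (coord_vec A \<kappa> p v) (coord_vec A \<kappa> p w)"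
  by (simp add: in_chart_def inv_coords)

lemma metric_at:
  "\<kappa> \<in> A \<Longrightarrow> p \<in> chart_dom \<kappa> \<Longrightarrow> X \<in> tangent_space A p \<Longrightarrow> Y \<in> tangent_space A p \<Longrightarrow>
    g p X Y = in_chart A g \<kappa> (coords \<kappa> p) (X \<kappa>) (Y \<kappa>)"
  by (simp add: in_chart_at coord_vec_eq)

text \<open>The set \<open>U\<close> allows for metrics examined on part of a chart only: the
  induced metric is treated where the immersion stays in one ambient chart.\<close>

lemma transition_isometric:
  assumes A: "\<kappa> \<in> A" "\<kappa>' \<in> A" and U: "open U"
    and m: "metric_on (coords \<kappa>' ` (chart_dom \<kappa>' \<inter> U)) (in_chart A g \<kappa>')"
  shows "isometric_map (coords \<kappa>' ` (chart_dom \<kappa>' \<inter> U)) (in_chart A g \<kappa>')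
    (coords \<kappa> ` (chart_dom \<kappa> \<inter> (chart_dom \<kappa>' \<inter> U))) (transition \<kappa> \<kappa>') (in_chart A g \<kappa>)"
proof (intro isometric_map.intro isometric_map_axioms.intro m)
  show "open (coords \<kappa> ` (chart_dom \<kappa> \<inter> (chart_dom \<kappa>' \<inter> U)))"
    using open_image[OF A(1) open_Int[OF chart(1)[OF A(2)] U]] .
  show "smooth_on (coords \<kappa> ` (chart_dom \<kappa> \<inter> (chart_dom \<kappa>' \<inter> U))) (transition \<kappa> \<kappa>')"
    by (rule smooth_on_subset[OF smooth_transition[OF A]]) auto
  fix x assume "x \<in> coords \<kappa> ` (chart_dom \<kappa> \<inter> (chart_dom \<kappa>' \<inter> U))"
  then obtain q where q: "q \<in> chart_dom \<kappa>" "q \<in> chart_dom \<kappa>'" "q \<in> U" "x = coords \<kappa> q" by blast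
  show "transition \<kappa> \<kappa>' x \<in> coords \<kappa>' ` (chart_dom \<kappa>' \<inter> U)" using q A by (simp add: transition_at)
  show "in_chart A g \<kappa> x v w = in_chart A g \<kappa>' (transition \<kappa> \<kappa>' x) (fd (transition \<kappa> \<kappa>') x v) (fd (transition \<kappa> \<kappa>') x w)" for v w
    using q A by (simp add: transition_at in_chart_at coord_vec_change)
  show "v = 0" if "fd (transition \<kappa> \<kappa>') x v = 0" for v
    using that q A fd_transition_comp[of \<kappa> \<kappa>' \<kappa> q v] linear_0[OF linear_transition[of \<kappa>' \<kappa> q]]
    by (simp add: fd_transition_self)
qed

lemma surj_transition:
  assumes "\<kappa> \<in> A" "\<kappa>' \<in> A" "p \<in> chart_dom \<kappa>" "p \<in> chart_dom \<kappa>'"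
  shows "fd (transition \<kappa> \<kappa>') (coords \<kappa> p) (fd (transition \<kappa>' \<kappa>) (coords \<kappa>' p) v) = v"
  using fd_transition_comp[of \<kappa>' \<kappa> \<kappa>' p v] fd_transition_self[of \<kappa>' p v] assms by simp

lemma local_curvature_transition:
  assumes A: "\<kappa> \<in> A" "\<kappa>' \<in> A" and U: "open U" and p: "p \<in> chart_dom \<kappa>" "p \<in> chart_dom \<kappa>'" "p \<in> U"
    and m: "metric_on (coords \<kappa>' ` (chart_dom \<kappa>' \<inter> U)) (in_chart A g \<kappa>')"
  shows "local_curvature (in_chart A g \<kappa>') (coords \<kappa>' p) (fd (transition \<kappa> \<kappa>') (coords \<kappa> p) u)
      (fd (transition \<kappa> \<kappa>') (coords \<kappa> p) v) (fd (transition \<kappa> \<kappa>') (coords \<kappa> p) w)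
    = fd (transition \<kappa> \<kappa>') (coords \<kappa> p) (local_curvature (in_chart A g \<kappa>) (coords \<kappa> p) u v w)"
proof -
  interpret i: isometric_map "coords \<kappa>' ` (chart_dom \<kappa>' \<inter> U)" "in_chart A g \<kappa>'"
    "coords \<kappa> ` (chart_dom \<kappa> \<inter> (chart_dom \<kappa>' \<inter> U))" "transition \<kappa> \<kappa>'" "in_chart A g \<kappa>"
    by (rule transition_isometric[OF A U m])
  have "local_curvature (in_chart A g \<kappa>') (transition \<kappa> \<kappa>' (coords \<kappa> p)) (fd (transition \<kappa> \<kappa>') (coords \<kappa> p) u)
      (fd (transition \<kappa> \<kappa>') (coords \<kappa> p) v) (fd (transition \<kappa> \<kappa>') (coords \<kappa> p) w)
    = fd (transition \<kappa> \<kappa>') (coords \<kappa> p) (local_curvature (in_chart A g \<kappa>) (coords \<kappa> p) u v w)"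
  proof (rule i.curvature_isometry)
    show "coords \<kappa> p \<in> coords \<kappa> ` (chart_dom \<kappa> \<inter> (chart_dom \<kappa>' \<inter> U))" using p by blast
    fix x assume "x \<in> coords \<kappa> ` (chart_dom \<kappa> \<inter> (chart_dom \<kappa>' \<inter> U))"
    then obtain q where q: "q \<in> chart_dom \<kappa>" "q \<in> chart_dom \<kappa>'" "x = coords \<kappa> q" by blast
    show "surj (fd (transition \<kappa> \<kappa>') x)" unfolding q(3)
      by (rule surjI[where f="fd (transition \<kappa>' \<kappa>) (coords \<kappa>' q)"]) (use surj_transition A q in blast)
  qed
  then show ?thesis using A p by (simp add: transition_at)
qed

lemma curvature_eq:
  assumes A: "\<kappa> \<in> A" and U: "open U" and p: "p \<in> chart_dom \<kappa>" "p \<in> U"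
    and m: "\<And>\<kappa>. \<kappa> \<in> A \<Longrightarrow> metric_on (coords \<kappa> ` (chart_dom \<kappa> \<inter> U)) (in_chart A g \<kappa>)"
    and X: "X \<in> tangent_space A p" "Y \<in> tangent_space A p" "Z \<in> tangent_space A p"
  shows "curvature A g p X Y Z = coord_vec A \<kappa> p (local_curvature (in_chart A g \<kappa>) (coords \<kappa> p) (X \<kappa>) (Y \<kappa>) (Z \<kappa>))"
proof
  fix \<kappa>'
  show "curvature A g p X Y Z \<kappa>' = coord_vec A \<kappa> p (local_curvature (in_chart A g \<kappa>) (coords \<kappa> p) (X \<kappa>) (Y \<kappa>) (Z \<kappa>)) \<kappa>'"
  proof (cases "\<kappa>' \<in> A \<and> p \<in> chart_dom \<kappa>'")
    case True
    then have "V \<kappa>' = fd (transition \<kappa> \<kappa>') (coords \<kappa> p) (V \<kappa>)" if "V \<in> tangent_space A p" for V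
      using that A p unfolding tangent_space_def by blast
    note V = this[OF X(1)] this[OF X(2)] this[OF X(3)]
    have "local_curvature (in_chart A g \<kappa>') (coords \<kappa>' p) (X \<kappa>') (Y \<kappa>') (Z \<kappa>')
      = fd (transition \<kappa> \<kappa>') (coords \<kappa> p) (local_curvature (in_chart A g \<kappa>) (coords \<kappa> p) (X \<kappa>) (Y \<kappa>) (Z \<kappa>))"
      unfolding V by (rule local_curvature_transition[OF A _ U p(1) _ p(2) m]) (use True in auto)
    then show ?thesis using True by (simp add: curvature_def coord_vec_def)
  qed (auto simp: curvature_def coord_vec_def)
qed

text \<open>\<open>ricci\<close> is defined in the chart \<open>chart_at A p\<close>. Passing to
  another chart conjugates the endomorphism by the differential of the transition map, which
  preserves the trace.\<close>

lemma ricci_eq: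
  assumes A: "\<kappa> \<in> A" and U: "open U" and p: "p \<in> chart_dom \<kappa>" "p \<in> U"
    and m: "\<And>\<kappa>. \<kappa> \<in> A \<Longrightarrow> metric_on (coords \<kappa> ` (chart_dom \<kappa> \<inter> U)) (in_chart A g \<kappa>)"
    and X: "X \<in> tangent_space A p" "Y \<in> tangent_space A p"
  shows "ricci A g p X Y = trace_lin (\<lambda>v. local_curvature (in_chart A g \<kappa>) (coords \<kappa> p) v (X \<kappa>) (Y \<kappa>))"
proof -
  define \<kappa>' where "\<kappa>' = chart_at A p"
  have A': "\<kappa>' \<in> A" "p \<in> chart_dom \<kappa>'" by (simp_all add: \<kappa>'_def chart_at)
  interpret mm: metric_on "coords \<kappa> ` (chart_dom \<kappa> \<inter> U)" "in_chart A g \<kappa>" by (rule m[OF A])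
  have pi: "coords \<kappa> p \<in> coords \<kappa> ` (chart_dom \<kappa> \<inter> U)" using p by blast
  define L where "L v = local_curvature (in_chart A g \<kappa>) (coords \<kappa> p) v (X \<kappa>) (Y \<kappa>)" for v
  define T where "T = fd (transition \<kappa> \<kappa>') (coords \<kappa> p)"
  define T' where "T' = fd (transition \<kappa>' \<kappa>) (coords \<kappa>' p)"
  have l: "linear L" "linear T" "linear T'" unfolding L_def T_def T'_def
    using mm.local_curvature_linear(1)[OF pi] linear_transition A A' p by auto
  have "curvature A g p (coord_vec A \<kappa>' p b) X Y \<kappa>' = T (L (T' b))" for b
    using curvature_eq[OF A U p m coord_vec_mem[OF A'] X] A A' p
    by (simp add: L_def T_def T'_def coord_vec_def)
  then have "ricci A g p X Y = trace_lin (\<lambda>v. T (L (T' v)))"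
    by (simp add: ricci_def trace_lin_def \<kappa>'_def)
  also have "\<dots> = trace_lin (\<lambda>v. L (T' (T v)))"
    using trace_comm[OF l(2) linear_compose[OF l(3,1)]] by (simp add: o_def)
  also have "\<dots> = trace_lin L"
    using surj_transition[of \<kappa>' \<kappa> p] A A' p by (simp add: T_def T'_def)
  finally show ?thesis by (simp add: L_def[abs_def])
qed

end

lemma complex_space_form_chart:
  fixes B :: "('b::{t2_space,second_countable_topology}, 'e::euclidean_space) chart set"
  assumes csf: "complex_space_form n c B G J" and mu: "\<mu> \<in> B"
  shows "kaehler_on (chart_image \<mu>) (in_chart B G \<mu>) (endo_in_chart B J \<mu>) c"
proof -
  have k: "smooth_manifold B" "almost_complex_structure B J" "hermitian_metric B G J" "parallel_endo B G J"
    using csf by (auto simp: complex_space_form_def kaehler_manifold_def)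
  interpret B: manifold B by unfold_locales (rule k)
  have rm: "riemannian_metric B G" using k(3) by (simp add: hermitian_metric_def)
  have met: "metric_on (chart_image \<mu>) (in_chart B G \<mu>)" if "\<mu> \<in> B" for \<mu>
    using rm that B.chart(2)[OF that] unfolding riemannian_metric_def metric_on_def ips_def by blast
  interpret m: metric_on "chart_image \<mu>" "in_chart B G \<mu>" by (rule met[OF mu])
  have J: "J p X \<in> tangent_space B p" "J p (J p X) = - X" if "X \<in> tangent_space B p" for p X
    using k(2) that unfolding almost_complex_structure_def by blast+
  have H: "G p (J p X) (J p Y) = G p X Y" if "X \<in> tangent_space B p" "Y \<in> tangent_space B p" for p X Y
    using k(3) that unfolding hermitian_metric_def by blast
  have E: "coord_vec B \<mu> q (endo_in_chart B J \<mu> x v) = J q (coord_vec B \<mu> q v)"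
    if "x \<in> chart_image \<mu>" "q = chart_inv \<mu> x" for x q v
    using that B.coord_vec_eq[OF mu _ J(1)[OF B.coord_vec_mem[OF mu]]] B.coords_inv[OF mu]
    by (simp add: endo_in_chart_def)
  have g: "in_chart B G \<mu> x v w = G q (coord_vec B \<mu> q v) (coord_vec B \<mu> q w)"
    if "q = chart_inv \<mu> x" for x q v w using that by (simp add: in_chart_def)
  have J1: "linear (endo_in_chart B J \<mu> x)" if "x \<in> chart_image \<mu>" for x
    using k(2) mu that unfolding almost_complex_structure_def by blast
  have J2: "smooth_on (chart_image \<mu>) (\<lambda>x. endo_in_chart B J \<mu> x v)" for v
    using k(2) mu unfolding almost_complex_structure_def by blast
  have J3: "endo_in_chart B J \<mu> x (endo_in_chart B J \<mu> x v) = - v" if x: "x \<in> chart_image \<mu>" for x v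
  proof -
    define q where "q = chart_inv \<mu> x"
    have q: "q \<in> chart_dom \<mu>" using B.coords_inv[OF mu x] by (simp add: q_def)
    have "coord_vec B \<mu> q (endo_in_chart B J \<mu> x (endo_in_chart B J \<mu> x v)) = coord_vec B \<mu> q (- v)"
      unfolding E[OF x q_def] J(2)[OF B.coord_vec_mem[OF mu q]] B.coord_vec_uminus[OF mu q] ..
    then show ?thesis by (rule B.coord_vec_inj[OF mu q])
  qed
  have J4: "in_chart B G \<mu> x (endo_in_chart B J \<mu> x v) (endo_in_chart B J \<mu> x w) = in_chart B G \<mu> x v w"
    if x: "x \<in> chart_image \<mu>" for x v w
    unfolding g[OF refl] E[OF x refl] by (rule H) (rule B.coord_vec_mem[OF mu B.coords_inv(2)[OF mu x]])+
  have J5: "fd (\<lambda>y. endo_in_chart B J \<mu> y v) x u + christoffel (in_chart B G \<mu>) x u (endo_in_chart B J \<mu> x v)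
     = endo_in_chart B J \<mu> x (christoffel (in_chart B G \<mu>) x u v)" if x: "x \<in> chart_image \<mu>" for x u v
    using k(4) mu x unfolding parallel_endo_def by blast
  have J6: "in_chart B G \<mu> x (local_curvature (in_chart B G \<mu>) x v (endo_in_chart B J \<mu> x v) (endo_in_chart B J \<mu> x v)) v
     = 4 * c * (in_chart B G \<mu> x v v)\<^sup>2" if x: "x \<in> chart_image \<mu>" for x v
  proof (cases "v = 0")
    case True
    then show ?thesis using ips.zero_r[OF m.ips[OF x]] ips.zero_l[OF m.ips[OF x]] by simp
  next
    case False
    interpret p: ips "in_chart B G \<mu> x" by (rule m.ips[OF x])
    define q where "q = chart_inv \<mu> x"
    have q: "q \<in> chart_dom \<mu>" "coords \<mu> q = x" using B.coords_inv[OF mu x] by (simp_all add: q_def)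
    define X where "X = coord_vec B \<mu> q v"
    have X: "X \<in> tangent_space B q" "X \<mu> = v" using B.coord_vec_mem[OF mu q(1)] B.coord_vec_self[OF mu q(1)] by (simp_all add: X_def)
    have "X \<noteq> (\<lambda>_. 0)" using X False by auto
    then have sc: "sectional_curvature B G q X (J q X) = 4 * c"
      using csf X unfolding complex_space_form_def by blast
    have JX: "J q X \<mu> = endo_in_chart B J \<mu> x v" by (simp add: endo_in_chart_def q_def X_def)
    have cv: "curvature B G q X (J q X) (J q X) = coord_vec B \<mu> q (local_curvature (in_chart B G \<mu>) x v (endo_in_chart B J \<mu> x v) (endo_in_chart B J \<mu> x v))"
      using B.curvature_eq[OF mu open_UNIV q(1) UNIV_I _ X(1) J(1)[OF X(1)] J(1)[OF X(1)], of G] met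
      by (simp add: q(2) X(2) JX flip: chart_image_def)
    have M: "G q Y Z = in_chart B G \<mu> x (Y \<mu>) (Z \<mu>)" if "Y \<in> tangent_space B q" "Z \<in> tangent_space B q" for Y Z
      using B.metric_at[OF mu q(1) that] q(2) by simp
    \<comment> \<open>\<open>v\<close> and its image under \<open>J\<close> are orthogonal and of
      equal length, so the denominator of the sectional curvature is \<open>r * r\<close>.\<close>
    have z: "in_chart B G \<mu> x v (endo_in_chart B J \<mu> x v) = 0"
    proof -
      have "in_chart B G \<mu> x v (endo_in_chart B J \<mu> x v) = in_chart B G \<mu> x (endo_in_chart B J \<mu> x v) (- v)"
        using J4[OF x, of v "endo_in_chart B J \<mu> x v"] by (simp add: J3[OF x])
      then show ?thesis using p.sym[of v "endo_in_chart B J \<mu> x v"] by (simp add: p.minus_r)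
    qed
    define r where "r = in_chart B G \<mu> x v v"
    have r: "r > 0" using p.pos[OF False] by (simp add: r_def)
    have "4 * c = in_chart B G \<mu> x (local_curvature (in_chart B G \<mu>) x v (endo_in_chart B J \<mu> x v) (endo_in_chart B J \<mu> x v)) v / (r * r)"
      using sc unfolding sectional_curvature_def cv
      by (simp add: M B.coord_vec_mem[OF mu q(1)] X J(1) B.coord_vec_self[OF mu q(1)] JX J4[OF x] z flip: r_def)
    then show ?thesis using r by (simp add: r_def[symmetric] field_simps power2_eq_square)
  qed
  show ?thesis
    by (intro kaehler_on.intro kaehler_on_axioms.intro met[OF mu] J1 J2 J3 J4 J5 J6; assumption)
qed

section \<open>Real hypersurfaces of a complex space form in charts\<close>

locale hypersurface_in_space_form =
  fixes n :: nat and c :: real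
    and B :: "('b::{t2_space,second_countable_topology}, 'e::euclidean_space) chart set"
    and G :: "('b, 'e) tensor2"
    and J :: "'b \<Rightarrow> ('b, 'e) tvec \<Rightarrow> ('b, 'e) tvec"
    and A :: "('m::{t2_space,second_countable_topology}, 'h::euclidean_space) chart set"
    and f :: "'m \<Rightarrow> 'b"
    and N :: "'m \<Rightarrow> ('b, 'e) tvec"
  assumes n3: "n \<ge> 3" and c0: "c \<noteq> 0" and csf: "complex_space_form n c B G J"
    and rh: "real_hypersurface A B G f N"
begin

sublocale mA: manifold A using rh by unfold_locales (simp add: real_hypersurface_def)
sublocale mB: manifold B using csf by unfold_locales (simp add: complex_space_form_def kaehler_manifold_def)

abbreviation "g \<equiv> induced_metric A B G f"

lemma dims: "DIM('e) = 2 * n" "DIM('h) = 2 * n - 1"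
  using csf rh by (simp_all add: complex_space_form_def real_hypersurface_def)

lemma immersion: "smooth_map A B f" "inj_on (differential A B f p) (tangent_space A p)"
  using rh by (auto simp: real_hypersurface_def immersion_def)

lemma normal: "N p \<in> tangent_space B (f p)" "G (f p) (N p) (N p) = 1"
  "X \<in> tangent_space A p \<Longrightarrow> G (f p) (differential A B f p X) (N p) = 0"
  "\<exists>W N'. open W \<and> p \<in> W \<and> smooth_along A B f W N' \<and> (\<forall>q\<in>W. N q = N' q \<or> N q = - N' q)"
  using rh unfolding real_hypersurface_def unit_normal_field_def by blast+

lemma open_preimage: "\<mu> \<in> B \<Longrightarrow> open (f -` chart_dom \<mu>)"
  using immersion(1) mB.chart(1) by (simp add: smooth_map_def open_vimage)

lemma smooth_rep: "\<kappa> \<in> A \<Longrightarrow> \<mu> \<in> B \<Longrightarrow> smooth_on (coords \<kappa> ` (chart_dom \<kappa> \<inter> f -` chart_dom \<mu>)) (local_rep \<kappa> \<mu> f)"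
  using immersion(1) unfolding smooth_map_def by blast

lemma rep_at: "\<kappa> \<in> A \<Longrightarrow> p \<in> chart_dom \<kappa> \<Longrightarrow> local_rep \<kappa> \<mu> f (coords \<kappa> p) = coords \<mu> (f p)"
  by (simp add: local_rep_def mA.inv_coords)

lemma rep_diff: "\<kappa> \<in> A \<Longrightarrow> \<mu> \<in> B \<Longrightarrow> p \<in> chart_dom \<kappa> \<Longrightarrow> f p \<in> chart_dom \<mu> \<Longrightarrow>
    local_rep \<kappa> \<mu> f differentiable (at (coords \<kappa> p))"
  by (rule smooth_on_diff[OF smooth_rep]) auto

text \<open>\<open>differential\<close> uses the chart \<open>chart_at A p\<close>. The chain rule
  for a change of chart on either side shows that every pair of charts computes the same tangent
  vector.\<close>

lemma differential_eq:
  assumes \<kappa>: "\<kappa> \<in> A" "p \<in> chart_dom \<kappa>" and \<mu>: "\<mu> \<in> B" "f p \<in> chart_dom \<mu>" and X: "X \<in> tangent_space A p"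
  shows "differential A B f p X = coord_vec B \<mu> (f p) (fd (local_rep \<kappa> \<mu> f) (coords \<kappa> p) (X \<kappa>))"
proof
  fix \<mu>'
  define \<kappa>' where "\<kappa>' = chart_at A p"
  have \<kappa>': "\<kappa>' \<in> A" "p \<in> chart_dom \<kappa>'" by (simp_all add: \<kappa>'_def mA.chart_at)
  show "differential A B f p X \<mu>' = coord_vec B \<mu> (f p) (fd (local_rep \<kappa> \<mu> f) (coords \<kappa> p) (X \<kappa>)) \<mu>'"
  proof (cases "\<mu>' \<in> B \<and> f p \<in> chart_dom \<mu>'")
    case True
    then have \<mu>': "\<mu>' \<in> B" "f p \<in> chart_dom \<mu>'" by auto
    define T where "T = coords \<kappa> ` (chart_dom \<kappa> \<inter> (chart_dom \<kappa>' \<inter> (f -` chart_dom \<mu> \<inter> f -` chart_dom \<mu>')))"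
    have T: "open T" "coords \<kappa> p \<in> T"
      using mA.open_image[OF \<kappa>(1) open_Int[OF mA.chart(1)[OF \<kappa>'(1)] open_Int[OF open_preimage[OF \<mu>(1)] open_preimage[OF \<mu>'(1)]]]]
        \<kappa> \<kappa>' \<mu> \<mu>' by (auto simp: T_def)
    have 1: "fd (local_rep \<kappa> \<mu>' f) (coords \<kappa> p) v
      = fd (local_rep \<kappa>' \<mu>' f) (coords \<kappa>' p) (fd (transition \<kappa> \<kappa>') (coords \<kappa> p) v)" for v
    proof -
      have "fd (local_rep \<kappa> \<mu>' f) (coords \<kappa> p) v = fd (\<lambda>y. local_rep \<kappa>' \<mu>' f (transition \<kappa> \<kappa>' y)) (coords \<kappa> p) v"
        by (rule fun_cong[OF fd_cong[OF T]]) (auto simp: T_def mA.transition_at \<kappa>(1) \<kappa>'(1) rep_at)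
      also have "\<dots> = fd (local_rep \<kappa>' \<mu>' f) (transition \<kappa> \<kappa>' (coords \<kappa> p)) (fd (transition \<kappa> \<kappa>') (coords \<kappa> p) v)"
        by (rule fd_chain) (simp_all add: mA.transition_at mA.transition_diff rep_diff \<kappa> \<kappa>' \<mu>')
      finally show ?thesis using \<kappa> by (simp add: mA.transition_at)
    qed
    have 2: "fd (local_rep \<kappa> \<mu>' f) (coords \<kappa> p) v
      = fd (transition \<mu> \<mu>') (coords \<mu> (f p)) (fd (local_rep \<kappa> \<mu> f) (coords \<kappa> p) v)" for v
    proof -
      have "fd (local_rep \<kappa> \<mu>' f) (coords \<kappa> p) v = fd (\<lambda>y. transition \<mu> \<mu>' (local_rep \<kappa> \<mu> f y)) (coords \<kappa> p) v"
        by (rule fun_cong[OF fd_cong[OF T]]) (auto simp: T_def mB.transition_at \<kappa>(1) \<mu>(1) rep_at)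
      also have "\<dots> = fd (transition \<mu> \<mu>') (local_rep \<kappa> \<mu> f (coords \<kappa> p)) (fd (local_rep \<kappa> \<mu> f) (coords \<kappa> p) v)"
        by (rule fd_chain) (simp_all add: mB.transition_diff rep_diff rep_at \<kappa> \<mu> \<mu>')
      finally show ?thesis using \<kappa> by (simp add: rep_at)
    qed
    have "X \<kappa>' = fd (transition \<kappa> \<kappa>') (coords \<kappa> p) (X \<kappa>)"
      using X \<kappa> \<kappa>' unfolding tangent_space_def by blast
    then have "differential A B f p X \<mu>' = fd (local_rep \<kappa> \<mu>' f) (coords \<kappa> p) (X \<kappa>)"
      using True 1 by (simp add: differential_def \<kappa>'_def)
    then show ?thesis using True by (simp add: coord_vec_def 2)
  qed (auto simp: differential_def coord_vec_def)
qed

lemma differential_mem: "X \<in> tangent_space A p \<Longrightarrow> differential A B f p X \<in> tangent_space B (f p)"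
  using differential_eq[OF mA.chart_at mB.chart_at] mB.coord_vec_mem[OF mB.chart_at] by metis

lemma local_isometric:
  assumes \<kappa>: "\<kappa> \<in> A" and \<mu>: "\<mu> \<in> B" and U: "open U" "U \<subseteq> f -` chart_dom \<mu>"
  shows "isometric_map (chart_image \<mu>) (in_chart B G \<mu>) (coords \<kappa> ` (chart_dom \<kappa> \<inter> U)) (local_rep \<kappa> \<mu> f) (in_chart A g \<kappa>)"
proof -
  interpret K: kaehler_on "chart_image \<mu>" "in_chart B G \<mu>" "endo_in_chart B J \<mu>" c
    by (rule complex_space_form_chart[OF csf \<mu>])
  show ?thesis
  proof (intro isometric_map.intro isometric_map_axioms.intro K.metric_on_axioms)
    show "open (coords \<kappa> ` (chart_dom \<kappa> \<inter> U))" by (rule mA.open_image[OF \<kappa> U(1)])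
    show "smooth_on (coords \<kappa> ` (chart_dom \<kappa> \<inter> U)) (local_rep \<kappa> \<mu> f)"
      by (rule smooth_on_subset[OF smooth_rep[OF \<kappa> \<mu>]]) (use U in auto)
    fix x assume "x \<in> coords \<kappa> ` (chart_dom \<kappa> \<inter> U)"
    then obtain q where q: "q \<in> chart_dom \<kappa>" "f q \<in> chart_dom \<mu>" "x = coords \<kappa> q" using U by blast
    have d: "differential A B f q (coord_vec A \<kappa> q v) = coord_vec B \<mu> (f q) (fd (local_rep \<kappa> \<mu> f) x v)" for v
      using differential_eq[OF \<kappa> q(1) \<mu> q(2) mA.coord_vec_mem[OF \<kappa> q(1)], of v] mA.coord_vec_self[OF \<kappa> q(1)] q(3) by simp
    show "local_rep \<kappa> \<mu> f x \<in> chart_image \<mu>" using q \<kappa> by (simp add: rep_at chart_image_def)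
    show "in_chart A g \<kappa> x v w = in_chart B G \<mu> (local_rep \<kappa> \<mu> f x) (fd (local_rep \<kappa> \<mu> f) x v) (fd (local_rep \<kappa> \<mu> f) x w)" for v w
      using q \<kappa> \<mu> by (simp add: mA.in_chart_at induced_metric_def rep_at mB.in_chart_at d)
    show "v = 0" if z: "fd (local_rep \<kappa> \<mu> f) x v = 0" for v
    proof -
      have "fd (local_rep \<kappa> \<mu> f) x 0 = 0"
        using linear_0[OF linear_fd[OF rep_diff[OF \<kappa> \<mu> q(1,2)]]] q(3) by simp
      then have "differential A B f q (coord_vec A \<kappa> q v) = differential A B f q (coord_vec A \<kappa> q 0)"
        using z by (simp add: d)
      then have "coord_vec A \<kappa> q v = coord_vec A \<kappa> q 0"
        using inj_onD[OF immersion(2)] mA.coord_vec_mem[OF \<kappa> q(1)] by blast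
      then show ?thesis by (rule mA.coord_vec_inj[OF \<kappa> q(1)])
    qed
  qed
qed

lemma metric_on_chart:
  assumes "\<kappa> \<in> A" "\<mu> \<in> B"
  shows "metric_on (coords \<kappa> ` (chart_dom \<kappa> \<inter> f -` chart_dom \<mu>)) (in_chart A g \<kappa>)"
  by (rule isometric_map.metric_on_pullback[OF local_isometric[OF assms open_preimage[OF assms(2)] subset_refl]])

lemma J_coord_vec:
  assumes \<mu>: "\<mu> \<in> B" "q \<in> chart_dom \<mu>"
  shows "J q (coord_vec B \<mu> q v) = coord_vec B \<mu> q (endo_in_chart B J \<mu> (coords \<mu> q) v)"
proof -
  have "J q (coord_vec B \<mu> q v) \<in> tangent_space B q"
    using csf mB.coord_vec_mem[OF \<mu>] unfolding complex_space_form_def kaehler_manifold_def almost_complex_structure_def by blast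
  then show ?thesis using mB.coord_vec_eq[OF \<mu>] \<mu> by (simp add: endo_in_chart_def mB.inv_coords)
qed

text \<open>The normal is replaced by the smooth local field \<open>N'\<close>, which agrees with
  \<open>N\<close> up to a sign that may vary from point to point. Unit length and orthogonality do
  not see that sign.\<close>

lemma local_hypersurface:
  assumes \<kappa>: "\<kappa> \<in> A" and \<mu>: "\<mu> \<in> B" and U: "open W'" "smooth_along A B f W' N'"
    and NN: "\<And>q. q \<in> W' \<Longrightarrow> N q = N' q \<or> N q = - N' q"
  shows "hypersurface (chart_image \<mu>) (in_chart B G \<mu>) (endo_in_chart B J \<mu>) c
    (coords \<kappa> ` (chart_dom \<kappa> \<inter> (W' \<inter> f -` chart_dom \<mu>))) (local_rep \<kappa> \<mu> f) (in_chart A g \<kappa>)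
    (\<lambda>x. N' (chart_inv \<kappa> x) \<mu>)"
proof (intro hypersurface.intro hypersurface_axioms.intro complex_space_form_chart[OF csf \<mu>])
  show "isometric_map (chart_image \<mu>) (in_chart B G \<mu>) (coords \<kappa> ` (chart_dom \<kappa> \<inter> (W' \<inter> f -` chart_dom \<mu>))) (local_rep \<kappa> \<mu> f) (in_chart A g \<kappa>)"
    by (rule local_isometric[OF \<kappa> \<mu>]) (use U open_preimage[OF \<mu>] in auto)
  show "DIM('h) + 1 = DIM('e)" using dims n3 by simp
  show "smooth_on (coords \<kappa> ` (chart_dom \<kappa> \<inter> (W' \<inter> f -` chart_dom \<mu>))) (\<lambda>x. N' (chart_inv \<kappa> x) \<mu>)"
    using U(2) \<kappa> \<mu> unfolding smooth_along_def by (simp add: Int_assoc)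
  fix x assume "x \<in> coords \<kappa> ` (chart_dom \<kappa> \<inter> (W' \<inter> f -` chart_dom \<mu>))"
  then obtain q where q: "q \<in> chart_dom \<kappa>" "q \<in> W'" "f q \<in> chart_dom \<mu>" "x = coords \<kappa> q" by blast
  interpret K: kaehler_on "chart_image \<mu>" "in_chart B G \<mu>" "endo_in_chart B J \<mu>" c
    by (rule complex_space_form_chart[OF csf \<mu>])
  have Fx: "local_rep \<kappa> \<mu> f x = coords \<mu> (f q)" "chart_inv \<kappa> x = q" using q \<kappa> by (simp_all add: rep_at mA.inv_coords)
  have "coords \<mu> (f q) \<in> chart_image \<mu>" using q by (simp add: chart_image_def)
  then interpret p: ips "in_chart B G \<mu> (coords \<mu> (f q))" by (rule K.ips)
  have M: "G (f q) Y Z = in_chart B G \<mu> (coords \<mu> (f q)) (Y \<mu>) (Z \<mu>)"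
    if "Y \<in> tangent_space B (f q)" "Z \<in> tangent_space B (f q)" for Y Z
    by (rule mB.metric_at[OF \<mu> q(3) that])
  have s: "N' q \<mu> = N q \<mu> \<or> N' q \<mu> = - N q \<mu>" using NN[OF q(2)]
  proof
    assume "N q = - N' q"
    then have "N q \<mu> = - N' q \<mu>" by (metis uminus_apply)
    then show ?thesis by simp
  qed simp
  show "in_chart B G \<mu> (local_rep \<kappa> \<mu> f x) (N' (chart_inv \<kappa> x) \<mu>) (N' (chart_inv \<kappa> x) \<mu>) = 1"
    unfolding Fx using s M[OF normal(1) normal(1)] normal(2)[of q] by (auto simp: p.minus_l p.minus_r)
  fix v
  have X: "coord_vec A \<kappa> q v \<in> tangent_space A q" by (rule mA.coord_vec_mem[OF \<kappa> q(1)])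
  have "differential A B f q (coord_vec A \<kappa> q v) \<mu> = fd (local_rep \<kappa> \<mu> f) x v"
    unfolding differential_eq[OF \<kappa> q(1) \<mu> q(3) X] mB.coord_vec_self[OF \<mu> q(3)] mA.coord_vec_self[OF \<kappa> q(1)] q(4) ..
  then show "in_chart B G \<mu> (local_rep \<kappa> \<mu> f x) (fd (local_rep \<kappa> \<mu> f) x v) (N' (chart_inv \<kappa> x) \<mu>) = 0"
    unfolding Fx using s M[OF differential_mem[OF X] normal(1)] normal(3)[OF X] by (auto simp: p.minus_r)
qed

abbreviation "xi_field \<equiv> structure_vector A B J f N"
abbreviation "contact \<equiv> contact_form A B G J f N"

text \<open>The function \<open>\<sigma>\<close> is \<open>S(\<xi>, \<xi>)\<close>. The mixed
  components vanish by the Hopf property, and the finite set is that of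
  \<open>principal_curvature_values\<close>.\<close>

lemma local_ricci:
  assumes a: "\<And>p X Y. X \<in> holomorphic_distribution A B G J f N p \<Longrightarrow> Y \<in> holomorphic_distribution A B G J f N p \<Longrightarrow>
      ricci A g p X Y = a * g p X Y"
  obtains T \<sigma> where "open T" "p \<in> T" "continuous_on T \<sigma>"
    "\<And>q. q \<in> T \<Longrightarrow> xi_field q \<in> tangent_space A q"
    "\<And>q. q \<in> T \<Longrightarrow> contact q (xi_field q) = 1" "\<And>q. q \<in> T \<Longrightarrow> g q (xi_field q) (xi_field q) = 1"
    "\<And>q X Y. q \<in> T \<Longrightarrow> X \<in> tangent_space A q \<Longrightarrow> Y \<in> tangent_space A q \<Longrightarrow>
      ricci A g q X Y = a * g q X Y + (\<sigma> q - a) * contact q X * contact q Y"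
    "\<And>q. q \<in> T \<Longrightarrow> \<sigma> q - (2 * real n - 2) * c \<in> {c + (a - (2 * real n + 1) * c) - (2 * real n - 2) * c, 0,
        2 * (real n - 1) * ((a - (2 * real n + 1) * c) - c), 2 * ((a - (2 * real n + 1) * c) + c)}"
proof -
  \<comment> \<open>The ambient curvature contributes \<open>(2 n + 1) c\<close> to the Ricci tensor
    on \<open>H\<close>.\<close>
  define k where "k = a - (2 * real n + 1) * c"
  define \<kappa> where "\<kappa> = chart_at A p"
  define \<mu> where "\<mu> = chart_at B (f p)"
  have \<kappa>: "\<kappa> \<in> A" "p \<in> chart_dom \<kappa>" and \<mu>: "\<mu> \<in> B" "f p \<in> chart_dom \<mu>"
    by (simp_all add: \<kappa>_def \<mu>_def mA.chart_at mB.chart_at)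
  obtain W' N' where W': "open W'" "p \<in> W'" "smooth_along A B f W' N'" and NN: "\<And>q. q \<in> W' \<Longrightarrow> N q = N' q \<or> N q = - N' q"
    using normal(4)[of p] by blast
  define U where "U = W' \<inter> f -` chart_dom \<mu>"
  define T where "T = chart_dom \<kappa> \<inter> U"
  define W where "W = coords \<kappa> ` (chart_dom \<kappa> \<inter> U)"
  define \<nu> where "\<nu> x = N' (chart_inv \<kappa> x) \<mu>" for x
  define F where "F = local_rep \<kappa> \<mu> f"
  interpret H: hypersurface "chart_image \<mu>" "in_chart B G \<mu>" "endo_in_chart B J \<mu>" c W F "in_chart A g \<kappa>" \<nu>
    unfolding W_def F_def \<nu>_def U_def by (rule local_hypersurface[OF \<kappa>(1) \<mu>(1) W'(1,3) NN])
  have oT: "open T" unfolding T_def U_def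
    using mA.chart(1)[OF \<kappa>(1)] W'(1) open_preimage[OF \<mu>(1)] by blast
  have pT: "p \<in> T" using \<kappa> \<mu> W' by (simp add: T_def U_def)
  have TW: "coords \<kappa> q \<in> W" if "q \<in> T" for q using that by (simp add: T_def W_def)
  have Tq: "q \<in> chart_dom \<kappa>" "f q \<in> chart_dom \<mu>" "q \<in> W'" if "q \<in> T" for q using that by (auto simp: T_def U_def)
  have WT: "\<exists>q\<in>T. x = coords \<kappa> q" if "x \<in> W" for x using that by (auto simp: T_def W_def)
  \<comment> \<open>The sign \<open>s\<close> between \<open>N\<close> and the smooth local normal
    carries over to the structure vector. It disappears from every product of two values of
    \<open>contact\<close>.\<close>
  have str: "\<exists>s. s * s = 1 \<and> xi_field q \<in> tangent_space A q \<and> xi_field q \<kappa> = s *\<^sub>R H.xi (coords \<kappa> q)" if q: "q \<in> T" for q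
  proof -
    define x where "x = coords \<kappa> q"
    have x: "x \<in> W" using TW[OF q] by (simp add: x_def)
    have "N q = N' q \<or> N q = - N' q" by (rule NN[OF Tq(3)[OF q]])
    then obtain s where s: "s * s = 1" "N q \<mu> = s *\<^sub>R \<nu> x"
    proof
      assume "N q = N' q"
      then show ?thesis using that[of 1] mA.inv_coords[OF \<kappa>(1) Tq(1)[OF q]] by (simp add: \<nu>_def x_def)
    next
      assume "N q = - N' q"
      then show ?thesis using that[of "-1"] mA.inv_coords[OF \<kappa>(1) Tq(1)[OF q]] by (simp add: \<nu>_def x_def)
    qed
    define X where "X = coord_vec A \<kappa> q (s *\<^sub>R H.xi x)"
    have X: "X \<in> tangent_space A q" "X \<kappa> = s *\<^sub>R H.xi x"
      unfolding X_def using mA.coord_vec_mem[OF \<kappa>(1) Tq(1)[OF q]] mA.coord_vec_self[OF \<kappa>(1) Tq(1)[OF q]] by auto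
    have Fx: "F x = coords \<mu> (f q)" using rep_at[OF \<kappa>(1) Tq(1)[OF q]] by (simp add: F_def x_def)
    have "fd F x (s *\<^sub>R H.xi x) = - endo_in_chart B J \<mu> (coords \<mu> (f q)) (N q \<mu>)"
      using H.fd_xi[OF x] by (simp add: linear_scale[OF H.F_linear[OF x]] linear_scale[OF H.J_linear[OF H.FS[OF x]]] s Fx[symmetric])
    then have "differential A B f q X = - J (f q) (coord_vec B \<mu> (f q) (N q \<mu>))"
      unfolding differential_eq[OF \<kappa>(1) Tq(1)[OF q] \<mu>(1) Tq(2)[OF q] X(1)] J_coord_vec[OF \<mu>(1) Tq(2)[OF q]]
        mB.coord_vec_uminus[OF \<mu>(1) Tq(2)[OF q], symmetric] X(2)
      by (simp add: F_def x_def)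
    then have d: "differential A B f q X = - J (f q) (N q)"
      by (simp add: mB.coord_vec_eq[OF \<mu>(1) Tq(2)[OF q] normal(1)])
    have "xi_field q = X" unfolding structure_vector_def
    proof (rule the_equality)
      show "Y = X" if "Y \<in> tangent_space A q \<and> differential A B f q Y = - J (f q) (N q)" for Y
        using inj_onD[OF immersion(2)] that X d by metis
    qed (use X d in blast)
    then show ?thesis using X s by (auto simp: x_def)
  qed
  have gx: "g q X Y = in_chart A g \<kappa> (coords \<kappa> q) (X \<kappa>) (Y \<kappa>)"
    if "q \<in> T" "X \<in> tangent_space A q" "Y \<in> tangent_space A q" for q X Y
    by (rule mA.metric_at[OF \<kappa>(1) Tq(1)[OF that(1)] that(2,3)])
  have ct: "\<exists>s. s * s = 1 \<and> (\<forall>X\<in>tangent_space A q. contact q X = s * in_chart A g \<kappa> (coords \<kappa> q) (X \<kappa>) (H.xi (coords \<kappa> q)))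
      \<and> xi_field q \<in> tangent_space A q \<and> xi_field q \<kappa> = s *\<^sub>R H.xi (coords \<kappa> q)" if q: "q \<in> T" for q
  proof -
    interpret p: ips "in_chart A g \<kappa> (coords \<kappa> q)" by (rule H.pull.ips[OF TW[OF q]])
    obtain s where s: "s * s = 1" "xi_field q \<in> tangent_space A q" "xi_field q \<kappa> = s *\<^sub>R H.xi (coords \<kappa> q)" using str[OF q] by blast
    then have "contact q X = s * in_chart A g \<kappa> (coords \<kappa> q) (X \<kappa>) (H.xi (coords \<kappa> q))" if "X \<in> tangent_space A q" for X
      using that gx[OF q that s(2)] by (simp add: contact_form_def p.scale_r)
    then show ?thesis using s by blast
  qed
  have ric: "ricci A g q X Y = c * ((2 * real n + 1) * in_chart A g \<kappa> x (X \<kappa>) (Y \<kappa>) - 3 * in_chart A g \<kappa> x (X \<kappa>) (H.xi x) * in_chart A g \<kappa> x (Y \<kappa>) (H.xi x))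
      + H.h x * in_chart A g \<kappa> x (H.shape x (X \<kappa>)) (Y \<kappa>) - in_chart A g \<kappa> x (H.shape x (X \<kappa>)) (H.shape x (Y \<kappa>))"
    if q: "q \<in> T" "x = coords \<kappa> q" and X: "X \<in> tangent_space A q" "Y \<in> tangent_space A q" for q x X Y
  proof -
    have "ricci A g q X Y = trace_lin (\<lambda>v. local_curvature (in_chart A g \<kappa>) x v (X \<kappa>) (Y \<kappa>))"
      unfolding q(2) by (rule mA.ricci_eq[OF \<kappa>(1) open_preimage[OF \<mu>(1)] Tq(1)[OF q(1)] _ metric_on_chart[OF _ \<mu>(1)] X])
        (use Tq(2)[OF q(1)] in auto)
    then show ?thesis using H.ricci_formula[of x n] TW[OF q(1)] q(2) dims n3 by simp
  qed
  have rc: "ricci_condition W (in_chart A g \<kappa>) H.shape H.phi H.xi c n k"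
  proof (intro ricci_condition.intro ricci_condition_axioms.intro H.hypersurface_eqs_axioms dims n3 c0)
    fix x v w assume x: "x \<in> W" and v: "in_chart A g \<kappa> x v (H.xi x) = 0" and w: "in_chart A g \<kappa> x w (H.xi x) = 0"
    obtain q where q: "q \<in> T" "x = coords \<kappa> q" using WT[OF x] by blast
    define X where "X = coord_vec A \<kappa> q v"
    define Y where "Y = coord_vec A \<kappa> q w"
    have X: "X \<in> tangent_space A q" "X \<kappa> = v" and Y: "Y \<in> tangent_space A q" "Y \<kappa> = w"
      unfolding X_def Y_def using mA.coord_vec_mem[OF \<kappa>(1) Tq(1)[OF q(1)]] mA.coord_vec_self[OF \<kappa>(1) Tq(1)[OF q(1)]] by auto
    have "contact q X = 0" "contact q Y = 0" using ct[OF q(1)] X Y v w q(2) by auto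
    then have "ricci A g q X Y = a * g q X Y" by (intro a) (auto simp: holomorphic_distribution_def X Y)
    then show "H.h x * in_chart A g \<kappa> x (H.shape x v) w - in_chart A g \<kappa> x (H.shape x v) (H.shape x w) = k * in_chart A g \<kappa> x v w"
      using ric[OF q X(1) Y(1)] gx[OF q(1) X(1) Y(1)] v w by (simp add: X Y k_def q(2) algebra_simps)
  qed
  interpret R: ricci_condition W "in_chart A g \<kappa>" H.shape H.phi H.xi c n k by (rule rc)
  \<comment> \<open>This is \<open>ricci_formula\<close> on the structure vector:
    \<open>2 n + 1 - 3 = 2 n - 2\<close>, and \<open>h \<alpha> - \<alpha>\<^sup>2\<close>
    remains.\<close>
  define \<sigma> where "\<sigma> q = (2 * real n - 2) * c + R.al (coords \<kappa> q) * (H.h (coords \<kappa> q) - R.al (coords \<kappa> q))" for q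
  show ?thesis
  proof (rule that[OF oT pT, of \<sigma>])
    have "continuous_on T (coords \<kappa>)"
      by (rule continuous_on_subset[OF homeomorphism_cont1[OF mA.chart(3)[OF \<kappa>(1)]]]) (simp add: T_def)
    then have cW: "continuous_on T (\<lambda>q. u (coords \<kappa> q))" if "continuous_on W u" for u :: "'h \<Rightarrow> real"
      by (rule continuous_on_compose2[OF that]) (rule image_subsetI[OF TW])
    show "continuous_on T \<sigma>" unfolding \<sigma>_def
      by (intro continuous_intros cW smooth_on_continuous[OF R.smooth_al] smooth_on_continuous[OF H.smooth_h])
    fix q assume q: "q \<in> T"
    define x where "x = coords \<kappa> q"
    have x: "x \<in> W" using TW[OF q] by (simp add: x_def)
    interpret p: ips "in_chart A g \<kappa> x" by (rule H.pull.ips[OF x])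
    obtain s where s: "s * s = 1" "\<And>X. X \<in> tangent_space A q \<Longrightarrow> contact q X = s * in_chart A g \<kappa> x (X \<kappa>) (H.xi x)"
      "xi_field q \<in> tangent_space A q" "xi_field q \<kappa> = s *\<^sub>R H.xi x" using ct[OF q] unfolding x_def by blast
    show "xi_field q \<in> tangent_space A q" by (rule s(3))
    show "contact q (xi_field q) = 1" using s H.\<xi>_unit[OF x] by (simp add: p.ip_simps)
    show "g q (xi_field q) (xi_field q) = 1"
      using gx[OF q s(3) s(3)] s H.\<xi>_unit[OF x] by (simp add: p.ip_simps flip: x_def)
    show "\<sigma> q - (2 * real n - 2) * c \<in> {c + (a - (2 * real n + 1) * c) - (2 * real n - 2) * c, 0,
        2 * (real n - 1) * ((a - (2 * real n + 1) * c) - c), 2 * ((a - (2 * real n + 1) * c) + c)}"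
      using R.principal_curvature_values[OF x] unfolding \<sigma>_def x_def[symmetric] k_def by simp
    fix X Y assume X: "X \<in> tangent_space A q" and Y: "Y \<in> tangent_space A q"
    define v where "v = X \<kappa> - in_chart A g \<kappa> x (X \<kappa>) (H.xi x) *\<^sub>R H.xi x"
    define w where "w = Y \<kappa> - in_chart A g \<kappa> x (Y \<kappa>) (H.xi x) *\<^sub>R H.xi x"
    define e where "e = in_chart A g \<kappa> x (X \<kappa>) (H.xi x)"
    define e' where "e' = in_chart A g \<kappa> x (Y \<kappa>) (H.xi x)"
    have XY: "X \<kappa> = v + e *\<^sub>R H.xi x" "Y \<kappa> = w + e' *\<^sub>R H.xi x" by (simp_all add: v_def w_def e_def e'_def)
    have vx: "in_chart A g \<kappa> x v (H.xi x) = 0" "in_chart A g \<kappa> x w (H.xi x) = 0"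
      by (simp_all add: v_def w_def p.ip_simps H.\<xi>_unit[OF x])
    then have vx': "in_chart A g \<kappa> x (H.xi x) v = 0" "in_chart A g \<kappa> x (H.xi x) w = 0" using p.sym by metis+
    have Ax: "H.shape x (u + r *\<^sub>R H.xi x) = H.shape x u + (r * R.al x) *\<^sub>R H.xi x" for u r
      by (simp add: linear_add[OF H.shape_linear[OF x]] linear_scale[OF H.shape_linear[OF x]] R.hopf[OF x])
    have Av: "in_chart A g \<kappa> x (H.shape x v) (H.xi x) = 0" "in_chart A g \<kappa> x (H.xi x) (H.shape x w) = 0"
      using vx vx' by (simp_all add: H.shape_sym[OF x, of v] H.shape_sym[OF x, of "H.xi x" w, symmetric] R.hopf[OF x] p.ip_simps)
    have cc: "contact q X * contact q Y = e * e'"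
    proof -
      have "contact q X * contact q Y = (s * s) * (e * e')" using s(2)[OF X] s(2)[OF Y] by (simp add: e_def e'_def)
      then show ?thesis using s(1) by simp
    qed
    have "ricci A g q X Y = a * in_chart A g \<kappa> x v w + \<sigma> q * (e * e')"
      unfolding ric[OF q x_def X Y] e_def[symmetric] e'_def[symmetric] XY Ax
      using R.ricci_H[OF x vx] H.\<xi>_unit[OF x] vx vx' Av
      by (simp add: p.ip_simps \<sigma>_def k_def algebra_simps flip: x_def)
    moreover have "g q X Y = in_chart A g \<kappa> x v w + e * e'"
      unfolding gx[OF q X Y] x_def[symmetric] XY using vx vx' H.\<xi>_unit[OF x] by (simp add: p.ip_simps)
    ultimately show "ricci A g q X Y = a * g q X Y + (\<sigma> q - a) * contact q X * contact q Y"
      using cc by (simp add: algebra_simps)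
  qed
qed

theorem ricci_constant_imp_pseudo_einstein:
  assumes conn: "connected (UNIV :: 'm set)"
    and a: "\<And>p X Y. X \<in> holomorphic_distribution A B G J f N p \<Longrightarrow> Y \<in> holomorphic_distribution A B G J f N p \<Longrightarrow>
      ricci A g p X Y = a * g p X Y"
  shows "pseudo_einstein A B G J f N"
proof -
  \<comment> \<open>Quadratic in the structure vector, hence insensitive to the sign of
    \<open>N\<close> and continuous even where \<open>N\<close> is not. The constant
    \<open>b\<close> of the conclusion is the value of \<open>\<sigma>\<close> minus
    \<open>a\<close>.\<close>
  define \<sigma> where "\<sigma> q = ricci A g q (xi_field q) (xi_field q)" for q
  define V where "V = (\<lambda>r. r + (2 * real n - 2) * c) ` {c + (a - (2 * real n + 1) * c) - (2 * real n - 2) * c, 0,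
        2 * (real n - 1) * ((a - (2 * real n + 1) * c) - c), 2 * ((a - (2 * real n + 1) * c) + c)}"
  have loc: "isCont \<sigma> p \<and> \<sigma> p \<in> V \<and> (\<forall>X\<in>tangent_space A p. \<forall>Y\<in>tangent_space A p.
      ricci A g p X Y = a * g p X Y + (\<sigma> p - a) * contact p X * contact p Y)" for p
  proof (rule local_ricci[where a=a and p=p])
    fix T \<sigma>' assume T: "open T" "p \<in> T" "continuous_on T \<sigma>'"
      and xi: "\<And>q. q \<in> T \<Longrightarrow> xi_field q \<in> tangent_space A q"
        "\<And>q. q \<in> T \<Longrightarrow> contact q (xi_field q) = 1" "\<And>q. q \<in> T \<Longrightarrow> g q (xi_field q) (xi_field q) = 1"
      and ric: "\<And>q X Y. q \<in> T \<Longrightarrow> X \<in> tangent_space A q \<Longrightarrow> Y \<in> tangent_space A q \<Longrightarrow>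
        ricci A g q X Y = a * g q X Y + (\<sigma>' q - a) * contact q X * contact q Y"
      and val: "\<And>q. q \<in> T \<Longrightarrow> \<sigma>' q - (2 * real n - 2) * c \<in> {c + (a - (2 * real n + 1) * c) - (2 * real n - 2) * c, 0,
        2 * (real n - 1) * ((a - (2 * real n + 1) * c) - c), 2 * ((a - (2 * real n + 1) * c) + c)}"
    have e: "\<sigma> q = \<sigma>' q" if "q \<in> T" for q using ric[OF that xi(1)[OF that] xi(1)[OF that]] xi[OF that] by (simp add: \<sigma>_def)
    then have "continuous_on T \<sigma>" using T(3) continuous_on_cong by blast
    then have "isCont \<sigma> p" using continuous_on_eq_continuous_at T by blast
    moreover have "\<sigma> p \<in> V" unfolding V_def e[OF T(2)] by (rule image_eqI[OF _ val[OF T(2)]]) simp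
    ultimately show ?thesis using ric[OF T(2)] e[OF T(2)] by simp
  qed (rule a)
  have "continuous_on UNIV \<sigma>" using loc by (simp add: continuous_at_imp_continuous_on)
  moreover have "finite (range \<sigma>)"
    by (rule finite_subset[of _ V]) (use loc in \<open>auto simp: V_def\<close>)
  ultimately have "\<sigma> constant_on UNIV" using continuous_finite_range_constant[OF conn] by blast
  then obtain s where "\<And>q. \<sigma> q = s" unfolding constant_on_def by auto
  then show ?thesis unfolding pseudo_einstein_def using loc by (intro exI[of _ a] exI[of _ "s - a"]) simp
qed

end

theorem mainTheorem1:
  fixes n :: nat and c :: real
    and B :: "('b::{t2_space,second_countable_topology}, 'e::euclidean_space) chart set"
    and G :: "('b, 'e) tensor2"
    and J :: "'b \<Rightarrow> ('b, 'e) tvec \<Rightarrow> ('b, 'e) tvec"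
    and A :: "('m::{t2_space,second_countable_topology}, 'h::euclidean_space) chart set"
    and f :: "'m \<Rightarrow> 'b"
    and N :: "'m \<Rightarrow> ('b, 'e) tvec"
  assumes "n \<ge> 3" and "c \<noteq> 0"
    and "complex_space_form n c B G J"
    and "real_hypersurface A B G f N"
    and "connected (UNIV :: 'm set)"
  shows "(\<exists>a. \<forall>p. \<forall>X\<in>holomorphic_distribution A B G J f N p.
             \<forall>Y\<in>holomorphic_distribution A B G J f N p.
               ricci A (induced_metric A B G f) p X Y = a * induced_metric A B G f p X Y)
         \<longleftrightarrow> pseudo_einstein A B G J f N"
proof
  assume "\<exists>a. \<forall>p. \<forall>X\<in>holomorphic_distribution A B G J f N p.
             \<forall>Y\<in>holomorphic_distribution A B G J f N p.
               ricci A (induced_metric A B G f) p X Y = a * induced_metric A B G f p X Y"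
  then obtain a where a: "\<And>p X Y. X \<in> holomorphic_distribution A B G J f N p \<Longrightarrow> Y \<in> holomorphic_distribution A B G J f N p \<Longrightarrow>
      ricci A (induced_metric A B G f) p X Y = a * induced_metric A B G f p X Y" by blast
  interpret hypersurface_in_space_form n c B G J A f N by unfold_locales (use assms in auto)
  show "pseudo_einstein A B G J f N" by (rule ricci_constant_imp_pseudo_einstein[OF assms(5) a])
next
  assume "pseudo_einstein A B G J f N"
  then obtain a b where ab: "\<And>p X Y. X \<in> tangent_space A p \<Longrightarrow> Y \<in> tangent_space A p \<Longrightarrow>
      ricci A (induced_metric A B G f) p X Y = a * induced_metric A B G f p X Y
        + b * contact_form A B G J f N p X * contact_form A B G J f N p Y"
    unfolding pseudo_einstein_def by blast
  show "\<exists>a. \<forall>p. \<forall>X\<in>holomorphic_distribution A B G J f N p.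
             \<forall>Y\<in>holomorphic_distribution A B G J f N p.
               ricci A (induced_metric A B G f) p X Y = a * induced_metric A B G f p X Y"
    by (rule exI[of _ a]) (auto simp: holomorphic_distribution_def ab)
qed

end
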